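(* Let $G$ be a finite group, $\mathcal C\subset G$ a conjugacy class stable under inversion, with base point $r$ and centraliser $C_G$, and let $\pi$ be an irreducible complex representation of $C_G$ which is real orthogonal (i.e. its matrices $\pi(n)$ in the chosen basis of $V_\pi$ are real orthogonal). Then there is a map $\underline S:U(\mathcal L_{\mathcal C,\pi})\to U(\mathcal L_{\mathcal C,\pi})$ defined on generators by $$\underline SE_{ai}{}^{bj}=\sum_m\pi(\zeta_b(ab^{-1})^{-1})^j{}_m\,E_{(ab^{-1}a^{-1})m}{}^{a^{-1}i}$$ and extended as a unital braided anti-algebra map, and $$B_{\mathcal C,\pi}:=U(\mathcal L_{\mathcal C,\pi})\Big/\Big\langle\sum_{c\in\mathcal C,m}E_{ai}{}^{cm}\,\underline SE_{cm}{}^{bj}-1\,\delta_{a,b}\delta_{i,j},\ \sum_{c\in\mathcal C,m}(\underline SE_{ai}{}^{cm})E_{cm}{}^{bj}-1\,\delta_{a,b}\delta_{i,j}\Big\rangle$$ (over all $a,b\in\mathcal C$ and all $i,j$) is a braided Hopf algebra in the category of $G$-crossed modules with invertible antipode, through which the map $U(\mathcal L_{\mathcal C,\pi})\to BD(G)$, $E_{ai}{}^{bj}\mapsto r_{ai}{}^{bj}$, factors. Moreover, $B_{\mathcal C,\pi}$ can be obtained as the comodule transmutation of the coquasitriangular Hopf algebra $$H_{\mathcal C,\pi}:=A_{\mathcal C,\pi}\Big/\Big\langle\sum_{c\in\mathcal C,m}t_{ai}{}^{cm}\,St_{cm}{}^{bj}-1\,\delta_{a,b}\delta_{i,j},\ \sum_{c\in\mathcal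 C,m}(St_{ai}{}^{cm})t_{cm}{}^{bj}-1\,\delta_{a,b}\delta_{i,j}\Big\rangle,\qquad St_{ai}{}^{bj}:=t_{b^{-1}j}{}^{a^{-1}i},$$ and the map $A_{\mathcal C,\pi}\to D^\vee(G)$, $t_{ai}{}^{bj}\mapsto r_{ai}{}^{bj}$, factors through $H_{\mathcal C,\pi}$.
   Context: Repeated $V_\pi$-indices are summed. $q:\mathcal C\to G$ satisfies $q_crq_c^{-1}=c$, $q_r=e$, and $\zeta_c(g)=q_{gcg^{-1}}^{-1}gq_c\in C_G$. A $G$-crossed module is a $G$-graded vector space with left $G$-action such that $|h\triangleright v|=h|v|h^{-1}$; these form a braided category with $\Psi(v\otimes w)=|v|\triangleright w\otimes v$. $\mathcal L_{\mathcal C,\pi}$ is the $G$-crossed module $\mathrm{End}(V_{\mathcal C,\pi})$, $V_{\mathcal C,\pi}=\mathbb C\mathcal C\otimes V_\pi$, with basis $E_{ai}{}^{bj}=E_{ai}\otimes E^{bj}$ ($a,b\in\mathcal C$), $h\triangleright E_{ci}=\pi(\zeta_c(h))^m{}_iE_{(hch^{-1})m}$, $h\triangleright E^{ci}=\pi(\zeta_c(h)^{-1})^i{}_mE^{(hch^{-1})m}$, $|E_{ai}{}^{bj}|=ab^{-1}$, matrix coalgebra $\Delta E_{ai}{}^{bj}=\sum_cE_{ai}{}^{cm}\otimes E_{cm}{}^{bj}$, $\epsilon(E_{ai}{}^{bj})=\delta_{a,b}\delta_{i,j}$, and fundamental braiding $\widetilde\Psi(E_{ai}{}^{bj}\otimes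 E_{cm}{}^{dl})=b^{-1}\triangleright E_{cm}{}^{dl}\otimes(|b^{-1}\triangleright E_{cm}{}^{dl}|^{-1}\triangleright E_{ai})\otimes E^{bj}$. $U(\mathcal L_{\mathcal C,\pi})$ is the tensor algebra on $\mathcal L_{\mathcal C,\pi}$ modulo the relations $xy=\cdot\widetilde\Psi(x\otimes y)$, a bialgebra in the braided category with the coproduct of $\mathcal L_{\mathcal C,\pi}$ extended multiplicatively to braided tensor products. A braided anti-algebra map $\underline S$ is a morphism with $\underline S\circ\cdot=\cdot\circ\Psi\circ(\underline S\otimes\underline S)$. $D^\vee(G)$ is the Hopf algebra on $\mathbb C(G)\otimes\mathbb CG$ with tensor product algebra and counit, $\Delta(\delta_g\otimes h)=\sum_f\delta_f\otimes f^{-1}ghg^{-1}f\otimes\delta_{f^{-1}g}\otimes h$, $S(\delta_g\otimes h)=\delta_{g^{-1}}\otimes gh^{-1}g^{-1}$, with coquasitriangular structure $\mathcal R(\delta_g\otimes h\otimes\delta_u\otimes v)=\delta_{g,e}\delta_{h,u}$. $BD(G)$ is the braided Hopf algebra on $\mathbb C(G)\otimes\mathbb CG$ with the coalgebra of $D^\vee(G)$, the product $(\delta_g\otimes h)(\delta_u\otimes v)=\delta_{g,huh^{-1}}\delta_g\otimes hv$, and $G$-crossed module structure $f\triangleright(\delta_g\otimes h)=\delta_{fgf^{-1}}\otimes fhf^{-1}$, $|\delta_g\otimes h|=gh^{-1}g^{-1}h$. Further, $r_{ai}{}^{bj}=\sum_{n\in C_G}\pi(n)^j{}_i\,\delta_{q_an^{-1}q_b^{-1}}\otimes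 b^{-1}$. $A_{\mathcal C,\pi}$ is the FRT bialgebra with generators $t_{ai}{}^{bj}$, matrix coalgebra, and relations $\mathcal R^{fp}{}_{ai}{}^{gs}{}_{cm}\,t_{fp}{}^{bj}t_{gs}{}^{dl}=t_{cm}{}^{gs}t_{ai}{}^{fp}\,\mathcal R^{bj}{}_{fp}{}^{dl}{}_{gs}$ (repeated indices summed, $f,g\in\mathcal C$), where $\mathcal R^{ai}{}_{bj}{}^{cm}{}_{dl}=\delta_{a,b}\,\delta_{i,j}\,\delta_{c,ada^{-1}}\,\pi(\zeta_d(a))^m{}_l$; it is coquasitriangular with $\mathcal R(t_{ai}{}^{bj}\otimes t_{cm}{}^{dl})=\mathcal R^{bj}{}_{ai}{}^{dl}{}_{cm}$ extended as a bialgebra bicharacter. In $H_{\mathcal C,\pi}$, $S$ is extended as an antialgebra map. The comodule transmutation of a coquasitriangular Hopf algebra $(H,\mathcal R)$ is the braided Hopf algebra with the same coalgebra, the right adjoint coaction $h\mapsto h_2\otimes(Sh_1)h_3$, and product $h\bullet g=h_2g_2\,\mathcal R((Sh_1)h_3\otimes Sg_1)$. Here right $H_{\mathcal C,\pi}$-comodules are viewed as $G$-crossed modules through $H_{\mathcal C,\pi}\to D^\vee(G)$, where a right $D^\vee(G)$-comodule is a $G$-crossed module by $\Delta_Rv=\sum_gg\triangleright v\otimes\delta_g\otimes|v|$.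
   Formalization: Adds the hypothesis π(ζ_{c⁻¹}(g)) = π(ζ_c(g)) for all c in the class and g in G; without it the map A → D^∨(G) does not factor through H, e.g. for (Z3×Z2×Z2)⋊Z2 (invert Z3, swap the Z2's), r generating Z3, π the sign of one Z2. *)

theory Defs
  imports "HOL-Algebra.QuotRing" "HOL-Algebra.Module" "HOL-Analysis.Cartesian_Space" "HOL-Library.Poly_Mapping"
begin

section \<open>Formal linear combinations, vector spaces and tensor products\<close>

text \<open>
  \<open>'x \<Rightarrow>\<^sub>0 complex\<close> is the complex vector space with basis \<open>'x\<close>.  Vector spaces and algebras with
  an explicit carrier are records of type \<open>(complex, 'v) module\<close> from HOL-Algebra, where the
  multiplicative fields are ignored when only the vector space structure is meant.
\<close>

definition complex_ring :: "complex ring" where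
  "complex_ring = \<lparr>carrier = UNIV, mult = (*), one = 1, zero = 0, add = (+)\<rparr>"

abbreviation basis :: "'x \<Rightarrow> ('x \<Rightarrow>\<^sub>0 complex)" where
  "basis x \<equiv> Poly_Mapping.single x 1"

definition csmul :: "complex \<Rightarrow> ('x \<Rightarrow>\<^sub>0 complex) \<Rightarrow> ('x \<Rightarrow>\<^sub>0 complex)" where
  "csmul k p = Poly_Mapping.map ((*) k) p"

text \<open>The linear extension of a map given on a basis: to a space with a basis, to a space with
  carrier, and to the complex numbers.\<close>

definition lext :: "('x \<Rightarrow> ('y \<Rightarrow>\<^sub>0 complex)) \<Rightarrow> ('x \<Rightarrow>\<^sub>0 complex) \<Rightarrow> ('y \<Rightarrow>\<^sub>0 complex)" where
  "lext f p = (\<Sum>x\<in>Poly_Mapping.keys p. csmul (Poly_Mapping.lookup p x) (f x))"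

definition leval ::
    "(complex, 'v, 'z) module_scheme \<Rightarrow> ('x \<Rightarrow> 'v) \<Rightarrow> ('x \<Rightarrow>\<^sub>0 complex) \<Rightarrow> 'v" where
  "leval V f p = finsum V (\<lambda>x. Poly_Mapping.lookup p x \<odot>\<^bsub>V\<^esub> f x) (Poly_Mapping.keys p)"

definition ceval :: "('x \<Rightarrow> complex) \<Rightarrow> ('x \<Rightarrow>\<^sub>0 complex) \<Rightarrow> complex" where
  "ceval f p = (\<Sum>x\<in>Poly_Mapping.keys p. Poly_Mapping.lookup p x * f x)"

definition linear_map ::
    "(complex, 'v, 'y) module_scheme \<Rightarrow> (complex, 'w, 'z) module_scheme \<Rightarrow> ('v \<Rightarrow> 'w) \<Rightarrow> bool" where
  "linear_map V W f \<longleftrightarrow>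
     f \<in> carrier V \<rightarrow> carrier W \<and>
     (\<forall>x\<in>carrier V. \<forall>y\<in>carrier V. f (x \<oplus>\<^bsub>V\<^esub> y) = f x \<oplus>\<^bsub>W\<^esub> f y) \<and>
     (\<forall>k. \<forall>x\<in>carrier V. f (k \<odot>\<^bsub>V\<^esub> x) = k \<odot>\<^bsub>W\<^esub> f x)"

definition linear_form :: "(complex, 'v, 'z) module_scheme \<Rightarrow> ('v \<Rightarrow> complex) \<Rightarrow> bool" where
  "linear_form V f \<longleftrightarrow>
     (\<forall>x\<in>carrier V. \<forall>y\<in>carrier V. f (x \<oplus>\<^bsub>V\<^esub> y) = f x + f y) \<and>
     (\<forall>k. \<forall>x\<in>carrier V. f (k \<odot>\<^bsub>V\<^esub> x) = k * f x)"

text \<open>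
  An element of \<open>V \<otimes> W\<close> is represented by a formal combination of pairs (this is Sweedler
  notation), and \<open>V \<otimes> W\<close> is the quotient of these formal combinations by \<open>tensor_null V W\<close>, the
  span of the bilinearity relations.  Equalities in \<open>V \<otimes> W\<close> are therefore written with
  \<open>tensor_eq\<close>; likewise for \<open>V \<otimes> V \<otimes> V\<close>.
\<close>

definition tensor_space ::
    "(complex, 'v, 'y) module_scheme \<Rightarrow> (complex, 'w, 'z) module_scheme \<Rightarrow>
     ('v \<times> 'w \<Rightarrow>\<^sub>0 complex) set" where
  "tensor_space V W = {p. Poly_Mapping.keys p \<subseteq> carrier V \<times> carrier W}"

inductive_set tensor_null ::
    "(complex, 'v, 'y) module_scheme \<Rightarrow> (complex, 'w, 'z) module_scheme \<Rightarrow>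
     ('v \<times> 'w \<Rightarrow>\<^sub>0 complex) set"
  for V :: "(complex, 'v, 'y) module_scheme" and W :: "(complex, 'w, 'z) module_scheme" where
  zero: "0 \<in> tensor_null V W"
| add: "p \<in> tensor_null V W \<Longrightarrow> p' \<in> tensor_null V W \<Longrightarrow> p + p' \<in> tensor_null V W"
| smul: "p \<in> tensor_null V W \<Longrightarrow> csmul k p \<in> tensor_null V W"
| add_left: "x \<in> carrier V \<Longrightarrow> x' \<in> carrier V \<Longrightarrow> y \<in> carrier W \<Longrightarrow>
    basis (x \<oplus>\<^bsub>V\<^esub> x', y) - basis (x, y) - basis (x', y) \<in> tensor_null V W"
| add_right: "x \<in> carrier V \<Longrightarrow> y \<in> carrier W \<Longrightarrow> y' \<in> carrier W \<Longrightarrow>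
    basis (x, y \<oplus>\<^bsub>W\<^esub> y') - basis (x, y) - basis (x, y') \<in> tensor_null V W"
| smul_left: "x \<in> carrier V \<Longrightarrow> y \<in> carrier W \<Longrightarrow>
    basis (k \<odot>\<^bsub>V\<^esub> x, y) - csmul k (basis (x, y)) \<in> tensor_null V W"
| smul_right: "x \<in> carrier V \<Longrightarrow> y \<in> carrier W \<Longrightarrow>
    basis (x, k \<odot>\<^bsub>W\<^esub> y) - csmul k (basis (x, y)) \<in> tensor_null V W"

definition tensor_eq ::
    "(complex, 'v, 'y) module_scheme \<Rightarrow> (complex, 'w, 'z) module_scheme \<Rightarrow>
     ('v \<times> 'w \<Rightarrow>\<^sub>0 complex) \<Rightarrow> ('v \<times> 'w \<Rightarrow>\<^sub>0 complex) \<Rightarrow> bool" where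
  "tensor_eq V W p p' \<longleftrightarrow> p - p' \<in> tensor_null V W"

inductive_set tensor3_null ::
    "(complex, 'v, 'z) module_scheme \<Rightarrow> ('v \<times> 'v \<times> 'v \<Rightarrow>\<^sub>0 complex) set"
  for V :: "(complex, 'v, 'z) module_scheme" where
  zero: "0 \<in> tensor3_null V"
| add: "p \<in> tensor3_null V \<Longrightarrow> p' \<in> tensor3_null V \<Longrightarrow> p + p' \<in> tensor3_null V"
| smul: "p \<in> tensor3_null V \<Longrightarrow> csmul k p \<in> tensor3_null V"
| add1: "x \<in> carrier V \<Longrightarrow> x' \<in> carrier V \<Longrightarrow> y \<in> carrier V \<Longrightarrow> z \<in> carrier V \<Longrightarrow>
    basis (x \<oplus>\<^bsub>V\<^esub> x', y, z) - basis (x, y, z) - basis (x', y, z) \<in> tensor3_null V"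
| add2: "x \<in> carrier V \<Longrightarrow> y \<in> carrier V \<Longrightarrow> y' \<in> carrier V \<Longrightarrow> z \<in> carrier V \<Longrightarrow>
    basis (x, y \<oplus>\<^bsub>V\<^esub> y', z) - basis (x, y, z) - basis (x, y', z) \<in> tensor3_null V"
| add3: "x \<in> carrier V \<Longrightarrow> y \<in> carrier V \<Longrightarrow> z \<in> carrier V \<Longrightarrow> z' \<in> carrier V \<Longrightarrow>
    basis (x, y, z \<oplus>\<^bsub>V\<^esub> z') - basis (x, y, z) - basis (x, y, z') \<in> tensor3_null V"
| smul1: "x \<in> carrier V \<Longrightarrow> y \<in> carrier V \<Longrightarrow> z \<in> carrier V \<Longrightarrow>
    basis (k \<odot>\<^bsub>V\<^esub> x, y, z) - csmul k (basis (x, y, z)) \<in> tensor3_null V"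
| smul2: "x \<in> carrier V \<Longrightarrow> y \<in> carrier V \<Longrightarrow> z \<in> carrier V \<Longrightarrow>
    basis (x, k \<odot>\<^bsub>V\<^esub> y, z) - csmul k (basis (x, y, z)) \<in> tensor3_null V"
| smul3: "x \<in> carrier V \<Longrightarrow> y \<in> carrier V \<Longrightarrow> z \<in> carrier V \<Longrightarrow>
    basis (x, y, k \<odot>\<^bsub>V\<^esub> z) - csmul k (basis (x, y, z)) \<in> tensor3_null V"

definition tensor3_eq ::
    "(complex, 'v, 'z) module_scheme \<Rightarrow>
     ('v \<times> 'v \<times> 'v \<Rightarrow>\<^sub>0 complex) \<Rightarrow> ('v \<times> 'v \<times> 'v \<Rightarrow>\<^sub>0 complex) \<Rightarrow> bool" where
  "tensor3_eq V p p' \<longleftrightarrow> p - p' \<in> tensor3_null V"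

definition pairs :: "('x \<Rightarrow>\<^sub>0 complex) \<Rightarrow> ('y \<Rightarrow>\<^sub>0 complex) \<Rightarrow> ('x \<times> 'y \<Rightarrow>\<^sub>0 complex)" where
  "pairs p p' = lext (\<lambda>x. lext (\<lambda>y. basis (x, y)) p') p"

definition tensor_map :: "('v \<Rightarrow> 'v') \<Rightarrow> ('w \<Rightarrow> 'w') \<Rightarrow>
    ('v \<times> 'w \<Rightarrow>\<^sub>0 complex) \<Rightarrow> ('v' \<times> 'w' \<Rightarrow>\<^sub>0 complex)" where
  "tensor_map f g p = lext (\<lambda>(x, y). basis (f x, g y)) p"


section \<open>Algebras, coalgebras and Hopf algebras\<close>

definition complex_algebra :: "(complex, 'v, 'z) module_scheme \<Rightarrow> bool" where
  "complex_algebra A \<longleftrightarrow>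
     ring A \<and> Module.module complex_ring A \<and>
     (\<forall>k. \<forall>x\<in>carrier A. \<forall>y\<in>carrier A.
        (k \<odot>\<^bsub>A\<^esub> x) \<otimes>\<^bsub>A\<^esub> y = k \<odot>\<^bsub>A\<^esub> (x \<otimes>\<^bsub>A\<^esub> y) \<and>
        x \<otimes>\<^bsub>A\<^esub> (k \<odot>\<^bsub>A\<^esub> y) = k \<odot>\<^bsub>A\<^esub> (x \<otimes>\<^bsub>A\<^esub> y))"

definition algebra_hom ::
    "(complex, 'v, 'y) module_scheme \<Rightarrow> (complex, 'w, 'z) module_scheme \<Rightarrow> ('v \<Rightarrow> 'w) \<Rightarrow> bool" where
  "algebra_hom A B f \<longleftrightarrow>
     linear_map A B f \<and>
     (\<forall>x\<in>carrier A. \<forall>y\<in>carrier A. f (x \<otimes>\<^bsub>A\<^esub> y) = f x \<otimes>\<^bsub>B\<^esub> f y) \<and>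
     f \<one>\<^bsub>A\<^esub> = \<one>\<^bsub>B\<^esub>"

text \<open>\<open>(\<Delta> \<otimes> id) \<Delta> x\<close>, i.e. \<open>x\<^sub>1 \<otimes> x\<^sub>2 \<otimes> x\<^sub>3\<close>.\<close>

definition comult2 :: "('v \<Rightarrow> ('v \<times> 'v \<Rightarrow>\<^sub>0 complex)) \<Rightarrow> 'v \<Rightarrow> ('v \<times> 'v \<times> 'v \<Rightarrow>\<^sub>0 complex)" where
  "comult2 \<Delta> x = lext (\<lambda>(y, z). lext (\<lambda>(u, v). basis (u, v, z)) (\<Delta> y)) (\<Delta> x)"

definition coalgebra ::
    "(complex, 'v, 'z) module_scheme \<Rightarrow> ('v \<Rightarrow> ('v \<times> 'v \<Rightarrow>\<^sub>0 complex)) \<Rightarrow> ('v \<Rightarrow> complex) \<Rightarrow> bool" where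
  "coalgebra C \<Delta> \<epsilon> \<longleftrightarrow>
     Module.module complex_ring C \<and>
     \<Delta> \<in> carrier C \<rightarrow> tensor_space C C \<and>
     (\<forall>x\<in>carrier C. \<forall>y\<in>carrier C. tensor_eq C C (\<Delta> (x \<oplus>\<^bsub>C\<^esub> y)) (\<Delta> x + \<Delta> y)) \<and>
     (\<forall>k. \<forall>x\<in>carrier C. tensor_eq C C (\<Delta> (k \<odot>\<^bsub>C\<^esub> x)) (csmul k (\<Delta> x))) \<and>
     linear_form C \<epsilon> \<and>
     (\<forall>x\<in>carrier C. tensor3_eq C (comult2 \<Delta> x)
        (lext (\<lambda>(y, z). lext (\<lambda>(u, v). basis (y, u, v)) (\<Delta> z)) (\<Delta> x))) \<and>
     (\<forall>x\<in>carrier C. leval C (\<lambda>(y, z). \<epsilon> y \<odot>\<^bsub>C\<^esub> z) (\<Delta> x) = x \<and>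
        leval C (\<lambda>(y, z). \<epsilon> z \<odot>\<^bsub>C\<^esub> y) (\<Delta> x) = x)"

definition coalgebra_hom ::
    "(complex, 'v, 'y) module_scheme \<Rightarrow> ('v \<Rightarrow> ('v \<times> 'v \<Rightarrow>\<^sub>0 complex)) \<Rightarrow> ('v \<Rightarrow> complex) \<Rightarrow>
     (complex, 'w, 'z) module_scheme \<Rightarrow> ('w \<Rightarrow> ('w \<times> 'w \<Rightarrow>\<^sub>0 complex)) \<Rightarrow> ('w \<Rightarrow> complex) \<Rightarrow>
     ('v \<Rightarrow> 'w) \<Rightarrow> bool" where
  "coalgebra_hom C \<Delta>C \<epsilon>C D \<Delta>D \<epsilon>D f \<longleftrightarrow>
     linear_map C D f \<and>
     (\<forall>x\<in>carrier C. tensor_eq D D (\<Delta>D (f x)) (tensor_map f f (\<Delta>C x)) \<and> \<epsilon>D (f x) = \<epsilon>C x)"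

definition bialgebra ::
    "(complex, 'v, 'z) module_scheme \<Rightarrow> ('v \<Rightarrow> ('v \<times> 'v \<Rightarrow>\<^sub>0 complex)) \<Rightarrow> ('v \<Rightarrow> complex) \<Rightarrow> bool" where
  "bialgebra A \<Delta> \<epsilon> \<longleftrightarrow>
     complex_algebra A \<and> coalgebra A \<Delta> \<epsilon> \<and>
     (\<forall>x\<in>carrier A. \<forall>y\<in>carrier A.
        tensor_eq A A (\<Delta> (x \<otimes>\<^bsub>A\<^esub> y))
          (lext (\<lambda>((x1, x2), (y1, y2)). basis (x1 \<otimes>\<^bsub>A\<^esub> y1, x2 \<otimes>\<^bsub>A\<^esub> y2)) (pairs (\<Delta> x) (\<Delta> y))) \<and>
        \<epsilon> (x \<otimes>\<^bsub>A\<^esub> y) = \<epsilon> x * \<epsilon> y) \<and>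
     tensor_eq A A (\<Delta> \<one>\<^bsub>A\<^esub>) (basis (\<one>\<^bsub>A\<^esub>, \<one>\<^bsub>A\<^esub>)) \<and> \<epsilon> \<one>\<^bsub>A\<^esub> = 1"

definition bialgebra_hom ::
    "(complex, 'v, 'y) module_scheme \<Rightarrow> ('v \<Rightarrow> ('v \<times> 'v \<Rightarrow>\<^sub>0 complex)) \<Rightarrow> ('v \<Rightarrow> complex) \<Rightarrow>
     (complex, 'w, 'z) module_scheme \<Rightarrow> ('w \<Rightarrow> ('w \<times> 'w \<Rightarrow>\<^sub>0 complex)) \<Rightarrow> ('w \<Rightarrow> complex) \<Rightarrow>
     ('v \<Rightarrow> 'w) \<Rightarrow> bool" where
  "bialgebra_hom A \<Delta>A \<epsilon>A B \<Delta>B \<epsilon>B f \<longleftrightarrow> algebra_hom A B f \<and> coalgebra_hom A \<Delta>A \<epsilon>A B \<Delta>B \<epsilon>B f"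

definition antipode_for ::
    "(complex, 'v, 'z) module_scheme \<Rightarrow> ('v \<Rightarrow> ('v \<times> 'v \<Rightarrow>\<^sub>0 complex)) \<Rightarrow> ('v \<Rightarrow> complex) \<Rightarrow>
     ('v \<Rightarrow> 'v) \<Rightarrow> bool" where
  "antipode_for A \<Delta> \<epsilon> S \<longleftrightarrow>
     linear_map A A S \<and>
     (\<forall>x\<in>carrier A.
        leval A (\<lambda>(y, z). S y \<otimes>\<^bsub>A\<^esub> z) (\<Delta> x) = \<epsilon> x \<odot>\<^bsub>A\<^esub> \<one>\<^bsub>A\<^esub> \<and>
        leval A (\<lambda>(y, z). y \<otimes>\<^bsub>A\<^esub> S z) (\<Delta> x) = \<epsilon> x \<odot>\<^bsub>A\<^esub> \<one>\<^bsub>A\<^esub>)"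

definition hopf_algebra ::
    "(complex, 'v, 'z) module_scheme \<Rightarrow> ('v \<Rightarrow> ('v \<times> 'v \<Rightarrow>\<^sub>0 complex)) \<Rightarrow> ('v \<Rightarrow> complex) \<Rightarrow>
     ('v \<Rightarrow> 'v) \<Rightarrow> bool" where
  "hopf_algebra A \<Delta> \<epsilon> S \<longleftrightarrow> bialgebra A \<Delta> \<epsilon> \<and> antipode_for A \<Delta> \<epsilon> S"

definition bilinear_form :: "(complex, 'v, 'z) module_scheme \<Rightarrow> ('v \<Rightarrow> 'v \<Rightarrow> complex) \<Rightarrow> bool" where
  "bilinear_form A R \<longleftrightarrow>
     (\<forall>x\<in>carrier A. linear_form A (R x) \<and> linear_form A (\<lambda>y. R y x))"

text \<open>
  Coquasitriangular structure \<open>R\<close>: convolution invertible, \<open>R(xy \<otimes> z) = R(x \<otimes> z\<^sub>1) R(y \<otimes> z\<^sub>2)\<close>,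
  \<open>R(x \<otimes> yz) = R(x\<^sub>1 \<otimes> z) R(x\<^sub>2 \<otimes> y)\<close> and \<open>y\<^sub>1 x\<^sub>1 R(x\<^sub>2 \<otimes> y\<^sub>2) = R(x\<^sub>1 \<otimes> y\<^sub>1) x\<^sub>2 y\<^sub>2\<close>.
\<close>

definition coquasitriangular ::
    "(complex, 'v, 'z) module_scheme \<Rightarrow> ('v \<Rightarrow> ('v \<times> 'v \<Rightarrow>\<^sub>0 complex)) \<Rightarrow> ('v \<Rightarrow> complex) \<Rightarrow>
     ('v \<Rightarrow> 'v \<Rightarrow> complex) \<Rightarrow> bool" where
  "coquasitriangular A \<Delta> \<epsilon> R \<longleftrightarrow>
     bilinear_form A R \<and>
     (\<exists>R'. bilinear_form A R' \<and>
        (\<forall>x\<in>carrier A. \<forall>y\<in>carrier A.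
           ceval (\<lambda>((x1, x2), (y1, y2)). R x1 y1 * R' x2 y2) (pairs (\<Delta> x) (\<Delta> y)) = \<epsilon> x * \<epsilon> y \<and>
           ceval (\<lambda>((x1, x2), (y1, y2)). R' x1 y1 * R x2 y2) (pairs (\<Delta> x) (\<Delta> y)) = \<epsilon> x * \<epsilon> y)) \<and>
     (\<forall>x\<in>carrier A. \<forall>y\<in>carrier A. \<forall>z\<in>carrier A.
        R (x \<otimes>\<^bsub>A\<^esub> y) z = ceval (\<lambda>(z1, z2). R x z1 * R y z2) (\<Delta> z) \<and>
        R x (y \<otimes>\<^bsub>A\<^esub> z) = ceval (\<lambda>(x1, x2). R x1 z * R x2 y) (\<Delta> x)) \<and>
     (\<forall>x\<in>carrier A. \<forall>y\<in>carrier A.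
        leval A (\<lambda>((x1, x2), (y1, y2)). R x2 y2 \<odot>\<^bsub>A\<^esub> (y1 \<otimes>\<^bsub>A\<^esub> x1)) (pairs (\<Delta> x) (\<Delta> y)) =
        leval A (\<lambda>((x1, x2), (y1, y2)). R x1 y1 \<odot>\<^bsub>A\<^esub> (x2 \<otimes>\<^bsub>A\<^esub> y2)) (pairs (\<Delta> x) (\<Delta> y)))"


section \<open>Crossed modules and braided Hopf algebras\<close>

text \<open>
  The \<open>G\<close>-grading is recorded by the projections \<open>hcomp V g\<close> onto the homogeneous components
  \<open>{v. |v| = g}\<close>.
\<close>

record ('g, 'v) crossed_module = "(complex, 'v) module" +
  act :: "'g \<Rightarrow> 'v \<Rightarrow> 'v"
  hcomp :: "'g \<Rightarrow> 'v \<Rightarrow> 'v"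

definition with_crossed ::
    "(complex, 'v, 'z) module_scheme \<Rightarrow> ('g \<Rightarrow> 'v \<Rightarrow> 'v) \<Rightarrow> ('g \<Rightarrow> 'v \<Rightarrow> 'v) \<Rightarrow>
     ('g, 'v) crossed_module" where
  "with_crossed A ac hc =
     \<lparr>carrier = carrier A, mult = mult A, one = one A, zero = zero A, add = add A,
      smult = smult A, act = ac, hcomp = hc\<rparr>"

definition is_crossed_module ::
    "('g, 'm) monoid_scheme \<Rightarrow> ('g, 'v, 'z) crossed_module_scheme \<Rightarrow> bool" where
  "is_crossed_module G V \<longleftrightarrow>
     Module.module complex_ring V \<and>
     (\<forall>g\<in>carrier G. linear_map V V (act V g) \<and> linear_map V V (hcomp V g)) \<and>
     (\<forall>x\<in>carrier V. act V \<one>\<^bsub>G\<^esub> x = x \<and>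
        (\<forall>g\<in>carrier G. \<forall>h\<in>carrier G. act V (g \<otimes>\<^bsub>G\<^esub> h) x = act V g (act V h x))) \<and>
     (\<forall>x\<in>carrier V. finsum V (\<lambda>g. hcomp V g x) (carrier G) = x \<and>
        (\<forall>g\<in>carrier G. \<forall>h\<in>carrier G.
           hcomp V g (hcomp V h x) = (if g = h then hcomp V g x else \<zero>\<^bsub>V\<^esub>))) \<and>
     (\<forall>x\<in>carrier V. \<forall>g\<in>carrier G. \<forall>h\<in>carrier G.
        act V h (hcomp V g x) = hcomp V (h \<otimes>\<^bsub>G\<^esub> g \<otimes>\<^bsub>G\<^esub> inv\<^bsub>G\<^esub> h) (act V h x))"

definition crossed_hom ::
    "('g, 'm) monoid_scheme \<Rightarrow> ('g, 'v, 'y) crossed_module_scheme \<Rightarrow>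
     ('g, 'w, 'z) crossed_module_scheme \<Rightarrow> ('v \<Rightarrow> 'w) \<Rightarrow> bool" where
  "crossed_hom G V W f \<longleftrightarrow>
     linear_map V W f \<and>
     (\<forall>g\<in>carrier G. \<forall>x\<in>carrier V.
        f (act V g x) = act W g (f x) \<and> f (hcomp V g x) = hcomp W g (f x))"

text \<open>\<open>\<Psi>(v \<otimes> w) = |v| \<triangleright> w \<otimes> v\<close> for homogeneous \<open>v\<close>.\<close>

definition braid ::
    "('g, 'm) monoid_scheme \<Rightarrow> ('g, 'v, 'y) crossed_module_scheme \<Rightarrow>
     ('g, 'w, 'z) crossed_module_scheme \<Rightarrow> 'v \<times> 'w \<Rightarrow> ('w \<times> 'v \<Rightarrow>\<^sub>0 complex)" where
  "braid G V W = (\<lambda>(v, w). \<Sum>g\<in>carrier G. basis (act W g w, hcomp V g v))"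

definition tensor_act ::
    "('g, 'v, 'z) crossed_module_scheme \<Rightarrow> 'g \<Rightarrow> ('v \<times> 'v \<Rightarrow>\<^sub>0 complex) \<Rightarrow> ('v \<times> 'v \<Rightarrow>\<^sub>0 complex)" where
  "tensor_act V g = tensor_map (act V g) (act V g)"

definition tensor_hcomp ::
    "('g, 'm) monoid_scheme \<Rightarrow> ('g, 'v, 'z) crossed_module_scheme \<Rightarrow> 'g \<Rightarrow>
     ('v \<times> 'v \<Rightarrow>\<^sub>0 complex) \<Rightarrow> ('v \<times> 'v \<Rightarrow>\<^sub>0 complex)" where
  "tensor_hcomp G V g p =
     (\<Sum>h\<in>carrier G. tensor_map (hcomp V h) (hcomp V (inv\<^bsub>G\<^esub> h \<otimes>\<^bsub>G\<^esub> g)) p)"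

text \<open>\<open>(x\<^sub>1 \<otimes> x\<^sub>2)(y\<^sub>1 \<otimes> y\<^sub>2) = x\<^sub>1 \<Psi>(x\<^sub>2 \<otimes> y\<^sub>1) y\<^sub>2\<close>.\<close>

definition braided_mult ::
    "('g, 'm) monoid_scheme \<Rightarrow> ('g, 'v, 'z) crossed_module_scheme \<Rightarrow>
     ('v \<times> 'v \<Rightarrow>\<^sub>0 complex) \<Rightarrow> ('v \<times> 'v \<Rightarrow>\<^sub>0 complex) \<Rightarrow> ('v \<times> 'v \<Rightarrow>\<^sub>0 complex)" where
  "braided_mult G B p p' =
     lext (\<lambda>((x1, x2), (y1, y2)).
        lext (\<lambda>(y, x). basis (x1 \<otimes>\<^bsub>B\<^esub> y, x \<otimes>\<^bsub>B\<^esub> y2)) (braid G B B (x2, y1))) (pairs p p')"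

definition crossed_algebra ::
    "('g, 'm) monoid_scheme \<Rightarrow> ('g, 'v, 'z) crossed_module_scheme \<Rightarrow> bool" where
  "crossed_algebra G B \<longleftrightarrow>
     complex_algebra B \<and> is_crossed_module G B \<and>
     (\<forall>g\<in>carrier G. \<forall>x\<in>carrier B. \<forall>y\<in>carrier B.
        act B g (x \<otimes>\<^bsub>B\<^esub> y) = act B g x \<otimes>\<^bsub>B\<^esub> act B g y) \<and>
     (\<forall>g\<in>carrier G. \<forall>h\<in>carrier G. \<forall>x\<in>carrier B. \<forall>y\<in>carrier B.
        hcomp B (g \<otimes>\<^bsub>G\<^esub> h) (hcomp B g x \<otimes>\<^bsub>B\<^esub> hcomp B h y) = hcomp B g x \<otimes>\<^bsub>B\<^esub> hcomp B h y) \<and>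
     (\<forall>g\<in>carrier G. act B g \<one>\<^bsub>B\<^esub> = \<one>\<^bsub>B\<^esub>) \<and> hcomp B \<one>\<^bsub>G\<^esub> \<one>\<^bsub>B\<^esub> = \<one>\<^bsub>B\<^esub>"

definition crossed_coalgebra ::
    "('g, 'm) monoid_scheme \<Rightarrow> ('g, 'v, 'z) crossed_module_scheme \<Rightarrow>
     ('v \<Rightarrow> ('v \<times> 'v \<Rightarrow>\<^sub>0 complex)) \<Rightarrow> ('v \<Rightarrow> complex) \<Rightarrow> bool" where
  "crossed_coalgebra G B \<Delta> \<epsilon> \<longleftrightarrow>
     coalgebra B \<Delta> \<epsilon> \<and> is_crossed_module G B \<and>
     (\<forall>g\<in>carrier G. \<forall>x\<in>carrier B.
        tensor_eq B B (\<Delta> (act B g x)) (tensor_act B g (\<Delta> x)) \<and>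
        tensor_eq B B (\<Delta> (hcomp B g x)) (tensor_hcomp G B g (\<Delta> x)) \<and>
        \<epsilon> (act B g x) = \<epsilon> x \<and>
        \<epsilon> (hcomp B g x) = (if g = \<one>\<^bsub>G\<^esub> then \<epsilon> x else 0))"

definition braided_bialgebra ::
    "('g, 'm) monoid_scheme \<Rightarrow> ('g, 'v, 'z) crossed_module_scheme \<Rightarrow>
     ('v \<Rightarrow> ('v \<times> 'v \<Rightarrow>\<^sub>0 complex)) \<Rightarrow> ('v \<Rightarrow> complex) \<Rightarrow> bool" where
  "braided_bialgebra G B \<Delta> \<epsilon> \<longleftrightarrow>
     crossed_algebra G B \<and> crossed_coalgebra G B \<Delta> \<epsilon> \<and>
     (\<forall>x\<in>carrier B. \<forall>y\<in>carrier B.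
        tensor_eq B B (\<Delta> (x \<otimes>\<^bsub>B\<^esub> y)) (braided_mult G B (\<Delta> x) (\<Delta> y)) \<and>
        \<epsilon> (x \<otimes>\<^bsub>B\<^esub> y) = \<epsilon> x * \<epsilon> y) \<and>
     tensor_eq B B (\<Delta> \<one>\<^bsub>B\<^esub>) (basis (\<one>\<^bsub>B\<^esub>, \<one>\<^bsub>B\<^esub>)) \<and> \<epsilon> \<one>\<^bsub>B\<^esub> = 1"

definition braided_hopf_algebra ::
    "('g, 'm) monoid_scheme \<Rightarrow> ('g, 'v, 'z) crossed_module_scheme \<Rightarrow>
     ('v \<Rightarrow> ('v \<times> 'v \<Rightarrow>\<^sub>0 complex)) \<Rightarrow> ('v \<Rightarrow> complex) \<Rightarrow> ('v \<Rightarrow> 'v) \<Rightarrow> bool" where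
  "braided_hopf_algebra G B \<Delta> \<epsilon> S \<longleftrightarrow>
     braided_bialgebra G B \<Delta> \<epsilon> \<and> crossed_hom G B B S \<and> antipode_for B \<Delta> \<epsilon> S"

definition braided_bialgebra_hom ::
    "('g, 'm) monoid_scheme \<Rightarrow>
     ('g, 'v, 'y) crossed_module_scheme \<Rightarrow> ('v \<Rightarrow> ('v \<times> 'v \<Rightarrow>\<^sub>0 complex)) \<Rightarrow> ('v \<Rightarrow> complex) \<Rightarrow>
     ('g, 'w, 'z) crossed_module_scheme \<Rightarrow> ('w \<Rightarrow> ('w \<times> 'w \<Rightarrow>\<^sub>0 complex)) \<Rightarrow> ('w \<Rightarrow> complex) \<Rightarrow>
     ('v \<Rightarrow> 'w) \<Rightarrow> bool" where
  "braided_bialgebra_hom G A \<Delta>A \<epsilon>A B \<Delta>B \<epsilon>B f \<longleftrightarrow>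
     bialgebra_hom A \<Delta>A \<epsilon>A B \<Delta>B \<epsilon>B f \<and> crossed_hom G A B f"

definition unital_braided_antialgebra_map ::
    "('g, 'm) monoid_scheme \<Rightarrow> ('g, 'v, 'z) crossed_module_scheme \<Rightarrow> ('v \<Rightarrow> 'v) \<Rightarrow> bool" where
  "unital_braided_antialgebra_map G B S \<longleftrightarrow>
     crossed_hom G B B S \<and> S \<one>\<^bsub>B\<^esub> = \<one>\<^bsub>B\<^esub> \<and>
     (\<forall>x\<in>carrier B. \<forall>y\<in>carrier B.
        S (x \<otimes>\<^bsub>B\<^esub> y) = leval B (\<lambda>(u, v). u \<otimes>\<^bsub>B\<^esub> v) (braid G B B (S x, S y)))"


section \<open>Free algebras, tensor algebras and quotients\<close>

definition free_algebra :: "'x set \<Rightarrow> (complex, 'x list \<Rightarrow>\<^sub>0 complex) module" where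
  "free_algebra X =
     \<lparr>carrier = {p. Poly_Mapping.keys p \<subseteq> lists X},
      mult = (\<lambda>p p'. lext (\<lambda>u. lext (\<lambda>v. basis (u @ v)) p') p),
      one = basis [], zero = 0, add = (+), smult = csmul\<rparr>"

fun act_word :: "('g \<Rightarrow> 'x \<Rightarrow> ('x \<Rightarrow>\<^sub>0 complex)) \<Rightarrow> 'g \<Rightarrow> 'x list \<Rightarrow> ('x list \<Rightarrow>\<^sub>0 complex)" where
  "act_word ac g [] = basis []"
| "act_word ac g (x # w) = lext (\<lambda>y. lext (\<lambda>v. basis (y # v)) (act_word ac g w)) (ac g x)"

fun deg_word :: "('g, 'm) monoid_scheme \<Rightarrow> ('x \<Rightarrow> 'g) \<Rightarrow> 'x list \<Rightarrow> 'g" where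
  "deg_word G dg [] = \<one>\<^bsub>G\<^esub>"
| "deg_word G dg (x # w) = dg x \<otimes>\<^bsub>G\<^esub> deg_word G dg w"

text \<open>The tensor algebra of a crossed module with homogeneous basis \<open>X\<close>, action \<open>ac\<close> and degree
  \<open>dg\<close> on basis elements.\<close>

definition tensor_algebra ::
    "('g, 'm) monoid_scheme \<Rightarrow> 'x set \<Rightarrow> ('g \<Rightarrow> 'x \<Rightarrow> ('x \<Rightarrow>\<^sub>0 complex)) \<Rightarrow> ('x \<Rightarrow> 'g) \<Rightarrow>
     ('g, 'x list \<Rightarrow>\<^sub>0 complex) crossed_module" where
  "tensor_algebra G X ac dg =
     with_crossed (free_algebra X)
       (\<lambda>g. lext (act_word ac g))
       (\<lambda>g. lext (\<lambda>w. if deg_word G dg w = g then basis w else 0))"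

definition quot_algebra ::
    "(complex, 'v, 'z) module_scheme \<Rightarrow> 'v set \<Rightarrow> (complex, 'v set) module" where
  "quot_algebra A I =
     \<lparr>carrier = carrier (A Quot I), mult = mult (A Quot I), one = one (A Quot I),
      zero = zero (A Quot I), add = add (A Quot I),
      smult = (\<lambda>k X. \<Union>x\<in>X. I +>\<^bsub>A\<^esub> (k \<odot>\<^bsub>A\<^esub> x))\<rparr>"

definition quot_crossed ::
    "('g, 'v, 'z) crossed_module_scheme \<Rightarrow> 'v set \<Rightarrow> ('g, 'v set) crossed_module" where
  "quot_crossed A I =
     with_crossed (quot_algebra A I)
       (\<lambda>g X. \<Union>x\<in>X. I +>\<^bsub>A\<^esub> act A g x)
       (\<lambda>g X. \<Union>x\<in>X. I +>\<^bsub>A\<^esub> hcomp A g x)"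


section \<open>Comodule transmutation\<close>

text \<open>\<open>x \<mapsto> x\<^sub>2 \<otimes> (S x\<^sub>1) x\<^sub>3\<close>.\<close>

definition adjoint_coaction ::
    "(complex, 'v, 'z) module_scheme \<Rightarrow> ('v \<Rightarrow> ('v \<times> 'v \<Rightarrow>\<^sub>0 complex)) \<Rightarrow> ('v \<Rightarrow> 'v) \<Rightarrow>
     'v \<Rightarrow> ('v \<times> 'v \<Rightarrow>\<^sub>0 complex)" where
  "adjoint_coaction H \<Delta> S x =
     lext (\<lambda>(x1, x2, x3). basis (x2, S x1 \<otimes>\<^bsub>H\<^esub> x3)) (comult2 \<Delta> x)"

text \<open>\<open>x \<bullet> y = x\<^sub>2 y\<^sub>2 R((S x\<^sub>1) x\<^sub>3 \<otimes> S y\<^sub>1)\<close>.\<close>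

definition transmuted_algebra ::
    "(complex, 'v) module \<Rightarrow> ('v \<Rightarrow> ('v \<times> 'v \<Rightarrow>\<^sub>0 complex)) \<Rightarrow> ('v \<Rightarrow> 'v) \<Rightarrow>
     ('v \<Rightarrow> 'v \<Rightarrow> complex) \<Rightarrow> (complex, 'v) module" where
  "transmuted_algebra H \<Delta> S R =
     H\<lparr>mult := (\<lambda>x y.
         leval H (\<lambda>((x1, x2, x3), (y1, y2)). R (S x1 \<otimes>\<^bsub>H\<^esub> x3) (S y1) \<odot>\<^bsub>H\<^esub> (x2 \<otimes>\<^bsub>H\<^esub> y2))
           (pairs (comult2 \<Delta> x) (\<Delta> y)))\<rparr>"


section \<open>The data of a conjugacy class with a representation of the centraliser\<close>

definition conjugacy_class :: "('g, 'm) monoid_scheme \<Rightarrow> 'g \<Rightarrow> 'g set" where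
  "conjugacy_class G r = {g \<otimes>\<^bsub>G\<^esub> r \<otimes>\<^bsub>G\<^esub> inv\<^bsub>G\<^esub> g | g. g \<in> carrier G}"

definition centraliser :: "('g, 'm) monoid_scheme \<Rightarrow> 'g \<Rightarrow> 'g set" where
  "centraliser G r = {g \<in> carrier G. g \<otimes>\<^bsub>G\<^esub> r = r \<otimes>\<^bsub>G\<^esub> g}"

definition matrix_rep :: "('g, 'm) monoid_scheme \<Rightarrow> 'g set \<Rightarrow> ('g \<Rightarrow> complex^'i^'i) \<Rightarrow> bool" where
  "matrix_rep G K \<pi> \<longleftrightarrow>
     \<pi> \<one>\<^bsub>G\<^esub> = mat 1 \<and> (\<forall>m\<in>K. \<forall>n\<in>K. \<pi> (m \<otimes>\<^bsub>G\<^esub> n) = \<pi> m ** \<pi> n)"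

definition irreducible_rep :: "'g set \<Rightarrow> ('g \<Rightarrow> complex^'i^'i) \<Rightarrow> bool" where
  "irreducible_rep K \<pi> \<longleftrightarrow>
     (\<forall>W. vec.subspace W \<and> (\<forall>n\<in>K. \<forall>w\<in>W. \<pi> n *v w \<in> W) \<longrightarrow> W = {0} \<or> W = UNIV)"

definition real_orthogonal_rep :: "'g set \<Rightarrow> ('g \<Rightarrow> complex^'i^'i) \<Rightarrow> bool" where
  "real_orthogonal_rep K \<pi> \<longleftrightarrow>
     (\<forall>n\<in>K. \<exists>Q::real^'i^'i. orthogonal_matrix Q \<and> \<pi> n = (\<chi> i j. complex_of_real (Q $ i $ j)))"

definition coset_section ::
    "('g, 'm) monoid_scheme \<Rightarrow> 'g set \<Rightarrow> 'g \<Rightarrow> ('g \<Rightarrow> 'g) \<Rightarrow> bool" where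
  "coset_section G C r q \<longleftrightarrow>
     (\<forall>c\<in>C. q c \<in> carrier G \<and> q c \<otimes>\<^bsub>G\<^esub> r \<otimes>\<^bsub>G\<^esub> inv\<^bsub>G\<^esub> (q c) = c) \<and> q r = \<one>\<^bsub>G\<^esub>"

definition zeta :: "('g, 'm) monoid_scheme \<Rightarrow> ('g \<Rightarrow> 'g) \<Rightarrow> 'g \<Rightarrow> 'g \<Rightarrow> 'g" where
  "zeta G q c g = inv\<^bsub>G\<^esub> (q (g \<otimes>\<^bsub>G\<^esub> c \<otimes>\<^bsub>G\<^esub> inv\<^bsub>G\<^esub> g)) \<otimes>\<^bsub>G\<^esub> g \<otimes>\<^bsub>G\<^esub> q c"

text \<open>
  Compatibility of the trivialisation \<open>q\<close> with inversion on \<open>C\<close>.  This is automatic when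
  \<open>r\<^sup>2 = e\<close> (then \<open>c\<^sup>-\<^sup>1 = c\<close> on \<open>C\<close>) and when \<open>\<pi>\<close> is trivial, and in general it is necessary for
  the elements \<open>r\<^sub>a\<^sub>i\<^sup>b\<^sup>j\<close> of \<open>D\<^sup>\<or>(G)\<close> to satisfy the relations of \<open>H\<close>: writing \<open>a' = a\<^sup>-\<^sup>1\<close>,
  \<open>c' = c\<^sup>-\<^sup>1\<close>, the coefficient of \<open>\<delta>\<^sub>g \<otimes> e\<close> in the sum over \<open>c, m\<close> of \<open>r\<^sub>a\<^sub>i\<^sup>c\<^sup>m r\<^sub>a\<^sub>'\<^sub>j\<^sup>c\<^sup>'\<^sup>m\<close>, the image of
  \<open>t\<^sub>a\<^sub>i\<^sup>c\<^sup>m S(t\<^sub>c\<^sub>m\<^sup>a\<^sup>j)\<close>, is the \<open>(i, j)\<close> entry of \<open>\<pi>(\<zeta>\<^sub>a(g\<^sup>-\<^sup>1))\<^sup>T \<pi>(\<zeta>\<^sub>a\<^sub>'(g\<^sup>-\<^sup>1))\<close>, and the relation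
  forces this orthogonal matrix to be the identity.  Stability of \<open>C\<close> under inversion does not
  imply it: take \<open>G = (Z\<^sub>3 \<times> Z\<^sub>2 \<times> Z\<^sub>2) \<rtimes> Z\<^sub>2\<close>, where the last \<open>Z\<^sub>2\<close> inverts \<open>Z\<^sub>3\<close> and swaps the
  other two factors, \<open>r\<close> a generator of \<open>Z\<^sub>3\<close>, and \<open>\<pi>\<close> the sign character of one of the swapped \<open>Z\<^sub>2\<close>.
\<close>

definition inversion_compatible ::
    "('g, 'm) monoid_scheme \<Rightarrow> 'g set \<Rightarrow> ('g \<Rightarrow> 'g) \<Rightarrow> ('g \<Rightarrow> complex^'i^'i) \<Rightarrow> bool" where
  "inversion_compatible G C q \<pi> \<longleftrightarrow>
     (\<forall>c\<in>C. \<forall>g\<in>carrier G. \<pi> (zeta G q (inv\<^bsub>G\<^esub> c) g) = \<pi> (zeta G q c g))"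

text \<open>
  The pair \<open>(a, i)\<close> is the index of the basis vector \<open>E\<^sub>a\<^sub>i\<close> of \<open>V\<close> or of the dual basis vector
  \<open>E\<^sup>a\<^sup>i\<close>, and a letter \<open>((a, i), (b, j))\<close> stands for \<open>E\<^sub>a\<^sub>i\<^sup>b\<^sup>j\<close> or \<open>t\<^sub>a\<^sub>i\<^sup>b\<^sup>j\<close>.  A matrix entry
  \<open>\<pi>(n)\<^sup>i\<^sub>j\<close> is \<open>\<pi> n $ i $ j\<close>.
\<close>

type_synonym ('g, 'i) letter = "('g \<times> 'i) \<times> ('g \<times> 'i)"

definition indices :: "'g set \<Rightarrow> ('g \<times> 'i) set" where
  "indices C = C \<times> UNIV"

definition letters :: "'g set \<Rightarrow> ('g, 'i) letter set" where
  "letters C = indices C \<times> indices C"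

definition actV ::
    "('g, 'm) monoid_scheme \<Rightarrow> ('g \<Rightarrow> 'g) \<Rightarrow> ('g \<Rightarrow> complex^'i^'i) \<Rightarrow> 'g \<Rightarrow> 'g \<times> 'i \<Rightarrow>
     ('g \<times> 'i \<Rightarrow>\<^sub>0 complex)" where
  "actV G q \<pi> h = (\<lambda>(c, i). \<Sum>m\<in>UNIV.
     csmul (\<pi> (zeta G q c h) $ m $ i) (basis (h \<otimes>\<^bsub>G\<^esub> c \<otimes>\<^bsub>G\<^esub> inv\<^bsub>G\<^esub> h, m)))"

definition actV_dual ::
    "('g, 'm) monoid_scheme \<Rightarrow> ('g \<Rightarrow> 'g) \<Rightarrow> ('g \<Rightarrow> complex^'i^'i) \<Rightarrow> 'g \<Rightarrow> 'g \<times> 'i \<Rightarrow>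
     ('g \<times> 'i \<Rightarrow>\<^sub>0 complex)" where
  "actV_dual G q \<pi> h = (\<lambda>(c, i). \<Sum>m\<in>UNIV.
     csmul (\<pi> (inv\<^bsub>G\<^esub> (zeta G q c h)) $ i $ m) (basis (h \<otimes>\<^bsub>G\<^esub> c \<otimes>\<^bsub>G\<^esub> inv\<^bsub>G\<^esub> h, m)))"

definition actL ::
    "('g, 'm) monoid_scheme \<Rightarrow> ('g \<Rightarrow> 'g) \<Rightarrow> ('g \<Rightarrow> complex^'i^'i) \<Rightarrow> 'g \<Rightarrow> ('g, 'i) letter \<Rightarrow>
     (('g, 'i) letter \<Rightarrow>\<^sub>0 complex)" where
  "actL G q \<pi> h = (\<lambda>(x, y). pairs (actV G q \<pi> h x) (actV_dual G q \<pi> h y))"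

definition degL :: "('g, 'm) monoid_scheme \<Rightarrow> ('g, 'i) letter \<Rightarrow> 'g" where
  "degL G = (\<lambda>((a, i), (b, j)). a \<otimes>\<^bsub>G\<^esub> inv\<^bsub>G\<^esub> b)"

text \<open>The fundamental braiding: \<open>z'\<close> runs through the basis elements, all of the same degree,
  occurring in \<open>b\<^sup>-\<^sup>1 \<triangleright> z\<close>.\<close>

definition fundamental_braiding ::
    "('g, 'm) monoid_scheme \<Rightarrow> ('g \<Rightarrow> 'g) \<Rightarrow> ('g \<Rightarrow> complex^'i^'i) \<Rightarrow>
     ('g, 'i) letter \<times> ('g, 'i) letter \<Rightarrow> (('g, 'i) letter \<times> ('g, 'i) letter \<Rightarrow>\<^sub>0 complex)" where
  "fundamental_braiding G q \<pi> = (\<lambda>((x, (b, j)), z).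
     lext (\<lambda>z'. lext (\<lambda>x'. basis (z', (x', (b, j)))) (actV G q \<pi> (inv\<^bsub>G\<^esub> (degL G z')) x))
       (actL G q \<pi> (inv\<^bsub>G\<^esub> b) z))"

text \<open>The matrix coalgebra on a family \<open>t\<close> of elements indexed by letters.\<close>

definition matrix_coalgebra_on ::
    "(complex, 'v, 'z) module_scheme \<Rightarrow> 'g set \<Rightarrow> (('g, 'i) letter \<Rightarrow> 'v) \<Rightarrow>
     ('v \<Rightarrow> ('v \<times> 'v \<Rightarrow>\<^sub>0 complex)) \<Rightarrow> ('v \<Rightarrow> complex) \<Rightarrow> bool" where
  "matrix_coalgebra_on A C t \<Delta> \<epsilon> \<longleftrightarrow>
     (\<forall>x\<in>indices C. \<forall>y\<in>indices C.
        tensor_eq A A (\<Delta> (t (x, y))) (\<Sum>z\<in>indices C. basis (t (x, z), t (z, y))) \<and>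
        \<epsilon> (t (x, y)) = (if x = y then 1 else 0))"

text \<open>The relations \<open>\<Sum>\<^sub>z t(x,z) s(z,y) = \<delta>\<^sub>x\<^sub>y\<close> and \<open>\<Sum>\<^sub>z s(x,z) t(z,y) = \<delta>\<^sub>x\<^sub>y\<close> saying that \<open>s\<close> is
  the matrix inverse of \<open>t\<close>.\<close>

definition antipode_relations ::
    "(complex, 'v, 'z) module_scheme \<Rightarrow> 'g set \<Rightarrow> (('g, 'i) letter \<Rightarrow> 'v) \<Rightarrow>
     (('g, 'i) letter \<Rightarrow> 'v) \<Rightarrow> 'v set" where
  "antipode_relations A C t s =
     {finsum A (\<lambda>z. t (x, z) \<otimes>\<^bsub>A\<^esub> s (z, y)) (indices C) \<ominus>\<^bsub>A\<^esub> (if x = y then \<one>\<^bsub>A\<^esub> else \<zero>\<^bsub>A\<^esub>)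
        | x y. x \<in> indices C \<and> y \<in> indices C} \<union>
     {finsum A (\<lambda>z. s (x, z) \<otimes>\<^bsub>A\<^esub> t (z, y)) (indices C) \<ominus>\<^bsub>A\<^esub> (if x = y then \<one>\<^bsub>A\<^esub> else \<zero>\<^bsub>A\<^esub>)
        | x y. x \<in> indices C \<and> y \<in> indices C}"


subsection \<open>\<open>U(L)\<close> and its quotient \<open>B\<close>\<close>

definition TL ::
    "('g, 'm) monoid_scheme \<Rightarrow> 'g set \<Rightarrow> ('g \<Rightarrow> 'g) \<Rightarrow> ('g \<Rightarrow> complex^'i^'i) \<Rightarrow>
     ('g, ('g, 'i) letter list \<Rightarrow>\<^sub>0 complex) crossed_module" where
  "TL G C q \<pi> = tensor_algebra G (letters C) (actL G q \<pi>) (degL G)"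

definition U_ideal ::
    "('g, 'm) monoid_scheme \<Rightarrow> 'g set \<Rightarrow> ('g \<Rightarrow> 'g) \<Rightarrow> ('g \<Rightarrow> complex^'i^'i) \<Rightarrow>
     (('g, 'i) letter list \<Rightarrow>\<^sub>0 complex) set" where
  "U_ideal G C q \<pi> = Idl\<^bsub>TL G C q \<pi>\<^esub>
     {basis [x, y] - lext (\<lambda>(z, w). basis [z, w]) (fundamental_braiding G q \<pi> (x, y))
        | x y. x \<in> letters C \<and> y \<in> letters C}"

definition U_alg ::
    "('g, 'm) monoid_scheme \<Rightarrow> 'g set \<Rightarrow> ('g \<Rightarrow> 'g) \<Rightarrow> ('g \<Rightarrow> complex^'i^'i) \<Rightarrow>
     ('g, (('g, 'i) letter list \<Rightarrow>\<^sub>0 complex) set) crossed_module" where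
  "U_alg G C q \<pi> = quot_crossed (TL G C q \<pi>) (U_ideal G C q \<pi>)"

definition U_lin ::
    "('g, 'm) monoid_scheme \<Rightarrow> 'g set \<Rightarrow> ('g \<Rightarrow> 'g) \<Rightarrow> ('g \<Rightarrow> complex^'i^'i) \<Rightarrow>
     (('g, 'i) letter \<Rightarrow>\<^sub>0 complex) \<Rightarrow> (('g, 'i) letter list \<Rightarrow>\<^sub>0 complex) set" where
  "U_lin G C q \<pi> p = U_ideal G C q \<pi> +>\<^bsub>TL G C q \<pi>\<^esub> lext (\<lambda>x. basis [x]) p"

definition U_gen ::
    "('g, 'm) monoid_scheme \<Rightarrow> 'g set \<Rightarrow> ('g \<Rightarrow> 'g) \<Rightarrow> ('g \<Rightarrow> complex^'i^'i) \<Rightarrow>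
     ('g, 'i) letter \<Rightarrow> (('g, 'i) letter list \<Rightarrow>\<^sub>0 complex) set" where
  "U_gen G C q \<pi> x = U_lin G C q \<pi> (basis x)"

definition SL ::
    "('g, 'm) monoid_scheme \<Rightarrow> ('g \<Rightarrow> 'g) \<Rightarrow> ('g \<Rightarrow> complex^'i^'i) \<Rightarrow>
     ('g, 'i) letter \<Rightarrow> (('g, 'i) letter \<Rightarrow>\<^sub>0 complex)" where
  "SL G q \<pi> = (\<lambda>((a, i), (b, j)). \<Sum>m\<in>UNIV.
     csmul (\<pi> (inv\<^bsub>G\<^esub> (zeta G q b (a \<otimes>\<^bsub>G\<^esub> inv\<^bsub>G\<^esub> b))) $ j $ m)
       (basis ((a \<otimes>\<^bsub>G\<^esub> inv\<^bsub>G\<^esub> b \<otimes>\<^bsub>G\<^esub> inv\<^bsub>G\<^esub> a, m), (inv\<^bsub>G\<^esub> a, i))))"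

definition B_ideal ::
    "('g, 'm) monoid_scheme \<Rightarrow> 'g set \<Rightarrow> ('g \<Rightarrow> 'g) \<Rightarrow> ('g \<Rightarrow> complex^'i^'i) \<Rightarrow>
     (('g, 'i) letter list \<Rightarrow>\<^sub>0 complex) set set" where
  "B_ideal G C q \<pi> = Idl\<^bsub>U_alg G C q \<pi>\<^esub>
     (antipode_relations (U_alg G C q \<pi>) C (U_gen G C q \<pi>) (\<lambda>x. U_lin G C q \<pi> (SL G q \<pi> x)))"

definition B_alg ::
    "('g, 'm) monoid_scheme \<Rightarrow> 'g set \<Rightarrow> ('g \<Rightarrow> 'g) \<Rightarrow> ('g \<Rightarrow> complex^'i^'i) \<Rightarrow>
     ('g, (('g, 'i) letter list \<Rightarrow>\<^sub>0 complex) set set) crossed_module" where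
  "B_alg G C q \<pi> = quot_crossed (U_alg G C q \<pi>) (B_ideal G C q \<pi>)"

definition B_proj ::
    "('g, 'm) monoid_scheme \<Rightarrow> 'g set \<Rightarrow> ('g \<Rightarrow> 'g) \<Rightarrow> ('g \<Rightarrow> complex^'i^'i) \<Rightarrow>
     (('g, 'i) letter list \<Rightarrow>\<^sub>0 complex) set \<Rightarrow> (('g, 'i) letter list \<Rightarrow>\<^sub>0 complex) set set" where
  "B_proj G C q \<pi> x = B_ideal G C q \<pi> +>\<^bsub>U_alg G C q \<pi>\<^esub> x"


subsection \<open>The FRT bialgebra \<open>A\<close> and its quotient \<open>H\<close>\<close>

text \<open>\<open>Rmat G q \<pi> (a,i) (b,j) (c,m) (d,l)\<close> is the entry with upper indices \<open>ai\<close>, \<open>cm\<close> and lower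
  indices \<open>bj\<close>, \<open>dl\<close>, in the order of the usual notation.\<close>

definition Rmat ::
    "('g, 'm) monoid_scheme \<Rightarrow> ('g \<Rightarrow> 'g) \<Rightarrow> ('g \<Rightarrow> complex^'i^'i) \<Rightarrow>
     'g \<times> 'i \<Rightarrow> 'g \<times> 'i \<Rightarrow> 'g \<times> 'i \<Rightarrow> 'g \<times> 'i \<Rightarrow> complex" where
  "Rmat G q \<pi> = (\<lambda>(a, i) (b, j) (c, m) (d, l).
     if a = b \<and> i = j \<and> c = a \<otimes>\<^bsub>G\<^esub> d \<otimes>\<^bsub>G\<^esub> inv\<^bsub>G\<^esub> a then \<pi> (zeta G q d a) $ m $ l else 0)"

definition A_ideal ::
    "('g, 'm) monoid_scheme \<Rightarrow> 'g set \<Rightarrow> ('g \<Rightarrow> 'g) \<Rightarrow> ('g \<Rightarrow> complex^'i^'i) \<Rightarrow>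
     (('g, 'i) letter list \<Rightarrow>\<^sub>0 complex) set" where
  "A_ideal G C q \<pi> = Idl\<^bsub>free_algebra (letters C)\<^esub>
     {(\<Sum>u\<in>indices C. \<Sum>v\<in>indices C. csmul (Rmat G q \<pi> u x v z) (basis [(u, y), (v, w)])) -
      (\<Sum>u\<in>indices C. \<Sum>v\<in>indices C. csmul (Rmat G q \<pi> y u w v) (basis [(z, v), (x, u)]))
        | x y z w. x \<in> indices C \<and> y \<in> indices C \<and> z \<in> indices C \<and> w \<in> indices C}"

definition A_alg ::
    "('g, 'm) monoid_scheme \<Rightarrow> 'g set \<Rightarrow> ('g \<Rightarrow> 'g) \<Rightarrow> ('g \<Rightarrow> complex^'i^'i) \<Rightarrow>
     (complex, (('g, 'i) letter list \<Rightarrow>\<^sub>0 complex) set) module" where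
  "A_alg G C q \<pi> = quot_algebra (free_algebra (letters C)) (A_ideal G C q \<pi>)"

definition A_gen ::
    "('g, 'm) monoid_scheme \<Rightarrow> 'g set \<Rightarrow> ('g \<Rightarrow> 'g) \<Rightarrow> ('g \<Rightarrow> complex^'i^'i) \<Rightarrow>
     ('g, 'i) letter \<Rightarrow> (('g, 'i) letter list \<Rightarrow>\<^sub>0 complex) set" where
  "A_gen G C q \<pi> x = A_ideal G C q \<pi> +>\<^bsub>free_algebra (letters C)\<^esub> basis [x]"

definition St :: "('g, 'm) monoid_scheme \<Rightarrow> ('g, 'i) letter \<Rightarrow> ('g, 'i) letter" where
  "St G = (\<lambda>((a, i), (b, j)). ((inv\<^bsub>G\<^esub> b, j), (inv\<^bsub>G\<^esub> a, i)))"

definition H_ideal ::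
    "('g, 'm) monoid_scheme \<Rightarrow> 'g set \<Rightarrow> ('g \<Rightarrow> 'g) \<Rightarrow> ('g \<Rightarrow> complex^'i^'i) \<Rightarrow>
     (('g, 'i) letter list \<Rightarrow>\<^sub>0 complex) set set" where
  "H_ideal G C q \<pi> = Idl\<^bsub>A_alg G C q \<pi>\<^esub>
     (antipode_relations (A_alg G C q \<pi>) C (A_gen G C q \<pi>) (\<lambda>x. A_gen G C q \<pi> (St G x)))"

definition H_alg ::
    "('g, 'm) monoid_scheme \<Rightarrow> 'g set \<Rightarrow> ('g \<Rightarrow> 'g) \<Rightarrow> ('g \<Rightarrow> complex^'i^'i) \<Rightarrow>
     (complex, (('g, 'i) letter list \<Rightarrow>\<^sub>0 complex) set set) module" where
  "H_alg G C q \<pi> = quot_algebra (A_alg G C q \<pi>) (H_ideal G C q \<pi>)"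

definition H_proj ::
    "('g, 'm) monoid_scheme \<Rightarrow> 'g set \<Rightarrow> ('g \<Rightarrow> 'g) \<Rightarrow> ('g \<Rightarrow> complex^'i^'i) \<Rightarrow>
     (('g, 'i) letter list \<Rightarrow>\<^sub>0 complex) set \<Rightarrow> (('g, 'i) letter list \<Rightarrow>\<^sub>0 complex) set set" where
  "H_proj G C q \<pi> x = H_ideal G C q \<pi> +>\<^bsub>A_alg G C q \<pi>\<^esub> x"

definition H_gen ::
    "('g, 'm) monoid_scheme \<Rightarrow> 'g set \<Rightarrow> ('g \<Rightarrow> 'g) \<Rightarrow> ('g \<Rightarrow> complex^'i^'i) \<Rightarrow>
     ('g, 'i) letter \<Rightarrow> (('g, 'i) letter list \<Rightarrow>\<^sub>0 complex) set set" where
  "H_gen G C q \<pi> x = H_proj G C q \<pi> (A_gen G C q \<pi> x)"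


subsection \<open>\<open>D\<^sup>\<or>(G)\<close> and \<open>BD(G)\<close>\<close>

text \<open>Both are spaces with basis \<open>G \<times> G\<close>, the pair \<open>(g, h)\<close> standing for \<open>\<delta>\<^sub>g \<otimes> h\<close>.\<close>

definition Dvee :: "('g, 'm) monoid_scheme \<Rightarrow> (complex, 'g \<times> 'g \<Rightarrow>\<^sub>0 complex) module" where
  "Dvee G =
     \<lparr>carrier = {p. Poly_Mapping.keys p \<subseteq> carrier G \<times> carrier G},
      mult = (\<lambda>p p'. lext (\<lambda>((g, h), (u, v)). if g = u then basis (g, h \<otimes>\<^bsub>G\<^esub> v) else 0) (pairs p p')),
      one = (\<Sum>g\<in>carrier G. basis (g, \<one>\<^bsub>G\<^esub>)),
      zero = 0, add = (+), smult = csmul\<rparr>"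

definition D_comult ::
    "('g, 'm) monoid_scheme \<Rightarrow> ('g \<times> 'g \<Rightarrow>\<^sub>0 complex) \<Rightarrow>
     (('g \<times> 'g \<Rightarrow>\<^sub>0 complex) \<times> ('g \<times> 'g \<Rightarrow>\<^sub>0 complex) \<Rightarrow>\<^sub>0 complex)" where
  "D_comult G = lext (\<lambda>(g, h). \<Sum>f\<in>carrier G.
     basis (basis (f, inv\<^bsub>G\<^esub> f \<otimes>\<^bsub>G\<^esub> g \<otimes>\<^bsub>G\<^esub> h \<otimes>\<^bsub>G\<^esub> inv\<^bsub>G\<^esub> g \<otimes>\<^bsub>G\<^esub> f), basis (inv\<^bsub>G\<^esub> f \<otimes>\<^bsub>G\<^esub> g, h)))"

definition D_counit :: "('g, 'm) monoid_scheme \<Rightarrow> ('g \<times> 'g \<Rightarrow>\<^sub>0 complex) \<Rightarrow> complex" where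
  "D_counit G = ceval (\<lambda>(g, h). if g = \<one>\<^bsub>G\<^esub> then 1 else 0)"

definition BD :: "('g, 'm) monoid_scheme \<Rightarrow> ('g, 'g \<times> 'g \<Rightarrow>\<^sub>0 complex) crossed_module" where
  "BD G = with_crossed
     ((Dvee G)\<lparr>mult := (\<lambda>p p'. lext (\<lambda>((g, h), (u, v)).
        if g = h \<otimes>\<^bsub>G\<^esub> u \<otimes>\<^bsub>G\<^esub> inv\<^bsub>G\<^esub> h then basis (g, h \<otimes>\<^bsub>G\<^esub> v) else 0) (pairs p p'))\<rparr>)
     (\<lambda>f. lext (\<lambda>(g, h). basis (f \<otimes>\<^bsub>G\<^esub> g \<otimes>\<^bsub>G\<^esub> inv\<^bsub>G\<^esub> f, f \<otimes>\<^bsub>G\<^esub> h \<otimes>\<^bsub>G\<^esub> inv\<^bsub>G\<^esub> f)))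
     (\<lambda>k. lext (\<lambda>(g, h). if g \<otimes>\<^bsub>G\<^esub> inv\<^bsub>G\<^esub> h \<otimes>\<^bsub>G\<^esub> inv\<^bsub>G\<^esub> g \<otimes>\<^bsub>G\<^esub> h = k then basis (g, h) else 0))"

definition r_elt ::
    "('g, 'm) monoid_scheme \<Rightarrow> 'g \<Rightarrow> ('g \<Rightarrow> 'g) \<Rightarrow> ('g \<Rightarrow> complex^'i^'i) \<Rightarrow>
     ('g, 'i) letter \<Rightarrow> ('g \<times> 'g \<Rightarrow>\<^sub>0 complex)" where
  "r_elt G r q \<pi> = (\<lambda>((a, i), (b, j)). \<Sum>n\<in>centraliser G r.
     csmul (\<pi> n $ j $ i) (basis (q a \<otimes>\<^bsub>G\<^esub> inv\<^bsub>G\<^esub> n \<otimes>\<^bsub>G\<^esub> inv\<^bsub>G\<^esub> (q b), inv\<^bsub>G\<^esub> b)))"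

text \<open>
  \<open>M\<close> is the comodule transmutation of the coquasitriangular Hopf algebra \<open>H\<close>, viewed in the
  category of \<open>G\<close>-crossed modules along \<open>\<psi> : H \<rightarrow> D\<^sup>\<or>(G)\<close>: the pushed out adjoint coaction has to
  be \<open>x \<mapsto> \<Sum>\<^sub>g g \<triangleright> x \<otimes> \<delta>\<^sub>g \<otimes> |x|\<close>, which determines the crossed module structure.  The coalgebra
  of \<open>M\<close> is that of \<open>H\<close>.
\<close>

definition is_transmutation ::
    "('g, 'm) monoid_scheme \<Rightarrow> (complex, 'v) module \<Rightarrow> ('v \<Rightarrow> ('v \<times> 'v \<Rightarrow>\<^sub>0 complex)) \<Rightarrow>
     ('v \<Rightarrow> 'v) \<Rightarrow> ('v \<Rightarrow> 'v \<Rightarrow> complex) \<Rightarrow> ('v \<Rightarrow> ('g \<times> 'g \<Rightarrow>\<^sub>0 complex)) \<Rightarrow>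
     ('g, 'v) crossed_module \<Rightarrow> bool" where
  "is_transmutation G H \<Delta> S R \<psi> M \<longleftrightarrow>
     (\<exists>ac hc. M = with_crossed (transmuted_algebra H \<Delta> S R) ac hc) \<and>
     is_crossed_module G M \<and>
     (\<forall>x\<in>carrier H. tensor_eq H (Dvee G)
        (tensor_map id \<psi> (adjoint_coaction H \<Delta> S x))
        (\<Sum>g\<in>carrier G. \<Sum>k\<in>carrier G. basis (act M g (hcomp M k x), basis (g, k))))"

end

theory Submission imports Defs begin

text \<open>
  All four algebras are quotients of the space of words in the letters \<open>(ai, bj)\<close>, on which the matrix
  coalgebra structure and the actions of \<open>G\<close> on the left and on the right indices are explicit.  Write
  \<open>NA\<close> for the ideal of relations of \<open>A\<close> and \<open>NH\<close> for that of \<open>H\<close>; they are coideals in the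
  kernel of the map to \<open>D\<^sup>\<or>(G)\<close>, which makes them stable under both actions and the grading.  Hence they
  are also ideals for the twisted product \<open>u (|u| \<triangleright> v)\<close> of words, where \<open>G\<close> acts on left
  indices only.  The isomorphism from the free algebra to the twisted algebra that fixes the letters
  carries the relations of \<open>U\<close> and \<open>B\<close> to \<open>NA\<close> and \<open>NH\<close>, so \<open>U\<close> and \<open>B\<close> are \<open>A\<close> and \<open>H\<close> with the
  twisted product.  The transmuted product of \<open>H\<close> is the twisted one as well, which identifies \<open>B\<close>
  with the transmutation of \<open>H\<close>.
\<close>

text \<open>The delicate point is that one ideal has to serve two products. Passing from
  concatenation to the twisted product is easy once an ideal is stable, and stability comes without
  touching the relations. Conversely, an ideal for the twisted product is not known to be stable; it
  is replaced by the set of elements all of whose translates have all their homogeneous components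
  in it (\<open>zset\<close>). This is an ideal for concatenation and still contains the relations,
  because a translate of a relation is a combination of homogeneous relations of the same kind.

  Orthogonality gives \<open>V\<close> and its dual the same matrices, so that one function
  \<open>rho\<close> serves both indices, and it makes the insertion of a group element on both
  copies of a contracted index harmless; twists in coproducts are moved this way. Compatibility of
  the section with inversion makes inverting an index equivariant, so that the antipode exchanges
  left and right actions.

  Coproducts on quotients depend on chosen representatives and tensors are formal combinations
  modulo null ones, so identities there are tested against linear, bilinear and trilinear
  forms.\<close>

lemma lookup_csmul [simp]: "Poly_Mapping.lookup (csmul k p) x = k * Poly_Mapping.lookup p x"
  unfolding csmul_def by transfer (auto simp: when_def)

interpretation csmul: vector_space csmul
  by unfold_locales (auto intro!: poly_mapping_eqI simp: lookup_add algebra_simps)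

lemma csmul_basis: "csmul k (basis x) = Poly_Mapping.single x k"
  by (rule poly_mapping_eqI) (simp add: lookup_single when_def)

lemma keys_csmul: "Poly_Mapping.keys (csmul k p) \<subseteq> Poly_Mapping.keys p"
  by (auto simp: in_keys_iff)

lemma lext_superset:
  assumes "finite S" "Poly_Mapping.keys p \<subseteq> S"
  shows "lext f p = (\<Sum>x\<in>S. csmul (Poly_Mapping.lookup p x) (f x))"
  unfolding lext_def using assms
  by (intro sum.mono_neutral_left) (auto simp: in_keys_iff)

lemma ceval_superset:
  assumes "finite S" "Poly_Mapping.keys p \<subseteq> S"
  shows "ceval f p = (\<Sum>x\<in>S. Poly_Mapping.lookup p x * f x)"
  unfolding ceval_def using assms
  by (intro sum.mono_neutral_left) (auto simp: in_keys_iff)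

lemma lext_zero [simp]: "lext f 0 = 0" and ceval_zero [simp]: "ceval h 0 = 0"
  by (simp_all add: lext_def ceval_def)

lemma lext_basis [simp]: "lext f (basis x) = f x" and ceval_basis [simp]: "ceval h (basis x) = h x"
  by (simp_all add: lext_def ceval_def)

lemma lext_add: "lext f (p + q) = lext f p + lext f q"
proof -
  let ?S = "Poly_Mapping.keys p \<union> Poly_Mapping.keys q"
  have "Poly_Mapping.keys (p + q) \<subseteq> ?S" by (rule Poly_Mapping.keys_add)
  then show ?thesis
    by (simp add: lext_superset[of ?S] lookup_add csmul.scale_left_distrib sum.distrib)
qed

lemma ceval_add: "ceval f (p + q) = ceval f p + ceval f q"
proof -
  let ?S = "Poly_Mapping.keys p \<union> Poly_Mapping.keys q"
  have "Poly_Mapping.keys (p + q) \<subseteq> ?S" by (rule Poly_Mapping.keys_add)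
  then show ?thesis
    by (simp add: ceval_superset[of ?S] lookup_add sum.distrib distrib_right)
qed

lemma lext_csmul: "lext f (csmul k p) = csmul k (lext f p)"
  by (simp add: lext_superset[of "Poly_Mapping.keys p"] keys_csmul csmul.scale_sum_right)

lemma ceval_csmul: "ceval f (csmul k p) = k * ceval f p"
  by (simp add: ceval_superset[of "Poly_Mapping.keys p"] keys_csmul sum_distrib_left mult.assoc)

lemma lext_sum: "lext f (sum g A) = (\<Sum>i\<in>A. lext f (g i))"
  by (induction A rule: infinite_finite_induct) (auto simp: lext_add)

lemma ceval_sum: "ceval f (sum g A) = (\<Sum>i\<in>A. ceval f (g i))"
  by (induction A rule: infinite_finite_induct) (auto simp: ceval_add)

lemma lext_uminus: "lext f (- p) = - lext f p"
  using lext_csmul[of f "-1" p] by simp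

lemma ceval_uminus: "ceval f (- p) = - ceval f p"
  using ceval_csmul[of f "-1" p] by simp

lemma lext_diff: "lext f (p - q) = lext f p - lext f q"
  using lext_add[of f p "- q"] by (simp add: lext_uminus)

lemma ceval_diff: "ceval f (p - q) = ceval f p - ceval f q"
  using ceval_add[of f p "- q"] by (simp add: ceval_uminus)

lemmas lext_linear = lext_add lext_csmul lext_sum lext_uminus lext_diff
lemmas ceval_linear = ceval_add ceval_csmul ceval_sum ceval_uminus ceval_diff

lemma lext_cong: "(\<And>x. x \<in> Poly_Mapping.keys p \<Longrightarrow> f x = g x) \<Longrightarrow> lext f p = lext g p"
  by (simp add: lext_def)

lemma ceval_cong: "(\<And>x. x \<in> Poly_Mapping.keys p \<Longrightarrow> f x = g x) \<Longrightarrow> ceval f p = ceval g p"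
  by (simp add: ceval_def)

lemma lext_lext: "lext f (lext g p) = lext (\<lambda>x. lext f (g x)) p"
  by (simp add: lext_def[of g] lext_def[of "\<lambda>x. lext f (g x)"] lext_sum lext_csmul)

lemma ceval_lext: "ceval f (lext g p) = ceval (\<lambda>x. ceval f (g x)) p"
  by (simp add: lext_def[of g] ceval_def[of "\<lambda>x. ceval f (g x)"] ceval_sum ceval_csmul)

lemma lext_basis_id [simp]: "lext basis p = p"
  unfolding lext_def csmul_basis
  by (rule poly_mapping_eqI) (auto simp: lookup_sum lookup_single when_def sum.delta' in_keys_iff)

lemma lext_fun_add: "lext (\<lambda>x. f x + g x) p = lext f p + lext g p"
  by (simp add: lext_def csmul.scale_right_distrib sum.distrib)

lemma lext_fun_csmul: "lext (\<lambda>x. csmul k (f x)) p = csmul k (lext f p)"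
  by (simp add: lext_def csmul.scale_sum_right mult.commute)

lemma lext_fun_zero [simp]: "lext (\<lambda>x. 0) p = 0"
  by (simp add: lext_def)

lemma lext_fun_sum: "lext (\<lambda>x. \<Sum>i\<in>A. f i x) p = (\<Sum>i\<in>A. lext (f i) p)"
  unfolding lext_def by (simp add: csmul.scale_sum_right) (rule sum.swap)

lemma ceval_fun_add: "ceval (\<lambda>x. f x + g x) p = ceval f p + ceval g p"
  by (simp add: ceval_def distrib_left sum.distrib)

lemma ceval_fun_mult: "ceval (\<lambda>x. k * f x) p = k * ceval f p"
  by (simp add: ceval_def sum_distrib_left mult.left_commute)

lemma ceval_fun_mult_right: "ceval (\<lambda>x. f x * k) p = ceval f p * k"
  by (simp add: ceval_def sum_distrib_right mult.assoc)

lemma ceval_fun_zero [simp]: "ceval (\<lambda>x. 0) p = 0"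
  by (simp add: ceval_def)

lemma ceval_fun_sum: "ceval (\<lambda>x. \<Sum>i\<in>A. f i x) p = (\<Sum>i\<in>A. ceval (f i) p)"
  unfolding ceval_def by (simp add: sum_distrib_left) (rule sum.swap)

lemma ceval_swap: "ceval (\<lambda>x. ceval (\<lambda>y. f x y) q) p = ceval (\<lambda>y. ceval (\<lambda>x. f x y) p) q"
  unfolding ceval_def by (simp add: sum_distrib_left mult.left_commute) (rule sum.swap)

lemma lext_swap: "lext (\<lambda>x. lext (\<lambda>y. f x y) q) p = lext (\<lambda>y. lext (\<lambda>x. f x y) p) q"
  unfolding lext_def
  by (simp add: csmul.scale_sum_right mult.commute) (rule sum.swap)

lemma ceval_eq_lookup: "ceval (\<lambda>y. if y = x then 1 else 0) p = Poly_Mapping.lookup p x"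
proof -
  have "ceval (\<lambda>y. if y = x then 1 else 0) p
      = (\<Sum>y\<in>insert x (Poly_Mapping.keys p). Poly_Mapping.lookup p y * (if y = x then 1 else 0))"
    by (rule ceval_superset) auto
  also have "\<dots> = (\<Sum>y\<in>insert x (Poly_Mapping.keys p). if y = x then Poly_Mapping.lookup p y else 0)"
    by (rule sum.cong) auto
  also have "\<dots> = Poly_Mapping.lookup p x" by (simp add: sum.delta)
  finally show ?thesis .
qed

text \<open>Evaluating at a functional turns an identity of formal combinations into an identity of
  complex sums over indices; most identities on words below are checked in that form.\<close>

lemma ceval_ext: "(\<And>f. ceval f p = ceval f q) \<Longrightarrow> p = q"
  by (rule poly_mapping_eqI) (metis ceval_eq_lookup)

lemma keys_lext: "Poly_Mapping.keys (lext f p) \<subseteq> (\<Union>x\<in>Poly_Mapping.keys p. Poly_Mapping.keys (f x))"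
  unfolding lext_def using keys_sum keys_csmul by fastforce

lemma lext_pairs: "lext f (pairs p q) = lext (\<lambda>x. lext (\<lambda>y. f (x, y)) q) p"
  by (simp add: pairs_def lext_lext)

lemma ceval_pairs: "ceval f (pairs p q) = ceval (\<lambda>x. ceval (\<lambda>y. f (x, y)) q) p"
  by (simp add: pairs_def ceval_lext)

text \<open>A basis of \<open>N\<close> stays independent when \<open>p\<close> is added, so some
  linear functional is \<open>0\<close> on it and \<open>1\<close> at \<open>p\<close>; on a space
  with a basis every linear functional is \<open>ceval\<close> of its values on the basis.\<close>

lemma exists_separating:
  assumes N: "csmul.subspace N" and p: "p \<notin> N"
  shows "\<exists>f. (\<forall>n\<in>N. ceval f n = 0) \<and> ceval f p \<noteq> 0"
proof -
  interpret C: vector_space "(*) :: complex \<Rightarrow> complex \<Rightarrow> complex"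
    by unfold_locales (auto simp: algebra_simps)
  interpret PC: vector_space_pair csmul "(*) :: complex \<Rightarrow> complex \<Rightarrow> complex" ..
  obtain B where B: "B \<subseteq> N" "csmul.independent B" "N \<subseteq> csmul.span B"
    using csmul.maximal_independent_subset[of N] by blast
  have sB: "csmul.span B = N" using B N csmul.span_minimal by blast
  then have "csmul.independent (insert p B)" using B(2) p by (simp add: csmul.independent_insert)
  from PC.linear_independent_extend[OF this, of "\<lambda>x. if x = p then 1 else 0"]
  obtain g where lg: "Vector_Spaces.linear csmul (*) g"
    and g: "\<forall>x\<in>insert p B. g x = (if x = p then 1 else 0)" by auto
  interpret g: Vector_Spaces.linear csmul "(*)" g by (rule lg)
  have g_eval: "g n = ceval (\<lambda>x. g (basis x)) n" for n
  proof -
    have "g n = g (lext basis n)" by simp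
    also have "\<dots> = ceval (\<lambda>x. g (basis x)) n"
      unfolding lext_def ceval_def by (simp add: g.sum g.scale)
    finally show ?thesis .
  qed
  have "\<forall>n\<in>N. g n = 0"
  proof
    fix n assume "n \<in> N"
    then have n: "n \<in> csmul.span B" by (simp add: sB)
    show "g n = 0"
      by (rule g.eq_0_on_span[OF _ n]) (use g B p in auto)
  qed
  moreover have "g p \<noteq> 0" using g by auto
  ultimately show ?thesis using g_eval by metis
qed

section \<open>Spaces spanned by a set of basis elements\<close>

definition psp :: "'x set \<Rightarrow> ('x \<Rightarrow>\<^sub>0 complex) set" where
  "psp X = {p. Poly_Mapping.keys p \<subseteq> X}"

lemma psp_zero [simp]: "0 \<in> psp X" by (simp add: psp_def)
lemma psp_add: "p \<in> psp X \<Longrightarrow> q \<in> psp X \<Longrightarrow> p + q \<in> psp X"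
  using Poly_Mapping.keys_add[of p q] by (auto simp: psp_def)
lemma psp_csmul: "p \<in> psp X \<Longrightarrow> csmul k p \<in> psp X"
  using keys_csmul[of k p] by (auto simp: psp_def)
lemma psp_uminus: "p \<in> psp X \<Longrightarrow> - p \<in> psp X"
  by (simp add: psp_def)
lemma psp_diff: "p \<in> psp X \<Longrightarrow> q \<in> psp X \<Longrightarrow> p - q \<in> psp X"
  using psp_add[of p X "-q"] by (simp add: psp_uminus)
lemma psp_sum: "(\<And>i. i \<in> A \<Longrightarrow> f i \<in> psp X) \<Longrightarrow> sum f A \<in> psp X"
  by (induction A rule: infinite_finite_induct) (auto intro: psp_add)
lemma psp_basis [simp]: "basis x \<in> psp X \<longleftrightarrow> x \<in> X"
  by (simp add: psp_def)
lemma psp_lext: "p \<in> psp Y \<Longrightarrow> (\<And>y. y \<in> Y \<Longrightarrow> f y \<in> psp X) \<Longrightarrow> lext f p \<in> psp X"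
  using keys_lext[of f p] by (fastforce simp: psp_def)
lemma psp_keysD: "p \<in> psp X \<Longrightarrow> x \<in> Poly_Mapping.keys p \<Longrightarrow> x \<in> X"
  by (auto simp: psp_def)

lemma psp_induct [consumes 1, case_names zero add basis]:
  assumes "p \<in> psp X" "Q 0" "\<And>p q. p \<in> psp X \<Longrightarrow> q \<in> psp X \<Longrightarrow> Q p \<Longrightarrow> Q q \<Longrightarrow> Q (p + q)"
    and "\<And>k x. x \<in> X \<Longrightarrow> Q (csmul k (basis x))"
  shows "Q p"
proof -
  have "Q (\<Sum>x\<in>S. csmul (Poly_Mapping.lookup p x) (basis x))" if "finite S" "S \<subseteq> X" for S
    using that
  proof (induction S rule: finite_induct)
    case empty then show ?case using assms(2) by simp
  next
    case (insert x S)
    have "csmul (Poly_Mapping.lookup p x) (basis x) + (\<Sum>x\<in>S. csmul (Poly_Mapping.lookup p x) (basis x)) \<in> psp X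
      \<and> Q (csmul (Poly_Mapping.lookup p x) (basis x) + (\<Sum>x\<in>S. csmul (Poly_Mapping.lookup p x) (basis x)))"
      using insert by (intro conjI assms(3,4) psp_add psp_sum psp_csmul) auto
    then show ?case using insert by simp
  qed
  from this[of "Poly_Mapping.keys p"] assms(1)
  have "Q (lext basis p)" unfolding lext_def psp_def by simp
  then show ?thesis by simp
qed

lemma lext_psp_cong:
  assumes "p \<in> psp X" "\<And>x. x \<in> X \<Longrightarrow> f x = g x"
  shows "lext f p = lext g p"
  by (rule lext_cong) (use assms in \<open>auto simp: psp_def\<close>)

lemma ceval_psp_cong:
  assumes "p \<in> psp X" "\<And>x. x \<in> X \<Longrightarrow> f x = g x"
  shows "ceval f p = ceval g p"
  by (rule ceval_cong) (use assms in \<open>auto simp: psp_def\<close>)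

section \<open>Detecting tensors by multilinear forms\<close>

definition bilin :: "(complex, 'v, 'y) module_scheme \<Rightarrow> (complex, 'w, 'z) module_scheme \<Rightarrow>
    ('v \<Rightarrow> 'w \<Rightarrow> complex) \<Rightarrow> bool" where
  "bilin V W \<beta> \<longleftrightarrow>
     (\<forall>x\<in>carrier V. \<forall>x'\<in>carrier V. \<forall>y\<in>carrier W. \<beta> (x \<oplus>\<^bsub>V\<^esub> x') y = \<beta> x y + \<beta> x' y) \<and>
     (\<forall>x\<in>carrier V. \<forall>y\<in>carrier W. \<forall>y'\<in>carrier W. \<beta> x (y \<oplus>\<^bsub>W\<^esub> y') = \<beta> x y + \<beta> x y') \<and>
     (\<forall>k. \<forall>x\<in>carrier V. \<forall>y\<in>carrier W. \<beta> (k \<odot>\<^bsub>V\<^esub> x) y = k * \<beta> x y \<and> \<beta> x (k \<odot>\<^bsub>W\<^esub> y) = k * \<beta> x y)"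

lemma tensor_null_subspace: "csmul.subspace (tensor_null V W)"
  by (auto simp: csmul.subspace_def intro: tensor_null.intros)

text \<open>The null tensors form a subspace, so a tensor outside it is separated from it by a
  functional \<open>f\<close>; that \<open>f\<close> vanishes on the bilinearity relations says that
  \<open>f (x, y)\<close> is bilinear. Identities of tensors thus reduce to identities of
  numbers.\<close>

lemma tensor_nullI:
  assumes "\<And>\<beta>. bilin V W \<beta> \<Longrightarrow> ceval (\<lambda>(x, y). \<beta> x y) p = 0"
  shows "p \<in> tensor_null V W"
proof (rule ccontr)
  assume "p \<notin> tensor_null V W"
  from exists_separating[OF tensor_null_subspace this]
  obtain f where f: "\<And>n. n \<in> tensor_null V W \<Longrightarrow> ceval f n = 0" "ceval f p \<noteq> 0" by blast
  have "bilin V W (\<lambda>x y. f (x, y))"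
    unfolding bilin_def
    using f(1)[OF tensor_null.add_left] f(1)[OF tensor_null.add_right]
      f(1)[OF tensor_null.smul_left] f(1)[OF tensor_null.smul_right]
    by (force simp: ceval_linear diff_diff_eq)
  from assms[OF this] f(2) show False by simp
qed

lemma tensor_eqI:
  assumes "\<And>\<beta>. bilin V W \<beta> \<Longrightarrow> ceval (\<lambda>(x, y). \<beta> x y) p = ceval (\<lambda>(x, y). \<beta> x y) p'"
  shows "tensor_eq V W p p'"
  unfolding tensor_eq_def by (rule tensor_nullI) (simp add: ceval_diff assms)

lemma tensor3_null_left:
  assumes "p \<in> tensor_null V V" "z \<in> carrier V"
  shows "lext (\<lambda>(u, v). basis (u, v, z)) p \<in> tensor3_null V"
  using assms(1)
  by induction (use assms(2) in \<open>auto simp: lext_linear intro: tensor3_null.intros\<close>)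

lemma tensor3_null_right:
  assumes "p \<in> tensor_null V V" "z \<in> carrier V"
  shows "lext (\<lambda>(u, v). basis (z, u, v)) p \<in> tensor3_null V"
  using assms(1)
  by induction (use assms(2) in \<open>auto simp: lext_linear intro: tensor3_null.intros\<close>)

lemma tensor3_null_sum: "(\<And>i. i \<in> A \<Longrightarrow> f i \<in> tensor3_null V) \<Longrightarrow> sum f A \<in> tensor3_null V"
  by (induction A rule: infinite_finite_induct) (auto intro: tensor3_null.intros)

lemma tensor3_null_lext:
  "(\<And>x. x \<in> Poly_Mapping.keys p \<Longrightarrow> f x \<in> tensor3_null V) \<Longrightarrow> lext f p \<in> tensor3_null V"
  unfolding lext_def by (intro tensor3_null_sum tensor3_null.smul)

lemma complex_ring_simps [simp]:
  "carrier complex_ring = UNIV" "x \<otimes>\<^bsub>complex_ring\<^esub> y = x * y" "\<one>\<^bsub>complex_ring\<^esub> = 1"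
  "\<zero>\<^bsub>complex_ring\<^esub> = 0" "x \<oplus>\<^bsub>complex_ring\<^esub> y = x + y"
  by (simp_all add: complex_ring_def)

lemma cring_complex_ring: "cring complex_ring"
proof (intro cringI abelian_groupI comm_monoidI)
  fix x :: complex
  show "\<exists>y\<in>carrier complex_ring. y \<oplus>\<^bsub>complex_ring\<^esub> x = \<zero>\<^bsub>complex_ring\<^esub>"
    by (rule bexI[of _ "-x"]) auto
qed (auto simp: algebra_simps)

lemma lext_fun_diff: "lext (\<lambda>x. f x - g x) p = lext f p - lext g p"
  using lext_fun_add[of "\<lambda>x. f x - g x" g p] by simp

section \<open>Structure carried to a quotient through chosen representatives\<close>

definition qsec :: "'x set \<Rightarrow> (('x \<Rightarrow>\<^sub>0 complex) \<Rightarrow> 'v) \<Rightarrow> 'v \<Rightarrow> ('x \<Rightarrow>\<^sub>0 complex)" where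
  "qsec X P x = (SOME p. p \<in> psp X \<and> P p = x)"

definition timg :: "(('x \<Rightarrow>\<^sub>0 complex) \<Rightarrow> 'v) \<Rightarrow> ('x \<times> 'x \<Rightarrow>\<^sub>0 complex) \<Rightarrow> ('v \<times> 'v \<Rightarrow>\<^sub>0 complex)" where
  "timg P d = lext (\<lambda>(u, v). basis (P (basis u), P (basis v))) d"

text \<open>The value is a formal combination that depends on the representative chosen by
  \<open>qsec\<close>; when the kernel is a coideal it is determined up to \<open>tensor_eq\<close>,
  which is all that \<open>coalgebra\<close> asks of a coproduct.\<close>

definition qcomult :: "'x set \<Rightarrow> ('x \<Rightarrow> ('x \<times> 'x \<Rightarrow>\<^sub>0 complex)) \<Rightarrow> (('x \<Rightarrow>\<^sub>0 complex) \<Rightarrow> 'v) \<Rightarrow>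
    'v \<Rightarrow> ('v \<times> 'v \<Rightarrow>\<^sub>0 complex)" where
  "qcomult X \<delta> P x = timg P (lext \<delta> (qsec X P x))"

definition qcounit :: "'x set \<Rightarrow> ('x \<Rightarrow> complex) \<Rightarrow> (('x \<Rightarrow>\<^sub>0 complex) \<Rightarrow> 'v) \<Rightarrow> 'v \<Rightarrow> complex" where
  "qcounit X \<epsilon> P x = ceval \<epsilon> (qsec X P x)"

definition lmul :: "('x \<Rightarrow> 'x \<Rightarrow> ('x \<Rightarrow>\<^sub>0 complex)) \<Rightarrow> ('x \<Rightarrow>\<^sub>0 complex) \<Rightarrow> ('x \<Rightarrow>\<^sub>0 complex) \<Rightarrow>
    ('x \<Rightarrow>\<^sub>0 complex)" where
  "lmul m p q = lext (\<lambda>u. lext (\<lambda>v. m u v) q) p"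

lemma lmul_basis [simp]: "lmul m (basis u) (basis v) = m u v"
  by (simp add: lmul_def)

lemma lmul_add_left: "lmul m (p + p') q = lmul m p q + lmul m p' q"
  and lmul_add_right: "lmul m p (q + q') = lmul m p q + lmul m p q'"
  and lmul_csmul_left: "lmul m (csmul k p) q = csmul k (lmul m p q)"
  and lmul_csmul_right: "lmul m p (csmul k q) = csmul k (lmul m p q)"
  and lmul_zero_left [simp]: "lmul m 0 q = 0"
  and lmul_zero_right [simp]: "lmul m p 0 = 0"
  and lmul_diff_left: "lmul m (p - p') q = lmul m p q - lmul m p' q"
  and lmul_sum_left: "lmul m (sum f A) q = (\<Sum>i\<in>A. lmul m (f i) q)"
  and lmul_sum_right: "lmul m p (sum f A) = (\<Sum>i\<in>A. lmul m p (f i))"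
  by (simp_all add: lmul_def lext_linear lext_fun_add lext_fun_csmul lext_fun_sum)

lemma lmul_diff_right: "lmul m p (q - q') = lmul m p q - lmul m p q'"
  using lmul_add_right[of m p "q - q'" q'] by simp

lemmas lmul_linear = lmul_add_left lmul_add_right lmul_csmul_left lmul_csmul_right
  lmul_diff_left lmul_diff_right lmul_sum_left lmul_sum_right

lemma lmul_lext_left: "lmul m (lext f p) q = lext (\<lambda>u. lmul m (f u) q) p"
  by (simp add: lmul_def lext_lext)

lemma lmul_lext_right: "lmul m p (lext f q) = lext (\<lambda>v. lmul m p (f v)) q"
  unfolding lmul_def by (subst (2) lext_swap) (simp add: lext_lext)

lemma lmul_alt: "lmul m p q = lext (\<lambda>u. lmul m (basis u) q) p"
  by (simp add: lmul_def)

lemma lmul_closed: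
  "\<lbrakk>\<And>u v. u \<in> X \<Longrightarrow> v \<in> Y \<Longrightarrow> m u v \<in> psp Z; p \<in> psp X; q \<in> psp Y\<rbrakk> \<Longrightarrow> lmul m p q \<in> psp Z"
  unfolding lmul_def by (blast intro: psp_lext)

lemma lext_lmul: "lext f (lmul m p q) = lext (\<lambda>u. lext (\<lambda>v. lext f (m u v)) q) p"
  by (simp add: lmul_def lext_lext)

lemma ceval_lmul: "ceval f (lmul m p q) = ceval (\<lambda>u. ceval (\<lambda>v. ceval f (m u v)) q) p"
  by (simp add: lmul_def ceval_lext)

section \<open>Quotients of spaces with a basis\<close>

text \<open>\<open>P\<close> presents \<open>K\<close> as a quotient of the space with basis \<open>X\<close>, so that structure on \<open>K\<close> can be
  given and checked on \<open>X\<close>.\<close>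

locale cover =
  fixes X :: "'x set" and K :: "(complex, 'v, 'z) module_scheme" (structure)
    and P :: "('x \<Rightarrow>\<^sub>0 complex) \<Rightarrow> 'v"
  assumes P_closed: "p \<in> psp X \<Longrightarrow> P p \<in> carrier K"
    and P_surj: "x \<in> carrier K \<Longrightarrow> \<exists>p\<in>psp X. P p = x"
    and P_zero: "P 0 = \<zero>"
    and P_add: "p \<in> psp X \<Longrightarrow> q \<in> psp X \<Longrightarrow> P (p + q) = P p \<oplus> P q"
    and P_csmul: "p \<in> psp X \<Longrightarrow> P (csmul k p) = k \<odot> P p"
begin

lemma P_ex: "x \<in> carrier K \<Longrightarrow> (\<And>p. p \<in> psp X \<Longrightarrow> x = P p \<Longrightarrow> thesis) \<Longrightarrow> thesis"
  using P_surj by blast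

lemma abelian_group: "abelian_group K"
proof (rule abelian_groupI)
  fix x y z assume "x \<in> carrier K" "y \<in> carrier K" "z \<in> carrier K"
  then obtain p q s where [simp]: "p \<in> psp X" "x = P p" "q \<in> psp X" "y = P q" "s \<in> psp X" "z = P s"
    by (metis P_surj)
  show "x \<oplus> y \<oplus> z = x \<oplus> (y \<oplus> z)"
    by (simp add: P_add[symmetric] psp_add add.assoc)
next
  fix x y assume "x \<in> carrier K" "y \<in> carrier K"
  then obtain p q where [simp]: "p \<in> psp X" "x = P p" "q \<in> psp X" "y = P q"
    by (metis P_surj)
  show "x \<oplus> y = y \<oplus> x" by (simp add: P_add[symmetric] add.commute)
  show "x \<oplus> y \<in> carrier K" by (simp add: P_add[symmetric] psp_add P_closed)
next
  fix x assume "x \<in> carrier K"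
  then obtain p where [simp]: "p \<in> psp X" "x = P p" by (metis P_surj)
  show "\<zero> \<oplus> x = x" by (simp add: P_add[symmetric] P_zero[symmetric])
  show "\<exists>y\<in>carrier K. y \<oplus> x = \<zero>"
    by (rule bexI[of _ "P (- p)"]) (simp_all add: P_add[symmetric] P_zero[symmetric] psp_uminus P_closed)
next
  show "\<zero> \<in> carrier K" using P_closed[of 0] by (simp add: P_zero)
qed

sublocale K: abelian_group K by (rule abelian_group)

lemma module: "Module.module complex_ring K"
proof (rule moduleI)
  fix a b x assume "x \<in> carrier K"
  then obtain p where [simp]: "p \<in> psp X" "x = P p" by (metis P_surj)
  show "a \<odot> x \<in> carrier K" by (simp add: P_csmul[symmetric] psp_csmul P_closed)
  show "(a \<oplus>\<^bsub>complex_ring\<^esub> b) \<odot> x = a \<odot> x \<oplus> b \<odot> x"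
    by (simp add: P_csmul[symmetric] P_add[symmetric] psp_csmul csmul.scale_left_distrib)
  show "(a \<otimes>\<^bsub>complex_ring\<^esub> b) \<odot> x = a \<odot> (b \<odot> x)"
    by (simp add: P_csmul[symmetric] psp_csmul)
  show "\<one>\<^bsub>complex_ring\<^esub> \<odot> x = x" by (simp add: P_csmul[symmetric])
next
  fix a x y assume "x \<in> carrier K" "y \<in> carrier K"
  then obtain p q where [simp]: "p \<in> psp X" "x = P p" "q \<in> psp X" "y = P q" by (metis P_surj)
  show "a \<odot> (x \<oplus> y) = a \<odot> x \<oplus> a \<odot> y"
    by (simp add: P_csmul[symmetric] P_add[symmetric] psp_csmul psp_add csmul.scale_right_distrib)
qed (simp_all add: cring_complex_ring abelian_group)

lemma P_sum: "(\<And>i. i \<in> A \<Longrightarrow> f i \<in> psp X) \<Longrightarrow> P (sum f A) = finsum K (\<lambda>i. P (f i)) A"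
proof (induction A rule: infinite_finite_induct)
  case (infinite A)
  then show ?case by (simp add: P_zero finsum_def finprod_def)
next
  case (insert x F)
  then have "P (sum f (insert x F)) = P (f x) \<oplus> finsum K (\<lambda>i. P (f i)) F"
    by (simp add: P_add psp_sum)
  also have "\<dots> = finsum K (\<lambda>i. P (f i)) (insert x F)"
    using insert by (subst K.finsum_insert) (auto intro!: P_closed)
  finally show ?case .
qed (simp add: P_zero)

lemma P_uminus: "p \<in> psp X \<Longrightarrow> P (- p) = \<ominus> P p"
  using P_add[of "- p" p] by (intro K.minus_equality[symmetric]) (auto simp: P_closed P_zero psp_uminus)

lemma P_diff: "p \<in> psp X \<Longrightarrow> q \<in> psp X \<Longrightarrow> P (p - q) = P p \<ominus> P q"
  using P_add[of p "- q"] by (simp add: P_uminus psp_uminus K.minus_eq)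

lemma P_eq_iff: "p \<in> psp X \<Longrightarrow> q \<in> psp X \<Longrightarrow> P p = P q \<longleftrightarrow> P (p - q) = \<zero>"
  using P_add[of "p - q" q] P_add[of p "- q"] P_add[of q "- q"]
  by (auto simp: psp_diff psp_uminus P_closed P_zero)

definition ker :: "('x \<Rightarrow>\<^sub>0 complex) set" where "ker = {p \<in> psp X. P p = \<zero>}"

lemma qsec: "x \<in> carrier K \<Longrightarrow> qsec X P x \<in> psp X \<and> P (qsec X P x) = x"
  unfolding qsec_def by (rule someI_ex) (use P_surj in blast)

lemma qsec_ker: "p \<in> psp X \<Longrightarrow> qsec X P (P p) - p \<in> ker"
  using qsec[OF P_closed] P_eq_iff[of "qsec X P (P p)" p] by (simp add: ker_def psp_diff)

lemma leval_P:
  assumes "\<And>x. x \<in> Poly_Mapping.keys q \<Longrightarrow> F x = P (f x) \<and> f x \<in> psp X"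
  shows "leval K F q = P (lext f q)"
proof -
  have "leval K F q = finsum K (\<lambda>x. P (csmul (Poly_Mapping.lookup q x) (f x))) (Poly_Mapping.keys q)"
    unfolding leval_def using assms
    by (intro K.finsum_cong') (auto simp: P_csmul psp_csmul intro!: P_closed psp_csmul)
  also have "\<dots> = P (lext f q)"
    unfolding lext_def using assms by (intro P_sum[symmetric]) (auto intro!: psp_csmul)
  finally show ?thesis .
qed

lemma P_lext_cong:
  assumes "\<And>x. x \<in> Poly_Mapping.keys d \<Longrightarrow> P (f x) = P (g x) \<and> f x \<in> psp X \<and> g x \<in> psp X"
  shows "P (lext f d) = P (lext g d)"
  using leval_P[of d "\<lambda>x. P (f x)" f] leval_P[of d "\<lambda>x. P (f x)" g] assms by force

lemma leval_lext_basis: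
  assumes "\<And>w. w \<in> Poly_Mapping.keys d \<Longrightarrow> F (h w) = P (f w) \<and> f w \<in> psp X"
  shows "leval K F (lext (\<lambda>w. basis (h w)) d) = P (lext f d)"
proof -
  \<comment> \<open>\<open>h\<close> need not be injective, so \<open>f\<close> cannot be
    transported along it; \<open>f'\<close> picks a representative that depends only on the image
    \<open>h w\<close>.\<close>
  define f' where "f' x = qsec X P (F x)" for x
  have f': "F (h w) = P (f' (h w)) \<and> f' (h w) \<in> psp X" if "w \<in> Poly_Mapping.keys d" for w
    using qsec[OF P_closed, of "f w"] assms[OF that] by (simp add: f'_def)
  have "Poly_Mapping.keys (lext (\<lambda>w. basis (h w)) d) \<subseteq> h ` Poly_Mapping.keys d"
    using keys_lext[of "\<lambda>w. basis (h w)" d] by auto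
  then have "leval K F (lext (\<lambda>w. basis (h w)) d) = P (lext f' (lext (\<lambda>w. basis (h w)) d))"
    by (intro leval_P) (use f' in blast)
  also have "\<dots> = P (lext (\<lambda>w. f' (h w)) d)" by (simp add: lext_lext)
  also have "\<dots> = P (lext f d)"
    by (rule P_lext_cong) (use f' assms in metis)
  finally show ?thesis .
qed

lemma linear_eval:
  assumes "\<And>x y. x \<in> carrier K \<Longrightarrow> y \<in> carrier K \<Longrightarrow> f (x \<oplus> y) = f x + f y"
    "\<And>k x. x \<in> carrier K \<Longrightarrow> f (k \<odot> x) = k * f x" "p \<in> psp X"
  shows "f (P p) = ceval (\<lambda>u. f (P (basis u))) p"
  using assms(3)
proof (induction rule: psp_induct)
  case zero
  then show ?case using assms(2)[of "P 0" 0] P_csmul[of 0 0] P_closed[of 0] by simp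
next
  case (add p q)
  then show ?case by (simp add: P_add assms(1) P_closed ceval_add)
next
  case (basis k x)
  then show ?case by (simp add: P_csmul assms(2) P_closed ceval_csmul)
qed

lemma bilin_left:
  assumes "bilin K W \<beta>" "p \<in> psp X" "y \<in> carrier W"
  shows "\<beta> (P p) y = ceval (\<lambda>u. \<beta> (P (basis u)) y) p"
  by (rule linear_eval) (use assms in \<open>auto simp: bilin_def\<close>)

lemma bilin_right:
  assumes "bilin W K \<beta>" "p \<in> psp X" "y \<in> carrier W"
  shows "\<beta> y (P p) = ceval (\<lambda>u. \<beta> y (P (basis u))) p"
  by (rule linear_eval) (use assms in \<open>auto simp: bilin_def\<close>)

lemma bilin_pairs:
  assumes "bilin K K \<beta>" "p \<in> psp X" "q \<in> psp X"
  shows "\<beta> (P p) (P q) = ceval (\<lambda>(u, v). \<beta> (P (basis u)) (P (basis v))) (pairs p q)"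
proof -
  have "\<beta> (P p) (P q) = ceval (\<lambda>u. \<beta> (P (basis u)) (P q)) p"
    using assms by (intro bilin_left) (auto simp: P_closed)
  also have "\<dots> = ceval (\<lambda>u. ceval (\<lambda>v. \<beta> (P (basis u)) (P (basis v))) q) p"
    using assms by (intro ceval_psp_cong[of _ X] bilin_right) (auto simp: P_closed)
  finally show ?thesis by (simp add: ceval_pairs)
qed

end

section \<open>Quotient coalgebras\<close>

definition vanish2 :: "'x set \<Rightarrow> ('x \<Rightarrow>\<^sub>0 complex) set \<Rightarrow> ('x \<Rightarrow> 'x \<Rightarrow> complex) \<Rightarrow> bool" where
  "vanish2 X N b \<longleftrightarrow> (\<forall>n\<in>N. \<forall>v\<in>X. ceval (\<lambda>u. b u v) n = 0 \<and> ceval (b v) n = 0)"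

text \<open>The condition \<open>\<Delta> N \<subseteq> N \<otimes> V + V \<otimes> N\<close>, stated by duality: a bilinear form vanishing on the right
  hand side vanishes on \<open>\<Delta> N\<close>.\<close>

definition coideal :: "'x set \<Rightarrow> ('x \<Rightarrow> ('x \<times> 'x \<Rightarrow>\<^sub>0 complex)) \<Rightarrow> ('x \<Rightarrow> complex) \<Rightarrow>
    ('x \<Rightarrow>\<^sub>0 complex) set \<Rightarrow> bool" where
  "coideal X \<delta> \<epsilon> N \<longleftrightarrow>
     (\<forall>b. vanish2 X N b \<longrightarrow> (\<forall>p\<in>N. ceval (\<lambda>(u, v). b u v) (lext \<delta> p) = 0)) \<and>
     (\<forall>p\<in>N. ceval \<epsilon> p = 0)"

locale cocover = cover +
  fixes \<delta> :: "'a \<Rightarrow> ('a \<times> 'a \<Rightarrow>\<^sub>0 complex)" and \<epsilon> :: "'a \<Rightarrow> complex"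
  assumes \<delta>_closed: "w \<in> X \<Longrightarrow> \<delta> w \<in> psp (X \<times> X)"
    and coassoc: "w \<in> X \<Longrightarrow> lext (\<lambda>(u, v). lext (\<lambda>(s, t). basis (s, t, v)) (\<delta> u)) (\<delta> w)
        = lext (\<lambda>(u, v). lext (\<lambda>(s, t). basis (u, s, t)) (\<delta> v)) (\<delta> w)"
    and counit_left: "w \<in> X \<Longrightarrow> lext (\<lambda>(u, v). csmul (\<epsilon> u) (basis v)) (\<delta> w) = basis w"
    and counit_right: "w \<in> X \<Longrightarrow> lext (\<lambda>(u, v). csmul (\<epsilon> v) (basis u)) (\<delta> w) = basis w"
    and coideal_ker: "coideal X \<delta> \<epsilon> ker"
begin

abbreviation "\<Delta> \<equiv> qcomult X \<delta> P"
abbreviation "cou \<equiv> qcounit X \<epsilon> P"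

lemma lext_\<delta>_closed: "p \<in> psp X \<Longrightarrow> lext \<delta> p \<in> psp (X \<times> X)"
  by (rule psp_lext) (auto simp: \<delta>_closed)

lemma ceval_timg: "ceval f (timg P d) = ceval (\<lambda>(u, v). f (P (basis u), P (basis v))) d"
  by (simp add: timg_def ceval_lext split_def)

text \<open>Well-definedness of the coproduct as seen by bilinear forms: the pullback of
  \<open>\<beta>\<close> along \<open>P\<close> vanishes as soon as one argument lies in
  \<open>ker\<close>, so the coideal condition removes the difference between \<open>p\<close> and
  the chosen representative of \<open>P p\<close>.\<close>

lemma \<Delta>_ceval:
  assumes "bilin K K \<beta>" "p \<in> psp X"
  shows "ceval (\<lambda>(x, y). \<beta> x y) (\<Delta> (P p)) = ceval (\<lambda>(u, v). \<beta> (P (basis u)) (P (basis v))) (lext \<delta> p)"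
proof -
  let ?b = "\<lambda>u v. \<beta> (P (basis u)) (P (basis v))"
  have z: "\<beta> \<zero> y = 0 \<and> \<beta> y \<zero> = 0" if "y \<in> carrier K" for y
    using bilin_left[OF assms(1), of 0 y] bilin_right[OF assms(1), of 0 y] that by (simp add: P_zero)
  have v: "vanish2 X ker ?b"
    unfolding vanish2_def
  proof (intro ballI conjI)
    fix n v assume n: "n \<in> ker" and v: "v \<in> X"
    show "ceval (\<lambda>u. ?b u v) n = 0"
      using bilin_left[OF assms(1), of n "P (basis v)"] n v z by (simp add: ker_def P_closed)
    show "ceval (?b v) n = 0"
      using bilin_right[OF assms(1), of n "P (basis v)"] n v z by (simp add: ker_def P_closed)
  qed
  have "ceval (\<lambda>(u, v). ?b u v) (lext \<delta> (qsec X P (P p) - p)) = 0"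
    using coideal_ker v qsec_ker[OF assms(2)] unfolding coideal_def by blast
  then show ?thesis
    by (simp add: qcomult_def ceval_timg lext_diff ceval_diff)
qed

lemma \<Delta>_P: "p \<in> psp X \<Longrightarrow> tensor_eq K K (\<Delta> (P p)) (timg P (lext \<delta> p))"
  by (rule tensor_eqI) (simp add: \<Delta>_ceval ceval_timg)

lemma ep_P: "p \<in> psp X \<Longrightarrow> cou (P p) = ceval \<epsilon> p"
  using coideal_ker qsec_ker[of p] unfolding coideal_def by (force simp: qcounit_def ceval_diff)

lemma tensor3_left_cong:
  assumes "tensor_eq K K d d'" "z \<in> carrier K"
  shows "lext (\<lambda>(u, v). basis (u, v, z)) d - lext (\<lambda>(u, v). basis (u, v, z)) d' \<in> tensor3_null K"
  using tensor3_null_left[of "d - d'" K z] assms by (simp add: tensor_eq_def lext_diff)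

lemma tensor3_right_cong:
  assumes "tensor_eq K K d d'" "z \<in> carrier K"
  shows "lext (\<lambda>(u, v). basis (z, u, v)) d - lext (\<lambda>(u, v). basis (z, u, v)) d' \<in> tensor3_null K"
  using tensor3_null_right[of "d - d'" K z] assms by (simp add: tensor_eq_def lext_diff)

definition \<delta>2 where
  "\<delta>2 p = lext (\<lambda>(u, v). lext (\<lambda>(s, t). basis (s, t, v)) (\<delta> u)) (lext \<delta> p)"

definition timg3 where
  "timg3 d = lext (\<lambda>(u, v, w). basis (P (basis u), P (basis v), P (basis w))) d"

text \<open>The second coproduct is applied to \<open>P (basis u)\<close>, whose chosen
  representative need not be \<open>basis u\<close>. Each summand is therefore off by a null tensor,
  and this stays null when a third factor is appended.\<close>

lemma comult2_eq:
  assumes "x \<in> carrier K" "p = qsec X P x"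
  shows "tensor3_eq K (comult2 \<Delta> x) (timg3 (\<delta>2 p))"
proof -
  have p: "p \<in> psp X" using assms qsec by auto
  have "comult2 \<Delta> x - timg3 (\<delta>2 p) =
    lext (\<lambda>(u, v). lext (\<lambda>(s, t). basis (s, t, P (basis v))) (\<Delta> (P (basis u)))
       - lext (\<lambda>(s, t). basis (s, t, P (basis v))) (timg P (\<delta> u))) (lext \<delta> p)"
    unfolding comult2_def timg3_def \<delta>2_def qcomult_def[of _ _ _ x] assms(2)[symmetric]
    by (simp add: timg_def lext_lext split_def lext_fun_diff)
  also have "\<dots> \<in> tensor3_null K"
  proof (rule tensor3_null_lext)
    fix x assume "x \<in> Poly_Mapping.keys (lext \<delta> p)"
    then have "x \<in> X \<times> X" using lext_\<delta>_closed[OF p] by (rule_tac psp_keysD)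
    then obtain u v where x: "x = (u, v)" "u \<in> X" "v \<in> X" by auto
    have "tensor_eq K K (\<Delta> (P (basis u))) (timg P (\<delta> u))" using \<Delta>_P[of "basis u"] x by simp
    then show "(case x of (u, v) \<Rightarrow> lext (\<lambda>(s, t). basis (s, t, P (basis v))) (\<Delta> (P (basis u)))
       - lext (\<lambda>(s, t). basis (s, t, P (basis v))) (timg P (\<delta> u))) \<in> tensor3_null K"
      using x by (simp add: tensor3_left_cong P_closed)
  qed
  finally show ?thesis by (simp add: tensor3_eq_def)
qed

lemma comult2_eq':
  assumes "x \<in> carrier K" "p = qsec X P x"
  shows "tensor3_eq K (lext (\<lambda>(y, z). lext (\<lambda>(u, v). basis (y, u, v)) (\<Delta> z)) (\<Delta> x)) (timg3 (\<delta>2 p))"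
proof -
  have p: "p \<in> psp X" using assms qsec by auto
  have "\<delta>2 p = lext (\<lambda>(u, v). lext (\<lambda>(s, t). basis (u, s, t)) (\<delta> v)) (lext \<delta> p)"
    unfolding \<delta>2_def lext_lext by (rule lext_psp_cong[OF p]) (rule coassoc)
  then have "lext (\<lambda>(y, z). lext (\<lambda>(u, v). basis (y, u, v)) (\<Delta> z)) (\<Delta> x) - timg3 (\<delta>2 p) =
    lext (\<lambda>(u, v). lext (\<lambda>(s, t). basis (P (basis u), s, t)) (\<Delta> (P (basis v)))
       - lext (\<lambda>(s, t). basis (P (basis u), s, t)) (timg P (\<delta> v))) (lext \<delta> p)"
    unfolding timg3_def qcomult_def[of _ _ _ x] assms(2)[symmetric]
    by (simp add: timg_def lext_lext split_def lext_fun_diff)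
  also have "\<dots> \<in> tensor3_null K"
  proof (rule tensor3_null_lext)
    fix x assume "x \<in> Poly_Mapping.keys (lext \<delta> p)"
    then have "x \<in> X \<times> X" using lext_\<delta>_closed[OF p] by (rule_tac psp_keysD)
    then obtain u v where x: "x = (u, v)" "u \<in> X" "v \<in> X" by auto
    have "tensor_eq K K (\<Delta> (P (basis v))) (timg P (\<delta> v))" using \<Delta>_P[of "basis v"] x by simp
    then show "(case x of (u, v) \<Rightarrow> lext (\<lambda>(s, t). basis (P (basis u), s, t)) (\<Delta> (P (basis v)))
       - lext (\<lambda>(s, t). basis (P (basis u), s, t)) (timg P (\<delta> v))) \<in> tensor3_null K"
      using x by (simp add: tensor3_right_cong P_closed)
  qed
  finally show ?thesis by (simp add: tensor3_eq_def)
qed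

lemma tensor3_eq_trans': "tensor3_eq K a c \<Longrightarrow> tensor3_eq K b c \<Longrightarrow> tensor3_eq K a b"
  unfolding tensor3_eq_def
  using tensor3_null.add[of "a - c" K "csmul (-1) (b - c)"] tensor3_null.smul[of "b - c" K "-1"]
  by (simp add: csmul.scale_right_diff_distrib)

lemma \<Delta>_tensor_space: "x \<in> carrier K \<Longrightarrow> \<Delta> x \<in> tensor_space K K"
proof -
  assume "x \<in> carrier K"
  then have "timg P (lext \<delta> (qsec X P x)) \<in> psp (carrier K \<times> carrier K)"
    unfolding timg_def using qsec
    by (intro psp_lext[of _ "X \<times> X"] lext_\<delta>_closed) (auto simp: P_closed)
  then show ?thesis by (simp add: qcomult_def tensor_space_def psp_def)
qed

lemma leval_\<Delta>:
  assumes "x \<in> carrier K" "\<And>u v. u \<in> X \<Longrightarrow> v \<in> X \<Longrightarrow> F (P (basis u), P (basis v)) = P (f u v) \<and> f u v \<in> psp X"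
  shows "leval K F (\<Delta> x) = P (lext (\<lambda>(u, v). f u v) (lext \<delta> (qsec X P x)))"
proof -
  have "lext \<delta> (qsec X P x) \<in> psp (X \<times> X)" using qsec[OF assms(1)] lext_\<delta>_closed by blast
  then show ?thesis
    unfolding qcomult_def timg_def case_prod_beta
    by (intro leval_lext_basis) (use assms(2) psp_keysD in fastforce)
qed

lemma coalgebra: "coalgebra K \<Delta> cou"
  unfolding coalgebra_def
proof (intro conjI ballI allI)
  show "linear_form K cou"
    unfolding linear_form_def
    by (auto elim!: P_ex simp: P_add[symmetric] P_csmul[symmetric] ep_P psp_add psp_csmul ceval_linear)
next
  fix x y assume "x \<in> carrier K" "y \<in> carrier K"
  then obtain p q where [simp]: "p \<in> psp X" "x = P p" "q \<in> psp X" "y = P q" by (metis P_surj)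
  show "tensor_eq K K (\<Delta> (x \<oplus> y)) (\<Delta> x + \<Delta> y)"
    by (rule tensor_eqI) (simp add: P_add[symmetric] \<Delta>_ceval psp_add ceval_add lext_add)
next
  fix k x assume "x \<in> carrier K"
  then obtain p where [simp]: "p \<in> psp X" "x = P p" by (metis P_surj)
  show "tensor_eq K K (\<Delta> (k \<odot> x)) (csmul k (\<Delta> x))"
    by (rule tensor_eqI) (simp add: P_csmul[symmetric] \<Delta>_ceval psp_csmul ceval_csmul lext_csmul)
next
  fix x assume x: "x \<in> carrier K"
  then show "tensor3_eq K (comult2 \<Delta> x) (lext (\<lambda>(y, z). lext (\<lambda>(u, v). basis (y, u, v)) (\<Delta> z)) (\<Delta> x))"
    by (intro tensor3_eq_trans'[OF comult2_eq comult2_eq']) auto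
  have "leval K (\<lambda>(y, z). cou y \<odot> z) (\<Delta> x)
      = P (lext (\<lambda>(u, v). csmul (\<epsilon> u) (basis v)) (lext \<delta> (qsec X P x)))"
    using x by (intro leval_\<Delta>) (auto simp: ep_P P_csmul psp_csmul)
  also have "lext (\<lambda>(u, v). csmul (\<epsilon> u) (basis v)) (lext \<delta> (qsec X P x)) = lext basis (qsec X P x)"
    unfolding lext_lext by (rule lext_psp_cong[of _ X]) (use x qsec counit_left in auto)
  finally show "leval K (\<lambda>(y, z). cou y \<odot> z) (\<Delta> x) = x" using qsec[OF x] by simp
  have "leval K (\<lambda>(y, z). cou z \<odot> y) (\<Delta> x)
      = P (lext (\<lambda>(u, v). csmul (\<epsilon> v) (basis u)) (lext \<delta> (qsec X P x)))"
    using x by (intro leval_\<Delta>) (auto simp: ep_P P_csmul psp_csmul)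
  also have "lext (\<lambda>(u, v). csmul (\<epsilon> v) (basis u)) (lext \<delta> (qsec X P x)) = lext basis (qsec X P x)"
    unfolding lext_lext by (rule lext_psp_cong[of _ X]) (use x qsec counit_right in auto)
  finally show "leval K (\<lambda>(y, z). cou z \<odot> y) (\<Delta> x) = x" using qsec[OF x] by simp
qed (auto simp: module \<Delta>_tensor_space)

end

section \<open>Maps induced on quotients\<close>

definition qdesc :: "'x set \<Rightarrow> (('x \<Rightarrow>\<^sub>0 complex) \<Rightarrow> 'v) \<Rightarrow> (('x \<Rightarrow>\<^sub>0 complex) \<Rightarrow> 'w) \<Rightarrow> 'v \<Rightarrow> 'w" where
  "qdesc X P Q x = Q (qsec X P x)"

context cover
begin

lemma qdesc_P:
  assumes "abelian_group L" "p \<in> psp X"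
    and "\<And>p. p \<in> psp X \<Longrightarrow> Q p \<in> carrier L"
    and "\<And>p q. p \<in> psp X \<Longrightarrow> q \<in> psp X \<Longrightarrow> Q (p + q) = Q p \<oplus>\<^bsub>L\<^esub> Q q"
    and "\<And>p. p \<in> ker \<Longrightarrow> Q p = \<zero>\<^bsub>L\<^esub>"
  shows "qdesc X P Q (P p) = Q p"
proof -
  interpret L: abelian_group L by fact
  have s: "qsec X P (P p) \<in> psp X" using qsec P_closed assms(2) by blast
  have "Q (qsec X P (P p) - p + p) = Q (qsec X P (P p) - p) \<oplus>\<^bsub>L\<^esub> Q p"
    by (rule assms(4)) (use s assms(2) in \<open>auto simp: psp_diff\<close>)
  also have "\<dots> = Q p" using assms(5)[OF qsec_ker[OF assms(2)]] assms(2,3) by simp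
  finally show ?thesis by (simp add: qdesc_def)
qed

lemma qdesc_cover:
  assumes "cover X L Q" "p \<in> psp X" "ker \<subseteq> cover.ker X L Q"
  shows "qdesc X P Q (P p) = Q p"
proof -
  interpret L: cover X L Q by fact
  show ?thesis
    by (rule qdesc_P[OF L.abelian_group assms(2)]) (use assms(3) in \<open>auto simp: L.P_closed L.P_add L.ker_def\<close>)
qed

lemma linear_mapI:
  assumes "\<And>p. p \<in> psp X \<Longrightarrow> f (P p) \<in> carrier L"
    and "\<And>p q. p \<in> psp X \<Longrightarrow> q \<in> psp X \<Longrightarrow> f (P (p + q)) = f (P p) \<oplus>\<^bsub>L\<^esub> f (P q)"
    and "\<And>k p. p \<in> psp X \<Longrightarrow> f (P (csmul k p)) = k \<odot>\<^bsub>L\<^esub> f (P p)"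
  shows "linear_map K L f"
  unfolding linear_map_def
  by (auto elim!: P_ex simp: P_add[symmetric] P_csmul[symmetric] assms)

lemma linear_map_cover:
  assumes "cover X L Q" "\<And>p. p \<in> psp X \<Longrightarrow> f (P p) = Q p"
  shows "linear_map K L f"
proof -
  interpret L: cover X L Q by fact
  show ?thesis
    by (rule linear_mapI) (auto simp: assms(2) L.P_closed L.P_add L.P_csmul psp_add psp_csmul)
qed

lemma linear_map_endo:
  assumes "\<And>p. p \<in> psp X \<Longrightarrow> f (P p) = P (lext s p)" "\<And>w. w \<in> X \<Longrightarrow> s w \<in> psp X"
  shows "linear_map K K f"
proof -
  have c: "lext s p \<in> psp X" if "p \<in> psp X" for p using that assms(2) by (rule psp_lext)
  show ?thesis
    by (rule linear_mapI)
      (simp_all add: assms(1) c P_closed psp_add psp_csmul, simp_all add: lext_linear P_add P_csmul c)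
qed

lemma qdesc_endo:
  assumes "p \<in> psp X" "\<And>w. w \<in> X \<Longrightarrow> s w \<in> psp X" "\<And>p. p \<in> ker \<Longrightarrow> lext s p \<in> ker"
  shows "qdesc X P (\<lambda>p. P (lext s p)) (P p) = P (lext s p)"
proof -
  have c: "lext s p \<in> psp X" if "p \<in> psp X" for p using that assms(2) by (rule psp_lext)
  show ?thesis
    by (rule qdesc_P[OF abelian_group assms(1)])
      (use assms(3) in \<open>auto simp: c P_closed lext_add P_add ker_def\<close>)
qed

end

text \<open>The product is prescribed on pairs of basis elements with values in combinations rather
  than basis elements, because the twisted product of two words is a sum of words.\<close>

locale algcover = cover X K P
  for X :: "'x set" and K :: "(complex, 'v, 'z) module_scheme" (structure) and P +
  fixes m :: "'x \<Rightarrow> 'x \<Rightarrow> ('x \<Rightarrow>\<^sub>0 complex)" and e :: 'x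
  assumes m_closed: "u \<in> X \<Longrightarrow> v \<in> X \<Longrightarrow> m u v \<in> psp X"
    and e_in: "e \<in> X"
    and m_assoc: "u \<in> X \<Longrightarrow> v \<in> X \<Longrightarrow> w \<in> X \<Longrightarrow> lmul m (m u v) (basis w) = lmul m (basis u) (m v w)"
    and m_one: "u \<in> X \<Longrightarrow> m e u = basis u" "u \<in> X \<Longrightarrow> m u e = basis u"
    and P_mult: "p \<in> psp X \<Longrightarrow> q \<in> psp X \<Longrightarrow> P (lmul m p q) = P p \<otimes> P q"
    and P_one: "P (basis e) = \<one>"
begin

lemma lmul_psp: "p \<in> psp X \<Longrightarrow> q \<in> psp X \<Longrightarrow> lmul m p q \<in> psp X"
  by (rule lmul_closed[OF m_closed])

lemma lmul_assoc:
  assumes "p \<in> psp X" "q \<in> psp X" "s \<in> psp X"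
  shows "lmul m (lmul m p q) s = lmul m p (lmul m q s)"
proof -
  have "lmul m (lmul m p q) s = lext (\<lambda>u. lext (\<lambda>v. lext (\<lambda>w. lmul m (m u v) (basis w)) s) q) p"
    by (simp add: lmul_def lext_lext) (rule lext_cong, rule lext_cong, rule lext_swap)
  also have "\<dots> = lext (\<lambda>u. lext (\<lambda>v. lext (\<lambda>w. lmul m (basis u) (m v w)) s) q) p"
    by (intro lext_psp_cong[OF assms(1)] lext_psp_cong[OF assms(2)] lext_psp_cong[OF assms(3)] m_assoc)
  also have "\<dots> = lmul m p (lmul m q s)"
    by (simp add: lmul_def lext_lext)
  finally show ?thesis .
qed

lemma lmul_one: assumes "p \<in> psp X" shows "lmul m (basis e) p = p" "lmul m p (basis e) = p"
  using lext_psp_cong[OF assms, of "\<lambda>u. m e u" basis] lext_psp_cong[OF assms, of "\<lambda>u. m u e" basis]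
  by (simp_all add: lmul_def m_one)

lemma ring: "ring K"
proof (rule ringI[OF abelian_group monoidI])
  fix x y z assume "x \<in> carrier K" "y \<in> carrier K" "z \<in> carrier K"
  then obtain p q s where [simp]: "p \<in> psp X" "x = P p" "q \<in> psp X" "y = P q" "s \<in> psp X" "z = P s"
    by (metis P_surj)
  show "x \<otimes> y \<otimes> z = x \<otimes> (y \<otimes> z)"
    by (simp add: P_mult[symmetric] lmul_psp lmul_assoc)
  show "(x \<oplus> y) \<otimes> z = x \<otimes> z \<oplus> y \<otimes> z" "z \<otimes> (x \<oplus> y) = z \<otimes> x \<oplus> z \<otimes> y"
    by (simp_all add: P_mult[symmetric] P_add[symmetric] lmul_psp psp_add lmul_linear)
next
  fix x y assume "x \<in> carrier K" "y \<in> carrier K"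
  then show "x \<otimes> y \<in> carrier K"
    by (auto elim!: P_ex simp: P_mult[symmetric] lmul_psp P_closed)
next
  show "\<one> \<in> carrier K" using P_closed[of "basis e"] by (simp add: P_one e_in)
next
  fix x assume "x \<in> carrier K"
  then obtain p where [simp]: "p \<in> psp X" "x = P p" by (metis P_surj)
  show "\<one> \<otimes> x = x" "x \<otimes> \<one> = x"
    by (simp_all add: P_one[symmetric] P_mult[symmetric] e_in lmul_one)
qed

lemma complex_algebra: "complex_algebra K"
  unfolding complex_algebra_def
proof (intro conjI ballI allI ring module)
  fix k x y assume "x \<in> carrier K" "y \<in> carrier K"
  then obtain p q where [simp]: "p \<in> psp X" "x = P p" "q \<in> psp X" "y = P q" by (metis P_surj)
  show "k \<odot> x \<otimes> y = k \<odot> (x \<otimes> y)" "x \<otimes> (k \<odot> y) = k \<odot> (x \<otimes> y)"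
    by (simp_all add: P_mult[symmetric] P_csmul[symmetric] lmul_psp psp_csmul lmul_linear)
qed

lemma algebra_hom_cover:
  assumes "algcover X L Q m e" "\<And>p. p \<in> psp X \<Longrightarrow> f (P p) = Q p"
  shows "algebra_hom K L f"
proof -
  interpret L: algcover X L Q m e by fact
  have "f \<one> = \<one>\<^bsub>L\<^esub>" using assms(2)[of "basis e"] by (simp add: P_one L.P_one e_in)
  then show ?thesis
    unfolding algebra_hom_def
    by (auto intro: linear_map_cover[OF L.cover_axioms assms(2)] elim!: P_ex
        simp: P_mult[symmetric] L.P_mult[symmetric] assms(2) lmul_psp)
qed

end

locale coalgcover = cocover X K P \<delta> \<epsilon> + algcover X K P m e
  for X :: "'x set" and K :: "(complex, 'v, 'z) module_scheme" (structure) and P \<delta> \<epsilon> m e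
begin

definition antip :: "('x \<Rightarrow> ('x \<Rightarrow>\<^sub>0 complex)) \<Rightarrow> 'v \<Rightarrow> 'v" where
  "antip s = qdesc X P (\<lambda>p. P (lext s p))"

text \<open>The convolution identities are assumed on basis elements and only after applying
  \<open>P\<close>, that is, modulo \<open>ker\<close>; \<open>leval_\<Delta>\<close> and linearity
  extend them to the quotient.\<close>

lemma antipode_for:
  assumes s: "\<And>w. w \<in> X \<Longrightarrow> s w \<in> psp X" and k: "\<And>p. p \<in> ker \<Longrightarrow> lext s p \<in> ker"
    and l: "\<And>w. w \<in> X \<Longrightarrow> P (lext (\<lambda>(u, v). lmul m (s u) (basis v)) (\<delta> w)) = P (csmul (\<epsilon> w) (basis e))"
    and r: "\<And>w. w \<in> X \<Longrightarrow> P (lext (\<lambda>(u, v). lmul m (basis u) (s v)) (\<delta> w)) = P (csmul (\<epsilon> w) (basis e))"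
  shows "antipode_for K \<Delta> cou (antip s)"
  unfolding antipode_for_def
proof (intro conjI ballI)
  note sP = qdesc_endo[of _ s, OF _ s k, folded antip_def]
  show "linear_map K K (antip s)" by (rule linear_map_endo[OF sP s])
  fix x assume x: "x \<in> carrier K"
  define p where "p = qsec X P x"
  have p: "p \<in> psp X" "x = P p" using qsec[OF x] by (auto simp: p_def)
  have d1: "lext (\<lambda>(u, v). lmul m (s u) (basis v)) (\<delta> w) \<in> psp X" if "w \<in> X" for w
    using \<delta>_closed[OF that] by (rule psp_lext) (auto intro!: lmul_psp s)
  have d2: "lext (\<lambda>(u, v). lmul m (basis u) (s v)) (\<delta> w) \<in> psp X" if "w \<in> X" for w
    using \<delta>_closed[OF that] by (rule psp_lext) (auto intro!: lmul_psp s)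
  have e: "P (lext (\<lambda>w. csmul (\<epsilon> w) (basis e)) p) = cou x \<odot> \<one>"
  proof -
    have "lext (\<lambda>w. csmul (\<epsilon> w) (basis e)) p = csmul (ceval \<epsilon> p) (basis e)"
      by (simp add: lext_def ceval_def csmul.scale_sum_left)
    then show ?thesis by (simp add: P_csmul e_in P_one p ep_P)
  qed
  have "leval K (\<lambda>(y, z). antip s y \<otimes> z) (\<Delta> x)
     = P (lext (\<lambda>(u, v). lmul m (s u) (basis v)) (lext \<delta> p))"
    unfolding p_def using x by (intro leval_\<Delta>) (auto simp: sP s P_mult intro!: lmul_psp)
  also have "\<dots> = P (lext (\<lambda>w. csmul (\<epsilon> w) (basis e)) p)"
    unfolding lext_lext using psp_keysD[OF p(1)]
    by (intro P_lext_cong) (auto simp: l d1 psp_csmul e_in)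
  finally show "leval K (\<lambda>(y, z). antip s y \<otimes> z) (\<Delta> x) = cou x \<odot> \<one>" by (simp add: e)
  have "leval K (\<lambda>(y, z). y \<otimes> antip s z) (\<Delta> x)
     = P (lext (\<lambda>(u, v). lmul m (basis u) (s v)) (lext \<delta> p))"
    unfolding p_def using x by (intro leval_\<Delta>) (auto simp: sP s P_mult intro!: lmul_psp)
  also have "\<dots> = P (lext (\<lambda>w. csmul (\<epsilon> w) (basis e)) p)"
    unfolding lext_lext using psp_keysD[OF p(1)]
    by (intro P_lext_cong) (auto simp: r d2 psp_csmul e_in)
  finally show "leval K (\<lambda>(y, z). y \<otimes> antip s z) (\<Delta> x) = cou x \<odot> \<one>" by (simp add: e)
qed

end

lemma coalgebra_hom_cover:
  assumes "cocover X K P \<delta> \<epsilon>" "cocover X L Q \<delta> \<epsilon>" "\<And>p. p \<in> psp X \<Longrightarrow> f (P p) = Q p"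
  shows "coalgebra_hom K (qcomult X \<delta> P) (qcounit X \<epsilon> P) L (qcomult X \<delta> Q) (qcounit X \<epsilon> Q) f"
proof -
  interpret K: cocover X K P \<delta> \<epsilon> by fact
  interpret L: cocover X L Q \<delta> \<epsilon> by fact
  show ?thesis
    unfolding coalgebra_hom_def
  proof (intro conjI ballI)
    show "linear_map K L f" by (rule K.linear_map_cover[OF L.cover_axioms assms(3)])
    fix x assume x: "x \<in> carrier K"
    define p where "p = qsec X P x"
    have p: "p \<in> psp X" "x = P p" using K.qsec[OF x] by (auto simp: p_def)
    show "qcounit X \<epsilon> Q (f x) = qcounit X \<epsilon> P x"
      by (simp add: p assms(3) K.ep_P L.ep_P)
    show "tensor_eq L L (qcomult X \<delta> Q (f x)) (tensor_map f f (qcomult X \<delta> P x))"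
    proof (rule tensor_eqI)
      fix \<beta> assume "bilin L L \<beta>"
      then have "ceval (\<lambda>(x, y). \<beta> x y) (qcomult X \<delta> Q (f x))
          = ceval (\<lambda>(u, v). \<beta> (Q (basis u)) (Q (basis v))) (lext \<delta> p)"
        by (simp add: p assms(3) L.\<Delta>_ceval)
      also have "\<dots> = ceval (\<lambda>(u, v). \<beta> (f (P (basis u))) (f (P (basis v)))) (lext \<delta> p)"
        by (intro ceval_psp_cong[OF K.lext_\<delta>_closed[OF p(1)]]) (auto simp: assms(3))
      also have "\<dots> = ceval (\<lambda>(x, y). \<beta> x y) (tensor_map f f (qcomult X \<delta> P x))"
        unfolding qcomult_def p_def[symmetric]
        by (simp add: tensor_map_def ceval_lext timg_def split_def)
      finally show "ceval (\<lambda>(x, y). \<beta> x y) (qcomult X \<delta> Q (f x)) =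
        ceval (\<lambda>(x, y). \<beta> x y) (tensor_map f f (qcomult X \<delta> P x))" .
    qed
  qed
qed

section \<open>Quotient bialgebras\<close>

locale bicover = coalgcover +
  assumes \<delta>_m: "u \<in> X \<Longrightarrow> v \<in> X \<Longrightarrow> lext \<delta> (m u v)
      = lext (\<lambda>((a1, a2), (b1, b2)). pairs (m a1 b1) (m a2 b2)) (pairs (\<delta> u) (\<delta> v))"
    and \<epsilon>_m: "u \<in> X \<Longrightarrow> v \<in> X \<Longrightarrow> ceval \<epsilon> (m u v) = \<epsilon> u * \<epsilon> v"
    and \<delta>_e: "\<delta> e = basis (e, e)" and \<epsilon>_e: "\<epsilon> e = 1"
begin

lemma ceval_\<epsilon>_lmul:
  assumes "p \<in> psp X" "q \<in> psp X"
  shows "ceval \<epsilon> (lmul m p q) = ceval \<epsilon> p * ceval \<epsilon> q"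
proof -
  have "ceval \<epsilon> (lmul m p q) = ceval (\<lambda>u. ceval (\<lambda>v. \<epsilon> u * \<epsilon> v) q) p"
    unfolding ceval_lmul by (intro ceval_psp_cong[OF assms(1)] ceval_psp_cong[OF assms(2)] \<epsilon>_m)
  then show ?thesis by (simp add: ceval_fun_mult ceval_fun_mult_right)
qed

lemma bialgebra: "bialgebra K \<Delta> cou"
  unfolding bialgebra_def
proof (intro conjI ballI complex_algebra coalgebra)
  show "tensor_eq K K (\<Delta> \<one>) (basis (\<one>, \<one>))"
    using \<Delta>_P[of "basis e"] by (simp add: e_in P_one \<delta>_e timg_def)
  show "cou \<one> = 1" using ep_P[of "basis e"] by (simp add: e_in P_one \<epsilon>_e)
next
  fix x y assume x: "x \<in> carrier K" and y: "y \<in> carrier K"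
  define p q where "p = qsec X P x" and "q = qsec X P y"
  have p: "p \<in> psp X" "x = P p" and q: "q \<in> psp X" "y = P q"
    using qsec x y by (auto simp: p_def q_def)
  show "cou (x \<otimes> y) = cou x * cou y"
    by (simp add: p q P_mult[symmetric] ep_P lmul_psp ceval_\<epsilon>_lmul)
  show "tensor_eq K K (\<Delta> (x \<otimes> y))
     (lext (\<lambda>((x1, x2), y1, y2). basis (x1 \<otimes> y1, x2 \<otimes> y2)) (pairs (\<Delta> x) (\<Delta> y)))"
  proof (rule tensor_eqI)
    fix \<beta> assume b: "bilin K K \<beta>"
    let ?b = "\<lambda>(u, v). \<beta> (P (basis u)) (P (basis v))"
    have "ceval (\<lambda>(x, y). \<beta> x y) (\<Delta> (x \<otimes> y)) = ceval ?b (lext \<delta> (lmul m p q))"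
      by (simp add: p q P_mult[symmetric] \<Delta>_ceval[OF b] lmul_psp)
    also have "\<dots> = ceval (\<lambda>u. ceval (\<lambda>v. ceval ?b (lext \<delta> (m u v))) q) p"
      by (simp add: lext_lmul ceval_lext)
    also have "\<dots> = ceval (\<lambda>u. ceval (\<lambda>v. ceval (\<lambda>(a1, a2). ceval (\<lambda>(b1, b2).
        \<beta> (P (m a1 b1)) (P (m a2 b2))) (\<delta> v)) (\<delta> u)) q) p"
    proof (intro ceval_psp_cong[OF p(1)] ceval_psp_cong[OF q(1)])
      fix u v assume u: "u \<in> X" and v: "v \<in> X"
      show "ceval ?b (lext \<delta> (m u v)) = ceval (\<lambda>(a1, a2). ceval (\<lambda>(b1, b2).
        \<beta> (P (m a1 b1)) (P (m a2 b2))) (\<delta> v)) (\<delta> u)"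
        unfolding \<delta>_m[OF u v] ceval_lext ceval_pairs split_def
        by (intro ceval_psp_cong[OF \<delta>_closed[OF u]] ceval_psp_cong[OF \<delta>_closed[OF v]])
          (auto simp: bilin_pairs[OF b] m_closed split_def ceval_pairs)
    qed
    also have "\<dots> = ceval (\<lambda>(a1, a2). ceval (\<lambda>(b1, b2). \<beta> (P (m a1 b1)) (P (m a2 b2)))
        (lext \<delta> q)) (lext \<delta> p)"
      unfolding ceval_lext split_def by (intro ceval_cong) (rule ceval_swap)
    also have "\<dots> = ceval (\<lambda>(a1, a2). ceval (\<lambda>(b1, b2). \<beta> (P (basis a1) \<otimes> P (basis b1)) (P (basis a2) \<otimes> P (basis b2)))
        (lext \<delta> q)) (lext \<delta> p)"
      unfolding split_def
      by (intro ceval_psp_cong[OF lext_\<delta>_closed[OF p(1)]] ceval_psp_cong[OF lext_\<delta>_closed[OF q(1)]])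
        (auto simp: P_mult[symmetric])
    also have "\<dots> = ceval (\<lambda>(x, y). \<beta> x y) (lext (\<lambda>((x1, x2), y1, y2). basis (x1 \<otimes> y1, x2 \<otimes> y2))
        (pairs (\<Delta> x) (\<Delta> y)))"
      unfolding qcomult_def p_def[symmetric] q_def[symmetric]
      by (simp add: ceval_lext ceval_pairs timg_def split_def)
    finally show "ceval (\<lambda>(x, y). \<beta> x y) (\<Delta> (x \<otimes> y)) = \<dots>" .
  qed
qed

end

section \<open>Homogeneous bases and quotients that are braided bialgebras\<close>

definition hpart :: "('x \<Rightarrow> 'g) \<Rightarrow> 'g \<Rightarrow> 'x \<Rightarrow> ('x \<Rightarrow>\<^sub>0 complex)" where
  "hpart deg g w = (if deg w = g then basis w else 0)"

lemma hpart_closed: "w \<in> X \<Longrightarrow> hpart deg g w \<in> psp X"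
  by (simp add: hpart_def)

lemma hpart_id: "p \<in> psp {w. deg w = g} \<Longrightarrow> lext (hpart deg g) p = p"
  using lext_psp_cong[of p "{w. deg w = g}" "hpart deg g" basis] by (simp add: hpart_def)

lemma hpart_other: "p \<in> psp {w. deg w = h} \<Longrightarrow> h \<noteq> g \<Longrightarrow> lext (hpart deg g) p = 0"
  using lext_psp_cong[of p "{w. deg w = h}" "hpart deg g" "\<lambda>_. 0"] by (simp add: hpart_def)

lemma psp_mono: "p \<in> psp X \<Longrightarrow> X \<subseteq> Y \<Longrightarrow> p \<in> psp Y"
  by (auto simp: psp_def)

text \<open>All basis elements are homogeneous, so the braiding of \<open>a2\<close> with
  \<open>b1\<close> is the single term in which \<open>deg a2\<close> acts on \<open>b1\<close>;
  \<open>\<delta>_m\<close> is multiplicativity of the coproduct for the braided tensor product in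
  this form.\<close>

locale braided_cover = coalgcover X K P \<delta> \<epsilon> m e
  for X :: "'x set" and K :: "('g, 'v, 'z) crossed_module_scheme" (structure) and P \<delta> \<epsilon> m e +
  fixes G :: "('g, 'm) monoid_scheme" and ac :: "'g \<Rightarrow> 'x \<Rightarrow> ('x \<Rightarrow>\<^sub>0 complex)" and deg :: "'x \<Rightarrow> 'g"
  assumes G: "group G" and finG: "finite (carrier G)"
    and deg_closed: "w \<in> X \<Longrightarrow> deg w \<in> carrier G"
    and ac_closed: "g \<in> carrier G \<Longrightarrow> w \<in> X \<Longrightarrow>
      ac g w \<in> psp {v \<in> X. deg v = g \<otimes>\<^bsub>G\<^esub> deg w \<otimes>\<^bsub>G\<^esub> inv\<^bsub>G\<^esub> g}"
    and ac_one: "w \<in> X \<Longrightarrow> ac \<one>\<^bsub>G\<^esub> w = basis w"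
    and ac_mult: "g \<in> carrier G \<Longrightarrow> h \<in> carrier G \<Longrightarrow> w \<in> X \<Longrightarrow> ac (g \<otimes>\<^bsub>G\<^esub> h) w = lext (ac g) (ac h w)"
    and act_P: "g \<in> carrier G \<Longrightarrow> p \<in> psp X \<Longrightarrow> act K g (P p) = P (lext (ac g) p)"
    and hcomp_P: "g \<in> carrier G \<Longrightarrow> p \<in> psp X \<Longrightarrow> hcomp K g (P p) = P (lext (hpart deg g) p)"
    and m_deg: "u \<in> X \<Longrightarrow> v \<in> X \<Longrightarrow> m u v \<in> psp {w \<in> X. deg w = deg u \<otimes>\<^bsub>G\<^esub> deg v}"
    and e_deg: "deg e = \<one>\<^bsub>G\<^esub>"
    and ac_m: "g \<in> carrier G \<Longrightarrow> u \<in> X \<Longrightarrow> v \<in> X \<Longrightarrow> lext (ac g) (m u v) = lmul m (ac g u) (ac g v)"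
    and ac_e: "g \<in> carrier G \<Longrightarrow> ac g e = basis e"
    and ac_\<delta>: "g \<in> carrier G \<Longrightarrow> w \<in> X \<Longrightarrow>
      lext \<delta> (ac g w) = lext (\<lambda>(u, v). pairs (ac g u) (ac g v)) (\<delta> w)"
    and \<delta>_deg: "w \<in> X \<Longrightarrow> \<delta> w \<in> psp {(u, v). u \<in> X \<and> v \<in> X \<and> deg u \<otimes>\<^bsub>G\<^esub> deg v = deg w}"
    and ac_\<epsilon>: "g \<in> carrier G \<Longrightarrow> w \<in> X \<Longrightarrow> ceval \<epsilon> (ac g w) = \<epsilon> w"
    and \<epsilon>_deg: "w \<in> X \<Longrightarrow> \<epsilon> w \<noteq> 0 \<Longrightarrow> deg w = \<one>\<^bsub>G\<^esub>"
    and \<delta>_m: "u \<in> X \<Longrightarrow> v \<in> X \<Longrightarrow> lext \<delta> (m u v) = lext (\<lambda>((a1, a2), (b1, b2)).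
        pairs (lmul m (basis a1) (ac (deg a2) b1)) (m a2 b2)) (pairs (\<delta> u) (\<delta> v))"
    and \<epsilon>_m: "u \<in> X \<Longrightarrow> v \<in> X \<Longrightarrow> ceval \<epsilon> (m u v) = \<epsilon> u * \<epsilon> v"
    and \<delta>_e: "\<delta> e = basis (e, e)" and \<epsilon>_e: "\<epsilon> e = 1"
begin

interpretation G: group G by (rule G)

lemma ac_psp: "g \<in> carrier G \<Longrightarrow> p \<in> psp X \<Longrightarrow> lext (ac g) p \<in> psp X"
  by (rule psp_lext, assumption) (rule psp_mono[OF ac_closed], auto)

lemma ac_psp_basis: "g \<in> carrier G \<Longrightarrow> w \<in> X \<Longrightarrow> ac g w \<in> psp X"
  using ac_psp[of g "basis w"] by simp

lemma hpart_psp: "p \<in> psp X \<Longrightarrow> lext (hpart deg g) p \<in> psp X"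
  by (rule psp_lext) (auto simp: hpart_closed)

lemma act_basis: "g \<in> carrier G \<Longrightarrow> w \<in> X \<Longrightarrow> act K g (P (basis w)) = P (ac g w)"
  by (simp add: act_P)

lemma hcomp_basis: "g \<in> carrier G \<Longrightarrow> w \<in> X \<Longrightarrow> hcomp K g (P (basis w)) = P (hpart deg g w)"
  by (simp add: hcomp_P)

lemma is_crossed_module: "is_crossed_module G K"
  unfolding is_crossed_module_def
proof (intro conjI ballI module)
  fix g assume g: "g \<in> carrier G"
  show "linear_map K K (act K g)"
    by (rule linear_map_endo[OF act_P]) (auto simp: g ac_psp_basis)
  show "linear_map K K (hcomp K g)"
    by (rule linear_map_endo[OF hcomp_P]) (auto simp: g hpart_closed)
next
  fix x assume "x \<in> carrier K"
  then obtain p where [simp]: "p \<in> psp X" "x = P p" by (metis P_surj)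
  show "act K \<one>\<^bsub>G\<^esub> x = x"
    using lext_psp_cong[of p X "ac \<one>\<^bsub>G\<^esub>" basis] by (simp add: act_P ac_one)
  { fix g h assume [simp]: "g \<in> carrier G" "h \<in> carrier G"
    show "act K (g \<otimes>\<^bsub>G\<^esub> h) x = act K g (act K h x)"
      using lext_psp_cong[of p X "ac (g \<otimes>\<^bsub>G\<^esub> h)" "\<lambda>w. lext (ac g) (ac h w)"]
      by (simp add: act_P ac_mult ac_psp lext_lext)
    show "hcomp K g (hcomp K h x) = (if g = h then hcomp K g x else \<zero>)"
    proof -
      have "lext (hpart deg g) (lext (hpart deg h) p) = (if g = h then lext (hpart deg g) p else 0)"
      proof -
        have "lext (hpart deg g) (hpart deg h w) = (if g = h then hpart deg g w else 0)" for w
          by (auto simp: hpart_def)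
        then show ?thesis by (simp add: lext_lext)
      qed
      then show ?thesis by (simp add: hcomp_P hpart_psp P_zero)
    qed
    show "act K h (hcomp K g x) = hcomp K (h \<otimes>\<^bsub>G\<^esub> g \<otimes>\<^bsub>G\<^esub> inv\<^bsub>G\<^esub> h) (act K h x)"
    proof -
      have "lext (ac h) (lext (hpart deg g) p) = lext (hpart deg (h \<otimes>\<^bsub>G\<^esub> g \<otimes>\<^bsub>G\<^esub> inv\<^bsub>G\<^esub> h)) (lext (ac h) p)"
        unfolding lext_lext
      proof (rule lext_psp_cong[of _ X])
        fix w assume w: "w \<in> X"
        have a: "ac h w \<in> psp {v. deg v = h \<otimes>\<^bsub>G\<^esub> deg w \<otimes>\<^bsub>G\<^esub> inv\<^bsub>G\<^esub> h}"
          by (rule psp_mono[OF ac_closed]) (auto simp: w)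
        show "lext (ac h) (hpart deg g w) = lext (hpart deg (h \<otimes>\<^bsub>G\<^esub> g \<otimes>\<^bsub>G\<^esub> inv\<^bsub>G\<^esub> h)) (ac h w)"
        proof (cases "deg w = g")
          case True
          then show ?thesis using hpart_id[OF a] by (simp add: hpart_def)
        next
          case False
          then have "h \<otimes>\<^bsub>G\<^esub> deg w \<otimes>\<^bsub>G\<^esub> inv\<^bsub>G\<^esub> h \<noteq> h \<otimes>\<^bsub>G\<^esub> g \<otimes>\<^bsub>G\<^esub> inv\<^bsub>G\<^esub> h"
            using w by (simp add: deg_closed)
          then show ?thesis using hpart_other[OF a] False by (simp add: hpart_def)
        qed
      qed simp
      then show ?thesis by (simp add: act_P hcomp_P hpart_psp ac_psp)
    qed
  }
  have "finsum K (\<lambda>g. hcomp K g x) (carrier G) = finsum K (\<lambda>g. P (lext (hpart deg g) p)) (carrier G)"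
    by (rule K.finsum_cong') (auto simp: hcomp_P P_closed hpart_psp)
  also have "\<dots> = P (\<Sum>g\<in>carrier G. lext (hpart deg g) p)"
    by (rule P_sum[symmetric]) (simp add: hpart_psp)
  also have "(\<Sum>g\<in>carrier G. lext (hpart deg g) p) = lext basis p"
    unfolding lext_fun_sum[symmetric]
    by (rule lext_psp_cong[of _ X]) (auto simp: hpart_def finG deg_closed)
  finally show "finsum K (\<lambda>g. hcomp K g x) (carrier G) = x" by simp
qed

lemma crossed_algebra: "crossed_algebra G K"
  unfolding crossed_algebra_def
proof (intro conjI ballI complex_algebra is_crossed_module)
  fix g assume [simp]: "g \<in> carrier G"
  show "act K g \<one> = \<one>" using act_basis[of g e] by (simp add: P_one ac_e e_in)
next
  show "hcomp K \<one>\<^bsub>G\<^esub> \<one> = \<one>" using hcomp_basis[of "\<one>\<^bsub>G\<^esub>" e] by (simp add: P_one hpart_def e_deg e_in)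
next
  fix g x y assume [simp]: "g \<in> carrier G" and "x \<in> carrier K" "y \<in> carrier K"
  then obtain p q where [simp]: "p \<in> psp X" "x = P p" "q \<in> psp X" "y = P q" by (metis P_surj)
  have "lext (ac g) (lmul m p q) = lmul m (lext (ac g) p) (lext (ac g) q)"
    unfolding lmul_lext_left lmul_lext_right lext_lmul lext_swap[of _ p q]
    by (intro lext_psp_cong[of p X] lext_psp_cong[of q X] ac_m) simp_all
  then show "act K g (x \<otimes> y) = act K g x \<otimes> act K g y"
    by (simp add: act_P P_mult[symmetric] lmul_psp ac_psp)
next
  fix g h x y assume [simp]: "g \<in> carrier G" "h \<in> carrier G" and "x \<in> carrier K" "y \<in> carrier K"
  then obtain p q where [simp]: "p \<in> psp X" "x = P p" "q \<in> psp X" "y = P q" by (metis P_surj)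
  have "lmul m (lext (hpart deg g) p) (lext (hpart deg h) q) \<in> psp {w. deg w = g \<otimes>\<^bsub>G\<^esub> h}"
    by (rule lmul_closed[of "{w \<in> X. deg w = g}" "{w \<in> X. deg w = h}"])
      (auto intro!: psp_mono[OF m_deg] psp_lext[of _ X] simp: hpart_def)
  then have "lext (hpart deg (g \<otimes>\<^bsub>G\<^esub> h)) (lmul m (lext (hpart deg g) p) (lext (hpart deg h) q))
      = lmul m (lext (hpart deg g) p) (lext (hpart deg h) q)"
    by (rule hpart_id)
  then show "hcomp K (g \<otimes>\<^bsub>G\<^esub> h) (hcomp K g x \<otimes> hcomp K h y) = hcomp K g x \<otimes> hcomp K h y"
    by (simp add: hcomp_P P_mult[symmetric] lmul_psp hpart_psp)
qed

lemma \<beta>_zero: assumes "bilin K K \<beta>" "y \<in> carrier K" shows "\<beta> \<zero> y = 0" "\<beta> y \<zero> = 0"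
  using bilin_left[OF assms(1) _ assms(2), of 0] bilin_right[OF assms(1) _ assms(2), of 0]
  by (simp_all add: P_zero)

lemma crossed_coalgebra: "crossed_coalgebra G K \<Delta> cou"
  unfolding crossed_coalgebra_def
proof (intro conjI ballI coalgebra is_crossed_module)
  fix g x assume g[simp]: "g \<in> carrier G" and x: "x \<in> carrier K"
  define p where "p = qsec X P x"
  have p[simp]: "p \<in> psp X" "x = P p" using qsec x by (auto simp: p_def)
  show "cou (act K g x) = cou x"
    using ceval_psp_cong[OF p(1), of "\<lambda>w. ceval \<epsilon> (ac g w)" \<epsilon>]
    by (simp add: act_P ep_P ac_psp ceval_lext ac_\<epsilon>)
  show "cou (hcomp K g x) = (if g = \<one>\<^bsub>G\<^esub> then cou x else 0)"
  proof -
    have "ceval (\<lambda>w. ceval \<epsilon> (hpart deg g w)) p = ceval (\<lambda>w. if g = \<one>\<^bsub>G\<^esub> then \<epsilon> w else 0) p"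
      by (rule ceval_psp_cong[OF p(1)]) (use \<epsilon>_deg in \<open>auto simp: hpart_def\<close>)
    then show ?thesis by (simp add: hcomp_P ep_P hpart_psp ceval_lext)
  qed
  show "tensor_eq K K (\<Delta> (act K g x)) (tensor_act K g (\<Delta> x))"
  proof (rule tensor_eqI)
    fix \<beta> assume b: "bilin K K \<beta>"
    let ?b = "\<lambda>(u, v). \<beta> (P (basis u)) (P (basis v))"
    have "ceval (\<lambda>(x, y). \<beta> x y) (\<Delta> (act K g x)) = ceval ?b (lext \<delta> (lext (ac g) p))"
      by (simp add: act_P \<Delta>_ceval[OF b] ac_psp)
    also have "lext \<delta> (lext (ac g) p) = lext (\<lambda>(u, v). pairs (ac g u) (ac g v)) (lext \<delta> p)"
      unfolding lext_lext by (rule lext_psp_cong[OF p(1)]) (simp add: ac_\<delta>)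
    also have "ceval ?b \<dots> = ceval (\<lambda>(u, v). \<beta> (P (ac g u)) (P (ac g v))) (lext \<delta> p)"
      unfolding ceval_lext[of ?b]
      by (intro ceval_psp_cong[OF lext_\<delta>_closed[OF p(1)]]) (auto simp: bilin_pairs[OF b] ac_psp_basis)
    also have "\<dots> = ceval (\<lambda>(u, v). \<beta> (act K g (P (basis u))) (act K g (P (basis v)))) (lext \<delta> p)"
      by (intro ceval_psp_cong[OF lext_\<delta>_closed[OF p(1)]]) (auto simp: act_basis)
    also have "\<dots> = ceval (\<lambda>(x, y). \<beta> x y) (tensor_act K g (\<Delta> x))"
      unfolding qcomult_def p_def[symmetric]
      by (simp add: tensor_act_def tensor_map_def ceval_lext timg_def split_def)
    finally show "ceval (\<lambda>(x, y). \<beta> x y) (\<Delta> (act K g x)) = \<dots>" .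
  qed
  show "tensor_eq K K (\<Delta> (hcomp K g x)) (tensor_hcomp G K g (\<Delta> x))"
  proof (rule tensor_eqI)
    fix \<beta> assume b: "bilin K K \<beta>"
    let ?b = "\<lambda>u v. \<beta> (P (basis u)) (P (basis v))"
    have bh: "\<beta> (hcomp K h (P (basis u))) (hcomp K k (P (basis v))) = (if deg u = h \<and> deg v = k then ?b u v else 0)"
      if "u \<in> X" "v \<in> X" "h \<in> carrier G" "k \<in> carrier G" for u v h k
      using that by (auto simp: hcomp_basis hpart_def P_zero \<beta>_zero[OF b] P_closed)
    \<comment> \<open>Basis elements being homogeneous, among the splittings of \<open>g\<close>
      only the one with \<open>h = deg u\<close> contributes.\<close>
    have bs: "(\<Sum>h\<in>carrier G. \<beta> (hcomp K h (P (basis u))) (hcomp K (inv\<^bsub>G\<^esub> h \<otimes>\<^bsub>G\<^esub> g) (P (basis v))))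
        = (if deg u \<otimes>\<^bsub>G\<^esub> deg v = g then ?b u v else 0)" if "u \<in> X" "v \<in> X" for u v
    proof -
      have "(deg u = h \<and> deg v = inv\<^bsub>G\<^esub> h \<otimes>\<^bsub>G\<^esub> g) \<longleftrightarrow> (h = deg u \<and> deg u \<otimes>\<^bsub>G\<^esub> deg v = g)" if "h \<in> carrier G" for h
        using that \<open>u \<in> X\<close> \<open>v \<in> X\<close> by (auto simp: deg_closed G.m_assoc[symmetric])
      then have "(\<Sum>h\<in>carrier G. \<beta> (hcomp K h (P (basis u))) (hcomp K (inv\<^bsub>G\<^esub> h \<otimes>\<^bsub>G\<^esub> g) (P (basis v))))
        = (\<Sum>h\<in>carrier G. if h = deg u \<and> deg u \<otimes>\<^bsub>G\<^esub> deg v = g then ?b u v else 0)"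
        using that by (intro sum.cong) (auto simp: bh)
      also have "\<dots> = (\<Sum>h\<in>carrier G. if h = deg u then (if deg u \<otimes>\<^bsub>G\<^esub> deg v = g then ?b u v else 0) else 0)"
        by (rule sum.cong) auto
      also have "\<dots> = (if deg u \<otimes>\<^bsub>G\<^esub> deg v = g then ?b u v else 0)"
        using that by (simp add: sum.delta finG deg_closed)
      finally show ?thesis .
    qed
    have "ceval (\<lambda>(x, y). \<beta> x y) (\<Delta> (hcomp K g x))
        = ceval (\<lambda>(u, v). ?b u v) (lext \<delta> (lext (hpart deg g) p))"
      by (simp add: hcomp_P \<Delta>_ceval[OF b] hpart_psp)
    also have "\<dots> = ceval (\<lambda>w. ceval (\<lambda>(u, v). ?b u v) (lext \<delta> (hpart deg g w))) p"
      by (simp add: lext_lext ceval_lext)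
    also have "\<dots> = ceval (\<lambda>w. ceval (\<lambda>(u, v). if deg u \<otimes>\<^bsub>G\<^esub> deg v = g then ?b u v else 0) (\<delta> w)) p"
    proof (rule ceval_psp_cong[OF p(1)])
      fix w assume w: "w \<in> X"
      show "ceval (\<lambda>(u, v). ?b u v) (lext \<delta> (hpart deg g w))
          = ceval (\<lambda>(u, v). if deg u \<otimes>\<^bsub>G\<^esub> deg v = g then ?b u v else 0) (\<delta> w)"
      proof (cases "deg w = g")
        case True
        then have "ceval (\<lambda>(u, v). if deg u \<otimes>\<^bsub>G\<^esub> deg v = g then ?b u v else 0) (\<delta> w) = ceval (\<lambda>(u, v). ?b u v) (\<delta> w)"
          by (intro ceval_psp_cong[OF \<delta>_deg[OF w]]) auto
        then show ?thesis using True by (simp add: hpart_def)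
      next
        case False
        then have "ceval (\<lambda>(u, v). if deg u \<otimes>\<^bsub>G\<^esub> deg v = g then ?b u v else 0) (\<delta> w) = ceval (\<lambda>_. 0) (\<delta> w)"
          by (intro ceval_psp_cong[OF \<delta>_deg[OF w]]) auto
        then show ?thesis using False by (simp add: hpart_def)
      qed
    qed
    also have "\<dots> = ceval (\<lambda>(u, v). if deg u \<otimes>\<^bsub>G\<^esub> deg v = g then ?b u v else 0) (lext \<delta> p)"
      by (simp add: ceval_lext)
    also have "\<dots> = ceval (\<lambda>(u, v). \<Sum>h\<in>carrier G. \<beta> (hcomp K h (P (basis u)))
        (hcomp K (inv\<^bsub>G\<^esub> h \<otimes>\<^bsub>G\<^esub> g) (P (basis v)))) (lext \<delta> p)"
      by (intro ceval_psp_cong[OF lext_\<delta>_closed[OF p(1)]]) (auto simp: bs)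
    also have "\<dots> = ceval (\<lambda>(x, y). \<beta> x y) (tensor_hcomp G K g (\<Delta> x))"
      unfolding qcomult_def p_def[symmetric]
      by (simp add: tensor_hcomp_def tensor_map_def ceval_lext ceval_sum timg_def split_def ceval_fun_sum)
    finally show "ceval (\<lambda>(x, y). \<beta> x y) (\<Delta> (hcomp K g x)) = \<dots>" .
  qed
qed

lemma braided_bialgebra: "braided_bialgebra G K \<Delta> cou"
  unfolding braided_bialgebra_def
proof (intro conjI ballI crossed_algebra crossed_coalgebra)
  show "tensor_eq K K (\<Delta> \<one>) (basis (\<one>, \<one>))"
    using \<Delta>_P[of "basis e"] by (simp add: e_in P_one \<delta>_e timg_def)
  show "cou \<one> = 1" using ep_P[of "basis e"] by (simp add: e_in P_one \<epsilon>_e)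
next
  fix x y assume x: "x \<in> carrier K" and y: "y \<in> carrier K"
  define p q where "p = qsec X P x" and "q = qsec X P y"
  have p: "p \<in> psp X" "x = P p" and q: "q \<in> psp X" "y = P q"
    using qsec x y by (auto simp: p_def q_def)
  show "cou (x \<otimes> y) = cou x * cou y"
  proof -
    have "ceval \<epsilon> (lmul m p q) = ceval (\<lambda>u. ceval (\<lambda>v. \<epsilon> u * \<epsilon> v) q) p"
      unfolding ceval_lmul by (intro ceval_psp_cong[OF p(1)] ceval_psp_cong[OF q(1)] \<epsilon>_m)
    then show ?thesis
      by (simp add: ceval_fun_mult ceval_fun_mult_right p q P_mult[symmetric] ep_P lmul_psp)
  qed
  show "tensor_eq K K (\<Delta> (x \<otimes> y)) (braided_mult G K (\<Delta> x) (\<Delta> y))"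
  proof (rule tensor_eqI)
    fix \<beta> assume b: "bilin K K \<beta>"
    let ?b = "\<lambda>(u, v). \<beta> (P (basis u)) (P (basis v))"
    let ?F = "\<lambda>a1 a2 b1 b2. \<beta> (P (lmul m (basis a1) (ac (deg a2) b1))) (P (m a2 b2))"
    let ?H = "\<lambda>a1 a2 b1 b2. \<Sum>g\<in>carrier G. \<beta> (P (basis a1) \<otimes> act K g (P (basis b1))) (hcomp K g (P (basis a2)) \<otimes> P (basis b2))"
    \<comment> \<open>Of the sum over \<open>G\<close> that defines the braiding, only the summand
      \<open>g = deg a2\<close> survives on a basis element \<open>a2\<close>.\<close>
    have FH: "?F a1 a2 b1 b2 = ?H a1 a2 b1 b2" if [simp]: "a1 \<in> X" "a2 \<in> X" "b1 \<in> X" "b2 \<in> X" for a1 a2 b1 b2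
    proof -
      have "\<beta> (P (basis a1) \<otimes> act K g (P (basis b1))) (hcomp K g (P (basis a2)) \<otimes> P (basis b2))
        = (if g = deg a2 then ?F a1 a2 b1 b2 else 0)" if g: "g \<in> carrier G" for g
      proof -
        have c: "lmul m (basis a1) (ac g b1) \<in> psp X" using g by (intro lmul_psp ac_psp_basis) auto
        have "hcomp K g (P (basis a2)) \<otimes> P (basis b2) = (if g = deg a2 then P (m a2 b2) else \<zero>)"
          using g by (auto simp: hcomp_basis hpart_closed P_mult[symmetric]) (auto simp: hpart_def P_zero)
        then show ?thesis
          using g c by (auto simp: act_basis P_mult[symmetric] ac_psp_basis \<beta>_zero[OF b] P_closed)
      qed
      then have "?H a1 a2 b1 b2 = (\<Sum>g\<in>carrier G. if g = deg a2 then ?F a1 a2 b1 b2 else 0)"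
        by (rule sum.cong[OF refl])
      then show ?thesis by (simp add: finG deg_closed)
    qed
    have "ceval (\<lambda>(x, y). \<beta> x y) (\<Delta> (x \<otimes> y)) = ceval ?b (lext \<delta> (lmul m p q))"
      by (simp add: p q P_mult[symmetric] \<Delta>_ceval[OF b] lmul_psp)
    also have "\<dots> = ceval (\<lambda>u. ceval (\<lambda>v. ceval ?b (lext \<delta> (m u v))) q) p"
      by (simp add: lext_lmul ceval_lext)
    also have "\<dots> = ceval (\<lambda>u. ceval (\<lambda>v. ceval (\<lambda>(a1, a2). ceval (\<lambda>(b1, b2).
        ?F a1 a2 b1 b2) (\<delta> v)) (\<delta> u)) q) p"
    proof (intro ceval_psp_cong[OF p(1)] ceval_psp_cong[OF q(1)])
      fix u v assume u: "u \<in> X" and v: "v \<in> X"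
      show "ceval ?b (lext \<delta> (m u v)) = ceval (\<lambda>(a1, a2). ceval (\<lambda>(b1, b2).
        ?F a1 a2 b1 b2) (\<delta> v)) (\<delta> u)"
        unfolding \<delta>_m[OF u v] ceval_lext ceval_pairs split_def
        by (intro ceval_psp_cong[OF \<delta>_closed[OF u]] ceval_psp_cong[OF \<delta>_closed[OF v]])
          (auto simp: bilin_pairs[OF b] m_closed lmul_psp ac_psp_basis deg_closed split_def ceval_pairs)
    qed
    also have "\<dots> = ceval (\<lambda>(a1, a2). ceval (\<lambda>(b1, b2). ?F a1 a2 b1 b2) (lext \<delta> q)) (lext \<delta> p)"
      unfolding ceval_lext split_def by (intro ceval_cong) (rule ceval_swap)
    also have "\<dots> = ceval (\<lambda>(a1, a2). ceval (\<lambda>(b1, b2). ?H a1 a2 b1 b2) (lext \<delta> q)) (lext \<delta> p)"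
      unfolding split_def
      by (intro ceval_psp_cong[OF lext_\<delta>_closed[OF p(1)]] ceval_psp_cong[OF lext_\<delta>_closed[OF q(1)]] FH) auto
    also have "\<dots> = ceval (\<lambda>(x, y). \<beta> x y) (braided_mult G K (\<Delta> x) (\<Delta> y))"
      unfolding qcomult_def p_def[symmetric] q_def[symmetric] braided_mult_def braid_def
      by (simp add: ceval_lext lext_sum ceval_sum ceval_pairs timg_def split_def)
    finally show "ceval (\<lambda>(x, y). \<beta> x y) (\<Delta> (x \<otimes> y)) = \<dots>" .
  qed
qed

lemma crossed_homI:
  assumes "linear_map K L f"
    and "\<And>g p. g \<in> carrier G \<Longrightarrow> p \<in> psp X \<Longrightarrow> f (P (lext (ac g) p)) = act L g (f (P p))"
    and "\<And>g p. g \<in> carrier G \<Longrightarrow> p \<in> psp X \<Longrightarrow> f (P (lext (hpart deg g) p)) = hcomp L g (f (P p))"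
  shows "crossed_hom G K L f"
  unfolding crossed_hom_def
  by (auto elim!: P_ex simp: act_P hcomp_P assms)

lemma braided_bialgebra_hom_cover:
  assumes "braided_cover X L Q \<delta> \<epsilon> m e G ac deg" "\<And>p. p \<in> psp X \<Longrightarrow> f (P p) = Q p"
  shows "braided_bialgebra_hom G K \<Delta> cou L (qcomult X \<delta> Q) (qcounit X \<epsilon> Q) f"
proof -
  interpret L: braided_cover X L Q \<delta> \<epsilon> m e G ac deg by fact
  show ?thesis
    unfolding braided_bialgebra_hom_def bialgebra_hom_def
    by (intro conjI algebra_hom_cover[OF L.algcover_axioms assms(2)] crossed_homI
        coalgebra_hom_cover[OF cocover_axioms L.cocover_axioms assms(2)]
        linear_map_cover[OF L.cover_axioms assms(2)])
      (simp_all add: assms(2) ac_psp hpart_psp L.act_P L.hcomp_P)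
qed

lemma crossed_hom_endo:
  assumes "\<And>p. p \<in> psp X \<Longrightarrow> f (P p) = P (lext s p)" "\<And>w. w \<in> X \<Longrightarrow> s w \<in> psp {v \<in> X. deg v = deg w}"
    and "\<And>g w. g \<in> carrier G \<Longrightarrow> w \<in> X \<Longrightarrow> lext s (ac g w) = lext (ac g) (s w)"
  shows "crossed_hom G K K f"
proof (rule crossed_homI)
  have sX: "s w \<in> psp X" if "w \<in> X" for w using assms(2)[OF that] by (rule psp_mono) auto
  show "linear_map K K f" by (rule linear_map_endo[OF assms(1) sX])
  fix g p assume g: "g \<in> carrier G" and p: "p \<in> psp X"
  have sp: "lext s p \<in> psp X" by (rule psp_lext[OF p sX])
  show "f (P (lext (ac g) p)) = act K g (f (P p))"
    using lext_psp_cong[OF p, of "\<lambda>w. lext s (ac g w)" "\<lambda>w. lext (ac g) (s w)"]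
    by (simp add: assms(1,3) p g ac_psp act_P sp lext_lext)
  have "lext s (hpart deg g w) = lext (hpart deg g) (s w)" if "w \<in> X" for w
  proof -
    have "s w \<in> psp {v. deg v = deg w}" by (rule psp_mono[OF assms(2)[OF that]]) auto
    from hpart_id[OF this] hpart_other[OF this, of g] show ?thesis
      by (cases "deg w = g") (auto simp: hpart_def[of _ _ w])
  qed
  then show "f (P (lext (hpart deg g) p)) = hcomp K g (f (P p))"
    using lext_psp_cong[OF p, of "\<lambda>w. lext s (hpart deg g w)" "\<lambda>w. lext (hpart deg g) (s w)"]
    by (simp add: assms(1) p g hpart_psp hcomp_P sp lext_lext)
qed

end

section \<open>Free algebras and their ideals\<close>

definition cm :: "'x list \<Rightarrow> 'x list \<Rightarrow> ('x list \<Rightarrow>\<^sub>0 complex)" where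
  "cm u v = basis (u @ v)"

definition is_free :: "'x set \<Rightarrow> (complex, 'x list \<Rightarrow>\<^sub>0 complex, 'z) module_scheme \<Rightarrow> bool" where
  "is_free L A \<longleftrightarrow> carrier A = psp (lists L) \<and> mult A = lmul cm \<and> one A = basis [] \<and> zero A = 0 \<and>
     add A = (+) \<and> smult A = csmul"

lemma is_free_free_algebra: "is_free L (free_algebra L)"
  by (simp add: is_free_def free_algebra_def psp_def lmul_def cm_def fun_eq_iff)

lemma is_free_tensor_algebra: "is_free L (tensor_algebra G L ac dg)"
  using is_free_free_algebra[of L] by (simp add: is_free_def tensor_algebra_def with_crossed_def)

lemma cm_closed: "u \<in> lists L \<Longrightarrow> v \<in> lists L \<Longrightarrow> cm u v \<in> psp (lists L)"
  by (auto simp: cm_def)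

lemma cm_assoc: "lmul cm (cm u v) (basis w) = lmul cm (basis u) (cm v w)"
  by (simp add: cm_def)

lemma cm_nil [simp]: "cm [] u = basis u" "cm u [] = basis u"
  by (simp_all add: cm_def)

lemma algcover_free: "is_free L A \<Longrightarrow> algcover (lists L) A id cm []"
  by unfold_locales (auto simp: is_free_def cm_closed cm_assoc)

definition tideal :: "'x set \<Rightarrow> ('x list \<Rightarrow>\<^sub>0 complex) set \<Rightarrow> bool" where
  "tideal L N \<longleftrightarrow> N \<subseteq> psp (lists L) \<and> csmul.subspace N \<and>
     (\<forall>n\<in>N. \<forall>u\<in>lists L. lmul cm (basis u) n \<in> N \<and> lmul cm n (basis u) \<in> N)"

lemma subspace_lext: "csmul.subspace N \<Longrightarrow> p \<in> psp X \<Longrightarrow> (\<And>x. x \<in> X \<Longrightarrow> f x \<in> N) \<Longrightarrow> lext f p \<in> N"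
  unfolding lext_def
  by (intro csmul.subspace_sum csmul.subspace_scale) (auto simp: psp_def)

lemma tideal_mult:
  assumes "tideal L N" "n \<in> N" "p \<in> psp (lists L)"
  shows "lmul cm p n \<in> N" "lmul cm n p \<in> N"
proof -
  show "lmul cm p n \<in> N" unfolding lmul_alt[of _ p]
    by (rule subspace_lext[OF _ assms(3)]) (use assms(1,2) in \<open>auto simp: tideal_def\<close>)
  have "lmul cm n p = lext (\<lambda>v. lmul cm n (basis v)) p"
    using lmul_lext_right[of cm n basis p] by simp
  then show "lmul cm n p \<in> N"
    by simp (rule subspace_lext[OF _ assms(3)], use assms(1,2) in \<open>auto simp: tideal_def\<close>)
qed

text \<open>Scalars act as multiples of the empty word, so ring ideals are subspaces; for a
  subspace, absorption of products need only be tested on words.\<close>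

lemma ideal_iff_tideal:
  assumes "is_free L A"
  shows "ideal N A \<longleftrightarrow> tideal L N"
proof
  interpret A: algcover "lists L" A id cm "[]" by (rule algcover_free[OF assms])
  have inv: "inv\<^bsub>add_monoid A\<^esub> x = - x" if "x \<in> psp (lists L)" for x
    using A.P_uminus[OF that] by (simp only: a_inv_def id_apply)
  note [simp] = assms[unfolded is_free_def]
  show "ideal N A" if N: "tideal L N"
  proof (rule idealI[OF A.ring])
    have NX: "N \<subseteq> psp (lists L)" and sub: "csmul.subspace N" using N by (auto simp: tideal_def)
    show "subgroup N (add_monoid A)"
    proof (rule group.subgroupI[OF A.K.a_group])
      show "N \<noteq> {}" using csmul.subspace_0[OF sub] by blast
      show "inv\<^bsub>add_monoid A\<^esub> a \<in> N" if "a \<in> N" for a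
        using csmul.subspace_neg[OF sub that] inv[of a] that NX by (simp only: subsetD)
      show "a \<otimes>\<^bsub>add_monoid A\<^esub> b \<in> N" if "a \<in> N" "b \<in> N" for a b
        using csmul.subspace_add[OF sub that] by simp
    qed (use NX in simp)
  qed (use N tideal_mult in auto)
  show "tideal L N" if N: "ideal N A"
  proof -
    interpret N: ideal N A by fact
    have s: "N \<subseteq> psp (lists L)" using N.a_subset by simp
    have z: "csmul k n \<in> N" if "n \<in> N" for k n
    proof -
      have "lmul cm (csmul k (basis [])) n \<in> N"
        using N.I_l_closed[OF that, of "csmul k (basis [])"] by (simp add: psp_csmul)
      moreover have "lmul cm (basis []) n = n" using A.lmul_one(1)[of n] s that by blast
      ultimately show ?thesis by (simp only: lmul_csmul_left)
    qed
    have "csmul.subspace N"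
      using N.zero_closed N.a_closed z by (auto simp: csmul.subspace_def)
    then show ?thesis
      using s N.I_l_closed N.I_r_closed by (force simp: tideal_def)
  qed
qed

lemma genideal_tideal:
  assumes "is_free L A" "S \<subseteq> psp (lists L)"
  shows "tideal L (Idl\<^bsub>A\<^esub> S)" "S \<subseteq> Idl\<^bsub>A\<^esub> S"
proof -
  interpret A: algcover "lists L" A id cm "[]" by (rule algcover_free[OF assms(1)])
  interpret R: ring A by (rule A.ring)
  show "tideal L (Idl\<^bsub>A\<^esub> S)"
    using R.genideal_ideal[of S] assms ideal_iff_tideal[OF assms(1)] by (simp add: is_free_def)
  show "S \<subseteq> Idl\<^bsub>A\<^esub> S" using R.genideal_self[of S] assms by (simp add: is_free_def)
qed

lemma genideal_minimal_free:
  assumes "is_free L A" "tideal L N" "S \<subseteq> N"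
  shows "Idl\<^bsub>A\<^esub> S \<subseteq> N"
proof -
  interpret A: algcover "lists L" A id cm "[]" by (rule algcover_free[OF assms(1)])
  interpret R: ring A by (rule A.ring)
  show ?thesis by (rule R.genideal_minimal) (use assms ideal_iff_tideal in auto)
qed

section \<open>Quotients of presented algebras\<close>

definition same_alg where
  "same_alg A B \<longleftrightarrow> carrier A = carrier B \<and> mult A = mult B \<and> one A = one B \<and> zero A = zero B \<and>
     add A = add B \<and> smult A = smult B"

lemma cover_same: "cover X A P \<Longrightarrow> same_alg A B \<Longrightarrow> cover X B P"
  by (simp add: cover_def same_alg_def)

lemma algcover_same: "algcover X A P m e \<Longrightarrow> same_alg A B \<Longrightarrow> algcover X B P m e"
  using cover_same[of X A P B] by (simp add: algcover_def algcover_axioms_def same_alg_def)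

lemma ker_same: "cover.ker X A P = cover.ker X B P" if "cover X A P" "same_alg A B"
  using that by (simp add: cover.ker_def cover_same same_alg_def)

lemma same_alg_quot_crossed: "same_alg (quot_algebra A J) (quot_crossed A J)"
  by (simp add: same_alg_def quot_crossed_def with_crossed_def)

lemma (in ideal) a_rcos_absorb: "i \<in> I \<Longrightarrow> x \<in> carrier R \<Longrightarrow> I +> (i \<oplus> x) = I +> x"
proof -
  assume "i \<in> I" "x \<in> carrier R"
  then have "i \<oplus> x \<in> I +> x" by (auto simp: a_r_coset_def')
  from a_repr_independence[OF this] \<open>x \<in> carrier R\<close> a_subgroup show ?thesis by simp
qed

text \<open>Scalars, actions and projections on a quotient are defined as unions over the members of
  a coset. For an additive map that preserves \<open>I\<close> all the cosets in this union
  coincide.\<close>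

lemma (in ideal) coset_descend:
  assumes "x \<in> carrier R" and f: "\<And>y. y \<in> carrier R \<Longrightarrow> f y \<in> carrier R"
    "\<And>y z. y \<in> carrier R \<Longrightarrow> z \<in> carrier R \<Longrightarrow> f (y \<oplus> z) = f y \<oplus> f z" "\<And>i. i \<in> I \<Longrightarrow> f i \<in> I"
  shows "(\<Union>y\<in>I +> x. I +> f y) = I +> f x"
proof -
  have "I +> f y = I +> f x" if "y \<in> I +> x" for y
  proof -
    from that obtain i where "i \<in> I" "y = i \<oplus> x" by (auto simp: a_r_coset_def')
    then show ?thesis using assms a_Hcarr by (simp add: a_rcos_absorb)
  qed
  moreover have "x \<in> I +> x" using assms(1) by (rule a_rcos_self)
  ultimately show ?thesis by blast
qed

lemma (in cover) ker_subspace: "csmul.subspace ker"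
proof -
  have "k \<odot> \<zero> = \<zero>" for k using P_csmul[of 0 k] by (simp add: P_zero)
  then show ?thesis
    by (auto simp: csmul.subspace_def ker_def psp_add psp_csmul P_add P_csmul P_zero)
qed

context algcover
begin

lemma algcover_quot:
  assumes "ideal J K"
  shows "algcover X (quot_algebra K J) (\<lambda>p. J +> P p) m e"
    and "cover.ker X (quot_algebra K J) (\<lambda>p. J +> P p) = {p \<in> psp X. P p \<in> J}"
proof -
  interpret J: ideal J K by fact
  have sm: "k \<odot> x \<in> J" if "x \<in> J" for k x
  proof -
    have "x \<in> carrier K" using that by (rule J.a_Hcarr)
    then obtain p where p: "p \<in> psp X" "x = P p" by (metis P_surj)
    have "P (csmul k (basis e)) \<otimes> x = P (lmul m (csmul k (basis e)) p)"
      using p e_in by (simp only: P_mult psp_csmul psp_basis)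
    also have "\<dots> = k \<odot> x" using p by (simp add: lmul_linear lmul_one P_csmul)
    finally have "k \<odot> x = P (csmul k (basis e)) \<otimes> x" by simp
    then show ?thesis using J.I_l_closed[OF that] by (simp add: P_closed psp_csmul e_in)
  qed
  have smq: "(\<Union>y\<in>J +> x. J +> (k \<odot> y)) = J +> (k \<odot> x)" if "x \<in> carrier K" for k x
    using that by (rule J.coset_descend)
      (auto elim!: P_ex simp: P_add[symmetric] P_csmul[symmetric] P_closed psp_add psp_csmul
        csmul.scale_right_distrib sm)
  show "algcover X (quot_algebra K J) (\<lambda>p. J +> P p) m e"
  proof (unfold_locales)
    fix p assume "p \<in> psp X"
    then show "J +> P p \<in> carrier (quot_algebra K J)"
      by (auto simp: quot_algebra_def FactRing_def A_RCOSETS_def' P_closed)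
  next
    fix x assume "x \<in> carrier (quot_algebra K J)"
    then show "\<exists>p\<in>psp X. J +> P p = x"
      by (auto simp: quot_algebra_def FactRing_def A_RCOSETS_def' elim!: P_ex)
  next
    fix k p assume "p \<in> psp X"
    then show "J +> P (csmul k p) = k \<odot>\<^bsub>quot_algebra K J\<^esub> (J +> P p)"
      by (simp add: quot_algebra_def smq P_closed P_csmul)
  next
    fix p q assume "p \<in> psp X" "q \<in> psp X"
    then show "J +> P (p + q) = (J +> P p) \<oplus>\<^bsub>quot_algebra K J\<^esub> (J +> P q)"
      "J +> P (lmul m p q) = (J +> P p) \<otimes>\<^bsub>quot_algebra K J\<^esub> (J +> P q)"
      by (simp_all add: quot_algebra_def FactRing_def J.a_rcos_sum P_closed P_add J.rcoset_mult_add P_mult)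
  next
    show "J +> P 0 = \<zero>\<^bsub>quot_algebra K J\<^esub>" "J +> P (basis e) = \<one>\<^bsub>quot_algebra K J\<^esub>"
      using J.a_rcos_const[OF J.zero_closed] by (simp_all add: quot_algebra_def FactRing_def P_zero P_one)
  qed (rule e_in | (rule m_closed m_assoc m_one, assumption+))+
  then interpret Q: algcover X "quot_algebra K J" "\<lambda>p. J +> P p" m e .
  have z: "\<zero>\<^bsub>quot_algebra K J\<^esub> = J" by (simp add: quot_algebra_def FactRing_def)
  show "Q.ker = {p \<in> psp X. P p \<in> J}"
    unfolding Q.ker_def z
    using J.rcos_const_imp_mem[OF P_closed] J.a_rcos_const by auto
qed

end

lemma kernel_tideal:
  assumes "algcover (lists L) K P cm []" "ideal J K"
  shows "tideal L {p \<in> psp (lists L). P p \<in> J}"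
proof -
  interpret algcover "lists L" K P cm "[]" by fact
  interpret J: ideal J K by fact
  interpret Q: algcover "lists L" "quot_algebra K J" "\<lambda>p. J +>\<^bsub>K\<^esub> P p" cm "[]"
    by (rule algcover_quot(1)[OF assms(2)])
  have e: "{p \<in> psp (lists L). P p \<in> J} = Q.ker" by (rule algcover_quot(2)[OF assms(2), symmetric])
  note Q.ker_subspace
  moreover have "P (lmul cm (basis u) n) \<in> J \<and> P (lmul cm n (basis u)) \<in> J"
    if "n \<in> psp (lists L)" "P n \<in> J" "u \<in> lists L" for n u
    using that J.I_l_closed J.I_r_closed by (simp add: P_mult P_closed)
  ultimately show ?thesis
    unfolding e[symmetric] tideal_def by (auto intro!: lmul_psp)
qed

text \<open>Since \<open>P\<close> is onto, \<open>P\<close> applied to \<open>N\<close> gives an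
  ideal of \<open>K\<close>, and it contains \<open>S\<close>. From \<open>P p = P n\<close> with
  \<open>n\<close> in \<open>N\<close> one returns to \<open>p\<close> in \<open>N\<close> because
  \<open>N\<close> contains the kernel.\<close>

lemma genideal_minimal_cover:
  assumes "algcover (lists L) K P cm []" "tideal L N" "cover.ker (lists L) K P \<subseteq> N"
    and S: "\<And>s. s \<in> S \<Longrightarrow> \<exists>p\<in>N. s = P p"
    and p: "p \<in> psp (lists L)" "P p \<in> Idl\<^bsub>K\<^esub> S"
  shows "p \<in> N"
proof -
  interpret algcover "lists L" K P cm "[]" by fact
  interpret R: ring K by (rule ring)
  have NX: "N \<subseteq> psp (lists L)" and sub: "csmul.subspace N"
    using assms(2) by (auto simp: tideal_def)
  have neg: "- x \<in> N" if "x \<in> N" for x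
    using csmul.subspace_neg[OF sub that] .
  have NP: "P n \<in> carrier K" if "n \<in> N" for n using that NX P_closed by blast
  have "ideal (P ` N) K"
  proof (rule idealI[OF ring])
    show "subgroup (P ` N) (add_monoid K)"
    proof (rule group.subgroupI[OF K.a_group])
      show "P ` N \<noteq> {}" using csmul.subspace_0[OF sub] by blast
      fix a b assume "a \<in> P ` N" "b \<in> P ` N"
      then obtain n n' where n: "n \<in> N" "a = P n" "n' \<in> N" "b = P n'" by blast
      have "\<ominus>\<^bsub>K\<^esub> P n = P (- n)" using n NX by (auto simp: P_uminus)
      then show "inv\<^bsub>add_monoid K\<^esub> a \<in> P ` N"
        using imageI[OF neg[OF n(1)], of P] n(2) by (simp only: a_inv_def)
      have "P n \<oplus>\<^bsub>K\<^esub> P n' = P (n + n')" using n NX by (intro P_add[symmetric]) auto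
      then show "a \<otimes>\<^bsub>add_monoid K\<^esub> b \<in> P ` N"
        using n csmul.subspace_add[OF sub] by auto
    qed (use NP in auto)
  next
    fix a x assume "a \<in> P ` N" "x \<in> carrier K"
    then obtain n s where n: "n \<in> N" "a = P n" "s \<in> psp (lists L)" "x = P s" by (metis P_surj imageE)
    then have "n \<in> psp (lists L)" using NX by blast
    then have "x \<otimes>\<^bsub>K\<^esub> a = P (lmul cm s n)" "a \<otimes>\<^bsub>K\<^esub> x = P (lmul cm n s)" using n by (simp_all add: P_mult)
    then show "x \<otimes>\<^bsub>K\<^esub> a \<in> P ` N" "a \<otimes>\<^bsub>K\<^esub> x \<in> P ` N"
      using tideal_mult[OF assms(2) n(1,3)] by auto
  qed
  moreover have "S \<subseteq> P ` N" using S by blast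
  ultimately have "P p \<in> P ` N" using R.genideal_minimal p(2) by blast
  then obtain n where n: "n \<in> N" "P p = P n" by blast
  then have "p - n \<in> ker" using p(1) NX P_eq_iff[of p n] by (auto simp: ker_def psp_diff)
  then have "p - n \<in> N" using assms(3) by blast
  from csmul.subspace_add[OF sub this n(1)] show ?thesis by simp
qed

lemma act_quot_crossed:
  assumes "ideal J K" "x \<in> carrier K" "\<And>y. y \<in> carrier K \<Longrightarrow> f y \<in> carrier K"
    "\<And>y z. y \<in> carrier K \<Longrightarrow> z \<in> carrier K \<Longrightarrow> f (y \<oplus>\<^bsub>K\<^esub> z) = f y \<oplus>\<^bsub>K\<^esub> f z" "\<And>i. i \<in> J \<Longrightarrow> f i \<in> J"
  shows "f = act K g \<Longrightarrow> act (quot_crossed K J) g (J +>\<^bsub>K\<^esub> x) = J +>\<^bsub>K\<^esub> f x"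
    and "f = hcomp K g \<Longrightarrow> hcomp (quot_crossed K J) g (J +>\<^bsub>K\<^esub> x) = J +>\<^bsub>K\<^esub> f x"
  using ideal.coset_descend[OF assms(1), of x f] assms(2-)
  by (simp_all add: quot_crossed_def with_crossed_def)

section \<open>Words in the matrix entries\<close>

text \<open>An orthogonal representation \<open>rho1\<close> graded by \<open>dg1\<close> (a crossed module with a homogeneous
  orthonormal basis \<open>I\<close>) and an equivariant involution \<open>st1\<close> of the basis inverting degrees.\<close>

locale orep = group G for G :: "('g, 'm) monoid_scheme" (structure) +
  fixes I :: "'a set" and dg1 :: "'a \<Rightarrow> 'g" and rho1 :: "'g \<Rightarrow> 'a \<Rightarrow> 'a \<Rightarrow> complex" and st1 :: "'a \<Rightarrow> 'a"
  assumes finG: "finite (carrier G)" and finI: "finite I"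
    and dg1_closed: "x \<in> I \<Longrightarrow> dg1 x \<in> carrier G"
    and rho1_one: "x \<in> I \<Longrightarrow> y \<in> I \<Longrightarrow> rho1 \<one> y x = (if y = x then 1 else 0)"
    and rho1_mult: "g \<in> carrier G \<Longrightarrow> h \<in> carrier G \<Longrightarrow> x \<in> I \<Longrightarrow> y \<in> I \<Longrightarrow>
      (\<Sum>z\<in>I. rho1 g y z * rho1 h z x) = rho1 (g \<otimes> h) y x"
    and rho1_deg: "g \<in> carrier G \<Longrightarrow> x \<in> I \<Longrightarrow> y \<in> I \<Longrightarrow> rho1 g y x \<noteq> 0 \<Longrightarrow> dg1 y = g \<otimes> dg1 x \<otimes> inv g"
    and rho1_inv: "g \<in> carrier G \<Longrightarrow> x \<in> I \<Longrightarrow> y \<in> I \<Longrightarrow> rho1 (inv g) x y = rho1 g y x"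
    and st1_closed: "x \<in> I \<Longrightarrow> st1 x \<in> I" and st1_st1: "x \<in> I \<Longrightarrow> st1 (st1 x) = x"
    and dg1_st1: "x \<in> I \<Longrightarrow> dg1 (st1 x) = inv dg1 x"
    and rho1_st1: "g \<in> carrier G \<Longrightarrow> x \<in> I \<Longrightarrow> y \<in> I \<Longrightarrow> rho1 g (st1 y) (st1 x) = rho1 g y x"
begin

text \<open>Degrees of multi-indices multiply in reverse order.\<close>

definition mi :: "nat \<Rightarrow> 'a list set" where "mi n = {xs. set xs \<subseteq> I \<and> length xs = n}"

fun dg :: "'a list \<Rightarrow> 'g" where
  "dg [] = \<one>" | "dg (x # xs) = dg xs \<otimes> dg1 x"

fun rho :: "'g \<Rightarrow> 'a list \<Rightarrow> 'a list \<Rightarrow> complex" where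
  "rho g [] [] = 1" | "rho g (y # ys) (x # xs) = rho1 g y x * rho g ys xs" | "rho g _ _ = 0"

definition st :: "'a list \<Rightarrow> 'a list" where "st xs = rev (map st1 xs)"

lemma mi_iff [simp]: "xs \<in> mi n \<longleftrightarrow> set xs \<subseteq> I \<and> length xs = n"
  by (simp add: mi_def)

lemma finite_mi [simp]: "finite (mi n)"
  unfolding mi_def using finite_lists_length_eq[OF finI] by simp

lemma mi_0 [simp]: "mi 0 = {[]}"
  by (auto simp: mi_def)

lemma sum_mi_append: "(\<Sum>a\<in>mi (n + k). f a) = (\<Sum>x\<in>mi n. \<Sum>y\<in>mi k. f (x @ y))"
proof -
  have "bij_betw (\<lambda>(x, y). x @ y) (mi n \<times> mi k) (mi (n + k))"
    by (rule bij_betw_byWitness[where f' = "\<lambda>a. (take n a, drop n a)"])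
      (auto dest!: set_take_subset[THEN subsetD] set_drop_subset[THEN subsetD])
  from sum.reindex_bij_betw[OF this, of f] show ?thesis
    by (simp add: sum.cartesian_product split_def)
qed

lemma sum_mi_Suc: "(\<Sum>a\<in>mi (Suc n). f a) = (\<Sum>x\<in>I. \<Sum>y\<in>mi n. f (x # y))"
proof -
  have "bij_betw (\<lambda>(x, y). x # y) (I \<times> mi n) (mi (Suc n))"
    by (rule bij_betw_byWitness[where f' = "\<lambda>a. (hd a, tl a)"]) (auto simp: length_Suc_conv subset_iff)
  from sum.reindex_bij_betw[OF this, of f] show ?thesis
    by (simp add: sum.cartesian_product split_def)
qed

lemma dg_closed [simp]: "set x \<subseteq> I \<Longrightarrow> dg x \<in> carrier G"
  by (induction x) (auto simp: dg1_closed)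

lemma dg_append [simp]: "set x \<subseteq> I \<Longrightarrow> set y \<subseteq> I \<Longrightarrow> dg (x @ y) = dg y \<otimes> dg x"
  by (induction x) (auto simp: dg1_closed m_assoc)

lemma st_length [simp]: "length (st x) = length x"
  by (simp add: st_def)

lemma st_closed [simp]: "set x \<subseteq> I \<Longrightarrow> set (st x) \<subseteq> I"
  by (auto simp: st_def st1_closed)

lemma st_append [simp]: "st (x @ y) = st y @ st x"
  by (simp add: st_def)

lemma st_st [simp]: "set x \<subseteq> I \<Longrightarrow> st (st x) = x"
  unfolding st_def rev_map[symmetric] rev_rev_ident map_map comp_def
  by (rule map_idI) (auto simp: st1_st1)

lemma st_eq_iff: "set x \<subseteq> I \<Longrightarrow> set y \<subseteq> I \<Longrightarrow> st x = st y \<longleftrightarrow> x = y"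
  using st_st by metis

lemma dg_st [simp]: "set x \<subseteq> I \<Longrightarrow> dg (st x) = inv dg x"
proof (induction x)
  case (Cons a x)
  have "st (a # x) = st x @ [st1 a]" by (simp add: st_def)
  then show ?case using Cons by (simp add: st1_closed dg1_closed dg1_st1 inv_mult_group)
qed (simp add: st_def)

lemma sum_mi_st: "(\<Sum>x\<in>mi n. f (st x)) = (\<Sum>x\<in>mi n. f x)"
  by (rule sum.reindex_bij_witness[where i = st and j = st]) auto

lemma rho_append [simp]: "length u = length x \<Longrightarrow> rho g (u @ v) (x @ y) = rho g u x * rho g v y"
  by (induction u x rule: list_induct2) auto

lemma rho_one [simp]:
  "set x \<subseteq> I \<Longrightarrow> set y \<subseteq> I \<Longrightarrow> length y = length x \<Longrightarrow> rho \<one> y x = (if y = x then 1 else 0)"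
proof (induction x arbitrary: y)
  case (Cons a x)
  then show ?case by (cases y) (auto simp: rho1_one)
qed simp

lemma rho_mult:
  assumes "g \<in> carrier G" "h \<in> carrier G"
  shows "set x \<subseteq> I \<Longrightarrow> set y \<subseteq> I \<Longrightarrow> length x = n \<Longrightarrow> length y = n \<Longrightarrow>
    (\<Sum>z\<in>mi n. rho g y z * rho h z x) = rho (g \<otimes> h) y x"
proof (induction n arbitrary: x y)
  case (Suc n)
  then obtain a x' b y' where [simp]: "x = a # x'" "y = b # y'" by (auto simp: length_Suc_conv)
  have "(\<Sum>z\<in>mi (Suc n). rho g y z * rho h z x)
      = (\<Sum>z\<in>I. \<Sum>z'\<in>mi n. (rho1 g b z * rho1 h z a) * (rho g y' z' * rho h z' x'))"
    by (simp add: sum_mi_Suc mult_ac)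
  also have "\<dots> = (\<Sum>z\<in>I. rho1 g b z * rho1 h z a) * (\<Sum>z'\<in>mi n. rho g y' z' * rho h z' x')"
    by (simp add: sum_product)
  also have "\<dots> = rho (g \<otimes> h) y x" using Suc by (simp add: rho1_mult assms)
  finally show ?case .
qed simp

lemma rho_inv:
  "g \<in> carrier G \<Longrightarrow> set x \<subseteq> I \<Longrightarrow> set y \<subseteq> I \<Longrightarrow> rho (inv g) x y = rho g y x"
  by (induction g y x rule: rho.induct) (auto simp: rho1_inv)

lemma conj_mult: "a \<in> carrier G \<Longrightarrow> b \<in> carrier G \<Longrightarrow> g \<in> carrier G \<Longrightarrow>
    (g \<otimes> a \<otimes> inv g) \<otimes> (g \<otimes> b \<otimes> inv g) = g \<otimes> (a \<otimes> b) \<otimes> inv g"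
  by (metis inv_closed inv_solve_left' m_assoc m_closed)

lemma conj_inv: "a \<in> carrier G \<Longrightarrow> g \<in> carrier G \<Longrightarrow> inv (g \<otimes> a \<otimes> inv g) = g \<otimes> inv a \<otimes> inv g"
  by (simp add: inv_mult_group m_assoc)

lemma rho_deg:
  "g \<in> carrier G \<Longrightarrow> set x \<subseteq> I \<Longrightarrow> set y \<subseteq> I \<Longrightarrow> rho g y x \<noteq> 0 \<Longrightarrow> dg y = g \<otimes> dg x \<otimes> inv g"
proof (induction g y x rule: rho.induct)
  case (2 g y ys x xs)
  have c: "dg1 x \<in> carrier G" "dg xs \<in> carrier G" using 2 by (auto simp: dg1_closed)
  have "dg ys = g \<otimes> dg xs \<otimes> inv g" "dg1 y = g \<otimes> dg1 x \<otimes> inv g"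
    using 2 rho1_deg[of g x y] by auto
  then show ?case using conj_mult[OF c(2,1)] 2 by simp
qed auto

lemma rho_st1: "g \<in> carrier G \<Longrightarrow> set x \<subseteq> I \<Longrightarrow> set y \<subseteq> I \<Longrightarrow> length y = length x \<Longrightarrow>
    rho g (map st1 y) (map st1 x) = rho g y x"
proof (induction x arbitrary: y)
  case (Cons a x)
  then show ?case by (cases y) (auto simp: rho1_st1)
qed simp

lemma rho_rev: "length y = length x \<Longrightarrow> rho g (rev y) (rev x) = rho g y x"
proof (induction x arbitrary: y)
  case (Cons a x)
  then show ?case by (cases y) auto
qed simp

lemma rho_st [simp]: "g \<in> carrier G \<Longrightarrow> set x \<subseteq> I \<Longrightarrow> set y \<subseteq> I \<Longrightarrow> length y = length x \<Longrightarrow>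
    rho g (st y) (st x) = rho g y x"
  by (simp add: st_def rho_rev rho_st1)

lemma rho_orth:
  assumes "g \<in> carrier G" "set x \<subseteq> I" "set y \<subseteq> I" "length x = n" "length y = n"
  shows "(\<Sum>z\<in>mi n. rho g z y * rho g z x) = (if y = x then 1 else 0)"
    and "(\<Sum>z\<in>mi n. rho g y z * rho g x z) = (if y = x then 1 else 0)"
proof -
  have "(\<Sum>z\<in>mi n. rho g z y * rho g z x) = (\<Sum>z\<in>mi n. rho (inv g) y z * rho g z x)"
    by (rule sum.cong) (use assms in \<open>auto simp: rho_inv\<close>)
  then show "(\<Sum>z\<in>mi n. rho g z y * rho g z x) = (if y = x then 1 else 0)"
    using assms by (simp add: rho_mult)
  have "(\<Sum>z\<in>mi n. rho g y z * rho g x z) = (\<Sum>z\<in>mi n. rho g y z * rho (inv g) z x)"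
    by (rule sum.cong) (use assms in \<open>auto simp: rho_inv\<close>)
  then show "(\<Sum>z\<in>mi n. rho g y z * rho g x z) = (if y = x then 1 else 0)"
    using assms by (simp add: rho_mult)
qed

section \<open>Words as pairs of index words, with left, right and diagonal actions\<close>

definition X :: "('a \<times> 'a) list set" where "X = lists (I \<times> I)"

definition wl :: "('a \<times> 'a) list \<Rightarrow> 'a list" where "wl u = map fst u"
definition wr :: "('a \<times> 'a) list \<Rightarrow> 'a list" where "wr u = map snd u"

lemma wl_zip [simp]: "length x = length y \<Longrightarrow> wl (zip x y) = x"
  and wr_zip [simp]: "length x = length y \<Longrightarrow> wr (zip x y) = y"
  by (simp_all add: wl_def wr_def)

lemma wl_append [simp]: "wl (u @ v) = wl u @ wl v" and wr_append [simp]: "wr (u @ v) = wr u @ wr v"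
  by (simp_all add: wl_def wr_def)

lemma wl_length [simp]: "length (wl u) = length u" and wr_length [simp]: "length (wr u) = length u"
  by (simp_all add: wl_def wr_def)

lemma wl_nil [simp]: "wl [] = []" and wr_nil [simp]: "wr [] = []"
  by (simp_all add: wl_def wr_def)

lemma zip_wl_wr [simp]: "zip (wl u) (wr u) = u"
  by (simp add: wl_def wr_def zip_map_fst_snd)

lemma wl_set [simp]: "u \<in> X \<Longrightarrow> set (wl u) \<subseteq> I" and wr_set [simp]: "u \<in> X \<Longrightarrow> set (wr u) \<subseteq> I"
  by (auto simp: X_def wl_def wr_def in_lists_conv_set)

lemma zip_X [simp]: "set x \<subseteq> I \<Longrightarrow> set y \<subseteq> I \<Longrightarrow> zip x y \<in> X"
  by (auto simp: X_def in_lists_conv_set) (meson set_zip_leftD set_zip_rightD subsetD)+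

lemma X_append [simp]: "u @ v \<in> X \<longleftrightarrow> u \<in> X \<and> v \<in> X" and X_nil [simp]: "[] \<in> X"
  by (auto simp: X_def)

lemma XE:
  assumes "u \<in> X"
  obtains x y where "set x \<subseteq> I" "set y \<subseteq> I" "length x = length y" "u = zip x y"
  using assms that[of "wl u" "wr u"] by simp

text \<open>The degree that a word acquires for the twisted product. It is multiplicative for
  \<open>tm\<close> (see \<open>tm_deg\<close>), while the degree that is multiplicative for
  concatenation is \<open>degw\<close>.\<close>

definition ad :: "('a \<times> 'a) list \<Rightarrow> 'g" where "ad u = dg (wl u) \<otimes> inv dg (wr u)"

definition Lw :: "'g \<Rightarrow> ('a \<times> 'a) list \<Rightarrow> (('a \<times> 'a) list \<Rightarrow>\<^sub>0 complex)" where
  "Lw g u = (\<Sum>v\<in>mi (length u). csmul (rho g v (wl u)) (basis (zip v (wr u))))"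

definition Rw :: "'g \<Rightarrow> ('a \<times> 'a) list \<Rightarrow> (('a \<times> 'a) list \<Rightarrow>\<^sub>0 complex)" where
  "Rw g u = (\<Sum>v\<in>mi (length u). csmul (rho g v (wr u)) (basis (zip (wl u) v)))"

text \<open>Both indices are moved by the same matrices \<open>rho\<close>, although the right one
  stands for a dual basis vector: in an orthonormal basis the contragredient representation has the
  same matrices.\<close>

definition Aw :: "'g \<Rightarrow> ('a \<times> 'a) list \<Rightarrow> (('a \<times> 'a) list \<Rightarrow>\<^sub>0 complex)" where
  "Aw g u = lext (Lw g) (Rw g u)"

definition dl :: "('a \<times> 'a) list \<Rightarrow> (('a \<times> 'a) list \<times> ('a \<times> 'a) list \<Rightarrow>\<^sub>0 complex)" where
  "dl u = (\<Sum>z\<in>mi (length u). basis (zip (wl u) z, zip z (wr u)))"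

definition ep :: "('a \<times> 'a) list \<Rightarrow> complex" where
  "ep u = (if wl u = wr u then 1 else 0)"

text \<open>The twisted product \<open>u (|u| \<triangleright> v)\<close>, where \<open>G\<close> acts on the left indices only.\<close>

definition tm :: "('a \<times> 'a) list \<Rightarrow> ('a \<times> 'a) list \<Rightarrow> (('a \<times> 'a) list \<Rightarrow>\<^sub>0 complex)" where
  "tm u v = lmul cm (basis u) (Lw (ad u) v)"

definition Sw :: "('a \<times> 'a) list \<Rightarrow> ('a \<times> 'a) list" where
  "Sw u = zip (st (wr u)) (st (wl u))"

text \<open>The form that the antipode takes after transmutation; on letters it is the prescribed
  map \<open>SL\<close> (see \<open>SL_sB\<close>).\<close>

definition sB :: "('a \<times> 'a) list \<Rightarrow> (('a \<times> 'a) list \<Rightarrow>\<^sub>0 complex)" where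
  "sB u = Lw (ad u) (Sw u)"

lemma ceval_Lw: "length x = length y \<Longrightarrow>
    ceval f (Lw g (zip x y)) = (\<Sum>v\<in>mi (length x). rho g v x * f (zip v y))"
  by (simp add: Lw_def ceval_linear)

lemma ceval_Rw: "length x = length y \<Longrightarrow>
    ceval f (Rw g (zip x y)) = (\<Sum>v\<in>mi (length x). rho g v y * f (zip x v))"
  by (simp add: Rw_def ceval_linear)

lemma ceval_Aw: "length x = length y \<Longrightarrow>
    ceval f (Aw g (zip x y)) = (\<Sum>w\<in>mi (length x). \<Sum>v\<in>mi (length x). rho g w y * rho g v x * f (zip v w))"
  by (simp add: Aw_def ceval_lext ceval_Rw ceval_Lw sum_distrib_left mult.assoc)

lemma ceval_dl: "length x = length y \<Longrightarrow>
    ceval f (dl (zip x y)) = (\<Sum>z\<in>mi (length x). f (zip x z, zip z y))"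
  by (simp add: dl_def ceval_linear)

lemma ep_zip [simp]: "length x = length y \<Longrightarrow> ep (zip x y) = (if x = y then 1 else 0)"
  by (simp add: ep_def)

lemma ad_zip [simp]: "length x = length y \<Longrightarrow> ad (zip x y) = dg x \<otimes> inv dg y"
  by (simp add: ad_def)

lemma ad_closed [simp]: "u \<in> X \<Longrightarrow> ad u \<in> carrier G"
  by (simp add: ad_def)

lemma ad_nil [simp]: "ad [] = \<one>" by (simp add: ad_def)

lemma Lw_closed: assumes "g \<in> carrier G" "u \<in> X"
  shows "Lw g u \<in> psp {v \<in> X. dg (wl v) = g \<otimes> dg (wl u) \<otimes> inv g \<and> wr v = wr u}"
  unfolding Lw_def
proof (rule psp_sum)
  fix v assume v: "v \<in> mi (length u)"
  show "csmul (rho g v (wl u)) (basis (zip v (wr u)))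
      \<in> psp {v \<in> X. dg (wl v) = g \<otimes> dg (wl u) \<otimes> inv g \<and> wr v = wr u}"
    using rho_deg[OF assms(1), of "wl u" v] v assms
    by (cases "rho g v (wl u) = 0") (auto intro!: psp_csmul)
qed

lemma Rw_closed: assumes "g \<in> carrier G" "u \<in> X"
  shows "Rw g u \<in> psp {v \<in> X. dg (wr v) = g \<otimes> dg (wr u) \<otimes> inv g \<and> wl v = wl u}"
  unfolding Rw_def
proof (rule psp_sum)
  fix v assume v: "v \<in> mi (length u)"
  show "csmul (rho g v (wr u)) (basis (zip (wl u) v))
      \<in> psp {v \<in> X. dg (wr v) = g \<otimes> dg (wr u) \<otimes> inv g \<and> wl v = wl u}"
    using rho_deg[OF assms(1), of "wr u" v] v assms
    by (cases "rho g v (wr u) = 0") (auto intro!: psp_csmul)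
qed

lemma Lw_psp: "g \<in> carrier G \<Longrightarrow> u \<in> X \<Longrightarrow> Lw g u \<in> psp X"
  by (rule psp_mono[OF Lw_closed]) auto
lemma Rw_psp: "g \<in> carrier G \<Longrightarrow> u \<in> X \<Longrightarrow> Rw g u \<in> psp X"
  by (rule psp_mono[OF Rw_closed]) auto

lemma lLw_psp: "g \<in> carrier G \<Longrightarrow> p \<in> psp X \<Longrightarrow> lext (Lw g) p \<in> psp X"
  by (rule psp_lext) (auto simp: Lw_psp)
lemma lRw_psp: "g \<in> carrier G \<Longrightarrow> p \<in> psp X \<Longrightarrow> lext (Rw g) p \<in> psp X"
  by (rule psp_lext) (auto simp: Rw_psp)

lemma Aw_closed: assumes "g \<in> carrier G" "u \<in> X"
  shows "Aw g u \<in> psp {v \<in> X. ad v = g \<otimes> ad u \<otimes> inv g}"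
  unfolding Aw_def
proof (rule psp_lext[OF Rw_closed[OF assms]])
  fix v assume "v \<in> {v \<in> X. dg (wr v) = g \<otimes> dg (wr u) \<otimes> inv g \<and> wl v = wl u}"
  then have v: "v \<in> X" "dg (wr v) = g \<otimes> dg (wr u) \<otimes> inv g" "wl v = wl u" by auto
  show "Lw g v \<in> psp {v \<in> X. ad v = g \<otimes> ad u \<otimes> inv g}"
    by (rule psp_mono[OF Lw_closed[OF assms(1) v(1)]])
      (use v assms in \<open>auto simp: ad_def conj_inv conj_mult\<close>)
qed

lemma Aw_psp: "g \<in> carrier G \<Longrightarrow> u \<in> X \<Longrightarrow> Aw g u \<in> psp X"
  by (rule psp_mono[OF Aw_closed]) auto

lemma Lw_mult:
  assumes "g \<in> carrier G" "h \<in> carrier G" "u \<in> X"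
  shows "lext (Lw g) (Lw h u) = Lw (g \<otimes> h) u"
proof (rule ceval_ext)
  fix f
  from assms(3) obtain x y where [simp]: "set x \<subseteq> I" "set y \<subseteq> I" "length x = length y" "u = zip x y"
    by (rule XE)
  have "ceval f (lext (Lw g) (Lw h u)) = (\<Sum>v\<in>mi (length y). \<Sum>w\<in>mi (length y). rho h v x * (rho g w v * f (zip w y)))"
    by (simp add: ceval_lext ceval_Lw sum_distrib_left)
  also have "\<dots> = (\<Sum>w\<in>mi (length y). (\<Sum>v\<in>mi (length y). rho g w v * rho h v x) * f (zip w y))"
    by (subst sum.swap) (simp add: sum_distrib_left mult_ac)
  also have "\<dots> = ceval f (Lw (g \<otimes> h) u)"
    by (simp add: rho_mult assms ceval_Lw)
  finally show "ceval f (lext (Lw g) (Lw h u)) = ceval f (Lw (g \<otimes> h) u)" .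
qed

lemma Rw_mult:
  assumes "g \<in> carrier G" "h \<in> carrier G" "u \<in> X"
  shows "lext (Rw g) (Rw h u) = Rw (g \<otimes> h) u"
proof (rule ceval_ext)
  fix f
  from assms(3) obtain x y where [simp]: "set x \<subseteq> I" "set y \<subseteq> I" "length x = length y" "u = zip x y"
    by (rule XE)
  have "ceval f (lext (Rw g) (Rw h u)) = (\<Sum>v\<in>mi (length y). \<Sum>w\<in>mi (length y). rho h v y * (rho g w v * f (zip x w)))"
    by (simp add: ceval_lext ceval_Rw sum_distrib_left)
  also have "\<dots> = (\<Sum>w\<in>mi (length y). (\<Sum>v\<in>mi (length y). rho g w v * rho h v y) * f (zip x w))"
    by (subst sum.swap) (simp add: sum_distrib_left mult_ac)
  also have "\<dots> = ceval f (Rw (g \<otimes> h) u)"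
    by (simp add: rho_mult assms ceval_Rw)
  finally show "ceval f (lext (Rw g) (Rw h u)) = ceval f (Rw (g \<otimes> h) u)" .
qed

lemma Lw_Rw: assumes "u \<in> X" shows "lext (Lw g) (Rw h u) = lext (Rw h) (Lw g u)"
proof (rule ceval_ext)
  fix f
  from assms obtain x y where [simp]: "set x \<subseteq> I" "set y \<subseteq> I" "length x = length y" "u = zip x y"
    by (rule XE)
  show "ceval f (lext (Lw g) (Rw h u)) = ceval f (lext (Rw h) (Lw g u))"
    by (simp add: ceval_lext ceval_Lw ceval_Rw sum_distrib_left mult_ac) (rule sum.swap)
qed

lemma Lw_one: assumes "u \<in> X" shows "Lw \<one> u = basis u"
proof (rule ceval_ext)
  fix f
  from assms obtain x y where [simp]: "set x \<subseteq> I" "set y \<subseteq> I" "length x = length y" "u = zip x y"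
    by (rule XE)
  have "(\<Sum>v\<in>mi (length y). rho \<one> v x * f (zip v y)) = (\<Sum>v\<in>mi (length y). if v = x then f (zip v y) else 0)"
    by (rule sum.cong) auto
  then show "ceval f (Lw \<one> u) = ceval f (basis u)" by (simp add: ceval_Lw)
qed

lemma Rw_one: assumes "u \<in> X" shows "Rw \<one> u = basis u"
proof (rule ceval_ext)
  fix f
  from assms obtain x y where [simp]: "set x \<subseteq> I" "set y \<subseteq> I" "length x = length y" "u = zip x y"
    by (rule XE)
  have "(\<Sum>v\<in>mi (length y). rho \<one> v y * f (zip x v)) = (\<Sum>v\<in>mi (length y). if v = y then f (zip x v) else 0)"
    by (rule sum.cong) auto
  then show "ceval f (Rw \<one> u) = ceval f (basis u)" by (simp add: ceval_Rw)
qed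

lemma Lw_append: assumes "u \<in> X" "v \<in> X" shows "Lw g (u @ v) = lmul cm (Lw g u) (Lw g v)"
proof (rule ceval_ext)
  fix f
  from assms(1) obtain x y where [simp]: "set x \<subseteq> I" "set y \<subseteq> I" "length x = length y" "u = zip x y"
    by (rule XE)
  from assms(2) obtain z w where [simp]: "set z \<subseteq> I" "set w \<subseteq> I" "length z = length w" "v = zip z w"
    by (rule XE)
  show "ceval f (Lw g (u @ v)) = ceval f (lmul cm (Lw g u) (Lw g v))"
    by (simp add: zip_append[symmetric] ceval_Lw ceval_lmul cm_def sum_mi_append sum_distrib_left mult_ac del: zip_append)
qed

lemma Rw_append: assumes "u \<in> X" "v \<in> X" shows "Rw g (u @ v) = lmul cm (Rw g u) (Rw g v)"
proof (rule ceval_ext)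
  fix f
  from assms(1) obtain x y where [simp]: "set x \<subseteq> I" "set y \<subseteq> I" "length x = length y" "u = zip x y"
    by (rule XE)
  from assms(2) obtain z w where [simp]: "set z \<subseteq> I" "set w \<subseteq> I" "length z = length w" "v = zip z w"
    by (rule XE)
  show "ceval f (Rw g (u @ v)) = ceval f (lmul cm (Rw g u) (Rw g v))"
    by (simp add: zip_append[symmetric] ceval_Rw ceval_lmul cm_def sum_mi_append sum_distrib_left mult_ac del: zip_append)
qed

lemma inv_cancel [simp]: "a \<in> carrier G \<Longrightarrow> b \<in> carrier G \<Longrightarrow> a \<otimes> (inv a \<otimes> b) = b"
  "a \<in> carrier G \<Longrightarrow> b \<in> carrier G \<Longrightarrow> inv a \<otimes> (a \<otimes> b) = b"
  by (simp_all add: m_assoc[symmetric])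

lemma lmul_cm_assoc: "lmul cm p (lmul cm q s) = lmul cm (lmul cm p q) s"
  by (simp add: lmul_def cm_def lext_lext)

lemma lLw_lmul:
  assumes "p \<in> psp X" "q \<in> psp X"
  shows "lext (Lw g) (lmul cm p q) = lmul cm (lext (Lw g) p) (lext (Lw g) q)"
  unfolding lext_lmul lmul_lext_left lmul_lext_right lext_swap[of _ p q]
  by (intro lext_psp_cong[OF assms(1)] lext_psp_cong[OF assms(2)]) (simp add: cm_def Lw_append)

lemma lRw_lmul:
  assumes "p \<in> psp X" "q \<in> psp X"
  shows "lext (Rw g) (lmul cm p q) = lmul cm (lext (Rw g) p) (lext (Rw g) q)"
  unfolding lext_lmul lmul_lext_left lmul_lext_right lext_swap[of _ p q]
  by (intro lext_psp_cong[OF assms(1)] lext_psp_cong[OF assms(2)]) (simp add: cm_def Rw_append)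

lemma lAw: "lext (Aw g) p = lext (Lw g) (lext (Rw g) p)"
  by (simp add: Aw_def[abs_def] lext_lext)

lemma lLw_mult: "g \<in> carrier G \<Longrightarrow> h \<in> carrier G \<Longrightarrow> p \<in> psp X \<Longrightarrow>
    lext (Lw g) (lext (Lw h) p) = lext (Lw (g \<otimes> h)) p"
  unfolding lext_lext by (rule lext_psp_cong) (auto simp: Lw_mult)

lemma lLw_lRw: "p \<in> psp X \<Longrightarrow> lext (Lw g) (lext (Rw h) p) = lext (Rw h) (lext (Lw g) p)"
  unfolding lext_lext by (rule lext_psp_cong) (auto simp: Lw_Rw)

lemma lLw_one: "p \<in> psp X \<Longrightarrow> lext (Lw \<one>) p = p"
  using lext_psp_cong[of p X "Lw \<one>" basis] by (simp add: Lw_one)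

section \<open>The twisted product\<close>

lemma cm_X: "u \<in> X \<Longrightarrow> v \<in> X \<Longrightarrow> cm u v \<in> psp X"
  by (simp add: cm_def)

lemma lcm_psp: "p \<in> psp X \<Longrightarrow> q \<in> psp X \<Longrightarrow> lmul cm p q \<in> psp X"
  by (rule lmul_closed[OF cm_X])

text \<open>The twist conjugates the left degree of \<open>v\<close> by \<open>ad u\<close>. In the
  degree of the product the factor \<open>inv ad u\<close> meets \<open>dg (wl u)\<close> and leaves
  \<open>dg (wr u)\<close>, which cancels against the right degree of \<open>u\<close>; this undoes
  the reversed order in \<open>dg\<close>.\<close>

lemma tm_deg: assumes "u \<in> X" "v \<in> X" shows "tm u v \<in> psp {w \<in> X. ad w = ad u \<otimes> ad v}"
  unfolding tm_def
proof (rule lmul_closed[of "{u}"])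
  have "ad u \<in> carrier G" by (simp add: assms)
  then show "Lw (ad u) v \<in> psp {w \<in> X. dg (wl w) = ad u \<otimes> dg (wl v) \<otimes> inv ad u \<and> wr w = wr v}"
    using assms by (rule_tac Lw_closed)
  fix u' w assume u': "u' \<in> {u}" and w: "w \<in> {w \<in> X. dg (wl w) = ad u \<otimes> dg (wl v) \<otimes> inv ad u \<and> wr w = wr v}"
  have c: "dg (wl u) \<in> carrier G" "dg (wr u) \<in> carrier G" "dg (wl v) \<in> carrier G" "dg (wr v) \<in> carrier G"
    using assms by simp_all
  have "ad (u @ w) = ad u \<otimes> dg (wl v) \<otimes> inv ad u \<otimes> dg (wl u) \<otimes> inv (dg (wr v) \<otimes> dg (wr u))"
    using w assms by (simp add: ad_def)
  also have "\<dots> = ad u \<otimes> ad v"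
    using c by (simp add: ad_def inv_mult_group m_assoc)
  finally show "cm u' w \<in> psp {w \<in> X. ad w = ad u \<otimes> ad v}"
    using u' w assms by (simp add: cm_def)
qed simp

lemma tm_psp: "u \<in> X \<Longrightarrow> v \<in> X \<Longrightarrow> tm u v \<in> psp X"
  by (rule psp_mono[OF tm_deg]) auto

lemma ltm_psp: "p \<in> psp X \<Longrightarrow> q \<in> psp X \<Longrightarrow> lmul tm p q \<in> psp X"
  by (rule lmul_closed[OF tm_psp])

lemma tm_nil: "u \<in> X \<Longrightarrow> tm [] u = basis u" "tm u [] = basis u"
proof -
  show "tm [] u = basis u" if "u \<in> X"
    using that by (simp add: tm_def Lw_one lmul_def cm_def)
  have "Lw g [] = basis []" for g by (simp add: Lw_def)
  then show "tm u [] = basis u" by (simp add: tm_def)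
qed

text \<open>All words in a homogeneous left factor twist the right factor by the same group element.
  General products are split into such ones by \<open>sum_hpart\<close>.\<close>

lemma ltm_homogeneous:
  assumes "p \<in> psp {u \<in> X. ad u = g}" "q \<in> psp X"
  shows "lmul tm p q = lmul cm p (lext (Lw g) q)"
proof -
  have "lmul tm p q = lext (\<lambda>u. lmul cm (basis u) (lext (Lw (ad u)) q)) p"
    by (simp add: lmul_def[of tm] tm_def lmul_lext_right)
  also have "\<dots> = lext (\<lambda>u. lmul cm (basis u) (lext (Lw g) q)) p"
    by (rule lext_psp_cong[OF assms(1)]) auto
  finally show ?thesis by (simp add: lmul_alt[of cm p])
qed

lemma ltm_basis: "q \<in> psp X \<Longrightarrow> u \<in> X \<Longrightarrow> lmul tm (basis u) q = lmul cm (basis u) (lext (Lw (ad u)) q)"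
  by (rule ltm_homogeneous) auto

text \<open>Both bracketings give \<open>u\<close>, followed by \<open>v\<close> moved by
  \<open>|u|\<close>, followed by \<open>w\<close> moved by \<open>|u||v|\<close>: the degree is
  multiplicative for \<open>tm\<close>, and left actions are algebra maps for concatenation.\<close>

lemma tm_assoc:
  assumes "u \<in> X" "v \<in> X" "w \<in> X"
  shows "lmul tm (tm u v) (basis w) = lmul tm (basis u) (tm v w)"
proof -
  have c: "ad u \<in> carrier G" "ad v \<in> carrier G" using assms by simp_all
  have "lmul tm (tm u v) (basis w) = lmul cm (tm u v) (Lw (ad u \<otimes> ad v) w)"
    using ltm_homogeneous[OF tm_deg[OF assms(1,2)], of "basis w"] assms by simp
  also have "\<dots> = lmul cm (basis u) (lmul cm (Lw (ad u) v) (lext (Lw (ad u)) (Lw (ad v) w)))"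
    using assms c by (simp add: tm_def lmul_cm_assoc Lw_mult)
  also have "\<dots> = lmul cm (basis u) (lext (Lw (ad u)) (tm v w))"
    using assms c by (simp add: tm_def[of v] lLw_lmul Lw_psp)
  also have "\<dots> = lmul tm (basis u) (tm v w)"
    using assms by (simp add: ltm_basis tm_psp)
  finally show ?thesis .
qed

lemma Aw_one: "w \<in> X \<Longrightarrow> Aw \<one> w = basis w"
  by (simp add: Aw_def Rw_one Lw_one)

lemma Aw_mult:
  assumes "g \<in> carrier G" "h \<in> carrier G" "w \<in> X"
  shows "Aw (g \<otimes> h) w = lext (Aw g) (Aw h w)"
  using assms
  by (simp add: lAw Aw_def lLw_lRw[symmetric] Rw_psp lLw_psp Rw_mult lLw_mult lRw_psp)

lemma Aw_nil: "Aw g [] = basis []"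
  by (simp add: Aw_def Rw_def Lw_def)

lemma lAw_psp: "g \<in> carrier G \<Longrightarrow> p \<in> psp X \<Longrightarrow> lext (Aw g) p \<in> psp X"
  by (rule psp_lext) (auto intro: Aw_psp)

lemma lAw_lmul: "g \<in> carrier G \<Longrightarrow> p \<in> psp X \<Longrightarrow> q \<in> psp X \<Longrightarrow>
    lext (Aw g) (lmul cm p q) = lmul cm (lext (Aw g) p) (lext (Aw g) q)"
  by (simp add: lAw lRw_lmul lLw_lmul lRw_psp)

text \<open>Acting by \<open>g\<close> after the left action of \<open>|u|\<close> is the left
  action of \<open>g |u| g^-1\<close> after acting by \<open>g\<close>, and this conjugate is the
  degree of every term of \<open>Aw g u\<close>.\<close>

lemma Aw_tm:
  assumes "g \<in> carrier G" "u \<in> X" "v \<in> X"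
  shows "lext (Aw g) (tm u v) = lmul tm (Aw g u) (Aw g v)"
proof -
  let ?h = "ad u"
  have h: "?h \<in> carrier G" using assms by simp
  have "lext (Aw g) (tm u v) = lmul cm (Aw g u) (lext (Aw g) (Lw ?h v))"
    using assms h by (simp add: tm_def lAw_lmul Lw_psp)
  also have "lext (Aw g) (Lw ?h v) = lext (Lw (g \<otimes> ?h)) (Rw g v)"
    using assms h by (simp add: lAw Lw_Rw[symmetric] lLw_mult Rw_psp)
  also have "\<dots> = lext (Lw (g \<otimes> ?h \<otimes> inv g)) (Aw g v)"
    using assms h by (simp add: Aw_def lLw_mult Rw_psp m_assoc)
  also have "lmul cm (Aw g u) \<dots> = lmul tm (Aw g u) (Aw g v)"
    using assms by (intro ltm_homogeneous[symmetric] Aw_closed Aw_psp)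
  finally show ?thesis .
qed

section \<open>The matrix coproduct on words\<close>

lemma dl_closed: assumes "w \<in> X" shows "dl w \<in> psp {(u, v). u \<in> X \<and> v \<in> X \<and> ad u \<otimes> ad v = ad w}"
  unfolding dl_def
proof (rule psp_sum)
  fix z assume "z \<in> mi (length w)"
  moreover have "dg (wl w) \<otimes> inv dg z \<otimes> (dg z \<otimes> inv dg (wr w)) = dg (wl w) \<otimes> inv dg (wr w)" if "set z \<subseteq> I"
    using that assms by (simp add: m_assoc)
  ultimately show "basis (zip (wl w) z, zip z (wr w)) \<in> psp {(u, v). u \<in> X \<and> v \<in> X \<and> ad u \<otimes> ad v = ad w}"
    using assms by (simp add: ad_def)
qed

lemma dl_psp: "w \<in> X \<Longrightarrow> dl w \<in> psp (X \<times> X)"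
  by (rule psp_mono[OF dl_closed]) auto

lemma dl_coassoc: assumes "w \<in> X"
  shows "lext (\<lambda>(u, v). lext (\<lambda>(s, t). basis (s, t, v)) (dl u)) (dl w)
        = lext (\<lambda>(u, v). lext (\<lambda>(s, t). basis (u, s, t)) (dl v)) (dl w)"
proof (rule ceval_ext)
  fix f
  from assms obtain x y where [simp]: "set x \<subseteq> I" "set y \<subseteq> I" "length x = length y" "w = zip x y"
    by (rule XE)
  show "ceval f (lext (\<lambda>(u, v). lext (\<lambda>(s, t). basis (s, t, v)) (dl u)) (dl w))
        = ceval f (lext (\<lambda>(u, v). lext (\<lambda>(s, t). basis (u, s, t)) (dl v)) (dl w))"
    by (simp add: ceval_lext ceval_dl split_def) (rule sum.swap)
qed

lemma sum_if_eq: "x \<in> mi n \<Longrightarrow> (\<Sum>z\<in>mi n. (if z = x then 1 else 0) * f z) = (f x :: complex)"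
  "x \<in> mi n \<Longrightarrow> (\<Sum>z\<in>mi n. (if x = z then 1 else 0) * f z) = (f x :: complex)"
  by (simp_all add: if_distrib[of "\<lambda>c. c * _"] sum.delta sum.delta' cong: if_cong del: mi_iff)

lemma dl_counit: assumes "w \<in> X"
  shows "lext (\<lambda>(u, v). csmul (ep u) (basis v)) (dl w) = basis w"
    and "lext (\<lambda>(u, v). csmul (ep v) (basis u)) (dl w) = basis w"
proof -
  from assms obtain x y where [simp]: "set x \<subseteq> I" "set y \<subseteq> I" "length x = length y" "w = zip x y"
    by (rule XE)
  show "lext (\<lambda>(u, v). csmul (ep u) (basis v)) (dl w) = basis w"
    using sum_if_eq(2)[of x "length y"]
    by (intro ceval_ext) (simp add: ceval_lext ceval_dl split_def ceval_csmul)
  show "lext (\<lambda>(u, v). csmul (ep v) (basis u)) (dl w) = basis w"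
    using sum_if_eq(1)[of y "length y"]
    by (intro ceval_ext) (simp add: ceval_lext ceval_dl split_def ceval_csmul)
qed

lemma dl_append: assumes "u \<in> X" "v \<in> X"
  shows "dl (u @ v) = lext (\<lambda>((a1, a2), (b1, b2)). pairs (cm a1 b1) (cm a2 b2)) (pairs (dl u) (dl v))"
proof (rule ceval_ext)
  fix f
  from assms(1) obtain x y where [simp]: "set x \<subseteq> I" "set y \<subseteq> I" "length x = length y" "u = zip x y"
    by (rule XE)
  from assms(2) obtain z w where [simp]: "set z \<subseteq> I" "set w \<subseteq> I" "length z = length w" "v = zip z w"
    by (rule XE)
  show "ceval f (dl (u @ v)) = ceval f (lext (\<lambda>((a1, a2), (b1, b2)). pairs (cm a1 b1) (cm a2 b2)) (pairs (dl u) (dl v)))"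
    by (simp add: zip_append[symmetric] ceval_dl ceval_lext ceval_pairs split_def cm_def sum_mi_append del: zip_append)
qed

lemma ep_append: "u \<in> X \<Longrightarrow> v \<in> X \<Longrightarrow> ep (u @ v) = ep u * ep v"
  by (simp add: ep_def)

lemma Lw_dl: assumes "v \<in> X" shows "lext dl (Lw h v) = lext (\<lambda>(b1, b2). pairs (Lw h b1) (basis b2)) (dl v)"
proof (rule ceval_ext)
  fix f
  from assms obtain z w where [simp]: "set z \<subseteq> I" "set w \<subseteq> I" "length z = length w" "v = zip z w"
    by (rule XE)
  show "ceval f (lext dl (Lw h v)) = ceval f (lext (\<lambda>(b1, b2). pairs (Lw h b1) (basis b2)) (dl v))"
    by (simp add: ceval_dl ceval_lext ceval_pairs ceval_Lw split_def sum_distrib_left) (rule sum.swap)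
qed

text \<open>The same \<open>k\<close> on the two copies of the contracted index cancels by
  orthogonality of \<open>rho\<close>. This invariance is what allows a twist to be moved between
  the two legs of a coproduct.\<close>

lemma Rw_Lw_dl: assumes "v \<in> X" "k \<in> carrier G"
  shows "lext (\<lambda>(b1, b2). pairs (Rw k b1) (Lw k b2)) (dl v) = dl v"
proof (rule ceval_ext)
  fix f
  from assms(1) obtain z w where [simp]: "set z \<subseteq> I" "set w \<subseteq> I" "length z = length w" "v = zip z w"
    by (rule XE)
  let ?M = "mi (length w)"
  have "ceval f (lext (\<lambda>(b1, b2). pairs (Rw k b1) (Lw k b2)) (dl v))
    = (\<Sum>t\<in>?M. \<Sum>a\<in>?M. \<Sum>b\<in>?M. rho k a t * rho k b t * f (zip z a, zip b w))"
    by (simp add: ceval_dl ceval_lext ceval_pairs ceval_Lw ceval_Rw split_def sum_distrib_left mult.assoc)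
  also have "\<dots> = (\<Sum>a\<in>?M. \<Sum>b\<in>?M. \<Sum>t\<in>?M. rho k a t * rho k b t * f (zip z a, zip b w))"
    by (subst sum.swap) (intro sum.cong refl sum.swap)
  also have "\<dots> = (\<Sum>a\<in>?M. \<Sum>b\<in>?M. (\<Sum>t\<in>?M. rho k a t * rho k b t) * f (zip z a, zip b w))"
    by (simp only: sum_distrib_right)
  also have "\<dots> = (\<Sum>a\<in>?M. \<Sum>b\<in>?M. (if a = b then 1 else 0) * f (zip z a, zip b w))"
    by (intro sum.cong refl) (simp add: rho_orth assms)
  also have "\<dots> = (\<Sum>a\<in>?M. f (zip z a, zip a w))"
    by (intro sum.cong refl sum_if_eq(2))
  also have "\<dots> = ceval f (dl v)" by (simp add: ceval_dl)
  finally show "ceval f (lext (\<lambda>(b1, b2). pairs (Rw k b1) (Lw k b2)) (dl v)) = ceval f (dl v)" .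
qed

lemma ceval_cong2: "p \<in> psp (X \<times> X) \<Longrightarrow> (\<And>a b. a \<in> X \<Longrightarrow> b \<in> X \<Longrightarrow> f (a, b) = g (a, b)) \<Longrightarrow> ceval f p = ceval g p"
  by (rule ceval_psp_cong) auto

text \<open>The twist by \<open>|u|\<close> falls on the first leg \<open>b1\<close> of
  \<open>v\<close> only. Since \<open>|u| = |a1| |a2|\<close>, inserting \<open>|a2|\<close> on both
  copies of the contracted index of \<open>v\<close> leaves in the first leg the diagonal action of
  \<open>|a2|\<close> on \<open>b1\<close> twisted by \<open>|a1|\<close>, and puts into the second
  leg the twist by \<open>|a2|\<close> that makes it \<open>tm a2 b2\<close>.\<close>

lemma dl_tm: assumes "u \<in> X" "v \<in> X"
  shows "lext dl (tm u v) = lext (\<lambda>((a1, a2), (b1, b2)). pairs (lmul tm (basis a1) (Aw (ad a2) b1)) (tm a2 b2))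
    (pairs (dl u) (dl v))"
proof (rule ceval_ext)
  fix f :: "('a \<times> 'a) list \<times> ('a \<times> 'a) list \<Rightarrow> complex"
  have h: "ad u \<in> carrier G" using assms by simp
  have "ceval f (lext dl (tm u v)) = ceval (\<lambda>v'. ceval f (dl (u @ v'))) (Lw (ad u) v)"
    by (simp add: tm_def ceval_lext ceval_lmul cm_def)
  also have "\<dots> = ceval (\<lambda>v'. ceval (\<lambda>b. ceval (\<lambda>a. f (fst a @ fst b, snd a @ snd b)) (dl u)) (dl v')) (Lw (ad u) v)"
  proof (rule ceval_psp_cong[OF Lw_psp[OF h assms(2)]])
    fix v' assume v': "v' \<in> X"
    show "ceval f (dl (u @ v')) = ceval (\<lambda>b. ceval (\<lambda>a. f (fst a @ fst b, snd a @ snd b)) (dl u)) (dl v')"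
      by (simp add: dl_append[OF assms(1) v'] ceval_lext ceval_pairs split_def cm_def ceval_swap[of _ "dl v'"])
  qed
  also have "\<dots> = ceval (\<lambda>b. ceval (\<lambda>a. f (fst a @ fst b, snd a @ snd b)) (dl u)) (lext dl (Lw (ad u) v))"
    by (simp add: ceval_lext)
  also have "\<dots> = ceval (\<lambda>b. ceval (\<lambda>b1. ceval (\<lambda>a. f (fst a @ b1, snd a @ snd b)) (dl u)) (Lw (ad u) (fst b))) (dl v)"
    by (simp add: Lw_dl[OF assms(2)] ceval_lext ceval_pairs split_def)
  also have "\<dots> = ceval (\<lambda>b. ceval (\<lambda>a. ceval (\<lambda>b1. f (fst a @ b1, snd a @ snd b)) (Lw (ad u) (fst b))) (dl u)) (dl v)"
    by (intro ceval_cong ceval_swap)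
  also have "\<dots> = ceval (\<lambda>a. ceval (\<lambda>b. ceval (\<lambda>b1. f (fst a @ b1, snd a @ snd b)) (Lw (ad u) (fst b))) (dl v)) (dl u)"
    by (rule ceval_swap)
  also have "\<dots> = ceval (\<lambda>(a1, a2). ceval (\<lambda>(b1, b2). ceval f (pairs (lmul tm (basis a1) (Aw (ad a2) b1)) (tm a2 b2))) (dl v)) (dl u)"
  proof (rule ceval_psp_cong[OF dl_closed[OF assms(1)]], safe)
    fix a1 a2 assume a: "a1 \<in> X" "a2 \<in> X" "ad a1 \<otimes> ad a2 = ad u"
    let ?k = "ad a2"
    let ?F = "\<lambda>(b1, b2). ceval (\<lambda>c. f (a1 @ c, a2 @ b2)) (Lw (ad a1 \<otimes> ?k) b1)"
    have k: "?k \<in> carrier G" "ad a1 \<in> carrier G" using a by simp_all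
    have "ceval (\<lambda>b. ceval (\<lambda>b1. f (fst (a1, a2) @ b1, snd (a1, a2) @ snd b)) (Lw (ad u) (fst b))) (dl v)
       = ceval ?F (dl v)" by (simp add: a split_def)
    also have "\<dots> = ceval ?F (lext (\<lambda>(b1, b2). pairs (Rw ?k b1) (Lw ?k b2)) (dl v))"
      by (simp only: Rw_Lw_dl[OF assms(2) k(1)])
    also have "\<dots> = ceval (\<lambda>(b1, b2). ceval f (pairs (lmul tm (basis a1) (Aw ?k b1)) (tm a2 b2))) (dl v)"
      unfolding ceval_lext
    proof (rule ceval_cong2[OF dl_psp[OF assms(2)]], simp only: prod.case)
      fix b1 b2 assume b: "b1 \<in> X" "b2 \<in> X"
      have e: "lext (Lw (ad a1)) (Aw ?k b1) = lext (Lw (ad a1 \<otimes> ?k)) (Rw ?k b1)"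
        using a b k by (simp add: Aw_def lLw_mult Rw_psp)
      have "ceval f (pairs (lmul tm (basis a1) (Aw ?k b1)) (tm a2 b2))
          = ceval (\<lambda>c. ceval (\<lambda>d. f (a1 @ c, a2 @ d)) (Lw ?k b2)) (lext (Lw (ad a1 \<otimes> ?k)) (Rw ?k b1))"
        using a b k by (simp add: ltm_basis Aw_psp e tm_def ceval_pairs ceval_lmul cm_def)
      also have "\<dots> = ceval ?F (pairs (Rw ?k b1) (Lw ?k b2))"
        by (simp add: ceval_lext ceval_pairs ceval_swap[of _ _ "Lw ?k b2"])
      finally show "ceval ?F (pairs (Rw ?k b1) (Lw ?k b2))
          = ceval f (pairs (lmul tm (basis a1) (Aw ?k b1)) (tm a2 b2))" by simp
    qed
    finally show "ceval (\<lambda>b. ceval (\<lambda>b1. f (fst (a1, a2) @ b1, snd (a1, a2) @ snd b)) (Lw (ad u) (fst b))) (dl v)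
      = ceval (\<lambda>(b1, b2). ceval f (pairs (lmul tm (basis a1) (Aw ?k b1)) (tm a2 b2))) (dl v)" .
  qed
  also have "\<dots> = ceval f (lext (\<lambda>((a1, a2), (b1, b2)). pairs (lmul tm (basis a1) (Aw (ad a2) b1)) (tm a2 b2))
    (pairs (dl u) (dl v)))"
    by (simp add: ceval_lext ceval_pairs split_def)
  finally show "ceval f (lext dl (tm u v)) = \<dots>" .
qed

text \<open>A word with nonzero counit has equal index words and hence degree one, so the twist it
  would cause is trivial.\<close>

lemma ep_tm: assumes "u \<in> X" "v \<in> X" shows "ceval ep (tm u v) = ep u * ep v"
proof -
  have "ceval ep (tm u v) = ceval (\<lambda>v'. ep u * ep v') (Lw (ad u) v)"
    unfolding tm_def ceval_lmul using assms
    by (simp add: cm_def) (rule ceval_psp_cong[of _ X], auto simp: ep_append Lw_psp)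
  also have "\<dots> = ep u * ceval ep (Lw (ad u) v)" by (simp add: ceval_fun_mult)
  also have "\<dots> = ep u * ep v"
  proof (cases "wl u = wr u")
    case True
    then have "ad u = \<one>" using assms by (simp add: ad_def)
    then show ?thesis by (simp add: Lw_one assms)
  qed (simp add: ep_def)
  finally show ?thesis .
qed

lemma ep_Aw: assumes "g \<in> carrier G" "w \<in> X" shows "ceval ep (Aw g w) = ep w"
proof -
  from assms(2) obtain x y where [simp]: "set x \<subseteq> I" "set y \<subseteq> I" "length x = length y" "w = zip x y"
    by (rule XE)
  have "ceval ep (Aw g w) = (\<Sum>a\<in>mi (length y). \<Sum>b\<in>mi (length y). (if b = a then 1 else 0) * (rho g b x * rho g a y))"
    by (simp add: ceval_Aw mult_ac)
  also have "\<dots> = (\<Sum>a\<in>mi (length y). rho g a x * rho g a y)"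
    by (intro sum.cong refl sum_if_eq(1))
  also have "\<dots> = ep w" by (simp add: rho_orth assms)
  finally show ?thesis .
qed

lemma ep_deg: "w \<in> X \<Longrightarrow> ep w \<noteq> 0 \<Longrightarrow> ad w = \<one>"
  by (simp add: ep_def ad_def split: if_splits)

text \<open>The right action on the first leg and the left action on the second leg hit the same
  contracted index and cancel by \<open>Rw_Lw_dl\<close>; what remains is the left action on the
  outer left index and the right action on the outer right index.\<close>

lemma dl_Aw: assumes "g \<in> carrier G" "w \<in> X"
  shows "lext dl (Aw g w) = lext (\<lambda>(u, v). pairs (Aw g u) (Aw g v)) (dl w)"
proof (rule ceval_ext)
  fix f :: "('a \<times> 'a) list \<times> ('a \<times> 'a) list \<Rightarrow> complex"
  from assms(2) obtain x y where [simp]: "set x \<subseteq> I" "set y \<subseteq> I" "length x = length y" "w = zip x y"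
    by (rule XE)
  let ?F = "\<lambda>(u, v). ceval f (pairs (Lw g u) (Rw g v))"
  have RL: "lext (\<lambda>(b1, b2). pairs (Rw g b1) (Lw g b2)) (dl w) = dl w" by (rule Rw_Lw_dl) fact+
  have "ceval f (lext (\<lambda>(u, v). pairs (Aw g u) (Aw g v)) (dl w))
      = ceval ?F (lext (\<lambda>(b1, b2). pairs (Rw g b1) (Lw g b2)) (dl w))"
    unfolding ceval_lext
  proof (rule ceval_cong2[OF dl_psp[OF assms(2)]], simp only: prod.case)
    fix u v assume "u \<in> X" "v \<in> X"
    then have Av: "Aw g v = lext (Rw g) (Lw g v)" unfolding Aw_def by (simp only: Lw_Rw)
    show "ceval f (pairs (Aw g u) (Aw g v)) = ceval ?F (pairs (Rw g u) (Lw g v))"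
      unfolding ceval_pairs Aw_def[of g u] Av ceval_lext prod.case
      by (intro ceval_cong ceval_swap)
  qed
  also have "\<dots> = ceval ?F (dl w)" by (simp only: RL)
  also have "\<dots> = ceval f (lext dl (Aw g w))"
  proof -
    let ?M = "mi (length y)"
    have "ceval ?F (dl w) = (\<Sum>z\<in>?M. \<Sum>a\<in>?M. \<Sum>b\<in>?M. rho g b y * rho g a x * f (zip a z, zip z b))"
      by (simp add: ceval_dl ceval_pairs ceval_Lw ceval_Rw sum_distrib_left mult_ac)
    also have "\<dots> = (\<Sum>a\<in>?M. \<Sum>b\<in>?M. \<Sum>z\<in>?M. rho g b y * rho g a x * f (zip a z, zip z b))"
      by (subst sum.swap) (intro sum.cong refl sum.swap)
    also have "\<dots> = ceval f (lext dl (Aw g w))"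
      by (simp add: ceval_lext ceval_Aw ceval_dl sum_distrib_left) (rule sum.swap)
    finally show ?thesis .
  qed
  finally show "ceval f (lext dl (Aw g w)) = ceval f (lext (\<lambda>(u, v). pairs (Aw g u) (Aw g v)) (dl w))" by simp
qed

section \<open>The antipode on words and its twisted form\<close>

definition lS :: "(('a \<times> 'a) list \<Rightarrow>\<^sub>0 complex) \<Rightarrow> (('a \<times> 'a) list \<Rightarrow>\<^sub>0 complex)" where
  "lS = lext (\<lambda>u. basis (Sw u))"

lemma lS_basis [simp]: "lS (basis u) = basis (Sw u)" by (simp add: lS_def)

lemma Sw_X [simp]: "u \<in> X \<Longrightarrow> Sw u \<in> X" by (simp add: Sw_def)

lemma st_nil [simp]: "st [] = []" by (simp add: st_def)

lemma Sw_nil [simp]: "Sw [] = []" by (simp add: Sw_def)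

lemma wl_Sw [simp]: "wl (Sw u) = st (wr u)" and wr_Sw [simp]: "wr (Sw u) = st (wl u)"
  by (simp_all add: Sw_def)

lemma Sw_Sw [simp]: "u \<in> X \<Longrightarrow> Sw (Sw u) = u"
  unfolding Sw_def[of "Sw u"] by simp

lemma Sw_append [simp]: "Sw (u @ v) = Sw v @ Sw u"
  by (simp add: Sw_def)

lemma lS_psp: "p \<in> psp X \<Longrightarrow> lS p \<in> psp X"
  unfolding lS_def by (rule psp_lext) auto

lemma lS_lS: "p \<in> psp X \<Longrightarrow> lS (lS p) = p"
  using lext_psp_cong[of p X "\<lambda>u. basis (Sw (Sw u))" basis] by (simp add: lS_def lext_lext)

lemma lS_lmul: "lS (lmul cm p q) = lmul cm (lS q) (lS p)"
  unfolding lS_def by (simp add: lmul_def lext_lext cm_def) (rule lext_swap)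

text \<open>\<open>Sw\<close> exchanges the two index words, and \<open>st\<close> commutes with the
  action (\<open>rho_st\<close>), so an action on the left index reappears on the right one.\<close>

lemma lS_Lw: assumes "g \<in> carrier G" "u \<in> X" shows "lS (Lw g u) = Rw g (Sw u)"
proof (rule ceval_ext)
  fix f
  from assms(2) obtain x y where [simp]: "set x \<subseteq> I" "set y \<subseteq> I" "length x = length y" "u = zip x y"
    by (rule XE)
  show "ceval f (lS (Lw g u)) = ceval f (Rw g (Sw u))"
    unfolding lS_def
    by (simp add: ceval_lext ceval_Lw ceval_Rw Sw_def assms)
      (subst sum_mi_st[symmetric], simp add: assms)
qed

lemma lS_Rw: assumes "g \<in> carrier G" "u \<in> X" shows "lS (Rw g u) = Lw g (Sw u)"
proof -
  have "Rw g u = lS (Lw g (Sw u))" using assms by (simp add: lS_Lw)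
  then show ?thesis using assms by (simp add: lS_lS Lw_psp)
qed

lemma lS_lLw: "g \<in> carrier G \<Longrightarrow> p \<in> psp X \<Longrightarrow> lS (lext (Lw g) p) = lext (Rw g) (lS p)"
  unfolding lS_def lext_lext
  by (rule lext_psp_cong, assumption) (simp add: lS_Lw[unfolded lS_def])

lemma lS_lRw: "g \<in> carrier G \<Longrightarrow> p \<in> psp X \<Longrightarrow> lS (lext (Rw g) p) = lext (Lw g) (lS p)"
  unfolding lS_def lext_lext
  by (rule lext_psp_cong, assumption) (simp add: lS_Rw[unfolded lS_def])

lemma lS_lAw: "g \<in> carrier G \<Longrightarrow> p \<in> psp X \<Longrightarrow> lS (lext (Aw g) p) = lext (Aw g) (lS p)"
  unfolding lAw by (simp only: lS_lLw lS_lRw lRw_psp lLw_lRw[symmetric] lS_psp)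

lemma sB_closed: assumes "u \<in> X" shows "sB u \<in> psp {v \<in> X. ad v = ad u}"
  unfolding sB_def
proof (rule psp_mono[OF Lw_closed])
  have c: "dg (wl u) \<in> carrier G" "dg (wr u) \<in> carrier G" using assms by simp_all
  show "{v \<in> X. dg (wl v) = ad u \<otimes> dg (wl (Sw u)) \<otimes> inv ad u \<and> wr v = wr (Sw u)} \<subseteq> {v \<in> X. ad v = ad u}"
    using c assms by (auto simp: ad_def inv_mult_group m_assoc)
qed (use assms in simp_all)

lemma sB_psp: "u \<in> X \<Longrightarrow> sB u \<in> psp X"
  by (rule psp_mono[OF sB_closed]) auto

lemma lsB_psp: "p \<in> psp X \<Longrightarrow> lext sB p \<in> psp X"
  by (rule psp_lext) (auto simp: sB_psp)

lemma sB_nil: "sB [] = basis []"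
  by (simp add: sB_def Lw_one)

lemma lsB_homogeneous:
  assumes "p \<in> psp {v \<in> X. ad v = h}" shows "lext sB p = lext (Lw h) (lS p)"
proof -
  have "lext sB p = lext (\<lambda>u. Lw h (Sw u)) p"
    by (rule lext_psp_cong[OF assms]) (auto simp: sB_def)
  then show ?thesis by (simp add: lS_def lext_lext)
qed

text \<open>\<open>lS\<close> exchanges the two commuting halves of \<open>Aw g\<close> and so
  commutes with it, while the degree by which \<open>sB\<close> twists is conjugated by
  \<open>g\<close>.\<close>

lemma sB_Aw: assumes g: "g \<in> carrier G" and u: "u \<in> X"
  shows "lext sB (Aw g u) = lext (Aw g) (sB u)"
proof -
  let ?h = "ad u"
  have h: "?h \<in> carrier G" using u by simp
  have "lext sB (Aw g u) = lext (Lw (g \<otimes> ?h \<otimes> inv g)) (lS (Aw g u))"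
    by (rule lsB_homogeneous[OF Aw_closed[OF g u]])
  also have "lS (Aw g u) = lext (Lw g) (Rw g (Sw u))"
    using lS_lAw[OF g, of "basis u"] u by (simp add: Aw_def[of g "Sw u"])
  also have "lext (Lw (g \<otimes> ?h \<otimes> inv g)) \<dots> = lext (Lw (g \<otimes> ?h)) (Rw g (Sw u))"
    using g h u by (simp add: lLw_mult Rw_psp m_assoc)
  also have "\<dots> = lext (Aw g) (sB u)"
    using g h u by (simp add: lAw sB_def Lw_Rw[symmetric] lLw_mult Rw_psp)
  finally show ?thesis .
qed

text \<open>Put \<open>h = |u|\<close> and \<open>k = |v|\<close>. The antipode reverses the product
  into \<open>Rw h (Sw v)\<close> followed by \<open>Sw u\<close>, and \<open>h k\<close> then acts
  on both factors. The first one becomes \<open>Aw h\<close> of \<open>sB v\<close>, of degree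
  \<open>h k h^-1\<close>, and the second one becomes \<open>sB u\<close> moved by exactly this
  degree, as the twisted product requires.\<close>

lemma sB_tm: assumes u: "u \<in> X" and v: "v \<in> X"
  shows "lext sB (tm u v) = lmul tm (lext (Aw (ad u)) (sB v)) (sB u)"
proof -
  let ?h = "ad u" and ?k = "ad v"
  have h: "?h \<in> carrier G" "?k \<in> carrier G" using u v by simp_all
  have A: "lext (Aw ?h) (sB v) \<in> psp {w \<in> X. ad w = ?h \<otimes> ?k \<otimes> inv ?h}"
    by (rule psp_lext[OF sB_closed[OF v]]) (rule psp_mono[OF Aw_closed[OF h(1)]], auto)
  have "lext sB (tm u v) = lext (Lw (?h \<otimes> ?k)) (lS (tm u v))"
    by (rule lsB_homogeneous[OF tm_deg[OF u v]])
  also have "lS (tm u v) = lmul cm (Rw ?h (Sw v)) (basis (Sw u))"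
    using h v by (simp add: tm_def lS_lmul lS_Lw)
  also have "lext (Lw (?h \<otimes> ?k)) \<dots> = lmul cm (lext (Lw (?h \<otimes> ?k)) (Rw ?h (Sw v))) (Lw (?h \<otimes> ?k) (Sw u))"
    using h u v by (simp add: lLw_lmul Rw_psp)
  also have "lext (Lw (?h \<otimes> ?k)) (Rw ?h (Sw v)) = lext (Aw ?h) (sB v)"
    using h v by (simp add: lAw sB_def Lw_Rw[symmetric] lLw_mult Rw_psp)
  also have "Lw (?h \<otimes> ?k) (Sw u) = lext (Lw (?h \<otimes> ?k \<otimes> inv ?h)) (sB u)"
    using h u by (simp add: sB_def Lw_mult m_assoc)
  also have "lmul cm (lext (Aw ?h) (sB v)) \<dots> = lmul tm (lext (Aw ?h) (sB v)) (sB u)"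
    using u by (intro ltm_homogeneous[OF A, symmetric] sB_psp)
  finally show ?thesis .
qed

text \<open>The antipode of words is an involution that exchanges left and right actions, so of its
  twisted form only the diagonal action of the degree is left after squaring. This is the source of
  the invertibility of the braided antipode.\<close>

lemma sB_sB: assumes u: "u \<in> X" shows "lext sB (sB u) = Aw (ad u) u"
proof -
  have h: "ad u \<in> carrier G" using u by simp
  have "lext sB (sB u) = lext (Lw (ad u)) (lS (sB u))"
    by (rule lsB_homogeneous[OF sB_closed[OF u]])
  also have "lS (sB u) = Rw (ad u) u" using h u by (simp add: sB_def lS_Lw)
  finally show ?thesis by (simp add: Aw_def)
qed

section \<open>Convolution of the twisted antipode with the identity\<close>

definition s1 :: "'a list \<Rightarrow> 'a list \<Rightarrow> (('a \<times> 'a) list \<Rightarrow>\<^sub>0 complex)" where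
  "s1 x y = (\<Sum>z\<in>mi (length x). basis (zip x z @ Sw (zip z y)))"

definition s2 :: "'a list \<Rightarrow> 'a list \<Rightarrow> (('a \<times> 'a) list \<Rightarrow>\<^sub>0 complex)" where
  "s2 x y = (\<Sum>z\<in>mi (length x). basis (Sw (zip x z) @ zip z y))"

text \<open>A nonzero entry on either side forces \<open>dg v\<close> to be the conjugate of
  \<open>dg z\<close> by \<open>dg x\<close>, and then the two group elements are inverse to each
  other. The purpose is to trade a group element that depends on \<open>z\<close> for one that
  depends on \<open>v\<close>, so that orthogonality applies to a sum over \<open>z\<close>.\<close>

lemma rho_conj_swap:
  assumes "set x \<subseteq> I" "set v \<subseteq> I" "set z \<subseteq> I"
  shows "rho (dg x \<otimes> inv dg z) v z * c = rho (inv dg x \<otimes> dg v) z v * c"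
proof -
  have c: "dg x \<in> carrier G" "dg v \<in> carrier G" "dg z \<in> carrier G" using assms by simp_all
  consider "rho (dg x \<otimes> inv dg z) v z \<noteq> 0" | "rho (inv dg x \<otimes> dg v) z v \<noteq> 0"
    | "rho (dg x \<otimes> inv dg z) v z = 0" "rho (inv dg x \<otimes> dg v) z v = 0" by blast
  then show ?thesis
  proof cases
    case 1
    then have "dg v = dg x \<otimes> inv dg z \<otimes> dg z \<otimes> inv (dg x \<otimes> inv dg z)"
      using rho_deg[of "dg x \<otimes> inv dg z" z v] assms by simp
    then have "inv dg x \<otimes> dg v = inv (dg x \<otimes> inv dg z)"
      using c by (simp add: m_assoc inv_mult_group)
    then show ?thesis using rho_inv[of "dg x \<otimes> inv dg z" z v] assms by simp
  next
    case 2
    then have "dg z = inv dg x \<otimes> dg v \<otimes> dg v \<otimes> inv (inv dg x \<otimes> dg v)"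
      using rho_deg[of "inv dg x \<otimes> dg v" v z] assms by simp
    then have "dg x \<otimes> inv dg z = inv (inv dg x \<otimes> dg v)"
      using c by (simp add: m_assoc inv_mult_group)
    then show ?thesis using rho_inv[of "inv dg x \<otimes> dg v" v z] assms by simp
  qed simp
qed

text \<open>The twist in \<open>tm\<close> and the twist in \<open>sB\<close> are by the same group
  element, which depends on the contracted index \<open>z\<close>. Expressed through
  \<open>v\<close> as in \<open>rho_conj_swap\<close>, the two matrix entries contract over
  \<open>z\<close> to a Kronecker delta and every twist disappears.\<close>

lemma sB_left: assumes "set x \<subseteq> I" "set y \<subseteq> I" "length x = length y"
  shows "lext (\<lambda>(a, b). lmul tm (sB a) (basis b)) (dl (zip x y)) = s2 x y"
proof (rule ceval_ext)
  fix f
  note [simp] = assms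
  let ?M = "mi (length y)"
  let ?k = "\<lambda>v. inv dg x \<otimes> dg v"
  have T: "ceval f (lmul tm (sB (zip x z)) (basis (zip z y)))
    = (\<Sum>v\<in>?M. \<Sum>u\<in>?M. rho (?k v) z v * rho (?k v) z u * f (Sw (zip x v) @ zip u y))" if "z \<in> ?M" for z
  proof -
    have [simp]: "set z \<subseteq> I" "length z = length y" using that by auto
    let ?h = "dg x \<otimes> inv dg z"
    have "lmul tm (sB (zip x z)) (basis (zip z y)) = lmul cm (sB (zip x z)) (Lw ?h (zip z y))"
      using ltm_homogeneous[OF sB_closed, of "zip x z" "basis (zip z y)"] by simp
    then have "ceval f (lmul tm (sB (zip x z)) (basis (zip z y)))
      = (\<Sum>v\<in>?M. \<Sum>u\<in>?M. rho ?h v (st z) * (rho ?h u z * f (zip v (st x) @ zip u y)))"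
      by (simp add: sB_def Sw_def ceval_lmul ceval_Lw cm_def sum_distrib_left)
    also have "\<dots> = (\<Sum>v\<in>?M. \<Sum>u\<in>?M. rho ?h (st v) (st z) * (rho ?h u z * f (zip (st v) (st x) @ zip u y)))"
      by (rule sum_mi_st[symmetric])
    also have "\<dots> = (\<Sum>v\<in>?M. \<Sum>u\<in>?M. rho ?h v z * (rho ?h u z * f (zip (st v) (st x) @ zip u y)))"
      by (intro sum.cong refl) simp
    also have "\<dots> = (\<Sum>v\<in>?M. \<Sum>u\<in>?M. rho (?k v) z v * rho (?k v) z u * f (Sw (zip x v) @ zip u y))"
    proof (intro sum.cong refl)
      fix v u assume "v \<in> ?M" "u \<in> ?M"
      then have [simp]: "set v \<subseteq> I" "length v = length y" "set u \<subseteq> I" "length u = length y" by auto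
      have c: "dg x \<in> carrier G" "dg v \<in> carrier G" "dg z \<in> carrier G" by simp_all
      have "rho ?h v z * (rho ?h u z * f (zip (st v) (st x) @ zip u y))
          = rho (?k v) z v * (rho (?k v) z u * f (zip (st v) (st x) @ zip u y))"
      proof (cases "rho ?h v z = 0")
        case True
        then show ?thesis using rho_conj_swap[of x v z 1] by simp
      next
        case False
        then have "dg v = ?h \<otimes> dg z \<otimes> inv ?h" using rho_deg[of ?h z v] by simp
        then have "?k v = inv ?h" using c by (simp add: m_assoc inv_mult_group)
        then show ?thesis using rho_inv[of ?h z u] rho_inv[of ?h z v] by simp
      qed
      then show "rho ?h v z * (rho ?h u z * f (zip (st v) (st x) @ zip u y))
          = rho (?k v) z v * rho (?k v) z u * f (Sw (zip x v) @ zip u y)"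
        by (simp add: Sw_def)
    qed
    finally show ?thesis .
  qed
  have "ceval f (lext (\<lambda>(a, b). lmul tm (sB a) (basis b)) (dl (zip x y)))
      = (\<Sum>z\<in>?M. \<Sum>v\<in>?M. \<Sum>u\<in>?M. rho (?k v) z v * rho (?k v) z u * f (Sw (zip x v) @ zip u y))"
    by (simp add: ceval_lext ceval_dl T del: mi_iff)
  also have "\<dots> = (\<Sum>v\<in>?M. \<Sum>u\<in>?M. \<Sum>z\<in>?M. rho (?k v) z v * rho (?k v) z u * f (Sw (zip x v) @ zip u y))"
    by (subst sum.swap) (intro sum.cong refl sum.swap)
  also have "\<dots> = (\<Sum>v\<in>?M. \<Sum>u\<in>?M. (\<Sum>z\<in>?M. rho (?k v) z v * rho (?k v) z u) * f (Sw (zip x v) @ zip u y))"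
    by (simp only: sum_distrib_right)
  also have "\<dots> = (\<Sum>v\<in>?M. \<Sum>u\<in>?M. (if v = u then 1 else 0) * f (Sw (zip x v) @ zip u y))"
    by (intro sum.cong refl) (simp add: rho_orth)
  also have "\<dots> = (\<Sum>v\<in>?M. f (Sw (zip x v) @ zip v y))"
    by (intro sum.cong refl sum_if_eq(2))
  finally show "ceval f (lext (\<lambda>(a, b). lmul tm (sB a) (basis b)) (dl (zip x y))) = ceval f (s2 x y)"
    by (simp add: s2_def ceval_linear)
qed

text \<open>The twists of \<open>tm\<close> and \<open>sB\<close> multiply to \<open>dg x\<close>
  times \<open>inv dg y\<close>, in which the contracted index no longer occurs. This action does
  not cancel; it survives as a change of the index \<open>y\<close> in \<open>s1\<close>.\<close>

lemma sB_right: assumes "set x \<subseteq> I" "set y \<subseteq> I" "length x = length y"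
  shows "lext (\<lambda>(a, b). lmul tm (basis a) (sB b)) (dl (zip x y))
    = (\<Sum>v\<in>mi (length x). csmul (rho (dg x \<otimes> inv dg y) v y) (s1 x v))"
proof (rule ceval_ext)
  fix f
  note [simp] = assms
  let ?M = "mi (length y)" and ?h = "dg x \<otimes> inv dg y"
  have T: "ceval f (lmul tm (basis (zip x z)) (sB (zip z y)))
    = (\<Sum>v\<in>?M. rho ?h v y * f (zip x z @ Sw (zip z v)))" if "z \<in> ?M" for z
  proof -
    have [simp]: "set z \<subseteq> I" "length z = length y" using that by auto
    have c: "dg x \<in> carrier G" "dg y \<in> carrier G" "dg z \<in> carrier G" by simp_all
    have "lmul tm (basis (zip x z)) (sB (zip z y)) = lmul cm (basis (zip x z)) (Lw ?h (Sw (zip z y)))"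
      using c by (simp add: ltm_basis sB_psp sB_def Lw_mult m_assoc Lw_psp)
    then have "ceval f (lmul tm (basis (zip x z)) (sB (zip z y)))
      = (\<Sum>v\<in>?M. rho ?h v (st y) * f (zip x z @ zip v (st z)))"
      by (simp add: Sw_def ceval_lmul ceval_Lw cm_def)
    also have "\<dots> = (\<Sum>v\<in>?M. rho ?h (st v) (st y) * f (zip x z @ zip (st v) (st z)))"
      by (rule sum_mi_st[symmetric])
    also have "\<dots> = (\<Sum>v\<in>?M. rho ?h v y * f (zip x z @ Sw (zip z v)))"
      by (intro sum.cong refl) (simp add: Sw_def)
    finally show ?thesis .
  qed
  have "ceval f (lext (\<lambda>(a, b). lmul tm (basis a) (sB b)) (dl (zip x y)))
      = (\<Sum>z\<in>?M. \<Sum>v\<in>?M. rho ?h v y * f (zip x z @ Sw (zip z v)))"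
    by (simp add: ceval_lext ceval_dl T del: mi_iff)
  also have "\<dots> = (\<Sum>v\<in>?M. \<Sum>z\<in>?M. rho ?h v y * f (zip x z @ Sw (zip z v)))"
    by (rule sum.swap)
  finally show "ceval f (lext (\<lambda>(a, b). lmul tm (basis a) (sB b)) (dl (zip x y)))
    = ceval f (\<Sum>v\<in>mi (length x). csmul (rho ?h v y) (s1 x v))"
    by (simp add: s1_def ceval_linear sum_distrib_left)
qed

text \<open>The isomorphism \<open>th\<close> from the free algebra to its twist fixing the letters, and its inverse.\<close>

fun th :: "('a \<times> 'a) list \<Rightarrow> (('a \<times> 'a) list \<Rightarrow>\<^sub>0 complex)" where
  "th [] = basis []" | "th (l # w) = lmul tm (basis [l]) (th w)"

fun thr :: "('a \<times> 'a) list \<Rightarrow> (('a \<times> 'a) list \<Rightarrow>\<^sub>0 complex)" where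
  "thr [] = basis []" | "thr (l # w) = lmul cm (thr w) (Lw (inv ad (rev w)) [l])"

text \<open>The recursion goes by the last letter: the word \<open>w l\<close> is the twisted
  product of \<open>w\<close> with the letter \<open>l\<close> moved back by the inverse of
  \<open>|w|\<close>. Hence the reversed word handed to \<open>thr\<close>.\<close>

definition th' :: "('a \<times> 'a) list \<Rightarrow> (('a \<times> 'a) list \<Rightarrow>\<^sub>0 complex)" where
  "th' u = thr (rev u)"

text \<open>The degree of the tensor algebra, multiplicative for concatenation; \<open>th\<close>
  carries it to \<open>ad\<close> (see \<open>th_closed\<close>).\<close>

fun degw :: "('a \<times> 'a) list \<Rightarrow> 'g" where
  "degw [] = \<one>" | "degw (l # w) = ad [l] \<otimes> degw w"

lemma X_cons [simp]: "l # w \<in> X \<longleftrightarrow> l \<in> I \<times> I \<and> w \<in> X"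
  by (auto simp: X_def)

lemma degw_closed [simp]: "w \<in> X \<Longrightarrow> degw w \<in> carrier G"
  by (induction w) auto

lemma th'_nil [simp]: "th' [] = basis []" by (simp add: th'_def)
lemma th'_snoc: "th' (w @ [l]) = lmul cm (th' w) (Lw (inv ad w) [l])" by (simp add: th'_def)

lemma Lw_length: "Lw g u \<in> psp {v. length v = length u}"
  unfolding Lw_def by (rule psp_sum) (auto intro!: psp_csmul)

lemma singleE: "v \<in> X \<Longrightarrow> length v = Suc 0 \<Longrightarrow> (\<And>l. l \<in> I \<times> I \<Longrightarrow> v = [l] \<Longrightarrow> thesis) \<Longrightarrow> thesis"
  by (cases v) (auto simp: X_def)

lemma psp_singles:
  assumes "p \<in> psp X" "p \<in> psp {v. length v = Suc 0}"
  shows "p \<in> psp ((\<lambda>l. [l]) ` (I \<times> I))"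
  unfolding psp_def
proof safe
  fix v assume "v \<in> Poly_Mapping.keys p"
  then have "v \<in> X" "length v = Suc 0" using assms by (auto simp: psp_def)
  then obtain l where "l \<in> I \<times> I" "v = [l]" by (rule singleE)
  then show "v \<in> (\<lambda>l. [l]) ` (I \<times> I)" by blast
qed

lemma Lw_single: "g \<in> carrier G \<Longrightarrow> l \<in> I \<times> I \<Longrightarrow> Lw g [l] \<in> psp ((\<lambda>l. [l]) ` (I \<times> I))"
  using Lw_psp[of g "[l]"] Lw_length[of g "[l]"] by (intro psp_singles) auto

text \<open>The words with the twisted product, presented by the identity map; this makes
  associativity and unit laws of \<open>algcover\<close> available for combinations of
  words.\<close>

definition twist_alg :: "(complex, ('a \<times> 'a) list \<Rightarrow>\<^sub>0 complex) module" where
  "twist_alg = \<lparr>carrier = psp X, mult = lmul tm, one = basis [], zero = 0, add = (+), smult = csmul\<rparr>"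

lemma algcover_twist: "algcover X twist_alg id tm []"
  by unfold_locales (auto simp: twist_alg_def tm_psp tm_assoc tm_nil)

lemmas ltm_assoc = algcover.lmul_assoc[OF algcover_twist]
lemmas ltm_one = algcover.lmul_one[OF algcover_twist]

lemma th_single: "l \<in> I \<times> I \<Longrightarrow> th [l] = basis [l]"
  by (simp add: tm_nil)

lemma th_closed: "w \<in> X \<Longrightarrow> th w \<in> psp {v \<in> X. ad v = degw w}"
proof (induction w)
  case (Cons l w)
  then show ?case
    by (auto intro!: lmul_closed[of "{[l]}" "{v \<in> X. ad v = degw w}"] psp_mono[OF tm_deg])
qed simp

lemma th_psp: "w \<in> X \<Longrightarrow> th w \<in> psp X"
  by (rule psp_mono[OF th_closed]) auto

lemma th_append: "u \<in> X \<Longrightarrow> v \<in> X \<Longrightarrow> th (u @ v) = lmul tm (th u) (th v)"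
proof (induction u)
  case (Cons l u)
  then show ?case by (simp add: ltm_assoc[symmetric] th_psp)
qed (simp add: ltm_one th_psp)

lemma lth_psp: "p \<in> psp X \<Longrightarrow> lext th p \<in> psp X"
  by (rule psp_lext) (auto simp: th_psp)

lemma lth_lmul:
  assumes "p \<in> psp X" "q \<in> psp X"
  shows "lext th (lmul cm p q) = lmul tm (lext th p) (lext th q)"
  unfolding lext_lmul lmul_lext_left lmul_lext_right lext_swap[of _ p q]
  by (intro lext_psp_cong[OF assms(1)] lext_psp_cong[OF assms(2)]) (simp add: cm_def th_append)

lemma ad_append_Lw:
  assumes "u \<in> X" "v \<in> X" "v' \<in> X" "dg (wl v') = inv ad u \<otimes> dg (wl v) \<otimes> ad u" "wr v' = wr v"
  shows "ad u \<otimes> ad v' = ad (u @ v)"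
proof -
  have c: "dg (wl u) \<in> carrier G" "dg (wr u) \<in> carrier G" "dg (wl v) \<in> carrier G" "dg (wr v) \<in> carrier G"
    using assms by simp_all
  have "ad u \<otimes> ad v' = ad u \<otimes> (inv ad u \<otimes> dg (wl v) \<otimes> ad u \<otimes> inv dg (wr v))"
    unfolding ad_def[of v'] assms(4,5) ..
  also have "\<dots> = dg (wl v) \<otimes> ad u \<otimes> inv dg (wr v)" using assms(1) c by (simp add: m_assoc)
  also have "\<dots> = ad (u @ v)" using assms c by (simp add: ad_def m_assoc inv_mult_group)
  finally show ?thesis .
qed

lemma degw_append: "u \<in> X \<Longrightarrow> v \<in> X \<Longrightarrow> degw (u @ v) = degw u \<otimes> degw v"
  by (induction u) (auto simp: m_assoc)

lemma th'_closed: "w \<in> X \<Longrightarrow> th' w \<in> psp {v \<in> X. degw v = ad w}"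
proof (induction w rule: rev_induct)
  case (snoc l w)
  then have w: "w \<in> X" and l: "l \<in> I \<times> I" "[l] \<in> X" by auto
  have k: "ad w \<in> carrier G" using w by simp
  show ?case unfolding th'_snoc
  proof (rule lmul_closed[OF _ snoc.IH[OF w] Lw_closed])
    fix u v assume u: "u \<in> {v \<in> X. degw v = ad w}"
      and v: "v \<in> {v \<in> X. dg (wl v) = inv ad w \<otimes> dg (wl [l]) \<otimes> inv (inv ad w) \<and> wr v = wr [l]}"
    have "length v = 1" using v wr_length[of v] by simp
    then obtain l' where l': "l' \<in> I \<times> I" "v = [l']" using v by (auto elim: singleE)
    have "degw (u @ v) = ad w \<otimes> ad v" using u v l' by (simp add: degw_append)
    also have "\<dots> = ad (w @ [l])" by (rule ad_append_Lw) (use v w l k in auto)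
    finally show "cm u v \<in> psp {v \<in> X. degw v = ad (w @ [l])}" using u v by (simp add: cm_def)
  qed (use k l in auto)
qed simp

lemma th'_psp: "w \<in> X \<Longrightarrow> th' w \<in> psp X"
  by (rule psp_mono[OF th'_closed]) auto

lemma lth'_psp: "p \<in> psp X \<Longrightarrow> lext th' p \<in> psp X"
  by (rule psp_lext) (auto simp: th'_psp)

text \<open>When the last letter of \<open>v\<close> is peeled off, the degree of \<open>u v\<close>
  has to be compared with that of the terms of \<open>v\<close> moved back by \<open>|u|\<close>: it
  is \<open>|u|\<close> times the latter (\<open>ad_append_Lw\<close>), so the letter receives the
  same correction on both sides.\<close>

lemma th'_append:
  "u \<in> X \<Longrightarrow> v \<in> X \<Longrightarrow> th' (u @ v) = lmul cm (th' u) (lext th' (Lw (inv ad u) v))"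
proof (induction v rule: rev_induct)
  case Nil
  have "Lw g [] = basis []" for g by (simp add: Lw_def)
  then show ?case using Nil lmul_lext_right[of cm "th' u" basis] by (simp add: lmul_def cm_def)
next
  case (snoc l v)
  then have v: "v \<in> X" and l: "l \<in> I \<times> I" "[l] \<in> X" by auto
  let ?k = "ad u"
  have k: "?k \<in> carrier G" using snoc by simp
  have "lext th' (Lw (inv ?k) (v @ [l]))
      = lext (\<lambda>v'. lext (\<lambda>w. th' (v' @ w)) (Lw (inv ?k) [l])) (Lw (inv ?k) v)"
    using v l by (simp add: Lw_append lext_lmul cm_def)
  also have "\<dots> = lext (\<lambda>v'. lmul cm (th' v') (Lw (inv ad (u @ v)) [l])) (Lw (inv ?k) v)"
  proof (rule lext_psp_cong[OF Lw_closed])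
    fix v' assume "v' \<in> {v' \<in> X. dg (wl v') = inv ?k \<otimes> dg (wl v) \<otimes> inv (inv ?k) \<and> wr v' = wr v}"
    then have v': "v' \<in> X" "dg (wl v') = inv ?k \<otimes> dg (wl v) \<otimes> ?k" "wr v' = wr v" using k by auto
    have e: "?k \<otimes> ad v' = ad (u @ v)" by (rule ad_append_Lw) (use v' v snoc in auto)
    have "lext (\<lambda>w. th' (v' @ w)) (Lw (inv ?k) [l]) = lext (\<lambda>w. lmul cm (th' v') (Lw (inv ad v') w)) (Lw (inv ?k) [l])"
      by (rule lext_psp_cong[OF Lw_single]) (use k l in \<open>auto simp: th'_snoc\<close>)
    also have "\<dots> = lmul cm (th' v') (Lw (inv (?k \<otimes> ad v')) [l])"
      using k l v' by (simp add: lmul_lext_right[symmetric] Lw_mult inv_mult_group)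
    finally show "lext (\<lambda>w. th' (v' @ w)) (Lw (inv ?k) [l]) = lmul cm (th' v') (Lw (inv ad (u @ v)) [l])"
      by (simp only: e)
  qed (use k v in auto)
  also have "\<dots> = lmul cm (lext th' (Lw (inv ?k) v)) (Lw (inv ad (u @ v)) [l])"
    by (simp add: lmul_lext_left)
  finally show ?case
    using snoc v th'_snoc[of "u @ v" l] by (simp add: lmul_cm_assoc)
qed

lemma th'_tm: assumes u: "u \<in> X" and v: "v \<in> X" shows "lext th' (tm u v) = lmul cm (th' u) (th' v)"
proof -
  have k: "ad u \<in> carrier G" using u by simp
  have "lext th' (tm u v) = lext (\<lambda>v'. th' (u @ v')) (Lw (ad u) v)"
    by (simp add: tm_def lext_lmul cm_def)
  also have "\<dots> = lext (\<lambda>v'. lmul cm (th' u) (lext th' (Lw (inv ad u) v'))) (Lw (ad u) v)"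
    by (rule lext_psp_cong[OF Lw_psp[OF k v]]) (simp add: th'_append u)
  also have "\<dots> = lmul cm (th' u) (lext th' (lext (Lw (inv ad u)) (Lw (ad u) v)))"
    by (simp add: lmul_lext_right lext_lext)
  also have "\<dots> = lmul cm (th' u) (th' v)"
    using k v by (simp add: Lw_mult Lw_one)
  finally show ?thesis .
qed

lemma lth'_ltm:
  assumes "p \<in> psp X" "q \<in> psp X"
  shows "lext th' (lmul tm p q) = lmul cm (lext th' p) (lext th' q)"
  unfolding lext_lmul lmul_lext_left lmul_lext_right lext_swap[of _ p q]
  by (intro lext_psp_cong[OF assms(1)] lext_psp_cong[OF assms(2)]) (simp add: th'_tm)

lemma th'_single: "l \<in> I \<times> I \<Longrightarrow> th' [l] = basis [l]"
  by (simp add: th'_def Lw_one)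

lemma th'_th: "u \<in> X \<Longrightarrow> lext th' (th u) = basis u"
proof (induction u)
  case (Cons l u)
  then show ?case by (simp add: lth'_ltm th_psp th'_single) (simp add: cm_def)
qed simp

lemma lth_single: "p \<in> psp ((\<lambda>l. [l]) ` (I \<times> I)) \<Longrightarrow> lext th p = p"
  using lext_psp_cong[of p "(\<lambda>l. [l]) ` (I \<times> I)" th basis] th_single by fastforce

lemma th_th': "u \<in> X \<Longrightarrow> lext th (th' u) = basis u"
proof (induction u rule: rev_induct)
  case (snoc l w)
  then have w: "w \<in> X" and l: "l \<in> I \<times> I" "[l] \<in> X" and IH: "lext th (th' w) = basis w" by auto
  have k: "ad w \<in> carrier G" using w by simp
  have "lext th (th' (w @ [l])) = lmul tm (basis w) (Lw (inv ad w) [l])"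
    using w l k by (simp add: th'_snoc lth_lmul th'_psp Lw_psp IH lth_single[OF Lw_single])
  also have "\<dots> = basis (w @ [l])"
    using w l k by (simp add: ltm_basis Lw_psp Lw_mult Lw_one cm_def)
  finally show ?case .
qed simp

lemma lth'_lth: "p \<in> psp X \<Longrightarrow> lext th' (lext th p) = p"
  using lext_psp_cong[of p X "\<lambda>u. lext th' (th u)" basis] by (simp add: lext_lext th'_th)

lemma lth_lth': "p \<in> psp X \<Longrightarrow> lext th (lext th' p) = p"
  using lext_psp_cong[of p X "\<lambda>u. lext th (th' u)" basis] by (simp add: lext_lext th_th')

lemma lAw_ltm:
  assumes "g \<in> carrier G" "p \<in> psp X" "q \<in> psp X"
  shows "lext (Aw g) (lmul tm p q) = lmul tm (lext (Aw g) p) (lext (Aw g) q)"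
  unfolding lext_lmul lmul_lext_left lmul_lext_right lext_swap[of _ p q]
  by (intro lext_psp_cong[OF assms(2)] lext_psp_cong[OF assms(3)] Aw_tm assms(1))

lemma Aw_append: "g \<in> carrier G \<Longrightarrow> u \<in> X \<Longrightarrow> v \<in> X \<Longrightarrow> Aw g (u @ v) = lmul cm (Aw g u) (Aw g v)"
  using lAw_lmul[of g "basis u" "basis v"] by (simp add: cm_def)

lemma Rw_length: "Rw g u \<in> psp {v. length v = length u}"
  unfolding Rw_def by (rule psp_sum) (auto intro!: psp_csmul)

lemma Aw_length: "Aw g u \<in> psp {v. length v = length u}"
  unfolding Aw_def by (rule psp_lext[OF Rw_length]) (rule psp_mono[OF Lw_length], auto)

lemma Aw_single: "g \<in> carrier G \<Longrightarrow> l \<in> I \<times> I \<Longrightarrow> Aw g [l] \<in> psp ((\<lambda>l. [l]) ` (I \<times> I))"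
  using Aw_psp[of g "[l]"] Aw_length[of g "[l]"] by (intro psp_singles) auto

lemma th_Aw: "g \<in> carrier G \<Longrightarrow> u \<in> X \<Longrightarrow> lext th (Aw g u) = lext (Aw g) (th u)"
proof (induction u)
  case (Cons l u)
  then have l: "l \<in> I \<times> I" "[l] \<in> X" and u: "u \<in> X" by auto
  have "Aw g (l # u) = lmul cm (Aw g [l]) (Aw g u)" using Aw_append[of g "[l]" u] Cons u l by simp
  then show ?case using Cons l u by (simp add: lth_lmul Aw_psp lth_single[OF Aw_single] lAw_ltm th_psp)
qed (simp add: Aw_nil)

lemma lth_lAw: "g \<in> carrier G \<Longrightarrow> p \<in> psp X \<Longrightarrow> lext th (lext (Aw g) p) = lext (Aw g) (lext th p)"
  unfolding lext_lext by (rule lext_psp_cong) (auto simp: th_Aw)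

lemma lth'_lAw: assumes "g \<in> carrier G" "p \<in> psp X" shows "lext th' (lext (Aw g) p) = lext (Aw g) (lext th' p)"
proof -
  have "lext th' (lext (Aw g) p) = lext th' (lext th (lext (Aw g) (lext th' p)))"
    using assms by (simp add: lth_lAw lth'_psp lth_lth')
  then show ?thesis using assms by (simp add: lth'_lth lth'_psp lAw_psp)
qed

lemma lth'_hpart: assumes "p \<in> psp X"
  shows "lext th' (lext (hpart ad g) p) = lext (hpart degw g) (lext th' p)"
  unfolding lext_lext
proof (rule lext_psp_cong[OF assms])
  fix u assume u: "u \<in> X"
  have t: "th' u \<in> psp {v. degw v = ad u}" by (rule psp_mono[OF th'_closed[OF u]]) auto
  show "lext th' (hpart ad g u) = lext (hpart degw g) (th' u)"
    using hpart_id[OF t] hpart_other[OF t] by (cases "ad u = g") (auto simp: hpart_def[of _ _ u])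
qed

section \<open>Ideals of words for concatenation\<close>

abbreviation "tid N \<equiv> tideal (I \<times> I) N"

lemma tid_iff: "tid N \<longleftrightarrow> N \<subseteq> psp X \<and> csmul.subspace N \<and>
     (\<forall>n\<in>N. \<forall>u\<in>X. lmul cm (basis u) n \<in> N \<and> lmul cm n (basis u) \<in> N)"
  by (simp add: tideal_def X_def)

lemma tid_mult:
  assumes "tid N" "n \<in> N" "p \<in> psp X"
  shows "lmul cm p n \<in> N" "lmul cm n p \<in> N"
  using tideal_mult[OF assms(1,2)] assms(3) by (auto simp: X_def)

lemma tid_sub: "tid N \<Longrightarrow> csmul.subspace N" and tid_psp: "tid N \<Longrightarrow> n \<in> N \<Longrightarrow> n \<in> psp X"
  by (auto simp: tid_iff)

text \<open>The generated ideal without reference to a ring record; \<open>Idl_tgen\<close>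
  identifies it with \<open>Idl\<close> both in the free algebra and in the tensor algebra.\<close>

definition tgen :: "(('a \<times> 'a) list \<Rightarrow>\<^sub>0 complex) set \<Rightarrow> (('a \<times> 'a) list \<Rightarrow>\<^sub>0 complex) set" where
  "tgen S = \<Inter>{N. tid N \<and> S \<subseteq> N}"

lemma tid_UNIV: "tid (psp X)"
  by (auto simp: tid_iff csmul.subspace_def psp_add psp_csmul intro: lcm_psp)

lemma tgen_tid: "S \<subseteq> psp X \<Longrightarrow> tid (tgen S)"
  using tid_UNIV unfolding tid_iff tgen_def csmul.subspace_def by blast

lemma tgen_incl: "S \<subseteq> tgen S" by (auto simp: tgen_def)
lemma tgen_min: "tid N \<Longrightarrow> S \<subseteq> N \<Longrightarrow> tgen S \<subseteq> N" by (auto simp: tgen_def)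

section \<open>The ideals of relations\<close>

text \<open>The relation of \<open>A\<close> for words in place of letters: modulo \<open>frt u v\<close>, the word \<open>v\<close> with
  transformed indices moves past \<open>u\<close>.\<close>

definition frt :: "('a \<times> 'a) list \<Rightarrow> ('a \<times> 'a) list \<Rightarrow> (('a \<times> 'a) list \<Rightarrow>\<^sub>0 complex)" where
  "frt u v = lmul cm (basis u) (Lw (dg (wl u)) v) - lmul cm (Rw (inv dg (wr u)) v) (basis u)"

definition frts :: "(('a \<times> 'a) list \<Rightarrow>\<^sub>0 complex) set" where
  "frts = {frt [l] [l'] | l l'. l \<in> I \<times> I \<and> l' \<in> I \<times> I}"

lemma frt_psp: "u \<in> X \<Longrightarrow> v \<in> X \<Longrightarrow> frt u v \<in> psp X"
  unfolding frt_def by (intro psp_diff lcm_psp Lw_psp Rw_psp) auto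

lemma frt_append_right:
  assumes "u \<in> X" "v \<in> X" "w \<in> X"
  shows "frt u (v @ w) = lmul cm (frt u v) (Lw (dg (wl u)) w) + lmul cm (Rw (inv dg (wr u)) v) (frt u w)"
  by (simp add: frt_def Lw_append Rw_append assms lmul_linear lmul_cm_assoc)

lemma lfrt: "lext (frt u) p = lmul cm (basis u) (lext (Lw (dg (wl u))) p) - lmul cm (lext (Rw (inv dg (wr u))) p) (basis u)"
  by (simp add: frt_def[abs_def] lext_fun_diff lmul_lext_left lmul_lext_right)

text \<open>The word \<open>w\<close> is carried past \<open>v\<close> and afterwards past
  \<open>u\<close>. The left actions it needs for this are by \<open>dg (wl v)\<close> after
  \<open>dg (wl u)\<close>, which is why \<open>dg\<close> multiplies in reverse order.\<close>

lemma frt_append_left: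
  assumes "u \<in> X" "v \<in> X" "w \<in> X"
  shows "frt (u @ v) w = lmul cm (basis u) (lext (frt v) (Lw (dg (wl u)) w))
    + lmul cm (lext (frt u) (Rw (inv dg (wr v)) w)) (basis v)"
proof -
  have c: "dg (wl u) \<in> carrier G" "dg (wr u) \<in> carrier G" "dg (wl v) \<in> carrier G" "dg (wr v) \<in> carrier G"
    using assms by simp_all
  have uv: "basis (u @ v) = lmul cm (basis u) (basis v)" by (simp add: cm_def)
  show ?thesis
    unfolding frt_def[of "u @ v"] lfrt uv using assms c
    by (simp add: lmul_linear lmul_cm_assoc Lw_mult Rw_mult inv_mult_group Lw_Rw del: lmul_basis)
qed

lemma frt_all:
  assumes N: "tid N" "frts \<subseteq> N" and "u \<in> X" "v \<in> X"
  shows "frt u v \<in> N"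
proof -
  have L0: "Lw g [] = basis []" "Rw g [] = basis []" for g by (simp_all add: Lw_def Rw_def)
  note sub = tid_sub[OF N(1)]
  have 1: "frt [l] v \<in> N" if l: "l \<in> I \<times> I" and v: "v \<in> X" for l v
    using v
  proof (induction v)
    case Nil
    then show ?case by (simp add: frt_def L0 cm_def csmul.subspace_0[OF sub])
  next
    case (Cons l' v)
    have c: "[l] \<in> X" "[l'] \<in> X" "v \<in> X" using Cons l by auto
    have "l' \<in> I \<times> I" using c by simp
    then have "frt [l] [l'] \<in> N" using N(2) l unfolding frts_def by blast
    then have "lmul cm (frt [l] [l']) (Lw (dg (wl [l])) v) \<in> N"
      using c by (intro tid_mult(2)[OF N(1)] Lw_psp dg_closed wl_set)
    moreover have "lmul cm (Rw (inv dg (wr [l])) [l']) (frt [l] v) \<in> N"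
      using c Cons by (intro tid_mult(1)[OF N(1)] Rw_psp inv_closed dg_closed wr_set) auto
    ultimately have "frt [l] ([l'] @ v) \<in> N"
      using c by (simp only: frt_append_right csmul.subspace_add[OF sub])
    then show ?case by simp
  qed
  have 2: "lext (frt [l]) p \<in> N" if "l \<in> I \<times> I" "p \<in> psp X" for l p
    by (rule subspace_lext[OF sub that(2)]) (use 1 that in auto)
  show ?thesis
    using \<open>u \<in> X\<close> \<open>v \<in> X\<close>
  proof (induction u arbitrary: v)
    case Nil
    then show ?case by (simp add: frt_def Lw_one Rw_one cm_def csmul.subspace_0[OF sub] lmul_def)
  next
    case (Cons l u)
    then have c: "[l] \<in> X" "u \<in> X" "l \<in> I \<times> I" by auto
    have "lext (frt u) (Lw (dg (wl [l])) v) \<in> N"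
      by (rule subspace_lext[OF sub, of _ X]) (use Cons c in \<open>auto intro!: Lw_psp\<close>)
    moreover have "lext (frt [l]) (Rw (inv dg (wr u)) v) \<in> N"
      using c Cons by (intro 2 Rw_psp) auto
    ultimately have "lmul cm (basis [l]) (lext (frt u) (Lw (dg (wl [l])) v)) \<in> N"
      "lmul cm (lext (frt [l]) (Rw (inv dg (wr u)) v)) (basis u) \<in> N"
      using c by (simp_all add: tid_mult[OF N(1)] del: wl_set)
    then have "frt ([l] @ u) v \<in> N"
      using c Cons by (simp only: frt_append_left csmul.subspace_add[OF sub])
    then show ?case by simp
  qed
qed

lemma lS_frt: assumes "u \<in> X" "v \<in> X" shows "lS (frt u v) = - frt (Sw u) (Sw v)"
proof -
  have c: "dg (wl u) \<in> carrier G" "dg (wr u) \<in> carrier G" using assms by simp_all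
  have "lS (frt u v) = lS (lmul cm (basis u) (Lw (dg (wl u)) v)) - lS (lmul cm (Rw (inv dg (wr u)) v) (basis u))"
    by (simp add: frt_def lS_def lext_diff)
  then show ?thesis using assms c by (simp add: lS_lmul lS_Lw lS_Rw frt_def)
qed

lemma lLw_frt: assumes "u \<in> X" "v \<in> X" "g \<in> carrier G"
  shows "lext (Lw g) (frt u v) = lext (\<lambda>u'. lext (frt u') (Lw g v)) (Lw g u)"
proof -
  let ?a = "dg (wl u)" and ?b = "dg (wr u)"
  have c: "?a \<in> carrier G" "?b \<in> carrier G" using assms by simp_all
  have "lext (\<lambda>u'. lext (frt u') (Lw g v)) (Lw g u)
    = lext (\<lambda>u'. lmul cm (basis u') (lext (Lw (g \<otimes> ?a)) (basis v)) - lmul cm (lext (Rw (inv ?b)) (Lw g v)) (basis u')) (Lw g u)"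
    by (rule lext_psp_cong[OF Lw_closed[OF assms(3,1)]]) (use assms c in \<open>auto simp: lfrt Lw_mult m_assoc\<close>)
  also have "\<dots> = lmul cm (Lw g u) (Lw (g \<otimes> ?a) v) - lmul cm (lext (Rw (inv ?b)) (Lw g v)) (Lw g u)"
    by (simp add: lext_fun_diff lmul_alt[of cm "Lw g u"])
      (metis lext_basis_id lmul_lext_right)
  also have "\<dots> = lext (Lw g) (frt u v)"
    using assms c by (simp add: frt_def lext_diff lLw_lmul Lw_psp Rw_psp Lw_mult Lw_Rw)
  finally show ?thesis by simp
qed

text \<open>With \<open>a\<close>, \<open>c\<close> the left and \<open>b\<close>, \<open>d\<close>
  the right degrees of \<open>u\<close>, \<open>v\<close>, the action in each of the two terms
  conjugates one degree in just the way that gives both terms the degree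
  \<open>a c (d b)^-1\<close>.\<close>

lemma frt_homogeneous: assumes "u \<in> X" "v \<in> X"
  shows "\<exists>h\<in>carrier G. frt u v \<in> psp {w \<in> X. ad w = h}"
proof -
  let ?a = "dg (wl u)" and ?b = "dg (wr u)" and ?c = "dg (wl v)" and ?d = "dg (wr v)"
  have c: "?a \<in> carrier G" "?b \<in> carrier G" "?c \<in> carrier G" "?d \<in> carrier G" using assms by simp_all
  let ?h = "?a \<otimes> ?c \<otimes> inv (?d \<otimes> ?b)"
  have "lmul cm (basis u) (Lw ?a v) \<in> psp {w \<in> X. ad w = ?h}"
    by (rule lmul_closed[of "{u}" _ _ _ _ _ , OF _ _ Lw_closed[OF c(1) assms(2)]])
      (use assms c in \<open>auto simp: cm_def ad_def m_assoc\<close>)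
  moreover have "lmul cm (Rw (inv ?b) v) (basis u) \<in> psp {w \<in> X. ad w = ?h}"
    by (rule lmul_closed[of _ "{u}" _ _ _ _, OF _ Rw_closed[OF inv_closed[OF c(2)] assms(2)]])
      (use assms c in \<open>auto simp: cm_def ad_def m_assoc\<close>)
  ultimately have "frt u v \<in> psp {w \<in> X. ad w = ?h}" unfolding frt_def by (rule psp_diff)
  then show ?thesis using c by blast
qed

section \<open>The antipode relations of \<open>H\<close> for words\<close>

definition d1 where "d1 x y = s1 x y - (if x = y then basis [] else 0)"
definition d2 where "d2 x y = s2 x y - (if x = y then basis [] else 0)"

definition ants :: "(('a \<times> 'a) list \<Rightarrow>\<^sub>0 complex) set" where
  "ants = {d1 [a] [b] | a b. a \<in> I \<and> b \<in> I} \<union> {d2 [a] [b] | a b. a \<in> I \<and> b \<in> I}"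

lemma s1_psp: "set x \<subseteq> I \<Longrightarrow> set y \<subseteq> I \<Longrightarrow> length x = length y \<Longrightarrow> s1 x y \<in> psp X"
  and s2_psp: "set x \<subseteq> I \<Longrightarrow> set y \<subseteq> I \<Longrightarrow> length x = length y \<Longrightarrow> s2 x y \<in> psp X"
  by (auto simp: s1_def s2_def intro!: psp_sum)

lemma d1_psp: "set x \<subseteq> I \<Longrightarrow> set y \<subseteq> I \<Longrightarrow> length x = length y \<Longrightarrow> d1 x y \<in> psp X"
  and d2_psp: "set x \<subseteq> I \<Longrightarrow> set y \<subseteq> I \<Longrightarrow> length x = length y \<Longrightarrow> d2 x y \<in> psp X"
  by (auto simp: d1_def d2_def intro!: psp_diff s1_psp s2_psp)

lemma s1_append:
  assumes "set x \<subseteq> I" "set y \<subseteq> I" "length x = length y" "set a \<subseteq> I" "set b \<subseteq> I" "length a = length b"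
  shows "s1 (a @ x) (b @ y) = (\<Sum>c\<in>mi (length a). lmul cm (lmul cm (basis (zip a c)) (s1 x y)) (basis (Sw (zip c b))))"
  using assms
  by (simp add: s1_def sum_mi_append lmul_linear cm_def zip_append[symmetric] del: zip_append)
    (simp add: Sw_def zip_append)

lemma s2_append:
  assumes "set x \<subseteq> I" "set y \<subseteq> I" "length x = length y" "set a \<subseteq> I" "set b \<subseteq> I" "length a = length b"
  shows "s2 (a @ x) (b @ y) = (\<Sum>z\<in>mi (length x). lmul cm (lmul cm (basis (Sw (zip x z))) (s2 a b)) (basis (zip z y)))"
  using assms
  by (simp add: s2_def sum_mi_append lmul_linear cm_def) (rule sum.swap)

text \<open>In the sum for the longer words the tails contribute \<open>s1 x y'\<close>, enclosed
  between two letters. Modulo the ideal this is a Kronecker delta, and the relation for the two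
  heads remains.\<close>

lemma d1_all:
  assumes N: "tid N" "ants \<subseteq> N"
  shows "set x \<subseteq> I \<Longrightarrow> set y \<subseteq> I \<Longrightarrow> length x = length y \<Longrightarrow> d1 x y \<in> N"
proof (induction x arbitrary: y)
  case Nil
  then show ?case by (simp add: d1_def s1_def csmul.subspace_0[OF tid_sub[OF N(1)]])
next
  case (Cons a x)
  then obtain b y' where y: "y = b # y'" by (cases y) auto
  note [simp] = y
  have h: "set x \<subseteq> I" "set y' \<subseteq> I" "length x = length y'" "a \<in> I" "b \<in> I" using Cons by auto
  note sub = tid_sub[OF N(1)]
  let ?T = "\<lambda>p. \<Sum>c\<in>mi 1. lmul cm (lmul cm (basis (zip [a] c)) p) (basis (Sw (zip c [b])))"
  have e: "s1 (a # x) (b # y') = ?T (s1 x y')" using s1_append[of x y' "[a]" "[b]"] h by simp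
  have "?T (d1 x y') \<in> N"
    using Cons.IH[of y'] h by (intro csmul.subspace_sum[OF sub] tid_mult[OF N(1)]) auto
  moreover have "?T (d1 x y') = s1 (a # x) (b # y') - (if x = y' then s1 [a] [b] else 0)"
    unfolding e by (simp add: d1_def lmul_linear sum_subtractf s1_def cm_def)
  moreover have "d1 [a] [b] \<in> N" using N h unfolding ants_def by blast
  ultimately have "s1 (a # x) (b # y') - (if x = y' then s1 [a] [b] else 0) + (if x = y' then d1 [a] [b] else 0) \<in> N"
    using csmul.subspace_add[OF sub] csmul.subspace_0[OF sub] by auto
  then show ?case by (auto simp: d1_def split: if_splits)
qed

text \<open>Here the antipode brings the heads next to each other, so the relation for single
  letters is applied inside and the induction hypothesis outside.\<close>

lemma d2_all:
  assumes N: "tid N" "ants \<subseteq> N"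
  shows "set x \<subseteq> I \<Longrightarrow> set y \<subseteq> I \<Longrightarrow> length x = length y \<Longrightarrow> d2 x y \<in> N"
proof (induction x arbitrary: y)
  case Nil
  then show ?case by (simp add: d2_def s2_def csmul.subspace_0[OF tid_sub[OF N(1)]])
next
  case (Cons a x)
  then obtain b y' where y: "y = b # y'" by (cases y) auto
  note [simp] = y
  have h: "set x \<subseteq> I" "set y' \<subseteq> I" "length x = length y'" "a \<in> I" "b \<in> I" using Cons by auto
  note sub = tid_sub[OF N(1)]
  let ?T = "\<lambda>p. \<Sum>z\<in>mi (length x). lmul cm (lmul cm (basis (Sw (zip x z))) p) (basis (zip z y'))"
  have e: "s2 (a # x) (b # y') = ?T (s2 [a] [b])" using s2_append[of x y' "[a]" "[b]"] h by simp
  have "d2 [a] [b] \<in> N" using N h unfolding ants_def by blast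
  then have "?T (d2 [a] [b]) \<in> N"
    using h by (intro csmul.subspace_sum[OF sub] tid_mult[OF N(1)]) auto
  moreover have "?T (d2 [a] [b]) = s2 (a # x) (b # y') - (if a = b then s2 x y' else 0)"
    unfolding e by (simp add: d2_def lmul_linear sum_subtractf) (simp add: s2_def cm_def)
  moreover have "d2 x y' \<in> N" using Cons.IH[of y'] h by auto
  ultimately have "s2 (a # x) (b # y') - (if a = b then s2 x y' else 0) + (if a = b then d2 x y' else 0) \<in> N"
    using csmul.subspace_add[OF sub] csmul.subspace_0[OF sub] by auto
  then show ?case by (auto simp: d2_def split: if_splits)
qed

lemma lS_s1: assumes "set x \<subseteq> I" "set y \<subseteq> I" "length x = length y" shows "lS (s1 x y) = s2 (st y) (st x)"
proof -
  have "lS (s1 x y) = (\<Sum>z\<in>mi (length x). basis (zip z y @ zip (st z) (st x)))"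
    using assms by (simp add: lS_def s1_def lext_sum) (simp add: Sw_def)
  also have "\<dots> = (\<Sum>z\<in>mi (length x). basis (zip (st z) y @ zip (st (st z)) (st x)))"
    by (rule sum_mi_st[symmetric])
  also have "\<dots> = s2 (st y) (st x)"
    using assms by (simp add: s2_def Sw_def)
  finally show ?thesis .
qed

lemma lS_s2: assumes "set x \<subseteq> I" "set y \<subseteq> I" "length x = length y" shows "lS (s2 x y) = s1 (st y) (st x)"
  using lS_s1[of "st y" "st x"] assms lS_lS[of "s1 (st y) (st x)"] s1_psp[of "st y" "st x"] by simp

lemma lS_d1: assumes "set x \<subseteq> I" "set y \<subseteq> I" "length x = length y" shows "lS (d1 x y) = d2 (st y) (st x)"
  using lS_s1[OF assms] st_eq_iff[of y x] assms by (auto simp: d1_def d2_def lS_def lext_diff)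

lemma lS_d2: assumes "set x \<subseteq> I" "set y \<subseteq> I" "length x = length y" shows "lS (d2 x y) = d1 (st y) (st x)"
  using lS_s2[OF assms] st_eq_iff[of y x] assms by (auto simp: d1_def d2_def lS_def lext_diff)

end

section \<open>The relations generate coideals\<close>

lemma vanish2D:
  assumes "vanish2 X N b" "n \<in> N" "q \<in> psp X"
  shows "ceval (\<lambda>u. ceval (\<lambda>v. b u v) q) n = 0" "ceval (\<lambda>v. ceval (\<lambda>u. b u v) q) n = 0"
proof -
  have "ceval (\<lambda>v. ceval (\<lambda>u. b u v) n) q = ceval (\<lambda>_. 0) q"
    by (rule ceval_psp_cong[OF assms(3)]) (use assms in \<open>auto simp: vanish2_def\<close>)
  then show "ceval (\<lambda>u. ceval (\<lambda>v. b u v) q) n = 0" by (simp add: ceval_swap[of _ q n])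
  have "ceval (\<lambda>u. ceval (\<lambda>v. b u v) n) q = ceval (\<lambda>_. 0) q"
    by (rule ceval_psp_cong[OF assms(3)]) (use assms in \<open>auto simp: vanish2_def\<close>)
  then show "ceval (\<lambda>v. ceval (\<lambda>u. b u v) q) n = 0" by (simp add: ceval_swap[of _ q n])
qed

context orep
begin

lemma ceval_dl_append:
  assumes "u \<in> X" "v \<in> X"
  shows "ceval f (dl (u @ v)) = ceval (\<lambda>(a1, a2). ceval (\<lambda>(b1, b2). f (a1 @ b1, a2 @ b2)) (dl v)) (dl u)"
  by (simp add: dl_append[OF assms] ceval_lext ceval_pairs split_def cm_def)

text \<open>The elements with the coideal property form an ideal \<open>N'\<close>: multiplying by a
  word multiplies both legs of the coproduct by words, and a form that vanishes on \<open>N\<close>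
  in either argument keeps doing so after such a shift because \<open>N\<close> is an ideal. Only
  the generators remain to be checked.\<close>

lemma coideal_gen:
  assumes N: "tid N" and min: "\<And>N'. tid N' \<Longrightarrow> S \<subseteq> N' \<Longrightarrow> N \<subseteq> N'" and SX: "S \<subseteq> psp X"
    and e: "\<And>s. s \<in> S \<Longrightarrow> ceval ep s = 0"
    and d: "\<And>s b. s \<in> S \<Longrightarrow> vanish2 X N b \<Longrightarrow> ceval (\<lambda>(u, v). b u v) (lext dl s) = 0"
  shows "coideal X dl ep N"
proof -
  define N' where "N' = {p \<in> psp X. ceval ep p = 0 \<and>
    (\<forall>b. vanish2 X N b \<longrightarrow> ceval (\<lambda>(u, v). b u v) (lext dl p) = 0)}"
  have "tid N'"
    unfolding tid_iff
  proof (intro conjI ballI)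
    show "N' \<subseteq> psp X" by (auto simp: N'_def)
    show "csmul.subspace N'"
      by (auto simp: csmul.subspace_def N'_def psp_add psp_csmul ceval_linear lext_linear)
  next
    fix p u assume p: "p \<in> N'" and u: "u \<in> X"
    then have pX: "p \<in> psp X" and pe: "ceval ep p = 0"
      and pd: "\<And>b. vanish2 X N b \<Longrightarrow> ceval (\<lambda>(u, v). b u v) (lext dl p) = 0" by (auto simp: N'_def)
    have 1: "ceval ep (lmul cm (basis u) p) = ep u * ceval ep p"
      unfolding ceval_lmul ceval_basis ceval_fun_mult[symmetric]
      by (rule ceval_psp_cong[OF pX]) (simp add: cm_def ep_append u)
    have 2: "ceval ep (lmul cm p (basis u)) = ceval ep p * ep u"
      unfolding ceval_lmul ceval_basis ceval_fun_mult_right[symmetric]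
      by (rule ceval_psp_cong[OF pX]) (simp add: cm_def ep_append u)
    have 3: "ceval (\<lambda>(u, v). b u v) (lext dl (lmul cm (basis u) p)) = 0" if b: "vanish2 X N b" for b
    proof -
      have "ceval (\<lambda>(u, v). b u v) (lext dl (lmul cm (basis u) p))
        = ceval (\<lambda>v. ceval (\<lambda>(a1, a2). ceval (\<lambda>(b1, b2). b (a1 @ b1) (a2 @ b2)) (dl v)) (dl u)) p"
        unfolding ceval_lext ceval_lmul ceval_basis
        by (rule ceval_psp_cong[OF pX]) (simp add: cm_def ceval_dl_append u)
      also have "\<dots> = ceval (\<lambda>(a1, a2). ceval (\<lambda>(b1, b2). b (a1 @ b1) (a2 @ b2)) (lext dl p)) (dl u)"
        unfolding split_def ceval_lext by (rule ceval_swap)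
      also have "\<dots> = ceval (\<lambda>_. 0) (dl u)"
      proof (rule ceval_cong2[OF dl_psp[OF u]], simp only: prod.case)
        fix a1 a2 assume a: "a1 \<in> X" "a2 \<in> X"
        have "vanish2 X N (\<lambda>b1 b2. b (a1 @ b1) (a2 @ b2))"
          unfolding vanish2_def
        proof (intro ballI conjI)
          fix n v assume n: "n \<in> N" and v: "v \<in> X"
          have m: "lmul cm (basis a1) n \<in> N" "lmul cm (basis a2) n \<in> N" using N n a by (auto simp: tid_iff)
          have "ceval (\<lambda>u. b u (a2 @ v)) (lmul cm (basis a1) n) = 0"
            "ceval (\<lambda>v'. b (a1 @ v) v') (lmul cm (basis a2) n) = 0"
            using b m a v unfolding vanish2_def by (meson X_append)+
          then show "ceval (\<lambda>u. b (a1 @ u) (a2 @ v)) n = 0" "ceval (\<lambda>b2. b (a1 @ v) (a2 @ b2)) n = 0"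
            by (simp_all add: ceval_lmul cm_def)
        qed
        from pd[OF this] show "ceval (\<lambda>(b1, b2). b (a1 @ b1) (a2 @ b2)) (lext dl p) = 0" .
      qed
      finally show ?thesis by simp
    qed
    have 4: "ceval (\<lambda>(u, v). b u v) (lext dl (lmul cm p (basis u))) = 0" if b: "vanish2 X N b" for b
    proof -
      have "ceval (\<lambda>(u, v). b u v) (lext dl (lmul cm p (basis u)))
        = ceval (\<lambda>v. ceval (\<lambda>(b1, b2). ceval (\<lambda>(a1, a2). b (b1 @ a1) (b2 @ a2)) (dl u)) (dl v)) p"
        unfolding ceval_lext ceval_lmul ceval_basis
        by (rule ceval_psp_cong[OF pX]) (simp add: cm_def ceval_dl_append u)
      also have "\<dots> = ceval (\<lambda>(b1, b2). ceval (\<lambda>(a1, a2). b (b1 @ a1) (b2 @ a2)) (dl u)) (lext dl p)"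
        by (simp add: ceval_lext)
      also have "\<dots> = ceval (\<lambda>(a1, a2). ceval (\<lambda>(b1, b2). b (b1 @ a1) (b2 @ a2)) (lext dl p)) (dl u)"
        unfolding split_def by (rule ceval_swap)
      also have "\<dots> = ceval (\<lambda>_. 0) (dl u)"
      proof (rule ceval_cong2[OF dl_psp[OF u]], simp only: prod.case)
        fix a1 a2 assume a: "a1 \<in> X" "a2 \<in> X"
        have "vanish2 X N (\<lambda>b1 b2. b (b1 @ a1) (b2 @ a2))"
          unfolding vanish2_def
        proof (intro ballI conjI)
          fix n v assume n: "n \<in> N" and v: "v \<in> X"
          have m: "lmul cm n (basis a1) \<in> N" "lmul cm n (basis a2) \<in> N" using N n a by (auto simp: tid_iff)
          have "ceval (\<lambda>u. b u (v @ a2)) (lmul cm n (basis a1)) = 0"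
            "ceval (\<lambda>v'. b (v @ a1) v') (lmul cm n (basis a2)) = 0"
            using b m a v unfolding vanish2_def by (meson X_append)+
          then show "ceval (\<lambda>u. b (u @ a1) (v @ a2)) n = 0" "ceval (\<lambda>b2. b (v @ a1) (b2 @ a2)) n = 0"
            by (simp_all add: ceval_lmul cm_def)
        qed
        from pd[OF this] show "ceval (\<lambda>(b1, b2). b (b1 @ a1) (b2 @ a2)) (lext dl p) = 0" .
      qed
      finally show ?thesis by simp
    qed
    show "lmul cm (basis u) p \<in> N'" "lmul cm p (basis u) \<in> N'"
      using 1 2 3 4 pe pX u by (auto simp: N'_def lcm_psp)
  qed
  moreover have "S \<subseteq> N'" using SX e d by (auto simp: N'_def)
  ultimately have "N \<subseteq> N'" by (rule min)
  then show ?thesis unfolding coideal_def N'_def by blast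
qed

lemma dl_keys: assumes "w \<in> X"
  shows "dl w \<in> psp {(u, v). u \<in> X \<and> v \<in> X \<and> wl u = wl w \<and> wr u = wl v \<and> wr v = wr w}"
  unfolding dl_def by (rule psp_sum) (use assms in auto)

lemma Rw_dl: assumes "v \<in> X" shows "lext dl (Rw h v) = lext (\<lambda>(b1, b2). pairs (basis b1) (Rw h b2)) (dl v)"
proof (rule ceval_ext)
  fix f
  from assms obtain z w where [simp]: "set z \<subseteq> I" "set w \<subseteq> I" "length z = length w" "v = zip z w"
    by (rule XE)
  show "ceval f (lext dl (Rw h v)) = ceval f (lext (\<lambda>(b1, b2). pairs (basis b1) (Rw h b2)) (dl v))"
    by (simp add: ceval_dl ceval_lext ceval_pairs ceval_Rw split_def sum_distrib_left) (rule sum.swap)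
qed

text \<open>The coproduct of \<open>u\<close> times \<open>v\<close> moved by its left degree is the
  sum of \<open>a1 (Lw b1) \<otimes> a2 b2\<close>. Using the relation in the first leg gives
  \<open>(Rw b1) a1 \<otimes> a2 b2\<close>, where the action is by the inverse of the degree
  \<open>s\<close> of the index contracted in \<open>u\<close>. Inserting \<open>s\<close> on the
  contracted index of \<open>v\<close> transfers it to the second leg,
  \<open>b1 a1 \<otimes> a2 (Lw b2)\<close>, where the relation applies again and produces the
  coproduct of the other term.\<close>

lemma frt_dl:
  assumes N: "tid N" "frts \<subseteq> N" and b: "vanish2 X N b" and u: "u \<in> X" and v: "v \<in> X"
  shows "ceval (\<lambda>(u, v). b u v) (lext dl (frt u v)) = 0"
proof -
  let ?a = "dg (wl u)" and ?k = "inv dg (wr u)"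
  let ?B = "\<lambda>p q. ceval (\<lambda>s. ceval (b s) q) p"
  have ac: "?a \<in> carrier G" and kc: "?k \<in> carrier G" using u by auto
  have frtN: "frt s t \<in> N" if "s \<in> X" "t \<in> X" for s t by (rule frt_all[OF N that])
  have B1: "?B (lmul cm (basis s) (Lw (dg (wl s)) t)) q = ?B (lmul cm (Rw (inv dg (wr s)) t) (basis s)) q"
    if "s \<in> X" "t \<in> X" "q \<in> psp X" for s t q
    using vanish2D(1)[OF b frtN[OF that(1,2)] that(3)] by (simp add: frt_def ceval_diff)
  have B2: "?B p (lmul cm (basis s) (Lw (dg (wl s)) t)) = ?B p (lmul cm (Rw (inv dg (wr s)) t) (basis s))"
    if "s \<in> X" "t \<in> X" "p \<in> psp X" for s t p
  proof -
    have "ceval (\<lambda>v. ceval (\<lambda>u. b u v) p) (frt s t) = 0" by (rule vanish2D(2)[OF b frtN[OF that(1,2)] that(3)])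
    then show ?thesis
      unfolding ceval_swap[of _ _ p] by (simp add: frt_def ceval_diff)
  qed
  have "ceval (\<lambda>(u, v). b u v) (lext dl (lmul cm (basis u) (Lw ?a v)))
      = ceval (\<lambda>v'. ceval (\<lambda>(b1, b2). ceval (\<lambda>(a1, a2). b (a1 @ b1) (a2 @ b2)) (dl u)) (dl v')) (Lw ?a v)"
    unfolding ceval_lext ceval_lmul ceval_basis
    by (rule ceval_psp_cong[OF Lw_psp[OF ac v]])
      (simp add: cm_def ceval_dl_append u split_def ceval_swap[of _ "dl _" "dl u"])
  also have "\<dots> = ceval (\<lambda>(b1, b2). ceval (\<lambda>(a1, a2). b (a1 @ b1) (a2 @ b2)) (dl u)) (lext dl (Lw ?a v))"
    by (simp add: ceval_lext)
  also have "\<dots> = ceval (\<lambda>(b1, b2). ceval (\<lambda>b1'. ceval (\<lambda>(a1, a2). b (a1 @ b1') (a2 @ b2)) (dl u)) (Lw ?a b1)) (dl v)"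
    by (simp add: Lw_dl[OF v] ceval_lext ceval_pairs split_def)
  also have "\<dots> = ceval (\<lambda>(b1, b2). ceval (\<lambda>(a1, a2). ceval (\<lambda>b1'. b (a1 @ b1') (a2 @ b2)) (Lw ?a b1)) (dl u)) (dl v)"
    unfolding split_def by (intro ceval_cong ceval_swap)
  also have "\<dots> = ceval (\<lambda>(a1, a2). ceval (\<lambda>(b1, b2). ceval (\<lambda>b1'. b (a1 @ b1') (a2 @ b2)) (Lw ?a b1)) (dl v)) (dl u)"
    unfolding split_def by (rule ceval_swap)
  also have "\<dots> = ceval (\<lambda>(a1, a2). ceval (\<lambda>(b1, b2). ceval (\<lambda>b2'. b (b1 @ a1) (b2' @ a2)) (Rw ?k b2)) (dl v)) (dl u)"
  proof (rule ceval_psp_cong[OF dl_keys[OF u]], safe)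
    fix a1 a2 assume a: "a1 \<in> X" "a2 \<in> X" "wl a1 = wl u" "wr a1 = wl a2" "wr a2 = wr u"
    let ?s = "dg (wl a2)"
    have s: "?s \<in> carrier G" using a by simp
    have "ceval (\<lambda>(b1, b2). ceval (\<lambda>b1'. b (a1 @ b1') (a2 @ b2)) (Lw ?a b1)) (dl v)
      = ceval (\<lambda>(b1, b2). ?B (lmul cm (Rw (inv ?s) b1) (basis a1)) (basis (a2 @ b2))) (dl v)"
    proof (rule ceval_cong2[OF dl_psp[OF v]], simp only: prod.case)
      fix b1 b2 assume "b1 \<in> X" "b2 \<in> X"
      then show "ceval (\<lambda>b1'. b (a1 @ b1') (a2 @ b2)) (Lw ?a b1) = ?B (lmul cm (Rw (inv ?s) b1) (basis a1)) (basis (a2 @ b2))"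
        using B1[of a1 b1 "basis (a2 @ b2)"] a by (simp add: ceval_lmul cm_def)
    qed
    also have "\<dots> = ceval (\<lambda>(b1, b2). ?B (lmul cm (Rw (inv ?s) b1) (basis a1)) (basis (a2 @ b2)))
        (lext (\<lambda>(b1, b2). pairs (Rw ?s b1) (Lw ?s b2)) (dl v))"
      by (simp only: Rw_Lw_dl[OF v s])
    also have "\<dots> = ceval (\<lambda>(b1, b2). ?B (basis (b1 @ a1)) (lmul cm (basis a2) (Lw ?s b2))) (dl v)"
      unfolding ceval_lext
    proof (rule ceval_cong2[OF dl_psp[OF v]], simp only: prod.case)
      fix b1 b2 assume bb: "b1 \<in> X" "b2 \<in> X"
      have "ceval (\<lambda>x. ceval (\<lambda>y. ?B (lmul cm (Rw (inv ?s) x) (basis a1)) (basis (a2 @ y))) (Lw ?s b2)) (Rw ?s b1)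
        = ceval (\<lambda>y. ?B (lmul cm (lext (Rw (inv ?s)) (Rw ?s b1)) (basis a1)) (basis (a2 @ y))) (Lw ?s b2)"
        by (subst ceval_swap) (simp add: ceval_lmul ceval_lext)
      also have "\<dots> = ?B (basis (b1 @ a1)) (lmul cm (basis a2) (Lw ?s b2))"
        using s bb by (simp add: Rw_mult Rw_one ceval_lmul cm_def)
      finally show "ceval (\<lambda>(b1, b2). ?B (lmul cm (Rw (inv ?s) b1) (basis a1)) (basis (a2 @ b2))) (pairs (Rw ?s b1) (Lw ?s b2))
        = ?B (basis (b1 @ a1)) (lmul cm (basis a2) (Lw ?s b2))" by (simp add: ceval_pairs)
    qed
    also have "\<dots> = ceval (\<lambda>(b1, b2). ceval (\<lambda>b2'. b (b1 @ a1) (b2' @ a2)) (Rw ?k b2)) (dl v)"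
    proof (rule ceval_cong2[OF dl_psp[OF v]], simp only: prod.case)
      fix b1 b2 assume "b1 \<in> X" "b2 \<in> X"
      then show "?B (basis (b1 @ a1)) (lmul cm (basis a2) (Lw ?s b2)) = ceval (\<lambda>b2'. b (b1 @ a1) (b2' @ a2)) (Rw ?k b2)"
        using B2[of a2 b2 "basis (b1 @ a1)"] a by (simp add: ceval_lmul cm_def)
    qed
    finally show "ceval (\<lambda>(b1, b2). ceval (\<lambda>b1'. b (a1 @ b1') (a2 @ b2)) (Lw ?a b1)) (dl v)
      = ceval (\<lambda>(b1, b2). ceval (\<lambda>b2'. b (b1 @ a1) (b2' @ a2)) (Rw ?k b2)) (dl v)" .
  qed
  also have "\<dots> = ceval (\<lambda>(b1, b2). ceval (\<lambda>(a1, a2). ceval (\<lambda>b2'. b (b1 @ a1) (b2' @ a2)) (Rw ?k b2)) (dl u)) (dl v)"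
    unfolding split_def by (rule ceval_swap)
  also have "\<dots> = ceval (\<lambda>(b1, b2). ceval (\<lambda>b2'. ceval (\<lambda>(a1, a2). b (b1 @ a1) (b2' @ a2)) (dl u)) (Rw ?k b2)) (dl v)"
    unfolding split_def by (intro ceval_cong ceval_swap)
  also have "\<dots> = ceval (\<lambda>(b1, b2). ceval (\<lambda>(a1, a2). b (b1 @ a1) (b2 @ a2)) (dl u)) (lext dl (Rw ?k v))"
    by (simp add: Rw_dl[OF v] ceval_lext ceval_pairs split_def)
  also have "\<dots> = ceval (\<lambda>(u, v). b u v) (lext dl (lmul cm (Rw ?k v) (basis u)))"
    unfolding ceval_lext ceval_lmul ceval_basis
    by (rule ceval_psp_cong[OF Rw_psp[OF kc v]]) (simp add: cm_def ceval_dl_append u)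
  finally show ?thesis by (simp add: frt_def lext_diff ceval_diff)
qed

text \<open>The antipode reverses coproducts, so the two inner legs meet in the second tensor factor
  and form \<open>s1\<close> of the two newly contracted indices. For \<open>s2\<close> they meet in
  the first factor.\<close>

lemma s1_dl: assumes "set x \<subseteq> I" "set y \<subseteq> I" "length x = length y"
  shows "ceval f (lext dl (s1 x y)) = (\<Sum>s\<in>mi (length x). \<Sum>t\<in>mi (length x).
    ceval (\<lambda>q. f (zip x s @ Sw (zip t y), q)) (s1 s t))"
proof -
  note [simp] = assms
  let ?M = "mi (length y)"
  have "ceval f (lext dl (s1 x y)) = (\<Sum>z\<in>?M. \<Sum>s\<in>?M. \<Sum>t\<in>?M.
      f (zip x s @ zip (st y) t, zip s z @ zip t (st z)))"
    by (simp add: s1_def lext_linear ceval_linear Sw_def zip_append[symmetric] ceval_dl sum_mi_append del: zip_append)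
  also have "\<dots> = (\<Sum>z\<in>?M. \<Sum>s\<in>?M. \<Sum>t\<in>?M. f (zip x s @ zip (st y) (st t), zip s z @ zip (st t) (st z)))"
    by (intro sum.cong refl sum_mi_st[symmetric])
  also have "\<dots> = (\<Sum>s\<in>?M. \<Sum>t\<in>?M. \<Sum>z\<in>?M. f (zip x s @ zip (st y) (st t), zip s z @ zip (st t) (st z)))"
    by (subst sum.swap) (intro sum.cong refl sum.swap)
  finally show ?thesis by (simp add: s1_def Sw_def ceval_linear)
qed

lemma s2_dl: assumes "set x \<subseteq> I" "set y \<subseteq> I" "length x = length y"
  shows "ceval f (lext dl (s2 x y)) = (\<Sum>s\<in>mi (length x). \<Sum>t\<in>mi (length x).
    ceval (\<lambda>p. f (p, Sw (zip x s) @ zip t y)) (s2 s t))"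
proof -
  note [simp] = assms
  let ?M = "mi (length y)"
  have "ceval f (lext dl (s2 x y)) = (\<Sum>z\<in>?M. \<Sum>s\<in>?M. \<Sum>t\<in>?M.
      f (zip (st z) s @ zip z t, zip s (st x) @ zip t y))"
    by (simp add: s2_def lext_linear ceval_linear Sw_def zip_append[symmetric] ceval_dl sum_mi_append del: zip_append)
  also have "\<dots> = (\<Sum>z\<in>?M. \<Sum>s\<in>?M. \<Sum>t\<in>?M. f (zip (st z) (st s) @ zip z t, zip (st s) (st x) @ zip t y))"
    by (intro sum.cong refl sum_mi_st[symmetric])
  also have "\<dots> = (\<Sum>s\<in>?M. \<Sum>t\<in>?M. \<Sum>z\<in>?M. f (zip (st z) (st s) @ zip z t, zip (st s) (st x) @ zip t y))"
    by (subst sum.swap) (intro sum.cong refl sum.swap)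
  finally show ?thesis by (simp add: s2_def Sw_def ceval_linear)
qed

lemma sum2_delta: "(\<Sum>s\<in>mi n. \<Sum>t\<in>mi n. (if s = t then f s t else 0)) = (\<Sum>s\<in>mi n. f s s :: complex)"
  by (intro sum.cong refl) (simp add: sum.delta del: mi_iff)

text \<open>Modulo \<open>N\<close> the inner factor found in \<open>s1_dl\<close> and
  \<open>s2_dl\<close> is a Kronecker delta in the two contracted indices, and the other leg then
  sums up to \<open>s1 x y\<close> or \<open>s2 x y\<close> again.\<close>

lemma ants_dl:
  assumes N: "tid N" "ants \<subseteq> N" and b: "vanish2 X N b"
    and x: "set x \<subseteq> I" "set y \<subseteq> I" "length x = length y"
  shows "ceval (\<lambda>(u, v). b u v) (lext dl (d1 x y)) = 0" "ceval (\<lambda>(u, v). b u v) (lext dl (d2 x y)) = 0"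
proof -
  note [simp] = x
  let ?M = "mi (length y)"
  have dn: "dl [] = basis ([], [])" by (simp add: dl_def)
  have vN: "ceval (b p) n = 0" "ceval (\<lambda>u. b u p) n = 0" if "n \<in> N" "p \<in> X" for p n
    using b that by (auto simp: vanish2_def)
  have 1: "ceval (\<lambda>(u, v). b u v) (lext dl (s1 x y)) = (if x = y then b [] [] else 0)"
  proof -
    have "ceval (\<lambda>(u, v). b u v) (lext dl (s1 x y))
        = (\<Sum>s\<in>?M. \<Sum>t\<in>?M. if s = t then b (zip x s @ Sw (zip t y)) [] else 0)"
      unfolding s1_dl[OF x] using vN(1)[OF d1_all[OF N]]
      by (intro sum.cong) (auto simp: d1_def ceval_diff)
    also have "\<dots> = ceval (\<lambda>u. b u []) (s1 x y)" by (simp add: sum2_delta s1_def ceval_linear)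
    also have "\<dots> = (if x = y then b [] [] else 0)"
      using vN(2)[OF d1_all[OF N x], of "[]"] by (auto simp: d1_def ceval_diff split: if_splits)
    finally show ?thesis .
  qed
  then show "ceval (\<lambda>(u, v). b u v) (lext dl (d1 x y)) = 0"
    by (auto simp: d1_def lext_diff ceval_diff dn)
  have 2: "ceval (\<lambda>(u, v). b u v) (lext dl (s2 x y)) = (if x = y then b [] [] else 0)"
  proof -
    have "ceval (\<lambda>(u, v). b u v) (lext dl (s2 x y))
        = (\<Sum>s\<in>?M. \<Sum>t\<in>?M. if s = t then b [] (Sw (zip x s) @ zip t y) else 0)"
      unfolding s2_dl[OF x] using vN(2)[OF d2_all[OF N]]
      by (intro sum.cong) (auto simp: d2_def ceval_diff)
    also have "\<dots> = ceval (b []) (s2 x y)" by (simp add: sum2_delta s2_def ceval_linear)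
    also have "\<dots> = (if x = y then b [] [] else 0)"
      using vN(1)[OF d2_all[OF N x], of "[]"] by (auto simp: d2_def ceval_diff split: if_splits)
    finally show ?thesis .
  qed
  then show "ceval (\<lambda>(u, v). b u v) (lext dl (d2 x y)) = 0"
    by (auto simp: d2_def lext_diff ceval_diff dn)
qed

text \<open>Either term has as counit \<open>ep u\<close> times an entry of \<open>rho\<close>; the
  two entries agree by symmetry under inversion, since \<open>ep u\<close> is zero unless the left
  and right index words of \<open>u\<close> coincide.\<close>

lemma ep_frt: assumes "u \<in> X" "v \<in> X" shows "ceval ep (frt u v) = 0"
proof -
  let ?a = "dg (wl u)" and ?k = "inv dg (wr u)"
  from assms(2) obtain z w where [simp]: "set z \<subseteq> I" "set w \<subseteq> I" "length z = length w" "v = zip z w"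
    by (rule XE)
  have c: "?a \<in> carrier G" "?k \<in> carrier G" using assms by auto
  have "ceval ep (lmul cm (basis u) (Lw ?a v)) = ceval (\<lambda>v'. ep u * ep v') (Lw ?a v)"
    unfolding ceval_lmul ceval_basis
    by (rule ceval_psp_cong[OF Lw_psp[OF c(1) assms(2)]]) (simp add: cm_def ep_append assms)
  also have "\<dots> = ep u * ceval ep (Lw ?a v)" by (rule ceval_fun_mult)
  also have "ceval ep (Lw ?a v) = (\<Sum>s\<in>mi (length w). (if s = w then 1 else 0) * rho ?a s z)"
    by (simp add: ceval_Lw mult.commute)
  also have "\<dots> = rho ?a w z" by (rule sum_if_eq(1)) simp
  finally have 1: "ceval ep (lmul cm (basis u) (Lw ?a v)) = ep u * rho ?a w z" .
  have "ceval ep (lmul cm (Rw ?k v) (basis u)) = ceval (\<lambda>v'. ep v' * ep u) (Rw ?k v)"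
    unfolding ceval_lmul ceval_basis
    by (rule ceval_psp_cong[OF Rw_psp[OF c(2) assms(2)]]) (simp add: cm_def ep_append assms)
  also have "\<dots> = ceval ep (Rw ?k v) * ep u" by (rule ceval_fun_mult_right)
  also have "ceval ep (Rw ?k v) = (\<Sum>s\<in>mi (length w). (if z = s then 1 else 0) * rho ?k s w)"
    by (simp add: ceval_Rw mult.commute)
  also have "\<dots> = rho ?k z w" by (rule sum_if_eq(2)) simp
  finally have 2: "ceval ep (lmul cm (Rw ?k v) (basis u)) = rho ?k z w * ep u" .
  have "rho ?k z w = rho (dg (wr u)) w z" using rho_inv[of "dg (wr u)" z w] assms by simp
  then show ?thesis
    unfolding frt_def ceval_diff 1 2 by (simp add: ep_def)
qed

lemma ep_ants: assumes "set x \<subseteq> I" "set y \<subseteq> I" "length x = length y"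
  shows "ceval ep (d1 x y) = 0" "ceval ep (d2 x y) = 0"
proof -
  note [simp] = assms
  have e: "ep (Sw u) = ep u" if "u \<in> X" for u using that st_eq_iff[of "wr u" "wl u"] by (auto simp: ep_def)
  have s: "ceval ep (s1 x y) = (\<Sum>z\<in>mi (length y). (if x = z then 1 else 0) * (if z = y then 1 else 0))"
    by (simp add: s1_def ceval_linear ep_append e)
  have t: "ceval ep (s2 x y) = (\<Sum>z\<in>mi (length y). (if x = z then 1 else 0) * (if z = y then 1 else 0))"
    by (simp add: s2_def ceval_linear ep_append e)
  have r: "(\<Sum>z\<in>mi (length y). (if x = z then 1 else 0) * (if z = y then 1 else 0 :: complex)) = (if x = y then 1 else 0)"
    by (rule sum_if_eq(2)) simp
  have "ep [] = 1" by (simp add: ep_def)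
  then show "ceval ep (d1 x y) = 0" "ceval ep (d2 x y) = 0"
    by (auto simp: d1_def d2_def ceval_diff s t r)
qed

section \<open>The ideals of \<open>A\<close> and \<open>H\<close> and the antipode\<close>

definition "NA = tgen frts"
definition "NH = tgen (frts \<union> ants)"

lemma frts_psp: "frts \<subseteq> psp X" by (auto simp: frts_def intro!: frt_psp)
lemma ants_psp: "ants \<subseteq> psp X" by (auto simp: ants_def intro!: d1_psp d2_psp)

lemma NA_tid: "tid NA" and NH_tid: "tid NH"
  using frts_psp ants_psp by (auto simp: NA_def NH_def intro!: tgen_tid)

lemma NA_frts: "frts \<subseteq> NA" and NH_frts: "frts \<subseteq> NH" and NH_ants: "ants \<subseteq> NH"
  using tgen_incl[of frts] tgen_incl[of "frts \<union> ants"] unfolding NA_def NH_def by blast+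

lemma coideal_NA: "coideal X dl ep NA"
proof (rule coideal_gen[OF NA_tid _ frts_psp])
  fix s assume "s \<in> frts"
  then obtain l l' where s: "s = frt [l] [l']" "[l] \<in> X" "[l'] \<in> X" by (auto simp: frts_def)
  show "ceval ep s = 0" using s by (simp add: ep_frt)
  show "ceval (\<lambda>(u, v). b u v) (lext dl s) = 0" if "vanish2 X NA b" for b
    using frt_dl[OF NA_tid NA_frts that] s by simp
qed (simp add: NA_def tgen_min)

lemma coideal_NH: "coideal X dl ep NH"
proof (rule coideal_gen[OF NH_tid, of "frts \<union> ants"])
  fix s assume "s \<in> frts \<union> ants"
  then consider l l' where "s = frt [l] [l']" "[l] \<in> X" "[l'] \<in> X"
    | a b where "s = d1 [a] [b] \<or> s = d2 [a] [b]" "a \<in> I" "b \<in> I"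
    by (fastforce simp: frts_def ants_def)
  note cs = this
  show "ceval ep s = 0" by (rule cs) (auto simp: ep_frt ep_ants)
  show "ceval (\<lambda>(u, v). b u v) (lext dl s) = 0" if "vanish2 X NH b" for b
    by (rule cs) (auto simp: frt_dl[OF NH_tid NH_frts that] ants_dl[OF NH_tid NH_ants that])
qed (use frts_psp ants_psp in \<open>simp_all add: NH_def tgen_min\<close>)

lemma lS_tid: "tid N \<Longrightarrow> tid {p \<in> psp X. lS p \<in> N}"
  by (auto simp: tid_iff csmul.subspace_def lS_lmul lcm_psp psp_add psp_csmul)
    (auto simp: lS_def lext_linear)

lemma lS_frts: assumes N: "tid N" "frts \<subseteq> N" shows "frts \<subseteq> {p \<in> psp X. lS p \<in> N}"
proof
  fix s assume "s \<in> frts"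
  then obtain l l' where s: "s = frt [l] [l']" "[l] \<in> X" "[l'] \<in> X" by (auto simp: frts_def)
  then have "frt (Sw [l]) (Sw [l']) \<in> N" by (intro frt_all[OF N]) auto
  then show "s \<in> {p \<in> psp X. lS p \<in> N}"
    using s csmul.subspace_neg[OF tid_sub[OF N(1)]] by (simp add: lS_frt frt_psp del: X_cons)
qed

lemma lS_NA: assumes "p \<in> NA" shows "lS p \<in> NA"
proof -
  have "NA \<subseteq> {p \<in> psp X. lS p \<in> NA}"
    unfolding NA_def using lS_frts[OF NA_tid NA_frts] lS_tid[OF NA_tid] by (intro tgen_min) (simp_all add: NA_def)
  then show ?thesis using assms by blast
qed

lemma lS_NH: assumes "p \<in> NH" shows "lS p \<in> NH"
proof -
  have "ants \<subseteq> {p \<in> psp X. lS p \<in> NH}"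
  proof
    fix s assume "s \<in> ants"
    then obtain a b where s: "s = d1 [a] [b] \<or> s = d2 [a] [b]" "set [a] \<subseteq> I" "set [b] \<subseteq> I"
      by (fastforce simp: ants_def)
    have "d1 (st [b]) (st [a]) \<in> NH" "d2 (st [b]) (st [a]) \<in> NH"
      using s by (intro d1_all[OF NH_tid NH_ants] d2_all[OF NH_tid NH_ants] st_closed; simp)+
    then show "s \<in> {p \<in> psp X. lS p \<in> NH}"
      using s lS_d1[of "[a]" "[b]"] lS_d2[of "[a]" "[b]"] d1_psp[of "[a]" "[b]"] d2_psp[of "[a]" "[b]"] by auto
  qed
  then have "NH \<subseteq> {p \<in> psp X. lS p \<in> NH}"
    unfolding NH_def using lS_frts[OF NH_tid NH_frts] lS_tid[OF NH_tid]
    by (intro tgen_min) (simp_all add: NH_def)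
  then show ?thesis using assms by blast
qed

section \<open>The map from words to the dual double\<close>

definition dv :: "'g \<times> 'g \<Rightarrow> 'g \<times> 'g \<Rightarrow> ('g \<times> 'g \<Rightarrow>\<^sub>0 complex)" where
  "dv = (\<lambda>(g, h) (u, v). if g = u then basis (g, h \<otimes> v) else 0)"

text \<open>The multiplicative extension of \<open>r_elt\<close> (see \<open>r_elt_ph\<close>), with
  the sum over the centraliser replaced by a sum over \<open>G\<close>: the entry of
  \<open>rho\<close> vanishes unless conjugation by \<open>g\<close> carries the right degree of
  \<open>u\<close> to its left degree.\<close>

definition ph :: "('a \<times> 'a) list \<Rightarrow> ('g \<times> 'g \<Rightarrow>\<^sub>0 complex)" where
  "ph u = (\<Sum>g\<in>carrier G. csmul (rho (inv g) (wr u) (wl u)) (basis (g, inv dg (wr u))))"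

lemma ceval_ph: "length x = length y \<Longrightarrow>
    ceval f (ph (zip x y)) = (\<Sum>g\<in>carrier G. rho (inv g) y x * f (g, inv dg y))"
  by (simp add: ph_def ceval_linear)

lemma ph_append: assumes "u \<in> X" "v \<in> X" shows "ph (u @ v) = lmul dv (ph u) (ph v)"
proof (rule ceval_ext)
  fix f
  from assms(1) obtain x y where [simp]: "set x \<subseteq> I" "set y \<subseteq> I" "length x = length y" "u = zip x y"
    by (rule XE)
  from assms(2) obtain z w where [simp]: "set z \<subseteq> I" "set w \<subseteq> I" "length z = length w" "v = zip z w"
    by (rule XE)
  have c: "dg y \<in> carrier G" "dg w \<in> carrier G" by simp_all
  have "ceval f (lmul dv (ph u) (ph v)) = (\<Sum>g\<in>carrier G. \<Sum>k\<in>carrier G.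
      if g = k then rho (inv g) y x * (rho (inv k) w z * f (g, inv dg y \<otimes> inv dg w)) else 0)"
    by (simp add: ceval_lmul ceval_ph dv_def sum_distrib_left)
      (intro sum.cong refl, simp)
  also have "\<dots> = (\<Sum>g\<in>carrier G. rho (inv g) y x * (rho (inv g) w z * f (g, inv dg y \<otimes> inv dg w)))"
    using finG by (intro sum.cong refl) (simp add: sum.delta)
  also have "\<dots> = ceval f (ph (u @ v))"
    using c by (simp add: zip_append[symmetric] ceval_ph inv_mult_group mult_ac del: zip_append)
  finally show "ceval f (ph (u @ v)) = ceval f (lmul dv (ph u) (ph v))" by simp
qed

lemma lph_lmul:
  assumes "p \<in> psp X" "q \<in> psp X"
  shows "lext ph (lmul cm p q) = lmul dv (lext ph p) (lext ph q)"
  unfolding lext_lmul lmul_lext_left lmul_lext_right lext_swap[of _ p q]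
  by (intro lext_psp_cong[OF assms(1)] lext_psp_cong[OF assms(2)]) (simp add: cm_def ph_append)

lemma ceval_lph_Lw:
  assumes "k \<in> carrier G" "set z \<subseteq> I" "set w \<subseteq> I" "length z = length w"
  shows "ceval f (lext ph (Lw k (zip z w))) = (\<Sum>g\<in>carrier G. rho (inv g \<otimes> k) w z * f (g, inv dg w))"
proof -
  note [simp] = assms
  have "ceval f (lext ph (Lw k (zip z w)))
      = (\<Sum>v\<in>mi (length w). \<Sum>g\<in>carrier G. rho k v z * (rho (inv g) w v * f (g, inv dg w)))"
    by (simp add: ceval_lext ceval_Lw ceval_ph sum_distrib_left)
  also have "\<dots> = (\<Sum>g\<in>carrier G. (\<Sum>v\<in>mi (length w). rho (inv g) w v * rho k v z) * f (g, inv dg w))"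
    by (subst sum.swap) (simp add: sum_distrib_left mult_ac)
  finally show ?thesis by (simp add: rho_mult)
qed

lemma ceval_lph_Rw:
  assumes "k \<in> carrier G" "set z \<subseteq> I" "set w \<subseteq> I" "length z = length w"
  shows "ceval f (lext ph (Rw k (zip z w)))
    = (\<Sum>g\<in>carrier G. rho (inv k \<otimes> inv g) w z * f (g, inv (k \<otimes> dg w \<otimes> inv k)))"
proof -
  note [simp] = assms
  have "ceval f (lext ph (Rw k (zip z w)))
      = (\<Sum>v\<in>mi (length w). rho k v w * (\<Sum>g\<in>carrier G. rho (inv g) v z * f (g, inv dg v)))"
    by (simp add: ceval_lext ceval_Rw ceval_ph)
  also have "\<dots> = (\<Sum>v\<in>mi (length w). rho (inv k) w v * (\<Sum>g\<in>carrier G. rho (inv g) v z * f (g, inv (k \<otimes> dg w \<otimes> inv k))))"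
  proof (intro sum.cong refl)
    fix v assume "v \<in> mi (length w)"
    then show "rho k v w * (\<Sum>g\<in>carrier G. rho (inv g) v z * f (g, inv dg v))
      = rho (inv k) w v * (\<Sum>g\<in>carrier G. rho (inv g) v z * f (g, inv (k \<otimes> dg w \<otimes> inv k)))"
      using rho_deg[of k w v] rho_inv[of k w v] by (cases "rho k v w = 0") auto
  qed
  also have "\<dots> = (\<Sum>v\<in>mi (length w). \<Sum>g\<in>carrier G. rho (inv k) w v * (rho (inv g) v z * f (g, inv (k \<otimes> dg w \<otimes> inv k))))"
    by (simp only: sum_distrib_left)
  also have "\<dots> = (\<Sum>g\<in>carrier G. (\<Sum>v\<in>mi (length w). rho (inv k) w v * rho (inv g) v z) * f (g, inv (k \<otimes> dg w \<otimes> inv k)))"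
    by (subst sum.swap) (simp add: sum_distrib_left mult_ac)
  finally show ?thesis by (simp add: rho_mult)
qed

text \<open>A nonzero coefficient of \<open>u\<close> at \<open>g\<close> forces \<open>g^-1\<close>
  times \<open>dg x\<close> to equal \<open>dg y\<close> times \<open>g^-1\<close>. This identifies
  the matrix entries produced by the left action on \<open>v\<close> with those produced by the
  right action.\<close>

lemma lph_frt: assumes u: "u \<in> X" and v: "v \<in> X" shows "lext ph (frt u v) = 0"
proof -
  from u obtain x y where [simp]: "set x \<subseteq> I" "set y \<subseteq> I" "length x = length y" "u = zip x y"
    by (rule XE)
  from v obtain z w where [simp]: "set z \<subseteq> I" "set w \<subseteq> I" "length z = length w" "v = zip z w"
    by (rule XE)
  have c: "dg x \<in> carrier G" "dg y \<in> carrier G" "dg w \<in> carrier G" by simp_all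
  have "lmul dv (ph u) (lext ph (Lw (dg x) v)) = lmul dv (lext ph (Rw (inv dg y) v)) (ph u)"
  proof (rule ceval_ext)
    fix f
    have "ceval f (lmul dv (ph u) (lext ph (Lw (dg x) v))) = (\<Sum>g\<in>carrier G. \<Sum>k\<in>carrier G.
      if g = k then rho (inv g) y x * (rho (inv k \<otimes> dg x) w z * f (g, inv dg y \<otimes> inv dg w)) else 0)"
      by (simp add: ceval_lmul ceval_ph ceval_lph_Lw dv_def sum_distrib_left) (intro sum.cong refl, simp)
    also have "\<dots> = (\<Sum>g\<in>carrier G. rho (inv g) y x * (rho (inv g \<otimes> dg x) w z * f (g, inv dg y \<otimes> inv dg w)))"
      using finG by (intro sum.cong refl) (simp add: sum.delta)
    also have "\<dots> = (\<Sum>g\<in>carrier G. rho (inv g) y x * (rho (dg y \<otimes> inv g) w z * f (g, inv dg y \<otimes> inv dg w)))"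
    proof (intro sum.cong refl)
      fix g assume [simp]: "g \<in> carrier G"
      show "rho (inv g) y x * (rho (inv g \<otimes> dg x) w z * f (g, inv dg y \<otimes> inv dg w))
          = rho (inv g) y x * (rho (dg y \<otimes> inv g) w z * f (g, inv dg y \<otimes> inv dg w))"
        using rho_deg[of "inv g" x y] c by (cases "rho (inv g) y x = 0") (auto simp: m_assoc)
    qed
    also have "\<dots> = (\<Sum>g\<in>carrier G. \<Sum>k\<in>carrier G.
      if g = k then rho (dg y \<otimes> inv g) w z * (rho (inv k) y x * f (g, inv dg y \<otimes> inv dg w)) else 0)"
      using finG by (intro sum.cong refl) (simp add: sum.delta)
    also have "\<dots> = ceval f (lmul dv (lext ph (Rw (inv dg y) v)) (ph u))"
    proof -
      have e: "inv (inv dg y \<otimes> dg w \<otimes> dg y) \<otimes> inv dg y = inv dg y \<otimes> inv dg w"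
        using c by (simp add: inv_mult_group m_assoc)
      show ?thesis
        using c by (simp add: ceval_lmul ceval_ph ceval_lph_Rw dv_def sum_distrib_left e)
          (intro sum.cong refl, simp add: e)
    qed
    finally show "ceval f (lmul dv (ph u) (lext ph (Lw (dg x) v))) = ceval f (lmul dv (lext ph (Rw (inv dg y) v)) (ph u))" .
  qed
  then show ?thesis
    using u v c by (simp add: frt_def lext_diff lph_lmul Lw_psp Rw_psp)
qed

lemma ph_nil: "ph [] = (\<Sum>g\<in>carrier G. basis (g, \<one>))"
  by (simp add: ph_def)

text \<open>For each \<open>g\<close> the contracted sum is one of the two orthogonality relations
  of \<open>rho (inv g)\<close>, by columns for \<open>s1\<close> and by rows for
  \<open>s2\<close>.\<close>

lemma lph_ants: assumes x: "set x \<subseteq> I" "set y \<subseteq> I" "length x = length y"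
  shows "lext ph (d1 x y) = 0" "lext ph (d2 x y) = 0"
proof -
  note [simp] = x
  have "lext ph (s1 x y) = (if x = y then ph [] else 0)"
  proof (rule ceval_ext)
    fix f
    have "ceval f (lext ph (s1 x y)) = (\<Sum>z\<in>mi (length y). \<Sum>g\<in>carrier G. rho (inv g) z x * rho (inv g) z y * f (g, \<one>))"
      by (simp add: s1_def lext_linear ceval_linear Sw_def zip_append[symmetric] ceval_ph del: zip_append)
    also have "\<dots> = (\<Sum>g\<in>carrier G. (\<Sum>z\<in>mi (length y). rho (inv g) z x * rho (inv g) z y) * f (g, \<one>))"
      by (subst sum.swap) (simp only: sum_distrib_right)
    also have "\<dots> = (\<Sum>g\<in>carrier G. (if x = y then 1 else 0) * f (g, \<one>))"
      by (intro sum.cong refl) (simp add: rho_orth)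
    finally show "ceval f (lext ph (s1 x y)) = ceval f (if x = y then ph [] else 0)"
      by (simp add: ph_nil ceval_linear)
  qed
  then show "lext ph (d1 x y) = 0" by (simp add: d1_def lext_diff)
  have "lext ph (s2 x y) = (if x = y then ph [] else 0)"
  proof (rule ceval_ext)
    fix f
    let ?h = "inv (dg y \<otimes> inv dg x)"
    have "ceval f (lext ph (s2 x y)) = (\<Sum>z\<in>mi (length y). \<Sum>g\<in>carrier G. rho (inv g) x z * rho (inv g) y z * f (g, ?h))"
      by (simp add: s2_def lext_linear ceval_linear Sw_def zip_append[symmetric] ceval_ph del: zip_append)
    also have "\<dots> = (\<Sum>g\<in>carrier G. (\<Sum>z\<in>mi (length y). rho (inv g) x z * rho (inv g) y z) * f (g, ?h))"
      by (subst sum.swap) (simp only: sum_distrib_right)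
    also have "\<dots> = (\<Sum>g\<in>carrier G. (if x = y then 1 else 0) * f (g, ?h))"
      by (intro sum.cong refl) (simp add: rho_orth)
    also have "\<dots> = (\<Sum>g\<in>carrier G. (if x = y then 1 else 0) * f (g, \<one>))"
      by (intro sum.cong refl) auto
    finally show "ceval f (lext ph (s2 x y)) = ceval f (if x = y then ph [] else 0)"
      by (simp add: ph_nil ceval_linear)
  qed
  then show "lext ph (d2 x y) = 0" by (simp add: d2_def lext_diff)
qed

lemma ker_ph_tid: "tid {p \<in> psp X. lext ph p = 0}"
  by (simp add: tid_iff csmul.subspace_def lph_lmul lcm_psp psp_add psp_csmul lext_linear)

lemma ph_NH: "p \<in> NH \<Longrightarrow> lext ph p = 0"
proof -
  have "frts \<union> ants \<subseteq> {p \<in> psp X. lext ph p = 0}"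
  proof
    fix s assume s: "s \<in> frts \<union> ants"
    then have "lext ph s = 0"
      by (auto simp: frts_def ants_def lph_frt lph_ants)
    moreover have "s \<in> psp X" using s frts_psp ants_psp by blast
    ultimately show "s \<in> {p \<in> psp X. lext ph p = 0}" by simp
  qed
  from tgen_min[OF ker_ph_tid this] show "p \<in> NH \<Longrightarrow> lext ph p = 0" unfolding NH_def by blast
qed

lemma NA_NH: "NA \<subseteq> NH"
  unfolding NA_def by (rule tgen_min[OF NH_tid NH_frts])

section \<open>Stability under the actions and the grading\<close>

definition nice where
  "nice N \<longleftrightarrow> tid N \<and> (\<forall>p\<in>N. \<forall>g\<in>carrier G. lext (Lw g) p \<in> N \<and> lext (Rw g) p \<in> N \<and> lext (hpart ad g) p \<in> N)"

text \<open>If the result were outside \<open>N\<close>, some functional \<open>f\<close> vanishing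
  on \<open>N\<close> would detect it. But the form made of \<open>c\<close> on one leg and
  \<open>f\<close> on the other vanishes whenever one leg lies in \<open>N\<close>, hence on the
  coproduct of \<open>p\<close>.\<close>

lemma coideal_functional:
  assumes co: "coideal X dl ep N" and N: "tid N" and c: "\<And>n. n \<in> N \<Longrightarrow> ceval c n = 0" and p: "p \<in> N"
  shows "lext (\<lambda>w. lext (\<lambda>(u, v). csmul (c u) (basis v)) (dl w)) p \<in> N"
    and "lext (\<lambda>w. lext (\<lambda>(u, v). csmul (c v) (basis u)) (dl w)) p \<in> N"
proof -
  show "lext (\<lambda>w. lext (\<lambda>(u, v). csmul (c u) (basis v)) (dl w)) p \<in> N"
  proof (rule ccontr)
    assume "lext (\<lambda>w. lext (\<lambda>(u, v). csmul (c u) (basis v)) (dl w)) p \<notin> N"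
    from exists_separating[OF tid_sub[OF N] this] obtain f where f: "\<forall>n\<in>N. ceval f n = 0"
      "ceval f (lext (\<lambda>w. lext (\<lambda>(u, v). csmul (c u) (basis v)) (dl w)) p) \<noteq> 0" by blast
    have "vanish2 X N (\<lambda>u v. c u * f v)"
      using f(1) c by (simp add: vanish2_def ceval_fun_mult ceval_fun_mult_right)
    then have "ceval (\<lambda>(u, v). c u * f v) (lext dl p) = 0" using co p unfolding coideal_def by blast
    then show False using f(2) by (simp add: ceval_lext split_def ceval_csmul)
  qed
  show "lext (\<lambda>w. lext (\<lambda>(u, v). csmul (c v) (basis u)) (dl w)) p \<in> N"
  proof (rule ccontr)
    assume "lext (\<lambda>w. lext (\<lambda>(u, v). csmul (c v) (basis u)) (dl w)) p \<notin> N"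
    from exists_separating[OF tid_sub[OF N] this] obtain f where f: "\<forall>n\<in>N. ceval f n = 0"
      "ceval f (lext (\<lambda>w. lext (\<lambda>(u, v). csmul (c v) (basis u)) (dl w)) p) \<noteq> 0" by blast
    have "vanish2 X N (\<lambda>u v. c v * f u)"
      using f(1) c by (simp add: vanish2_def ceval_fun_mult ceval_fun_mult_right)
    then have "ceval (\<lambda>(u, v). c v * f u) (lext dl p) = 0" using co p unfolding coideal_def by blast
    then show False using f(2) by (simp add: ceval_lext split_def ceval_csmul)
  qed
qed

text \<open>The total coefficient of \<open>ph u\<close> at the pairs with first entry
  \<open>inv g\<close> (see \<open>chi_ph\<close>). Convolution with it on the first leg of the
  coproduct is the left action of \<open>g\<close>, on the second leg the right action of
  \<open>inv g\<close>.\<close>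

definition chi :: "'g \<Rightarrow> ('a \<times> 'a) list \<Rightarrow> complex" where
  "chi g u = rho g (wr u) (wl u)"

text \<open>The coefficient of \<open>ph u\<close> at the pair \<open>(\<one>, inv k)\<close> (see
  \<open>gam_ph\<close>). Convolution with it on the first or second leg projects onto the words of
  left or right degree \<open>k\<close>.\<close>

definition gam :: "'g \<Rightarrow> ('a \<times> 'a) list \<Rightarrow> complex" where
  "gam k u = (if wl u = wr u \<and> dg (wl u) = k then 1 else 0)"

lemma chi_ph: assumes "g \<in> carrier G"
  shows "chi g u = ceval (\<lambda>(k, h). if k = inv g then 1 else 0) (ph u)"
proof -
  have "ceval (\<lambda>(k, h). if k = inv g then 1 else 0) (ph u)
      = (\<Sum>k\<in>carrier G. if k = inv g then rho (inv k) (wr u) (wl u) else 0)"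
    unfolding ph_def ceval_linear by (intro sum.cong refl) simp
  also have "\<dots> = rho g (wr u) (wl u)" using assms by (subst sum.delta[OF finG]) simp
  finally show ?thesis by (simp only: chi_def)
qed

lemma gam_ph: assumes "k \<in> carrier G" "u \<in> X"
  shows "gam k u = ceval (\<lambda>(g, h). if g = \<one> \<and> h = inv k then 1 else 0) (ph u)"
proof -
  have "ceval (\<lambda>(g, h). if g = \<one> \<and> h = inv k then 1 else 0) (ph u)
      = (\<Sum>g\<in>carrier G. if g = \<one> then (if dg (wr u) = k then rho \<one> (wr u) (wl u) else 0) else 0)"
    unfolding ph_def ceval_linear
  proof (intro sum.cong refl)
    fix g
    have "inv dg (wr u) = inv k \<longleftrightarrow> dg (wr u) = k" using assms by (metis inv_inv dg_closed wr_set)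
    then show "rho (inv g) (wr u) (wl u) * ceval (\<lambda>(g, h). if g = \<one> \<and> h = inv k then 1 else 0) (basis (g, inv dg (wr u)))
      = (if g = \<one> then (if dg (wr u) = k then rho \<one> (wr u) (wl u) else 0) else 0)"
      by auto
  qed
  also have "\<dots> = (if dg (wr u) = k then rho \<one> (wr u) (wl u) else 0)"
    by (subst sum.delta[OF finG]) simp
  finally show ?thesis using assms by (auto simp: gam_def)
qed

lemma chi_vanish: assumes "g \<in> carrier G" "lext ph n = 0" shows "ceval (chi g) n = 0"
proof -
  have "ceval (chi g) n = ceval (\<lambda>u. ceval (\<lambda>(k, h). if k = inv g then 1 else 0) (ph u)) n"
    by (rule ceval_cong) (rule chi_ph[OF assms(1)])
  then show ?thesis using assms(2) ceval_lext[of "\<lambda>(k, h). if k = inv g then 1 else 0" ph n] by simp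
qed

lemma gam_vanish: assumes "k \<in> carrier G" "n \<in> psp X" "lext ph n = 0" shows "ceval (gam k) n = 0"
proof -
  have "ceval (gam k) n = ceval (\<lambda>u. ceval (\<lambda>(g, h). if g = \<one> \<and> h = inv k then 1 else 0) (ph u)) n"
    by (rule ceval_psp_cong[OF assms(2)]) (simp add: gam_ph assms(1))
  then show ?thesis using assms(3) ceval_lext[of "\<lambda>(g, h). if g = \<one> \<and> h = inv k then 1 else 0" ph n] by simp
qed

lemma Lw_dl_chi: assumes "g \<in> carrier G" "w \<in> X"
  shows "lext (\<lambda>(u, v). csmul (chi g u) (basis v)) (dl w) = Lw g w"
proof (rule ceval_ext)
  fix f
  from assms(2) obtain x y where [simp]: "set x \<subseteq> I" "set y \<subseteq> I" "length x = length y" "w = zip x y"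
    by (rule XE)
  show "ceval f (lext (\<lambda>(u, v). csmul (chi g u) (basis v)) (dl w)) = ceval f (Lw g w)"
    by (simp add: ceval_lext ceval_dl ceval_csmul chi_def ceval_Lw)
qed

lemma Rw_dl_chi: assumes "g \<in> carrier G" "w \<in> X"
  shows "lext (\<lambda>(u, v). csmul (chi (inv g) v) (basis u)) (dl w) = Rw g w"
proof (rule ceval_ext)
  fix f
  from assms(2) obtain x y where [simp]: "set x \<subseteq> I" "set y \<subseteq> I" "length x = length y" "w = zip x y"
    by (rule XE)
  show "ceval f (lext (\<lambda>(u, v). csmul (chi (inv g) v) (basis u)) (dl w)) = ceval f (Rw g w)"
    by (simp add: ceval_lext ceval_dl ceval_csmul chi_def ceval_Rw assms rho_inv)
qed

lemma dl_gam: assumes "w \<in> X"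
  shows "lext (\<lambda>(u, v). csmul (gam k u) (basis v)) (dl w) = hpart (\<lambda>w. dg (wl w)) k w"
    and "lext (\<lambda>(u, v). csmul (gam k v) (basis u)) (dl w) = hpart (\<lambda>w. dg (wr w)) k w"
proof -
  from assms obtain x y where [simp]: "set x \<subseteq> I" "set y \<subseteq> I" "length x = length y" "w = zip x y"
    by (rule XE)
  show "lext (\<lambda>(u, v). csmul (gam k u) (basis v)) (dl w) = hpart (\<lambda>w. dg (wl w)) k w"
  proof (rule ceval_ext)
    fix f
    have "ceval f (lext (\<lambda>(u, v). csmul (gam k u) (basis v)) (dl w))
      = (\<Sum>z\<in>mi (length y). (if x = z then 1 else 0) * (if dg x = k then f (zip z y) else 0))"
      by (simp add: ceval_lext ceval_dl ceval_csmul gam_def; intro sum.cong refl; simp)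
    also have "\<dots> = (if dg x = k then f (zip x y) else 0)" by (rule sum_if_eq(2)) simp
    finally show "ceval f (lext (\<lambda>(u, v). csmul (gam k u) (basis v)) (dl w)) = ceval f (hpart (\<lambda>w. dg (wl w)) k w)"
      by (simp add: hpart_def)
  qed
  show "lext (\<lambda>(u, v). csmul (gam k v) (basis u)) (dl w) = hpart (\<lambda>w. dg (wr w)) k w"
  proof (rule ceval_ext)
    fix f
    have "ceval f (lext (\<lambda>(u, v). csmul (gam k v) (basis u)) (dl w))
      = (\<Sum>z\<in>mi (length y). (if z = y then 1 else 0) * (if dg z = k then f (zip x z) else 0))"
      by (simp add: ceval_lext ceval_dl ceval_csmul gam_def; intro sum.cong refl; simp)
    also have "\<dots> = (if dg y = k then f (zip x y) else 0)" by (rule sum_if_eq(1)) simp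
    finally show "ceval f (lext (\<lambda>(u, v). csmul (gam k v) (basis u)) (dl w)) = ceval f (hpart (\<lambda>w. dg (wr w)) k w)"
      by (simp add: hpart_def)
  qed
qed

text \<open>A word has degree \<open>k\<close> exactly when its right degree is \<open>inv k\<close>
  times its left degree, so the projection is assembled from the projections by left and right
  degrees, summed over the possible left degrees \<open>a\<close>.\<close>

lemma hpart_ad: assumes "w \<in> X" "k \<in> carrier G"
  shows "hpart ad k w = (\<Sum>a\<in>carrier G. lext (hpart (\<lambda>w. dg (wr w)) (inv k \<otimes> a)) (hpart (\<lambda>w. dg (wl w)) a w))"
proof -
  have c: "dg (wl w) \<in> carrier G" "dg (wr w) \<in> carrier G" using assms by simp_all
  have "(\<Sum>a\<in>carrier G. lext (hpart (\<lambda>w. dg (wr w)) (inv k \<otimes> a)) (hpart (\<lambda>w. dg (wl w)) a w))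
    = (\<Sum>a\<in>carrier G. if a = dg (wl w) then hpart (\<lambda>w. dg (wr w)) (inv k \<otimes> dg (wl w)) w else 0)"
    by (intro sum.cong refl) (auto simp: hpart_def)
  also have "\<dots> = hpart (\<lambda>w. dg (wr w)) (inv k \<otimes> dg (wl w)) w" using c finG by simp
  also have "\<dots> = hpart ad k w"
  proof -
    have "dg (wr w) = inv k \<otimes> dg (wl w) \<longleftrightarrow> ad w = k"
      using c assms unfolding ad_def by (metis inv_closed inv_inv inv_solve_left inv_solve_right m_closed)
    then show ?thesis by (simp add: hpart_def)
  qed
  finally show ?thesis by simp
qed

text \<open>The two actions and the grading are convolutions with functionals factoring through the map
  \<open>ph\<close> to \<open>D\<^sup>\<or>(G)\<close>, so they preserve every coideal in its kernel.\<close>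

lemma nice_coideal:
  assumes co: "coideal X dl ep N" and N: "tid N" and ph: "\<And>n. n \<in> N \<Longrightarrow> lext ph n = 0"
  shows "nice N"
  unfolding nice_def
proof (intro conjI ballI N)
  fix p g assume p: "p \<in> N" and g: "g \<in> carrier G"
  have pX: "p \<in> psp X" by (rule tid_psp[OF N p])
  have "lext (\<lambda>w. lext (\<lambda>(u, v). csmul (chi g u) (basis v)) (dl w)) p \<in> N"
    by (rule coideal_functional(1)[OF co N _ p]) (simp add: chi_vanish g ph)
  then show "lext (Lw g) p \<in> N" using lext_psp_cong[OF pX Lw_dl_chi[OF g]] by simp
  have "lext (\<lambda>w. lext (\<lambda>(u, v). csmul (chi (inv g) v) (basis u)) (dl w)) p \<in> N"
    by (rule coideal_functional(2)[OF co N _ p]) (simp add: chi_vanish g ph)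
  then show "lext (Rw g) p \<in> N" using lext_psp_cong[OF pX Rw_dl_chi[OF g]] by simp
  have Hl: "lext (hpart (\<lambda>w. dg (wl w)) k) q \<in> N" and Hr: "lext (hpart (\<lambda>w. dg (wr w)) k) q \<in> N"
    if k: "k \<in> carrier G" and q: "q \<in> N" for k q
  proof -
    have qX: "q \<in> psp X" by (rule tid_psp[OF N q])
    have v: "ceval (gam k) n = 0" if "n \<in> N" for n by (rule gam_vanish[OF k tid_psp[OF N that] ph[OF that]])
    show "lext (hpart (\<lambda>w. dg (wl w)) k) q \<in> N"
      using coideal_functional(1)[OF co N v q] lext_psp_cong[OF qX dl_gam(1)] by simp
    show "lext (hpart (\<lambda>w. dg (wr w)) k) q \<in> N"
      using coideal_functional(2)[OF co N v q] lext_psp_cong[OF qX dl_gam(2)] by simp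
  qed
  have "lext (hpart ad g) p
    = lext (\<lambda>w. \<Sum>a\<in>carrier G. lext (hpart (\<lambda>w. dg (wr w)) (inv g \<otimes> a)) (hpart (\<lambda>w. dg (wl w)) a w)) p"
    by (rule lext_psp_cong[OF pX]) (simp add: hpart_ad g)
  also have "\<dots> = (\<Sum>a\<in>carrier G. lext (hpart (\<lambda>w. dg (wr w)) (inv g \<otimes> a)) (lext (hpart (\<lambda>w. dg (wl w)) a) p))"
    by (simp add: lext_fun_sum lext_lext)
  also have "\<dots> \<in> N"
    using g p by (intro csmul.subspace_sum[OF tid_sub[OF N]] Hl Hr) auto
  finally show "lext (hpart ad g) p \<in> N" .
qed

lemma nice_NA: "nice NA"
  by (rule nice_coideal[OF coideal_NA NA_tid]) (use NA_NH ph_NH in blast)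

lemma nice_NH: "nice NH"
  by (rule nice_coideal[OF coideal_NH NH_tid ph_NH])

section \<open>Ideals for the twisted product\<close>

definition tmid where
  "tmid N \<longleftrightarrow> N \<subseteq> psp X \<and> csmul.subspace N \<and>
     (\<forall>n\<in>N. \<forall>u\<in>X. lmul tm (basis u) n \<in> N \<and> lmul tm n (basis u) \<in> N)"

lemma sum_hpart: "p \<in> psp X \<Longrightarrow> (\<Sum>k\<in>carrier G. lext (hpart ad k) p) = p"
proof -
  assume p: "p \<in> psp X"
  have "(\<Sum>k\<in>carrier G. lext (hpart ad k) p) = lext basis p"
    unfolding lext_fun_sum[symmetric]
    by (rule lext_psp_cong[OF p]) (simp add: hpart_def finG)
  then show ?thesis by simp
qed

lemma hpart_ad_closed: "p \<in> psp X \<Longrightarrow> lext (hpart ad k) p \<in> psp {w \<in> X. ad w = k}"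
  by (rule psp_lext) (auto simp: hpart_def)

text \<open>Multiplying an element of \<open>N\<close> by a word on its left needs stability under
  the left action. Multiplying it on its right needs its homogeneous components in \<open>N\<close>,
  because each of them twists the word by its own degree.\<close>

lemma nice_tmid: assumes "nice N" shows "tmid N"
  unfolding tmid_def
proof (intro conjI ballI)
  have N: "tid N" using assms by (simp add: nice_def)
  show "N \<subseteq> psp X" "csmul.subspace N" using N by (auto simp: tid_iff)
  fix n u assume n: "n \<in> N" and u: "u \<in> X"
  have nX: "n \<in> psp X" by (rule tid_psp[OF N n])
  show "lmul tm (basis u) n \<in> N"
    using assms n u by (simp add: ltm_basis nX tid_mult[OF N] nice_def)
  have "lmul tm n (basis u) = (\<Sum>k\<in>carrier G. lmul tm (lext (hpart ad k) n) (basis u))"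
    using sum_hpart[OF nX] by (simp add: lmul_linear[symmetric])
  also have "\<dots> = (\<Sum>k\<in>carrier G. lmul cm (lext (hpart ad k) n) (Lw k u))"
    using ltm_homogeneous[OF hpart_ad_closed[OF nX], of "basis u"] u by simp
  also have "\<dots> \<in> N"
    using assms n u by (intro csmul.subspace_sum[OF tid_sub[OF N]] tid_mult[OF N] Lw_psp) (auto simp: nice_def)
  finally show "lmul tm n (basis u) \<in> N" .
qed

lemma tmid_mult:
  assumes "tmid N" "n \<in> N" "p \<in> psp X"
  shows "lmul tm p n \<in> N" "lmul tm n p \<in> N"
proof -
  have sub: "csmul.subspace N" using assms by (simp add: tmid_def)
  show "lmul tm p n \<in> N" unfolding lmul_alt[of _ p]
    by (rule subspace_lext[OF sub assms(3)]) (use assms(1,2) in \<open>auto simp: tmid_def\<close>)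
  have "lmul tm n p = lext (\<lambda>v. lmul tm n (basis v)) p"
    using lmul_lext_right[of tm n basis p] by simp
  then show "lmul tm n p \<in> N"
    by simp (rule subspace_lext[OF sub assms(3)], use assms(1,2) in \<open>auto simp: tmid_def\<close>)
qed

text \<open>The passage from ideals for the twisted product to ideals for concatenation.\<close>

definition zset where
  "zset N = {p \<in> psp X. \<forall>g\<in>carrier G. \<forall>k\<in>carrier G. lext (hpart ad k) (lext (Lw g) p) \<in> N}"

lemma hpart_ltm:
  assumes "p \<in> psp {w \<in> X. ad w = h}" "q \<in> psp X" "h \<in> carrier G" "k \<in> carrier G"
  shows "lext (hpart ad k) (lmul tm p q) = lmul tm p (lext (hpart ad (inv h \<otimes> k)) q)"
proof -
  have "lext (hpart ad k) (tm u v) = lmul tm (basis u) (hpart ad (inv h \<otimes> k) v)"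
    if "u \<in> X" "ad u = h" "v \<in> X" for u v
  proof -
    have c: "ad v \<in> carrier G" using that by simp
    have t: "tm u v \<in> psp {w. ad w = h \<otimes> ad v}"
      by (rule psp_mono[OF tm_deg]) (use that in auto)
    have "ad v = inv h \<otimes> k \<longleftrightarrow> h \<otimes> ad v = k"
      using c assms(3,4) by (metis inv_closed inv_inv inv_solve_left m_closed)
    then show ?thesis
      using hpart_id[OF t] hpart_other[OF t, of k] by (cases "h \<otimes> ad v = k") (auto simp: hpart_def[of ad _ v])
  qed
  note 1 = this
  have "lext (hpart ad k) (lmul tm p q) = lext (\<lambda>u. lext (\<lambda>v. lext (hpart ad k) (tm u v)) q) p"
    by (rule lext_lmul)
  also have "\<dots> = lext (\<lambda>u. lext (\<lambda>v. lmul tm (basis u) (hpart ad (inv h \<otimes> k) v)) q) p"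
    by (intro lext_psp_cong[OF assms(1)] lext_psp_cong[OF assms(2)] 1) auto
  also have "\<dots> = lmul tm p (lext (hpart ad (inv h \<otimes> k)) q)"
    by (subst (2) lmul_alt) (simp only: lmul_lext_right)
  finally show ?thesis .
qed

lemma cm_as_tm:
  assumes "p \<in> psp {w \<in> X. ad w = h}" "q \<in> psp X" "h \<in> carrier G"
  shows "lmul cm p q = lmul tm p (lext (Lw (inv h)) q)"
  using assms by (simp add: ltm_homogeneous[OF assms(1)] lLw_psp lLw_mult lLw_one)

text \<open>Concatenation with a left factor of degree \<open>h\<close> is the twisted product with
  the right factor moved by \<open>inv h\<close> (\<open>cm_as_tm\<close>), and projecting the
  result shifts the degree by \<open>h\<close> (\<open>hpart_ltm\<close>). Since membership in
  \<open>zset\<close> is required for all translates and all components, neither shift leads out of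
  it.\<close>

lemma zset_tid: assumes N: "tmid N" shows "tid (zset N)"
  unfolding tid_iff
proof (intro conjI ballI)
  have sub: "csmul.subspace N" using N by (simp add: tmid_def)
  show "zset N \<subseteq> psp X" by (auto simp: zset_def)
  show "csmul.subspace (zset N)"
    using sub by (auto simp: csmul.subspace_def zset_def psp_add psp_csmul lext_linear)
  fix p u assume p: "p \<in> zset N" and u: "u \<in> X"
  have pX: "p \<in> psp X" using p by (simp add: zset_def)
  have pz: "lext (hpart ad k) (lext (Lw g) p) \<in> N" if "g \<in> carrier G" "k \<in> carrier G" for g k
    using p that by (simp add: zset_def)
  show "lmul cm (basis u) p \<in> zset N"
  proof -
    have "lext (hpart ad k) (lext (Lw g) (lmul cm (basis u) p)) \<in> N" if g: "g \<in> carrier G" and k: "k \<in> carrier G" for g k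
    proof -
      have "lext (hpart ad k) (lext (Lw g) (lmul cm (basis u) p))
        = lext (\<lambda>u'. lext (hpart ad k) (lmul cm (basis u') (lext (Lw g) p))) (Lw g u)"
        using u pX by (simp add: lLw_lmul lmul_alt[of cm "Lw g u"] lext_lext)
      also have "\<dots> \<in> N"
      proof (rule subspace_lext[OF sub Lw_psp[OF g u]])
        fix u' assume u': "u' \<in> X"
        have a: "ad u' \<in> carrier G" using u' by simp
        have "lext (hpart ad k) (lmul cm (basis u') (lext (Lw g) p))
          = lmul tm (basis u') (lext (hpart ad (inv ad u' \<otimes> k)) (lext (Lw (inv ad u' \<otimes> g)) p))"
          using u' g k a pX cm_as_tm[of "basis u'" "ad u'" "lext (Lw g) p"]
            hpart_ltm[of "basis u'" "ad u'" "lext (Lw (inv ad u' \<otimes> g)) p" k]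
          by (simp add: lLw_psp lLw_mult)
        also have "\<dots> \<in> N" using u' g k a by (intro tmid_mult[OF N] pz) auto
        finally show "lext (hpart ad k) (lmul cm (basis u') (lext (Lw g) p)) \<in> N" .
      qed
      finally show ?thesis .
    qed
    then show ?thesis using u pX by (simp add: zset_def lcm_psp)
  qed
  show "lmul cm p (basis u) \<in> zset N"
  proof -
    have "lext (hpart ad k) (lext (Lw g) (lmul cm p (basis u))) \<in> N" if g: "g \<in> carrier G" and k: "k \<in> carrier G" for g k
    proof -
      have gX: "lext (Lw g) p \<in> psp X" by (rule lLw_psp[OF g pX])
      have "lext (hpart ad k) (lext (Lw g) (lmul cm p (basis u)))
        = lext (hpart ad k) (lmul cm (\<Sum>h\<in>carrier G. lext (hpart ad h) (lext (Lw g) p)) (Lw g u))"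
        using u pX by (simp add: lLw_lmul sum_hpart gX)
      also have "\<dots> = (\<Sum>h\<in>carrier G. lext (hpart ad k) (lmul cm (lext (hpart ad h) (lext (Lw g) p)) (Lw g u)))"
        by (simp add: lmul_linear lext_linear)
      also have "\<dots> \<in> N"
      proof (rule csmul.subspace_sum[OF sub])
        fix h assume h: "h \<in> carrier G"
        note H = hpart_ad_closed[OF gX, of h]
        have "lext (hpart ad k) (lmul cm (lext (hpart ad h) (lext (Lw g) p)) (Lw g u))
          = lmul tm (lext (hpart ad h) (lext (Lw g) p)) (lext (hpart ad (inv h \<otimes> k)) (lext (Lw (inv h)) (Lw g u)))"
          using cm_as_tm[OF H Lw_psp[OF g u] h] hpart_ltm[OF H lLw_psp[OF inv_closed[OF h] Lw_psp[OF g u]] h k] by simp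
        also have "\<dots> \<in> N"
          using h g u by (intro tmid_mult[OF N] pz psp_mono[OF hpart_ad_closed] lLw_psp Lw_psp) auto
        finally show "lext (hpart ad k) (lmul cm (lext (hpart ad h) (lext (Lw g) p)) (Lw g u)) \<in> N" .
      qed
      finally show ?thesis .
    qed
    then show ?thesis using u pX by (simp add: zset_def lcm_psp)
  qed
qed

lemma zset_sub: assumes N: "tmid N" and p: "p \<in> zset N" shows "p \<in> N"
proof -
  have sub: "csmul.subspace N" using N by (simp add: tmid_def)
  have pX: "p \<in> psp X" using p by (simp add: zset_def)
  have "(\<Sum>k\<in>carrier G. lext (hpart ad k) (lext (Lw \<one>) p)) \<in> N"
    using p by (intro csmul.subspace_sum[OF sub]) (simp add: zset_def)
  then show ?thesis using pX by (simp add: lLw_one sum_hpart)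
qed

section \<open>The relations of \<open>U\<close> and \<open>B\<close> and their images under the
  twist\<close>

lemma Lw_nil [simp]: "Lw g [] = basis []"
  by (simp add: Lw_def)

abbreviation "singles \<equiv> (\<lambda>l. [l]) ` (I \<times> I)"

text \<open>For letters this is the defining relation of \<open>U\<close> (see
  \<open>fundamental_gU\<close>): \<open>v'\<close> runs through the terms of the inverse right
  degree of \<open>u\<close> acting on \<open>v\<close>, and the inverse degree of \<open>v'\<close>
  moves only the left index of \<open>u\<close>.\<close>

definition gU :: "('a \<times> 'a) list \<Rightarrow> ('a \<times> 'a) list \<Rightarrow> (('a \<times> 'a) list \<Rightarrow>\<^sub>0 complex)" where
  "gU u v = cm u v - lext (\<lambda>v'. lmul cm (basis v') (Lw (inv ad v') u)) (Aw (inv dg (wr u)) v)"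

definition "gUs = {gU [l] [l'] | l l'. l \<in> I \<times> I \<and> l' \<in> I \<times> I}"

lemma gU_psp: "u \<in> X \<Longrightarrow> v \<in> X \<Longrightarrow> gU u v \<in> psp X"
  unfolding gU_def by (intro psp_diff cm_X psp_lext[OF Aw_psp] lcm_psp Lw_psp) auto

text \<open>The correction by the inverse degree of \<open>v'\<close> is undone by the twist, so
  that term becomes a plain concatenation. In the other term the twist by \<open>a b^-1\<close> is
  the left action by \<open>a\<close> of \<open>frt\<close>, applied after \<open>b^-1\<close>; the
  same \<open>b^-1\<close> is left over from the diagonal action on the first side.\<close>

lemma lth_gU: assumes l: "l \<in> I \<times> I" "l' \<in> I \<times> I"
  shows "lext th (gU [l] [l']) = lext (frt [l]) (Lw (inv dg (wr [l])) [l'])"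
proof -
  let ?b = "dg (wr [l])" and ?a = "dg (wl [l])"
  have X: "[l] \<in> X" "[l'] \<in> X" using l by auto
  have c: "?a \<in> carrier G" "?b \<in> carrier G" using dg_closed[OF wl_set[OF X(1)]] dg_closed[OF wr_set[OF X(1)]] by auto
  have ad: "ad [l] = ?a \<otimes> inv ?b" by (simp add: ad_def)
  have 1: "lext th (cm [l] [l']) = lmul cm (basis [l]) (lext (Lw ?a) (Lw (inv ?b) [l']))"
    using X l c by (simp add: cm_def[of "[l]"] tm_nil tm_def ad Lw_mult del: X_cons)
  have "lext th (lmul cm (basis v') (Lw (inv ad v') [l])) = lmul cm (basis v') (basis [l])" if v': "v' \<in> singles" for v'
  proof -
    have vX: "v' \<in> X" and k: "ad v' \<in> carrier G" using v' by auto
    have "lext th (lmul cm (basis v') (Lw (inv ad v') [l])) = lmul tm (basis v') (Lw (inv ad v') [l])"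
      using v' vX k l X(1) by (simp add: lth_lmul Lw_psp lth_single[OF Lw_single] lth_single[of "basis v'", simplified] del: X_cons)
    also have "\<dots> = lmul cm (basis v') (basis [l])"
      using vX k X(1) by (simp add: ltm_basis Lw_psp Lw_mult Lw_one del: X_cons)
    finally show ?thesis .
  qed
  then have "lext th (lext (\<lambda>v'. lmul cm (basis v') (Lw (inv ad v') [l])) (Aw (inv ?b) [l']))
    = lext (\<lambda>v'. lmul cm (basis v') (basis [l])) (Aw (inv ?b) [l'])"
    unfolding lext_lext using c l by (intro lext_psp_cong[OF Aw_single]) auto
  also have "\<dots> = lmul cm (lext (Rw (inv ?b)) (Lw (inv ?b) [l'])) (basis [l])"
    using Lw_Rw[OF X(2), of "inv ?b" "inv ?b"] by (simp add: lmul_alt[symmetric] Aw_def del: lmul_basis)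
  finally show ?thesis by (simp add: gU_def lext_diff 1 lfrt)
qed

text \<open>Inverts \<open>lth_gU\<close>: starting from the left translate of \<open>l'\<close> by
  \<open>b\<close> absorbs the inverse of \<open>b\<close> that appears there.\<close>

lemma frt_gU: assumes l: "l \<in> I \<times> I" "l' \<in> I \<times> I"
  shows "frt [l] [l'] = lext th (lext (gU [l]) (Lw (dg (wr [l])) [l']))"
proof -
  let ?b = "dg (wr [l])"
  have X: "[l] \<in> X" "[l'] \<in> X" using l by auto
  have c: "?b \<in> carrier G" using dg_closed[OF wr_set[OF X(1)]] by auto
  have "lext th (lext (gU [l]) (Lw ?b [l'])) = lext (\<lambda>v'. lext (frt [l]) (Lw (inv ?b) v')) (Lw ?b [l'])"
    unfolding lext_lext using l by (intro lext_psp_cong[OF Lw_single[OF c l(2)]]) (auto simp: lth_gU)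
  also have "\<dots> = lext (frt [l]) (lext (Lw (inv ?b)) (Lw ?b [l']))" by (simp only: lext_lext)
  also have "\<dots> = frt [l] [l']" using c X by (simp add: Lw_mult Lw_one del: X_cons)
  finally show ?thesis by simp
qed

definition e1 :: "'a \<Rightarrow> 'a \<Rightarrow> (('a \<times> 'a) list \<Rightarrow>\<^sub>0 complex)" where
  "e1 a b = lext (\<lambda>(u, v). lmul cm (basis u) (sB v)) (dl [(a, b)]) - (if a = b then basis [] else 0)"

definition e2 :: "'a \<Rightarrow> 'a \<Rightarrow> (('a \<times> 'a) list \<Rightarrow>\<^sub>0 complex)" where
  "e2 a b = lext (\<lambda>(u, v). lmul cm (sB u) (basis v)) (dl [(a, b)]) - (if a = b then basis [] else 0)"

definition "antsB = {e1 a b | a b. a \<in> I \<and> b \<in> I} \<union> {e2 a b | a b. a \<in> I \<and> b \<in> I}"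

lemma sB_single: "u \<in> singles \<Longrightarrow> sB u \<in> psp singles"
proof -
  assume "u \<in> singles"
  then obtain a b where u: "u = [(a, b)]" "a \<in> I" "b \<in> I" by auto
  then have "Sw u = [(st1 b, st1 a)]" by (simp add: Sw_def st_def wl_def wr_def)
  then show ?thesis unfolding sB_def using u
    by (simp only:) (intro Lw_single ad_closed, auto simp: st1_closed)
qed

lemma dl_single: "a \<in> I \<Longrightarrow> b \<in> I \<Longrightarrow> dl [(a, b)] \<in> psp (singles \<times> singles)"
  unfolding dl_def by (rule psp_sum) (auto simp: length_Suc_conv wl_def wr_def)

lemma e1_psp: "a \<in> I \<Longrightarrow> b \<in> I \<Longrightarrow> e1 a b \<in> psp X" and e2_psp: "a \<in> I \<Longrightarrow> b \<in> I \<Longrightarrow> e2 a b \<in> psp X"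
  unfolding e1_def e2_def
  by (auto intro!: psp_diff psp_lext[OF dl_psp] lcm_psp sB_psp)

lemma lth_e: assumes ab: "a \<in> I" "b \<in> I"
  shows "lext th (e1 a b) = (\<Sum>v\<in>mi 1. csmul (rho (dg [a] \<otimes> inv dg [b]) v [b]) (s1 [a] v)) - (if a = b then basis [] else 0)"
    and "lext th (e2 a b) = d2 [a] [b]"
proof -
  have "lext th (lext (\<lambda>(u, v). lmul cm (basis u) (sB v)) (dl [(a, b)]))
      = lext (\<lambda>(u, v). lmul tm (basis u) (sB v)) (dl [(a, b)])"
    unfolding lext_lext
  proof (rule lext_psp_cong[OF dl_single[OF ab]])
    fix w assume "w \<in> singles \<times> singles"
    then obtain l l' where w: "w = ([l], [l'])" and l: "l \<in> I \<times> I" "l' \<in> I \<times> I" by auto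
    then have m: "[l] \<in> singles" "[l'] \<in> singles" "[l] \<in> X" "[l'] \<in> X" by auto
    have "lext th (lmul cm (basis [l]) (sB [l'])) = lmul tm (lext th (basis [l])) (lext th (sB [l']))"
      using m by (intro lth_lmul) (simp_all add: sB_psp)
    then show "lext th (case w of (u, v) \<Rightarrow> lmul cm (basis u) (sB v)) = (case w of (u, v) \<Rightarrow> lmul tm (basis u) (sB v))"
      using m l by (simp add: w lth_single[OF sB_single] th_single del: th.simps X_cons)
  qed
  then show "lext th (e1 a b) = (\<Sum>v\<in>mi 1. csmul (rho (dg [a] \<otimes> inv dg [b]) v [b]) (s1 [a] v)) - (if a = b then basis [] else 0)"
    using sB_right[of "[a]" "[b]"] ab by (simp add: e1_def lext_diff)
  have "lext th (lext (\<lambda>(u, v). lmul cm (sB u) (basis v)) (dl [(a, b)]))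
      = lext (\<lambda>(u, v). lmul tm (sB u) (basis v)) (dl [(a, b)])"
    unfolding lext_lext
  proof (rule lext_psp_cong[OF dl_single[OF ab]])
    fix w assume "w \<in> singles \<times> singles"
    then obtain l l' where w: "w = ([l], [l'])" and l: "l \<in> I \<times> I" "l' \<in> I \<times> I" by auto
    then have m: "[l] \<in> singles" "[l'] \<in> singles" "[l] \<in> X" "[l'] \<in> X" by auto
    have "lext th (lmul cm (sB [l]) (basis [l'])) = lmul tm (lext th (sB [l])) (lext th (basis [l']))"
      using m by (intro lth_lmul) (simp_all add: sB_psp)
    then show "lext th (case w of (u, v) \<Rightarrow> lmul cm (sB u) (basis v)) = (case w of (u, v) \<Rightarrow> lmul tm (sB u) (basis v))"
      using m l by (simp add: w lth_single[OF sB_single] th_single del: th.simps X_cons)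
  qed
  then show "lext th (e2 a b) = d2 [a] [b]"
    using sB_left[of "[a]" "[b]"] ab by (simp add: e2_def d2_def lext_diff)
qed

text \<open>The case \<open>v = x\<close> of \<open>rho_conj_swap\<close>, where the other group
  element is the unit.\<close>

lemma rho_self: assumes "set x \<subseteq> I" "set y \<subseteq> I" "length x = length y"
  shows "rho (dg x \<otimes> inv dg y) x y = (if x = y then 1 else 0)"
  using rho_conj_swap[of x x y 1] assms by simp

text \<open>For single indices this is what \<open>th\<close> makes of the relation
  \<open>e1\<close> of \<open>B\<close>: a recombination of the relations \<open>d1\<close>, and not
  \<open>d1\<close> itself.\<close>

definition tw where "tw x y = (\<Sum>v\<in>mi (length x). csmul (rho (dg x \<otimes> inv dg y) v y) (s1 x v)) - (if x = y then basis [] else 0)"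

lemma tw_d1: assumes x: "set x \<subseteq> I" "set y \<subseteq> I" "length x = length y"
  shows "tw x y = (\<Sum>v\<in>mi (length x). csmul (rho (dg x \<otimes> inv dg y) v y) (d1 x v))"
proof -
  have "(\<Sum>v\<in>mi (length x). csmul (rho (dg x \<otimes> inv dg y) v y) (if x = v then basis [] else (0 :: ('a \<times> 'a) list \<Rightarrow>\<^sub>0 complex)))
    = (\<Sum>v\<in>mi (length x). if x = v then csmul (rho (dg x \<otimes> inv dg y) x y) (basis []) else 0)"
    by (rule sum.cong) auto
  also have "\<dots> = (if x = y then basis [] else 0)"
    using x by (subst sum.delta') (auto simp: rho_self)
  finally show ?thesis by (simp only: tw_def d1_def csmul.scale_right_diff_distrib sum_subtractf)
qed

text \<open>Inverts \<open>tw_d1\<close>. Where the entries do not vanish, \<open>dg x\<close> times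
  \<open>inv dg y\<close> is the inverse of a group element depending on \<open>v\<close> only, so
  orthogonality contracts the double sum over \<open>y\<close>.\<close>

lemma d1_tw: assumes x: "set x \<subseteq> I" "set v \<subseteq> I" "length x = length v"
  shows "d1 x v = (\<Sum>y\<in>mi (length x). csmul (rho (inv dg x \<otimes> dg v) y v) (tw x y))"
proof -
  let ?M = "mi (length x)" and ?k = "\<lambda>v. inv dg x \<otimes> dg v"
  note [simp] = x
  have c: "dg x \<in> carrier G" "dg v \<in> carrier G" by simp_all
  have s: "(\<Sum>y\<in>?M. rho (?k v) y v * rho (dg x \<otimes> inv dg y) v' y) = (if v' = v then 1 else 0)" if v': "v' \<in> ?M" for v'
  proof -
    have [simp]: "set v' \<subseteq> I" "length v' = length v" using v' by auto
    have "(\<Sum>y\<in>?M. rho (?k v) y v * rho (dg x \<otimes> inv dg y) v' y) = (\<Sum>y\<in>?M. rho (?k v) y v * rho (?k v) y v')"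
    proof (intro sum.cong refl)
      fix y assume "y \<in> ?M"
      then have [simp]: "set y \<subseteq> I" "length y = length v" by auto
      have cy: "dg y \<in> carrier G" "dg v' \<in> carrier G" by simp_all
      show "rho (?k v) y v * rho (dg x \<otimes> inv dg y) v' y = rho (?k v) y v * rho (?k v) y v'"
      proof (cases "rho (?k v) y v = 0")
        case False
        then have "dg y = ?k v \<otimes> dg v \<otimes> inv (?k v)" using rho_deg[of "?k v" v y] by simp
        then have "dg x \<otimes> inv dg y = inv (?k v)" using c by (simp add: m_assoc inv_mult_group)
        then show ?thesis using rho_inv[of "?k v" v' y] by simp
      qed simp
    qed
    also have "\<dots> = (if v = v' then 1 else 0)" by (rule rho_orth) auto
    finally show ?thesis by auto
  qed
  have "(\<Sum>y\<in>?M. csmul (rho (?k v) y v) (tw x y))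
    = (\<Sum>y\<in>?M. \<Sum>v'\<in>?M. csmul (rho (?k v) y v * rho (dg x \<otimes> inv dg y) v' y) (d1 x v'))"
    by (intro sum.cong refl) (simp add: tw_d1 csmul.scale_sum_right)
  also have "\<dots> = (\<Sum>v'\<in>?M. csmul (\<Sum>y\<in>?M. rho (?k v) y v * rho (dg x \<otimes> inv dg y) v' y) (d1 x v'))"
    by (subst sum.swap) (simp only: csmul.scale_sum_left)
  also have "\<dots> = (\<Sum>v'\<in>?M. csmul (if v' = v then 1 else 0) (d1 x v'))"
    by (intro sum.cong refl) (simp only: s)
  also have "\<dots> = (\<Sum>v'\<in>?M. if v' = v then d1 x v' else 0)"
    by (intro sum.cong refl) auto
  also have "\<dots> = d1 x v" by (subst sum.delta) auto
  finally show ?thesis by simp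
qed

lemma lth_e1: "a \<in> I \<Longrightarrow> b \<in> I \<Longrightarrow> lext th (e1 a b) = tw [a] [b]"
  using lth_e(1)[of a b] by (simp add: tw_def)

definition "NU = tgen gUs"
definition "NB = tgen (gUs \<union> antsB)"

lemma gUs_psp: "gUs \<subseteq> psp X" by (auto simp: gUs_def intro!: gU_psp)
lemma antsB_psp: "antsB \<subseteq> psp X" by (auto simp: antsB_def e1_psp e2_psp)
lemma NU_tid: "tid NU" and NB_tid: "tid NB"
  using gUs_psp antsB_psp by (simp_all add: NU_def NB_def tgen_tid)

lemma lth_pre_tid: assumes N: "tmid N" shows "tid {p \<in> psp X. lext th p \<in> N}"
  using N by (simp add: tid_iff tmid_def csmul.subspace_def psp_add psp_csmul lext_linear lcm_psp lth_lmul)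
    (blast intro: tmid_mult[OF N] th_psp)

lemma lth'_pre_tmid: assumes N: "tid N" shows "tmid {p \<in> psp X. lext th' p \<in> N}"
  using N by (simp add: tid_iff tmid_def csmul.subspace_def psp_add psp_csmul lext_linear ltm_psp lth'_ltm)
    (blast intro: tid_mult[OF N] th'_psp)

lemma homogeneous_hpart:
  assumes "csmul.subspace N" "p \<in> N" "p \<in> psp {w \<in> X. ad w = h}"
  shows "lext (hpart ad k) p \<in> N"
proof -
  have "p \<in> psp {w. ad w = h}" by (rule psp_mono[OF assms(3)]) auto
  from hpart_id[OF this] hpart_other[OF this, of k] csmul.subspace_0[OF assms(1)] assms(2)
  show ?thesis by (cases "h = k") (metis, metis)
qed

text \<open>A left translate of a relation between letters is a combination of relations between
  letters, and each of these is homogeneous, so a projection either keeps it or sends it to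
  zero.\<close>

lemma frts_zset:
  assumes N: "tmid N" and f: "\<And>l l'. l \<in> I \<times> I \<Longrightarrow> l' \<in> I \<times> I \<Longrightarrow> frt [l] [l'] \<in> N"
  shows "frts \<subseteq> zset N"
proof
  have sub: "csmul.subspace N" using N by (simp add: tmid_def)
  fix s assume "s \<in> frts"
  then obtain l l' where s: "s = frt [l] [l']" "l \<in> I \<times> I" "l' \<in> I \<times> I" by (auto simp: frts_def)
  have X: "[l] \<in> X" "[l'] \<in> X" using s by auto
  have "lext (hpart ad k) (lext (Lw g) s) \<in> N" if g: "g \<in> carrier G" and k: "k \<in> carrier G" for g k
    unfolding s lLw_frt[OF X g] lext_lext
  proof (rule subspace_lext[OF sub Lw_single[OF g s(2)]], rule subspace_lext[OF sub Lw_single[OF g s(3)]])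
    fix u v assume uv: "u \<in> singles" "v \<in> singles"
    then have "frt u v \<in> N" using f by blast
    moreover have "u \<in> X" "v \<in> X" using uv by auto
    ultimately show "lext (hpart ad k) (frt u v) \<in> N"
      using frt_homogeneous[of u v] homogeneous_hpart[OF sub] by blast
  qed
  then show "s \<in> zset N" using s X by (simp add: zset_def frt_psp del: X_cons)
qed

lemma s1_homogeneous: assumes "set x \<subseteq> I" "set y \<subseteq> I" "length x = length y"
  shows "d1 x y \<in> psp {w \<in> X. ad w = inv dg y \<otimes> dg x}" "d2 x y \<in> psp {w \<in> X. ad w = dg x \<otimes> inv dg y}"
  unfolding d1_def d2_def s1_def s2_def
  using assms by (auto intro!: psp_diff psp_sum simp: ad_def inv_mult_group)

text \<open>The left indices of the two factors are the outer indices in \<open>s1\<close>, which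
  are therefore both moved. In \<open>s2\<close> they are the two copies of the contracted index,
  where the action cancels by orthogonality.\<close>

lemma lLw_d: assumes x: "set x \<subseteq> I" "set y \<subseteq> I" "length x = length y" and g: "g \<in> carrier G"
  shows "lext (Lw g) (d1 x y) = (\<Sum>a\<in>mi (length x). \<Sum>b\<in>mi (length x). csmul (rho g a x * rho g b y) (d1 a b))"
    and "lext (Lw g) (d2 x y) = d2 x y"
proof -
  note [simp] = x g
  let ?M = "mi (length y)"
  show "lext (Lw g) (d1 x y) = (\<Sum>a\<in>mi (length x). \<Sum>b\<in>mi (length x). csmul (rho g a x * rho g b y) (d1 a b))"
  proof (rule ceval_ext)
    fix f
    have "ceval f (lext (Lw g) (s1 x y)) = (\<Sum>z\<in>?M. \<Sum>a\<in>?M. \<Sum>b\<in>?M. rho g a x * (rho g b (st y) * f (zip a z @ zip b (st z))))"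
      by (simp add: s1_def lext_linear ceval_linear Sw_def Lw_append ceval_lmul ceval_Lw cm_def sum_distrib_left)
    also have "\<dots> = (\<Sum>z\<in>?M. \<Sum>a\<in>?M. \<Sum>b\<in>?M. rho g a x * (rho g (st b) (st y) * f (zip a z @ zip (st b) (st z))))"
      by (intro sum.cong refl sum_mi_st[symmetric])
    also have "\<dots> = (\<Sum>a\<in>?M. \<Sum>b\<in>?M. \<Sum>z\<in>?M. rho g a x * (rho g (st b) (st y) * f (zip a z @ zip (st b) (st z))))"
      by (subst sum.swap) (intro sum.cong refl sum.swap)
    also have "\<dots> = (\<Sum>a\<in>?M. \<Sum>b\<in>?M. (rho g a x * rho g b y) * ceval f (s1 a b))"
      by (intro sum.cong refl) (simp add: s1_def Sw_def ceval_linear sum_distrib_left mult.assoc)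
    finally have 1: "ceval f (lext (Lw g) (s1 x y)) = (\<Sum>a\<in>?M. \<Sum>b\<in>?M. (rho g a x * rho g b y) * ceval f (s1 a b))" .
    have "(\<Sum>a\<in>?M. \<Sum>b\<in>?M. (rho g a x * rho g b y) * (if a = b then f [] else 0))
      = (\<Sum>a\<in>?M. \<Sum>b\<in>?M. if a = b then rho g a x * rho g b y * f [] else 0)"
      by (intro sum.cong refl) auto
    also have "\<dots> = (\<Sum>a\<in>?M. rho g a x * rho g a y) * f []" by (simp add: sum2_delta sum_distrib_right)
    also have "\<dots> = (if x = y then f [] else 0)" by (simp add: rho_orth)
    finally have 2: "(\<Sum>a\<in>?M. \<Sum>b\<in>?M. (rho g a x * rho g b y) * (if a = b then f [] else 0)) = (if x = y then f [] else 0)" .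
    have "ceval f (\<Sum>a\<in>?M. \<Sum>b\<in>?M. csmul (rho g a x * rho g b y) (d1 a b))
      = (\<Sum>a\<in>?M. \<Sum>b\<in>?M. (rho g a x * rho g b y) * ceval f (s1 a b) - (rho g a x * rho g b y) * (if a = b then f [] else 0))"
      unfolding ceval_linear d1_def by (intro sum.cong refl) (simp add: right_diff_distrib)
    also have "\<dots> = ceval f (lext (Lw g) (s1 x y)) - (if x = y then f [] else 0)"
      by (simp only: sum_subtractf 1 2)
    finally show "ceval f (lext (Lw g) (d1 x y)) = ceval f (\<Sum>a\<in>mi (length x). \<Sum>b\<in>mi (length x). csmul (rho g a x * rho g b y) (d1 a b))"
      by (simp add: d1_def lext_diff ceval_diff)
  qed
  show "lext (Lw g) (d2 x y) = d2 x y"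
  proof (rule ceval_ext)
    fix f
    have "ceval f (lext (Lw g) (s2 x y)) = (\<Sum>z\<in>?M. \<Sum>a\<in>?M. \<Sum>b\<in>?M. rho g a (st z) * (rho g b z * f (zip a (st x) @ zip b y)))"
      by (simp add: s2_def lext_linear ceval_linear Sw_def Lw_append ceval_lmul ceval_Lw cm_def sum_distrib_left)
    also have "\<dots> = (\<Sum>z\<in>?M. \<Sum>a\<in>?M. \<Sum>b\<in>?M. rho g (st a) (st z) * (rho g b z * f (zip (st a) (st x) @ zip b y)))"
      by (intro sum.cong refl sum_mi_st[symmetric])
    also have "\<dots> = (\<Sum>a\<in>?M. \<Sum>b\<in>?M. \<Sum>z\<in>?M. rho g (st a) (st z) * (rho g b z * f (zip (st a) (st x) @ zip b y)))"
      by (subst sum.swap) (intro sum.cong refl sum.swap)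
    also have "\<dots> = (\<Sum>a\<in>?M. \<Sum>b\<in>?M. (\<Sum>z\<in>?M. rho g a z * rho g b z) * f (zip (st a) (st x) @ zip b y))"
      by (intro sum.cong refl) (simp add: sum_distrib_right mult.assoc)
    also have "\<dots> = (\<Sum>a\<in>?M. \<Sum>b\<in>?M. (if a = b then 1 else 0) * f (zip (st a) (st x) @ zip b y))"
      by (intro sum.cong refl) (simp add: rho_orth)
    also have "\<dots> = (\<Sum>a\<in>?M. f (zip (st a) (st x) @ zip a y))" by (intro sum.cong refl sum_if_eq(2))
    also have "\<dots> = ceval f (s2 x y)" by (simp add: s2_def Sw_def ceval_linear)
    finally show "ceval f (lext (Lw g) (d2 x y)) = ceval f (d2 x y)"
      by (auto simp: d2_def lext_diff ceval_diff)
  qed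
qed

lemma ants_zset:
  assumes N: "tmid N" and f: "\<And>a b. a \<in> I \<Longrightarrow> b \<in> I \<Longrightarrow> d1 [a] [b] \<in> N \<and> d2 [a] [b] \<in> N"
  shows "ants \<subseteq> zset N"
proof
  have sub: "csmul.subspace N" using N by (simp add: tmid_def)
  fix s assume "s \<in> ants"
  then obtain a b where s: "s = d1 [a] [b] \<or> s = d2 [a] [b]" "a \<in> I" "b \<in> I" by (auto simp: ants_def)
  have h: "lext (hpart ad k) (d1 x y) \<in> N" "lext (hpart ad k) (d2 x y) \<in> N"
    if "set x \<subseteq> I" "set y \<subseteq> I" "length x = 1" "length y = 1" for x y k
  proof -
    from that obtain a b where xy: "x = [a]" "y = [b]" "a \<in> I" "b \<in> I" by (auto simp: length_Suc_conv)
    have "d1 x y \<in> N" "d2 x y \<in> N" using f xy by auto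
    then show "lext (hpart ad k) (d1 x y) \<in> N" "lext (hpart ad k) (d2 x y) \<in> N"
      using s1_homogeneous[of x y] that by (auto intro: homogeneous_hpart[OF sub])
  qed
  have "lext (hpart ad k) (lext (Lw g) (d1 [a] [b])) \<in> N" "lext (hpart ad k) (lext (Lw g) (d2 [a] [b])) \<in> N"
    if g: "g \<in> carrier G" for g k
  proof -
    have 1: "lext (hpart ad k) (lext (Lw g) (d1 [a] [b]))
      = (\<Sum>x\<in>mi 1. \<Sum>y\<in>mi 1. csmul (rho g x [a] * rho g y [b]) (lext (hpart ad k) (d1 x y)))"
      using lLw_d(1)[of "[a]" "[b]" g] s g by (simp add: lext_linear)
    show "lext (hpart ad k) (lext (Lw g) (d1 [a] [b])) \<in> N"
      unfolding 1 by (intro csmul.subspace_sum[OF sub] csmul.subspace_scale[OF sub] h) auto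
    show "lext (hpart ad k) (lext (Lw g) (d2 [a] [b])) \<in> N"
      using lLw_d(2)[of "[a]" "[b]" g] s g h(2)[of "[a]" "[b]"] by simp
  qed
  then show "s \<in> zset N" using s by (auto simp: zset_def d1_psp d2_psp)
qed

lemma NU_gUs: "gUs \<subseteq> NU" "gUs \<subseteq> NB" "antsB \<subseteq> NB"
  using tgen_incl[of gUs] tgen_incl[of "gUs \<union> antsB"] unfolding NU_def NB_def by blast+

lemma lth'_frt: assumes N: "tid N" "gUs \<subseteq> N" and l: "l \<in> I \<times> I" "l' \<in> I \<times> I"
  shows "lext th' (frt [l] [l']) \<in> N"
proof -
  have X: "[l] \<in> X" "[l'] \<in> X" using l by auto
  have c: "dg (wr [l]) \<in> carrier G" using dg_closed[OF wr_set[OF X(1)]] by auto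
  have "lext (gU [l]) (Lw (dg (wr [l])) [l']) \<in> N"
  proof (rule subspace_lext[OF tid_sub[OF N(1)] Lw_single[OF c l(2)]])
    fix v assume "v \<in> singles"
    then show "gU [l] v \<in> N" using N(2) l(1) unfolding gUs_def by blast
  qed
  moreover from this have "lext (gU [l]) (Lw (dg (wr [l])) [l']) \<in> psp X" by (rule tid_psp[OF N(1)])
  ultimately show ?thesis using frt_gU[OF l] by (simp add: lth'_lth)
qed

text \<open>\<open>NA\<close> is a twisted ideal and \<open>th\<close> an algebra map into the
  twisted algebra, so it suffices that \<open>th\<close> sends the generators of \<open>NU\<close>
  into \<open>NA\<close>. Conversely the elements sent into \<open>NU\<close> by \<open>th'\<close>
  form a twisted ideal, and its \<open>zset\<close> is an ideal for concatenation that contains the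
  generators of \<open>NA\<close>.\<close>

theorem kerU: "{p \<in> psp X. lext th' p \<in> NU} = NA"
proof
  have tA: "tmid NA" by (rule nice_tmid[OF nice_NA])
  have "gUs \<subseteq> {p \<in> psp X. lext th p \<in> NA}"
  proof
    fix s assume s: "s \<in> gUs"
    then obtain l l' where l: "s = gU [l] [l']" "l \<in> I \<times> I" "l' \<in> I \<times> I" by (auto simp: gUs_def)
    have X: "[l] \<in> X" "[l'] \<in> X" using l by auto
    have c: "dg (wr [l]) \<in> carrier G" using dg_closed[OF wr_set[OF X(1)]] by auto
    have "lext (frt [l]) (Lw (inv dg (wr [l])) [l']) \<in> NA"
      by (rule subspace_lext[OF tid_sub[OF NA_tid] Lw_psp]) (use X c frt_all[OF NA_tid NA_frts] in auto)
    then show "s \<in> {p \<in> psp X. lext th p \<in> NA}" using l s gUs_psp lth_gU by auto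
  qed
  then have le: "NU \<subseteq> {p \<in> psp X. lext th p \<in> NA}" unfolding NU_def by (rule tgen_min[OF lth_pre_tid[OF tA]])
  show "{p \<in> psp X. lext th' p \<in> NU} \<subseteq> NA"
  proof clarify
    fix p assume "p \<in> psp X" "lext th' p \<in> NU"
    then have "lext th (lext th' p) \<in> NA" using le by blast
    then show "p \<in> NA" using \<open>p \<in> psp X\<close> by (simp add: lth_lth')
  qed
  let ?N = "{p \<in> psp X. lext th' p \<in> NU}"
  have t: "tmid ?N" by (rule lth'_pre_tmid[OF NU_tid])
  have "frts \<subseteq> zset ?N"
    by (rule frts_zset[OF t]) (use lth'_frt[OF NU_tid NU_gUs(1)] frt_psp in auto)
  then have "NA \<subseteq> zset ?N" unfolding NA_def by (rule tgen_min[OF zset_tid[OF t]])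
  then show "NA \<subseteq> ?N" using zset_sub[OF t] by blast
qed

theorem kerB: "{p \<in> psp X. lext th' p \<in> NB} = NH"
proof
  have tH: "tmid NH" by (rule nice_tmid[OF nice_NH])
  have subH: "csmul.subspace NH" by (rule tid_sub[OF NH_tid])
  have "gUs \<union> antsB \<subseteq> {p \<in> psp X. lext th p \<in> NH}"
  proof
    fix s assume s: "s \<in> gUs \<union> antsB"
    then have sX: "s \<in> psp X" using gUs_psp antsB_psp by blast
    have "lext th s \<in> NH"
    proof (cases "s \<in> gUs")
      case True
      then obtain l l' where l: "s = gU [l] [l']" "l \<in> I \<times> I" "l' \<in> I \<times> I" by (auto simp: gUs_def)
      have X: "[l] \<in> X" "[l'] \<in> X" using l by auto
      have c: "dg (wr [l]) \<in> carrier G" using dg_closed[OF wr_set[OF X(1)]] by auto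
      have "lext (frt [l]) (Lw (inv dg (wr [l])) [l']) \<in> NH"
        by (rule subspace_lext[OF subH Lw_psp]) (use X c frt_all[OF NH_tid NH_frts] in auto)
      then show ?thesis using l lth_gU by auto
    next
      case False
      then obtain a b where ab: "s = e1 a b \<or> s = e2 a b" "a \<in> I" "b \<in> I" using s by (auto simp: antsB_def)
      have "tw [a] [b] \<in> NH"
        using ab d1_all[OF NH_tid NH_ants]
        by (subst tw_d1) (auto intro!: csmul.subspace_sum[OF subH] csmul.subspace_scale[OF subH])
      moreover have "d2 [a] [b] \<in> NH" using ab by (intro d2_all[OF NH_tid NH_ants]) auto
      ultimately show ?thesis using ab lth_e(2) lth_e1 by auto
    qed
    then show "s \<in> {p \<in> psp X. lext th p \<in> NH}" using sX by simp
  qed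
  then have le: "NB \<subseteq> {p \<in> psp X. lext th p \<in> NH}" unfolding NB_def by (rule tgen_min[OF lth_pre_tid[OF tH]])
  show "{p \<in> psp X. lext th' p \<in> NB} \<subseteq> NH"
  proof clarify
    fix p assume "p \<in> psp X" "lext th' p \<in> NB"
    then have "lext th (lext th' p) \<in> NH" using le by blast
    then show "p \<in> NH" using \<open>p \<in> psp X\<close> by (simp add: lth_lth')
  qed
  let ?N = "{p \<in> psp X. lext th' p \<in> NB}"
  have t: "tmid ?N" by (rule lth'_pre_tmid[OF NB_tid])
  have subN: "csmul.subspace ?N" using t by (simp add: tmid_def)
  have f: "frts \<subseteq> zset ?N"
    by (rule frts_zset[OF t]) (use lth'_frt[OF NB_tid NU_gUs(2)] frt_psp in auto)
  have e: "tw [a] [b] \<in> ?N \<and> d2 [a] [b] \<in> ?N" if ab: "a \<in> I" "b \<in> I" for a b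
  proof -
    have eB: "e1 a b \<in> NB" "e2 a b \<in> NB" using NU_gUs(3) ab unfolding antsB_def by blast+
    have eX: "e1 a b \<in> psp X" "e2 a b \<in> psp X" using ab by (simp_all add: e1_psp e2_psp)
    have "lext th (e1 a b) \<in> ?N" "lext th (e2 a b) \<in> ?N"
      using eB eX by (simp_all add: lth'_lth lth_psp)
    then show ?thesis using ab lth_e(2) lth_e1 by auto
  qed
  have "ants \<subseteq> zset ?N"
  proof (rule ants_zset[OF t], rule conjI)
    fix a b assume ab: "a \<in> I" "b \<in> I"
    show "d2 [a] [b] \<in> ?N" using e ab by blast
    \<comment> \<open>The twisted ideal is known to contain the recombined relations
      \<open>tw\<close>; with these coefficients they give back \<open>d1\<close>.\<close>
    have "(\<Sum>y\<in>mi (length [a]). csmul (rho (inv dg [a] \<otimes> dg [b]) y [b]) (tw [a] y)) \<in> ?N"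
    proof (intro csmul.subspace_sum[OF subN] csmul.subspace_scale[OF subN])
      fix y assume "y \<in> mi (length [a])"
      then obtain c where "y = [c]" "c \<in> I" by (auto simp: length_Suc_conv)
      then show "tw [a] y \<in> ?N" using e ab by blast
    qed
    then show "d1 [a] [b] \<in> ?N" using d1_tw[of "[a]" "[b]"] ab by simp
  qed
  with f have "frts \<union> ants \<subseteq> zset ?N" by blast
  then have "NH \<subseteq> zset ?N" unfolding NH_def by (rule tgen_min[OF zset_tid[OF t]])
  then show "NH \<subseteq> ?N" using zset_sub[OF t] by blast
qed

end

section \<open>Hopf structures on quotients of the space of words\<close>

lemma (in cover) leval_sum_basis:
  assumes "finite A" "\<And>i. i \<in> A \<Longrightarrow> F (h i) = P (f i) \<and> f i \<in> psp X"
  shows "leval K F (\<Sum>i\<in>A. basis (h i)) = P (\<Sum>i\<in>A. f i)"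
proof -
  have k: "i \<in> A" if "i \<in> Poly_Mapping.keys (\<Sum>i\<in>A. basis i :: _ \<Rightarrow>\<^sub>0 complex)" for i
    using that keys_sum[of basis A] by auto
  have "leval K F (lext (\<lambda>i. basis (h i)) (\<Sum>i\<in>A. basis i)) = P (lext f (\<Sum>i\<in>A. basis i))"
    by (rule leval_lext_basis) (use assms(2) k in blast)
  then show ?thesis by (simp add: lext_sum)
qed

context orep
begin

lemma conj_self: "a \<in> carrier G \<Longrightarrow> a \<otimes> a \<otimes> inv a = a"
  by (simp add: m_assoc)

lemma cocover_K:
  assumes "cover X K P" "coideal X dl ep (cover.ker X K P)"
  shows "cocover X K P dl ep"
proof -
  interpret cover X K P by fact
  show ?thesis
    by unfold_locales (auto simp: dl_psp dl_coassoc dl_counit assms(2))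
qed

lemma bicover_K:
  assumes "algcover X K P cm []" "coideal X dl ep (cover.ker X K P)"
  shows "bicover X K P dl ep cm []"
proof -
  interpret algcover X K P cm "[]" by fact
  interpret cocover X K P dl ep by (rule cocover_K[OF cover_axioms assms(2)])
  show ?thesis
    by unfold_locales (auto simp: cm_def dl_append[unfolded cm_def] ep_append, simp_all add: dl_def ep_def)
qed

lemma braided_K:
  fixes K :: "('g, 'v, 'z) crossed_module_scheme"
  assumes "algcover X K P tm []" "coideal X dl ep (cover.ker X K P)"
    and "\<And>g p. g \<in> carrier G \<Longrightarrow> p \<in> psp X \<Longrightarrow> act K g (P p) = P (lext (Aw g) p)"
    and "\<And>g p. g \<in> carrier G \<Longrightarrow> p \<in> psp X \<Longrightarrow> hcomp K g (P p) = P (lext (hpart ad g) p)"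
  shows "braided_cover X K P dl ep tm [] G Aw ad"
proof -
  interpret algcover X K P tm "[]" by fact
  interpret cocover X K P dl ep by (rule cocover_K[OF cover_axioms assms(2)])
  show ?thesis
  proof (unfold_locales)
    fix u v assume "u \<in> X" "v \<in> X"
    then show "lext dl (tm u v) = lext (\<lambda>((a1, a2), b1, b2). pairs (lmul tm (basis a1) (Aw (ad a2) b1)) (tm a2 b2))
        (pairs (dl u) (dl v))" by (rule dl_tm)
  qed (auto simp: finG Aw_closed Aw_one Aw_mult assms(3,4) tm_deg Aw_tm Aw_nil dl_Aw dl_closed ep_Aw ep_deg ep_tm,
      simp_all add: dl_def ep_def)
qed

text \<open>On each homogeneous component \<open>sB\<close> is \<open>lS\<close> followed by a
  single left action, and both preserve \<open>N\<close>, as do the projections onto the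
  components.\<close>

lemma sB_ker: assumes "nice N" "\<And>p. p \<in> N \<Longrightarrow> lS p \<in> N" "p \<in> N" shows "lext sB p \<in> N"
proof -
  have N: "tid N" using assms(1) by (simp add: nice_def)
  have pX: "p \<in> psp X" by (rule tid_psp[OF N assms(3)])
  have "lext sB p = (\<Sum>k\<in>carrier G. lext sB (lext (hpart ad k) p))"
    using sum_hpart[OF pX] by (simp add: lext_sum[symmetric])
  also have "\<dots> = (\<Sum>k\<in>carrier G. lext (Lw k) (lS (lext (hpart ad k) p)))"
    by (simp add: lsB_homogeneous[OF hpart_ad_closed[OF pX]])
  also have "\<dots> \<in> N"
    by (rule csmul.subspace_sum[OF tid_sub[OF N]]) (use assms in \<open>auto simp: nice_def\<close>)
  finally show ?thesis .
qed

lemma s_ep: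
  assumes "cover X K P" "set x \<subseteq> I" "set y \<subseteq> I" "length x = length y"
  shows "d1 x y \<in> cover.ker X K P \<Longrightarrow> P (s1 x y) = P (csmul (ep (zip x y)) (basis []))"
    and "d2 x y \<in> cover.ker X K P \<Longrightarrow> P (s2 x y) = P (csmul (ep (zip x y)) (basis []))"
proof -
  interpret cover X K P by fact
  have e: "csmul (ep (zip x y)) (basis []) = (if x = y then basis [] else 0)" using assms by simp
  show "d1 x y \<in> ker \<Longrightarrow> P (s1 x y) = P (csmul (ep (zip x y)) (basis []))"
    unfolding e using assms by (subst P_eq_iff) (auto simp: s1_psp d1_def ker_def)
  show "d2 x y \<in> ker \<Longrightarrow> P (s2 x y) = P (csmul (ep (zip x y)) (basis []))"
    unfolding e using assms by (subst P_eq_iff) (auto simp: s2_psp d2_def ker_def)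
qed

text \<open>For concatenation the convolutions of \<open>Sw\<close> with the identity on the word
  \<open>zip x y\<close> are literally \<open>s2 x y\<close> and \<open>s1 x y\<close>, so the
  antipode axioms are the relations \<open>d2\<close> and \<open>d1\<close> for words.\<close>

lemma hopf_K:
  assumes "bicover X K P dl ep cm []" "cover.ker X K P = NH"
  shows "hopf_algebra K (qcomult X dl P) (qcounit X ep P) (coalgcover.antip X P (\<lambda>u. basis (Sw u)))"
    and "p \<in> psp X \<Longrightarrow> coalgcover.antip X P (\<lambda>u. basis (Sw u)) (P p) = P (lS p)"
proof -
  interpret bicover X K P dl ep cm "[]" by fact
  have k: "lext (\<lambda>u. basis (Sw u)) p \<in> ker" if "p \<in> ker" for p
    using lS_NH[of p] that by (simp add: assms(2) lS_def)
  show "p \<in> psp X \<Longrightarrow> antip (\<lambda>u. basis (Sw u)) (P p) = P (lS p)"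
    unfolding antip_def lS_def by (rule qdesc_endo) (auto simp: k)
  have "antipode_for K \<Delta> cou (antip (\<lambda>u. basis (Sw u)))"
  proof (rule antipode_for[OF _ k])
    fix w assume "w \<in> X"
    then obtain x y where x: "set x \<subseteq> I" "set y \<subseteq> I" "length x = length y" "w = zip x y" by (rule XE)
    have "lext (\<lambda>(u, v). lmul cm (basis (Sw u)) (basis v)) (dl w) = s2 x y"
      "lext (\<lambda>(u, v). lmul cm (basis u) (basis (Sw v))) (dl w) = s1 x y"
      using x by (auto intro!: ceval_ext simp: ceval_lext ceval_dl split_def cm_def s1_def s2_def ceval_linear)
    then show "P (lext (\<lambda>(u, v). lmul cm (basis (Sw u)) (basis v)) (dl w)) = P (csmul (ep w) (basis []))"
      "P (lext (\<lambda>(u, v). lmul cm (basis u) (basis (Sw v))) (dl w)) = P (csmul (ep w) (basis []))"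
      using s_ep[OF cover_axioms x(1-3)] d1_all[OF NH_tid NH_ants x(1-3)] d2_all[OF NH_tid NH_ants x(1-3)] x
      by (simp_all add: assms(2))
  qed auto
  then show "hopf_algebra K \<Delta> cou (antip (\<lambda>u. basis (Sw u)))"
    unfolding hopf_algebra_def using bialgebra by blast
qed

lemma braided_antip:
  fixes K :: "('g, 'v, 'z) crossed_module_scheme"
  assumes "braided_cover X K P dl ep tm [] G Aw ad" "nice (cover.ker X K P)"
    "\<And>p. p \<in> cover.ker X K P \<Longrightarrow> lS p \<in> cover.ker X K P"
  defines "S \<equiv> coalgcover.antip X P sB"
  shows "p \<in> psp X \<Longrightarrow> S (P p) = P (lext sB p)"
    and "crossed_hom G K K S"
    and "unital_braided_antialgebra_map G K S"
    and "bij_betw S (carrier K) (carrier K)"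
proof -
  interpret braided_cover X K P dl ep tm "[]" G Aw ad by fact
  have k: "lext sB p \<in> ker" if "p \<in> ker" for p by (rule sB_ker[OF assms(2,3) that])
  show SP: "S (P p) = P (lext sB p)" if "p \<in> psp X" for p
    unfolding S_def antip_def by (rule qdesc_endo[OF that sB_psp k])
  show ch: "crossed_hom G K K S"
    by (rule crossed_hom_endo[OF SP]) (auto simp: sB_closed sB_Aw)
  show "unital_braided_antialgebra_map G K S"
    unfolding unital_braided_antialgebra_map_def
  proof (intro conjI ballI ch)
    show "S \<one>\<^bsub>K\<^esub> = \<one>\<^bsub>K\<^esub>" using SP[of "basis []"] by (simp add: P_one sB_nil)
    fix x y assume "x \<in> carrier K" "y \<in> carrier K"
    then obtain p q where p: "p \<in> psp X" "x = P p" and q: "q \<in> psp X" "y = P q" by (metis P_surj)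
    \<comment> \<open>The braiding is a sum over \<open>G\<close>; at a word \<open>u\<close> only
      the term \<open>g = ad u\<close> survives, since \<open>sB u\<close> has the degree of
      \<open>u\<close>, and that term is \<open>sB_tm\<close>.\<close>
    have 1: "lext sB (lmul tm p q) = (\<Sum>g\<in>carrier G. lmul tm (lext (Aw g) (lext sB q)) (lext (hpart ad g) (lext sB p)))"
    proof -
      have w: "lext sB (tm u v) = (\<Sum>g\<in>carrier G. lmul tm (lext (Aw g) (sB v)) (lext (hpart ad g) (sB u)))"
        if u: "u \<in> X" and v: "v \<in> X" for u v
      proof -
        have s: "sB u \<in> psp {w. ad w = ad u}" by (rule psp_mono[OF sB_closed[OF u]]) auto
        have "(\<Sum>g\<in>carrier G. lmul tm (lext (Aw g) (sB v)) (lext (hpart ad g) (sB u)))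
          = (\<Sum>g\<in>carrier G. if g = ad u then lmul tm (lext (Aw (ad u)) (sB v)) (sB u) else 0)"
          using hpart_id[OF s] hpart_other[OF s] by (intro sum.cong refl) auto
        then show ?thesis using u v finG by (simp add: sB_tm)
      qed
      have "lext sB (lmul tm p q) = lext (\<lambda>u. lext (\<lambda>v. \<Sum>g\<in>carrier G. lmul tm (lext (Aw g) (sB v)) (lext (hpart ad g) (sB u))) q) p"
        unfolding lext_lmul by (intro lext_psp_cong[OF p(1)] lext_psp_cong[OF q(1)] w)
      also have "\<dots> = (\<Sum>g\<in>carrier G. lext (\<lambda>u. lext (\<lambda>v. lmul tm (lext (Aw g) (sB v)) (lext (hpart ad g) (sB u))) q) p)"
        by (simp only: lext_fun_sum)
      also have "\<dots> = (\<Sum>g\<in>carrier G. lmul tm (lext (Aw g) (lext sB q)) (lext (hpart ad g) (lext sB p)))"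
      proof -
        have "lmul tm (lext F q) (lext H p) = lext (\<lambda>u. lext (\<lambda>v. lmul tm (F v) (H u)) q) p"
          for F H :: "('a \<times> 'a) list \<Rightarrow> (('a \<times> 'a) list \<Rightarrow>\<^sub>0 complex)"
          by (subst lmul_lext_right) (simp only: lmul_lext_left)
        then show ?thesis by (simp only: lext_lext)
      qed
      finally show ?thesis .
    qed
    have c: "lext sB p \<in> psp X" "lext sB q \<in> psp X" using p q by (auto intro: lsB_psp)
    have "leval K (\<lambda>(u, v). u \<otimes>\<^bsub>K\<^esub> v) (braid G K K (S x, S y))
      = leval K (\<lambda>(u, v). u \<otimes>\<^bsub>K\<^esub> v) (\<Sum>g\<in>carrier G. basis (act K g (S y), hcomp K g (S x)))"
      by (simp add: braid_def)
    also have "\<dots> = P (\<Sum>g\<in>carrier G. lmul tm (lext (Aw g) (lext sB q)) (lext (hpart ad g) (lext sB p)))"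
      by (rule leval_sum_basis[OF finG])
        (auto simp: p q SP act_P hcomp_P c P_mult ac_psp hpart_psp intro!: lmul_psp)
    finally show "S (x \<otimes>\<^bsub>K\<^esub> y) = leval K (\<lambda>(u, v). u \<otimes>\<^bsub>K\<^esub> v) (braid G K K (S x, S y))"
      by (simp add: 1[symmetric] p q SP P_mult[symmetric] lmul_psp)
  qed
  \<comment> \<open>\<open>V\<close> is the square of \<open>S\<close> on words: each homogeneous
    element is acted on by its own degree. Acting by the inverse degree gives the inverse
    \<open>V'\<close>, and as \<open>V'\<close> preserves the kernel, \<open>S\<close> is bijective
    on the quotient.\<close>
  define V where "V = lext (\<lambda>u. Aw (ad u) u)"
  define V' where "V' = lext (\<lambda>u. Aw (inv ad u) u)"
  have V'X: "V' p \<in> psp X" if "p \<in> psp X" for p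
    unfolding V'_def by (rule psp_lext[OF that]) (auto intro: Aw_psp)
  have VX: "V p \<in> psp X" if "p \<in> psp X" for p
    unfolding V_def by (rule psp_lext[OF that]) (auto intro: Aw_psp)
  have VV': "V (V' p) = p \<and> V' (V p) = p" if p: "p \<in> psp X" for p
  proof
    have "V (Aw (inv ad u) u) = basis u" if u: "u \<in> X" for u
    proof -
      have a: "ad u \<in> carrier G" using u by simp
      have "V (Aw (inv ad u) u) = lext (Aw (ad u)) (Aw (inv ad u) u)"
        unfolding V_def by (rule lext_psp_cong[OF Aw_closed[OF inv_closed[OF a] u]]) (use a in auto)
      then show ?thesis using a u by (simp add: Aw_mult[symmetric] Aw_one)
    qed
    then show "V (V' p) = p"
      using lext_psp_cong[OF p, of "\<lambda>u. V (Aw (inv ad u) u)" basis] by (simp add: V_def V'_def lext_lext)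
    have "V' (Aw (ad u) u) = basis u" if u: "u \<in> X" for u
    proof -
      have a: "ad u \<in> carrier G" using u by simp
      have "V' (Aw (ad u) u) = lext (Aw (inv ad u)) (Aw (ad u) u)"
        unfolding V'_def by (rule lext_psp_cong[OF Aw_closed[OF a u]]) (use a in \<open>auto simp: conj_self\<close>)
      then show ?thesis using a u by (simp add: Aw_mult[symmetric] Aw_one)
    qed
    then show "V' (V p) = p"
      using lext_psp_cong[OF p, of "\<lambda>u. V' (Aw (ad u) u)" basis] by (simp add: V_def V'_def lext_lext)
  qed
  have V'k: "V' p \<in> ker" if pk: "p \<in> ker" for p
  proof -
    have t: "tid ker" using assms(2) by (simp add: nice_def)
    have p: "p \<in> psp X" using pk by (simp add: ker_def)
    have "V' p = (\<Sum>k\<in>carrier G. V' (lext (hpart ad k) p))"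
      using sum_hpart[OF p] by (simp add: V'_def lext_sum[symmetric])
    also have "\<dots> = (\<Sum>k\<in>carrier G. lext (Aw (inv k)) (lext (hpart ad k) p))"
      unfolding V'_def by (intro sum.cong refl lext_psp_cong[OF hpart_ad_closed[OF p]]) auto
    also have "\<dots> \<in> ker"
      unfolding lAw by (intro csmul.subspace_sum[OF tid_sub[OF t]]) (use assms(2) pk in \<open>auto simp: nice_def\<close>)
    finally show ?thesis .
  qed
  have SS: "lext sB (lext sB p) = V p" if "p \<in> psp X" for p
    unfolding V_def lext_lext by (rule lext_psp_cong[OF that sB_sB])
  show "bij_betw S (carrier K) (carrier K)"
    unfolding bij_betw_def
  proof
    show "inj_on S (carrier K)"
    proof (rule inj_onI)
      fix x y assume xy: "x \<in> carrier K" "y \<in> carrier K" "S x = S y"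
      then obtain p q where p: "p \<in> psp X" "x = P p" and q: "q \<in> psp X" "y = P q" by (metis P_surj)
      have "P (V p) = P (V q)"
        using arg_cong[OF xy(3), of S] by (simp add: p q SP lsB_psp SS)
      then have "V p - V q \<in> ker" using P_eq_iff[of "V p" "V q"] p q VX by (simp add: ker_def psp_diff)
      from V'k[OF this] have "V' (V p) - V' (V q) \<in> ker" by (simp add: V'_def lext_diff)
      then have "p - q \<in> ker" using VV' p q by simp
      then show "x = y" using P_eq_iff[of p q] p q by (simp add: ker_def)
    qed
    show "S ` carrier K = carrier K"
    proof
      show "S ` carrier K \<subseteq> carrier K"
        by (auto elim!: P_ex simp: SP P_closed lsB_psp)
      show "carrier K \<subseteq> S ` carrier K"
      proof
        fix x assume "x \<in> carrier K"
        then obtain p where p: "p \<in> psp X" "x = P p" by (metis P_surj)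
        have "x = S (P (lext sB (V' p)))" using p VV' by (simp add: SP lsB_psp V'X SS)
        then show "x \<in> S ` carrier K" using p by (auto simp: P_closed lsB_psp V'X)
      qed
    qed
  qed
qed

lemma braided_hopf_K:
  fixes K :: "('g, 'v, 'z) crossed_module_scheme"
  assumes "braided_cover X K P dl ep tm [] G Aw ad" "cover.ker X K P = NH"
  shows "braided_hopf_algebra G K (qcomult X dl P) (qcounit X ep P) (coalgcover.antip X P sB)"
proof -
  interpret braided_cover X K P dl ep tm "[]" G Aw ad by fact
  have n: "nice ker" by (simp add: assms(2) nice_NH)
  have lk: "lS p \<in> ker" if "p \<in> ker" for p using lS_NH that by (simp add: assms(2))
  have "antipode_for K \<Delta> cou (antip sB)"
  proof (rule antipode_for[OF sB_psp sB_ker[OF n lk]])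
    fix w assume "w \<in> X"
    then obtain x y where x: "set x \<subseteq> I" "set y \<subseteq> I" "length x = length y" "w = zip x y" by (rule XE)
    show "P (lext (\<lambda>(u, v). lmul tm (sB u) (basis v)) (dl w)) = P (csmul (ep w) (basis []))"
      using s_ep(2)[OF cover_axioms x(1-3)] d2_all[OF NH_tid NH_ants x(1-3)] sB_left[OF x(1-3)] x
      by (simp add: assms(2))
    \<comment> \<open>By \<open>sB_right\<close> the right antipode identity is the recombined
      relation, which lies in the ideal together with all the \<open>d1\<close>.\<close>
    have "tw x y \<in> ker"
      unfolding tw_d1[OF x(1-3)] assms(2) using x
      by (intro csmul.subspace_sum[OF tid_sub[OF NH_tid]] csmul.subspace_scale[OF tid_sub[OF NH_tid]]
          d1_all[OF NH_tid NH_ants]) auto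
    moreover have "csmul (ep w) (basis []) = (if x = y then basis [] else 0)" using x by simp
    moreover have "(\<Sum>v\<in>mi (length x). csmul (rho (dg x \<otimes> inv dg y) v y) (s1 x v)) \<in> psp X"
      using x by (intro psp_sum psp_csmul s1_psp) auto
    ultimately show "P (lext (\<lambda>(u, v). lmul tm (basis u) (sB v)) (dl w)) = P (csmul (ep w) (basis []))"
      using sB_right[OF x(1-3)] x by (subst P_eq_iff) (auto simp: tw_def ker_def)
  qed
  then show ?thesis
    unfolding braided_hopf_algebra_def
    using braided_bialgebra braided_antip(2)[OF assms(1) n lk] by blast
qed

section \<open>Homomorphisms to the dual double and to its transmutation\<close>

abbreviation "GG \<equiv> carrier G \<times> carrier G"

lemma Dvee_simps [simp]:
  "carrier (Dvee G) = psp GG" "\<zero>\<^bsub>Dvee G\<^esub> = 0" "add (Dvee G) = (+)" "smult (Dvee G) = csmul"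
  "mult (Dvee G) = lmul dv" "\<one>\<^bsub>Dvee G\<^esub> = ph []"
  by (simp_all add: Dvee_def psp_def ph_nil fun_eq_iff lmul_def lext_pairs dv_def)

definition bm :: "'g \<times> 'g \<Rightarrow> 'g \<times> 'g \<Rightarrow> ('g \<times> 'g \<Rightarrow>\<^sub>0 complex)" where
  "bm = (\<lambda>(g, h) (u, v). if g = h \<otimes> u \<otimes> inv h then basis (g, h \<otimes> v) else 0)"

lemma BD_simps [simp]:
  "carrier (BD G) = psp GG" "\<zero>\<^bsub>BD G\<^esub> = 0" "add (BD G) = (+)" "smult (BD G) = csmul"
  "mult (BD G) = lmul bm" "\<one>\<^bsub>BD G\<^esub> = ph []"
  by (simp_all add: BD_def with_crossed_def fun_eq_iff lmul_def lext_pairs bm_def)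

lemma cover_Dvee: "cover GG (Dvee G) id" and cover_BD: "cover GG (BD G) id"
  by unfold_locales auto

lemma ph_psp: "u \<in> X \<Longrightarrow> ph u \<in> psp GG"
  unfolding ph_def by (intro psp_sum psp_csmul) auto

lemma lph_psp: "p \<in> psp X \<Longrightarrow> lext ph p \<in> psp GG"
  by (rule psp_lext) (auto intro: ph_psp)

lemma algebra_hom_Dvee:
  assumes "algcover X K P cm []" "\<And>p. p \<in> psp X \<Longrightarrow> f (P p) = lext ph p"
  shows "algebra_hom K (Dvee G) f"
proof -
  interpret algcover X K P cm "[]" by fact
  have "linear_map K (Dvee G) f"
    by (rule linear_mapI) (simp_all add: assms(2) lph_psp psp_add psp_csmul lext_linear)
  moreover have "f \<one>\<^bsub>K\<^esub> = ph []" using assms(2)[of "basis []"] by (simp add: P_one)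
  ultimately show ?thesis
    unfolding algebra_hom_def
    by (auto elim!: P_ex simp: P_mult[symmetric] assms(2) lph_lmul lmul_psp)
qed

lemma sum_G_mult: "f \<in> carrier G \<Longrightarrow> (\<Sum>g\<in>carrier G. c (inv f \<otimes> g)) = (\<Sum>k\<in>carrier G. c k)"
  by (rule sum.reindex_bij_witness[where i = "\<lambda>k. f \<otimes> k" and j = "\<lambda>g. inv f \<otimes> g"]) (auto simp: m_assoc[symmetric])

text \<open>After the substitution \<open>g = f k\<close> the entry of \<open>rho\<close> at the
  inverse of \<open>f k\<close> splits into a sum over an intermediate index word \<open>z\<close>.
  A nonzero term forces \<open>dg z\<close> to be \<open>dg y\<close> conjugated by
  \<open>k\<close>, whose inverse is the group element occurring in the first leg.\<close>

lemma D_comult_ph: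
  assumes "u \<in> X"
  shows "ceval \<beta> (lext (\<lambda>(g, h). \<Sum>f\<in>carrier G. basis ((f, inv f \<otimes> g \<otimes> h \<otimes> inv g \<otimes> f), (inv f \<otimes> g, h))) (ph u))
    = ceval (\<lambda>(a, b). ceval \<beta> (pairs (ph a) (ph b))) (dl u)"
proof -
  from assms obtain x y where [simp]: "set x \<subseteq> I" "set y \<subseteq> I" "length x = length y" "u = zip x y"
    by (rule XE)
  have c: "dg y \<in> carrier G" by simp
  let ?F = "\<lambda>f k. rho (inv k \<otimes> inv f) y x * \<beta> ((f, k \<otimes> inv dg y \<otimes> inv k), (k, inv dg y))"
  have "ceval \<beta> (lext (\<lambda>(g, h). \<Sum>f\<in>carrier G. basis ((f, inv f \<otimes> g \<otimes> h \<otimes> inv g \<otimes> f), (inv f \<otimes> g, h))) (ph u))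
    = (\<Sum>f\<in>carrier G. \<Sum>g\<in>carrier G. rho (inv g) y x * \<beta> ((f, inv f \<otimes> g \<otimes> inv dg y \<otimes> inv g \<otimes> f), (inv f \<otimes> g, inv dg y)))"
    by (simp add: ceval_lext ceval_ph ceval_sum sum_distrib_left) (rule sum.swap)
  also have "\<dots> = (\<Sum>f\<in>carrier G. \<Sum>g\<in>carrier G. ?F f (inv f \<otimes> g))"
    using c by (intro sum.cong refl) (simp add: inv_mult_group m_assoc)
  also have "\<dots> = (\<Sum>f\<in>carrier G. \<Sum>k\<in>carrier G. ?F f k)"
    by (intro sum.cong refl sum_G_mult[where c = "?F _"])
  also have "\<dots> = (\<Sum>f\<in>carrier G. \<Sum>k\<in>carrier G. \<Sum>z\<in>mi (length y).
      rho (inv f) z x * (rho (inv k) y z * \<beta> ((f, inv dg z), (k, inv dg y))))"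
  proof (intro sum.cong refl)
    fix f k assume [simp]: "f \<in> carrier G" "k \<in> carrier G"
    have "?F f k = (\<Sum>z\<in>mi (length y). rho (inv k) y z * rho (inv f) z x) * \<beta> ((f, k \<otimes> inv dg y \<otimes> inv k), (k, inv dg y))"
      by (simp add: rho_mult)
    also have "\<dots> = (\<Sum>z\<in>mi (length y). rho (inv f) z x * (rho (inv k) y z * \<beta> ((f, k \<otimes> inv dg y \<otimes> inv k), (k, inv dg y))))"
      by (simp only: sum_distrib_right mult_ac)
    also have "\<dots> = (\<Sum>z\<in>mi (length y). rho (inv f) z x * (rho (inv k) y z * \<beta> ((f, inv dg z), (k, inv dg y))))"
    proof (intro sum.cong refl)
      fix z assume "z \<in> mi (length y)"
      then have z: "set z \<subseteq> I" "length z = length y" by auto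
      have cz: "dg z \<in> carrier G" using z by simp
      have "inv dg z = k \<otimes> inv dg y \<otimes> inv k" if "rho (inv k) y z \<noteq> 0"
        using rho_deg[OF _ z(1) _ that] c cz by (simp add: m_assoc inv_mult_group)
      then show "rho (inv f) z x * (rho (inv k) y z * \<beta> ((f, k \<otimes> inv dg y \<otimes> inv k), (k, inv dg y)))
        = rho (inv f) z x * (rho (inv k) y z * \<beta> ((f, inv dg z), (k, inv dg y)))"
        by (cases "rho (inv k) y z = 0") simp_all
    qed
    finally show "?F f k = (\<Sum>z\<in>mi (length y). rho (inv f) z x * (rho (inv k) y z * \<beta> ((f, inv dg z), (k, inv dg y))))" .
  qed
  also have "\<dots> = (\<Sum>z\<in>mi (length y). \<Sum>f\<in>carrier G. \<Sum>k\<in>carrier G.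
      rho (inv f) z x * (rho (inv k) y z * \<beta> ((f, inv dg z), (k, inv dg y))))"
    by (subst sum.swap[of _ _ "mi (length y)"]) (intro sum.cong refl sum.swap)
  also have "\<dots> = ceval (\<lambda>(a, b). ceval \<beta> (pairs (ph a) (ph b))) (dl u)"
    by (simp add: ceval_dl ceval_pairs ceval_ph sum_distrib_left)
  finally show ?thesis .
qed

text \<open>\<open>L\<close> is left open because \<open>Dvee G\<close> and \<open>BD G\<close> have
  the same underlying coalgebra.\<close>

lemma coalgebra_hom_D:
  assumes "cocover X K P dl ep" "cover GG L id" and f: "\<And>p. p \<in> psp X \<Longrightarrow> f (P p) = lext ph p"
  shows "coalgebra_hom K (qcomult X dl P) (qcounit X ep P) L (D_comult G) (D_counit G) f"
proof -
  interpret cocover X K P dl ep by fact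
  interpret L: cover GG L id by fact
  have ladd: "x \<oplus>\<^bsub>L\<^esub> y = x + y" if "x \<in> psp GG" "y \<in> psp GG" for x y using L.P_add[of x y] that by simp
  have lsm: "k \<odot>\<^bsub>L\<^esub> x = csmul k x" if "x \<in> psp GG" for k x using L.P_csmul[of x k] that by simp
  show ?thesis
    unfolding coalgebra_hom_def
  proof (intro conjI ballI)
    show "linear_map K L f"
      using L.P_closed
      by (intro linear_mapI) (simp_all add: f lph_psp psp_add psp_csmul lext_linear ladd lsm)
    fix x assume x: "x \<in> carrier K"
    define p where "p = qsec X P x"
    have p: "p \<in> psp X" "x = P p" using qsec[OF x] by (auto simp: p_def)
    have "ceval (\<lambda>(g, h). if g = \<one> then 1 else 0) (ph u) = ep u" if u: "u \<in> X" for u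
    proof -
      from u obtain x y where [simp]: "set x \<subseteq> I" "set y \<subseteq> I" "length x = length y" "u = zip x y"
        by (rule XE)
      have "ceval (\<lambda>(g, h). if g = \<one> then 1 else 0) (ph u) = (\<Sum>g\<in>carrier G. if g = \<one> then rho (inv g) y x else 0)"
        by (simp add: ceval_ph) (intro sum.cong refl, simp)
      also have "\<dots> = rho (inv \<one>) y x" by (subst sum.delta[OF finG]) simp
      finally show ?thesis by auto
    qed
    from ceval_psp_cong[OF p(1) this] show "D_counit G (f x) = qcounit X ep P x"
      by (simp add: p f D_counit_def ceval_lext ep_P)
    show "tensor_eq L L (D_comult G (f x)) (tensor_map f f (qcomult X dl P x))"
    proof (rule tensor_eqI)
      fix \<beta> assume b: "bilin L L \<beta>"
      let ?b = "\<lambda>(u, v). \<beta> (basis u) (basis v)"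
      have bp: "\<beta> r s = ceval ?b (pairs r s)" if "r \<in> psp GG" "s \<in> psp GG" for r s
        using L.bilin_pairs[OF b that] by simp
      have "ceval (\<lambda>(x, y). \<beta> x y) (D_comult G (f x))
        = ceval (\<lambda>u. ceval ?b (lext (\<lambda>(g, h). \<Sum>f\<in>carrier G. basis ((f, inv f \<otimes> g \<otimes> h \<otimes> inv g \<otimes> f), (inv f \<otimes> g, h))) (ph u))) p"
        by (simp add: p f D_comult_def ceval_lext ceval_sum split_def)
      also have "\<dots> = ceval (\<lambda>u. ceval (\<lambda>(a, b). ceval ?b (pairs (ph a) (ph b))) (dl u)) p"
        by (intro ceval_psp_cong[OF p(1)] D_comult_ph)
      also have "\<dots> = ceval (\<lambda>(a, b). ceval ?b (pairs (ph a) (ph b))) (lext dl p)"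
        by (simp add: ceval_lext)
      also have "\<dots> = ceval (\<lambda>(a, b). \<beta> (f (P (basis a))) (f (P (basis b)))) (lext dl p)"
        by (intro ceval_psp_cong[OF lext_\<delta>_closed[OF p(1)]]) (auto simp: bp f ph_psp)
      also have "\<dots> = ceval (\<lambda>(x, y). \<beta> x y) (tensor_map f f (qcomult X dl P x))"
        unfolding qcomult_def p_def[symmetric]
        by (simp add: tensor_map_def ceval_lext timg_def split_def)
      finally show "ceval (\<lambda>(x, y). \<beta> x y) (D_comult G (f x)) = \<dots>" .
    qed
  qed
qed

lemma bialgebra_hom_Dvee:
  assumes "bicover X K P dl ep cm []" "\<And>p. p \<in> psp X \<Longrightarrow> f (P p) = lext ph p"
  shows "bialgebra_hom K (qcomult X dl P) (qcounit X ep P) (Dvee G) (D_comult G) (D_counit G) f"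
proof -
  interpret bicover X K P dl ep cm "[]" by fact
  show ?thesis
    unfolding bialgebra_hom_def
    by (intro conjI algebra_hom_Dvee[OF algcover_axioms assms(2)] coalgebra_hom_D[OF cocover_axioms cover_Dvee assms(2)])
qed

text \<open>Where the coefficient of \<open>u\<close> at \<open>g\<close> is nonzero,
  \<open>g^-1 |u|\<close> is the inverse of \<open>g\<close> conjugated by \<open>dg y\<close>. The
  twist therefore replaces the condition of equal first entries in \<open>Dvee G\<close> by the
  conjugated matching condition of \<open>BD G\<close>.\<close>

lemma ph_tm: assumes "u \<in> X" "v \<in> X" shows "lext ph (tm u v) = lmul bm (ph u) (ph v)"
proof (rule ceval_ext)
  fix f
  from assms(1) obtain x y where [simp]: "set x \<subseteq> I" "set y \<subseteq> I" "length x = length y" "u = zip x y"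
    by (rule XE)
  from assms(2) obtain z w where [simp]: "set z \<subseteq> I" "set w \<subseteq> I" "length z = length w" "v = zip z w"
    by (rule XE)
  have c: "dg x \<in> carrier G" "dg y \<in> carrier G" "dg w \<in> carrier G" by simp_all
  let ?h = "dg x \<otimes> inv dg y"
  have "lext ph (tm u v) = lmul dv (ph u) (lext ph (Lw ?h v))"
    using c assms by (simp add: tm_def lph_lmul Lw_psp)
  then have "ceval f (lext ph (tm u v)) = (\<Sum>g\<in>carrier G. \<Sum>k\<in>carrier G.
      if g = k then rho (inv g) y x * (rho (inv k \<otimes> ?h) w z * f (g, inv dg y \<otimes> inv dg w)) else 0)"
    by (simp add: ceval_lmul ceval_ph ceval_lph_Lw dv_def sum_distrib_left) (intro sum.cong refl, simp)
  also have "\<dots> = (\<Sum>g\<in>carrier G. rho (inv g) y x * (rho (inv g \<otimes> ?h) w z * f (g, inv dg y \<otimes> inv dg w)))"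
    using finG by (intro sum.cong refl) (simp add: sum.delta)
  also have "\<dots> = (\<Sum>g\<in>carrier G. rho (inv g) y x * (rho (inv (dg y \<otimes> g \<otimes> inv dg y)) w z * f (g, inv dg y \<otimes> inv dg w)))"
  proof (intro sum.cong refl)
    fix g assume [simp]: "g \<in> carrier G"
    have "inv g \<otimes> ?h = inv (dg y \<otimes> g \<otimes> inv dg y)" if "rho (inv g) y x \<noteq> 0"
    proof -
      have "dg y = inv g \<otimes> dg x \<otimes> g" using rho_deg[of "inv g" x y] that by simp
      then have "dg y \<otimes> inv g = inv g \<otimes> dg x" using c by (simp add: m_assoc)
      then show ?thesis using c by (simp add: inv_mult_group m_assoc[symmetric])
    qed
    then show "rho (inv g) y x * (rho (inv g \<otimes> ?h) w z * f (g, inv dg y \<otimes> inv dg w))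
        = rho (inv g) y x * (rho (inv (dg y \<otimes> g \<otimes> inv dg y)) w z * f (g, inv dg y \<otimes> inv dg w))"
      by (cases "rho (inv g) y x = 0") simp_all
  qed
  also have "\<dots> = (\<Sum>g\<in>carrier G. \<Sum>k\<in>carrier G. if k = dg y \<otimes> g \<otimes> inv dg y
      then rho (inv g) y x * (rho (inv k) w z * f (g, inv dg y \<otimes> inv dg w)) else 0)"
    using finG c by (intro sum.cong refl) (subst sum.delta, auto)
  also have "\<dots> = (\<Sum>g\<in>carrier G. \<Sum>k\<in>carrier G. rho (inv g) y x * (rho (inv k) w z *
      ceval f (bm (g, inv dg y) (k, inv dg w))))"
  proof (intro sum.cong refl)
    fix g k assume gk: "g \<in> carrier G" "k \<in> carrier G"
    have "(k = dg y \<otimes> g \<otimes> inv dg y) = (g = inv dg y \<otimes> k \<otimes> dg y)"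
    proof
      assume "k = dg y \<otimes> g \<otimes> inv dg y"
      then show "g = inv dg y \<otimes> k \<otimes> dg y" using c gk by (simp add: m_assoc)
    next
      assume "g = inv dg y \<otimes> k \<otimes> dg y"
      then show "k = dg y \<otimes> g \<otimes> inv dg y" using c gk by (simp add: m_assoc)
    qed
    then show "(if k = dg y \<otimes> g \<otimes> inv dg y
        then rho (inv g) y x * (rho (inv k) w z * f (g, inv dg y \<otimes> inv dg w)) else 0)
      = rho (inv g) y x * (rho (inv k) w z * ceval f (bm (g, inv dg y) (k, inv dg w)))"
      using c by (simp add: bm_def)
  qed
  also have "\<dots> = ceval f (lmul bm (ph u) (ph v))"
    by (simp add: ceval_lmul ceval_ph sum_distrib_left)
  finally show "ceval f (lext ph (tm u v)) = ceval f (lmul bm (ph u) (ph v))" .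
qed

lemma lph_ltm:
  assumes "p \<in> psp X" "q \<in> psp X"
  shows "lext ph (lmul tm p q) = lmul bm (lext ph p) (lext ph q)"
  unfolding lext_lmul lmul_lext_left lmul_lext_right lext_swap[of _ p q]
  by (intro lext_psp_cong[OF assms(1)] lext_psp_cong[OF assms(2)] ph_tm)

lemma ph_Aw: assumes u: "u \<in> X" and k: "k \<in> carrier G"
  shows "lext ph (Aw k u) = lext (\<lambda>(g, h). basis (k \<otimes> g \<otimes> inv k, k \<otimes> h \<otimes> inv k)) (ph u)"
proof (rule ceval_ext)
  fix f
  from u obtain x y where [simp]: "set x \<subseteq> I" "set y \<subseteq> I" "length x = length y" "u = zip x y"
    by (rule XE)
  have c: "dg y \<in> carrier G" by simp
  have "ceval f (lext ph (Aw k u)) = (\<Sum>a\<in>mi (length y). rho k a x * ceval f (lext ph (Rw k (zip a y))))"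
    by (simp add: Aw_def Lw_Rw ceval_lext ceval_Lw)
  also have "\<dots> = (\<Sum>a\<in>mi (length y). \<Sum>g\<in>carrier G. rho k a x * (rho (inv k \<otimes> inv g) y a * f (g, inv (k \<otimes> dg y \<otimes> inv k))))"
    using k by (simp add: ceval_lph_Rw sum_distrib_left)
  also have "\<dots> = (\<Sum>g\<in>carrier G. (\<Sum>a\<in>mi (length y). rho (inv k \<otimes> inv g) y a * rho k a x) * f (g, inv (k \<otimes> dg y \<otimes> inv k)))"
    by (subst sum.swap) (simp add: sum_distrib_left mult_ac)
  also have "\<dots> = (\<Sum>g\<in>carrier G. rho (inv k \<otimes> inv g \<otimes> k) y x * f (g, inv (k \<otimes> dg y \<otimes> inv k)))"
    using k by (intro sum.cong refl) (simp add: rho_mult)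
  also have "\<dots> = (\<Sum>g\<in>carrier G. rho (inv g) y x * f (k \<otimes> g \<otimes> inv k, k \<otimes> inv dg y \<otimes> inv k))"
    by (rule sum.reindex_bij_witness[where i = "\<lambda>g. k \<otimes> g \<otimes> inv k" and j = "\<lambda>g. inv k \<otimes> g \<otimes> k"])
      (use k c in \<open>auto simp: m_assoc inv_mult_group\<close>)
  also have "\<dots> = ceval f (lext (\<lambda>(g, h). basis (k \<otimes> g \<otimes> inv k, k \<otimes> h \<otimes> inv k)) (ph u))"
    by (simp add: ceval_lext ceval_ph)
  finally show "ceval f (lext ph (Aw k u)) = \<dots>" .
qed

lemma ph_deg: assumes u: "u \<in> X"
  shows "ph u \<in> psp {(g, h). g \<otimes> inv h \<otimes> inv g \<otimes> h = ad u}"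
proof -
  from u obtain x y where [simp]: "set x \<subseteq> I" "set y \<subseteq> I" "length x = length y" "u = zip x y"
    by (rule XE)
  have c: "dg x \<in> carrier G" "dg y \<in> carrier G" by simp_all
  show ?thesis unfolding ph_def
  proof (rule psp_sum)
    fix g assume g: "g \<in> carrier G"
    have "g \<otimes> dg y \<otimes> inv g \<otimes> inv dg y = dg x \<otimes> inv dg y" if "rho (inv g) y x \<noteq> 0"
      using rho_deg[of "inv g" x y] that g c by (simp add: m_assoc)
    then show "csmul (rho (inv g) (wr u) (wl u)) (basis (g, inv dg (wr u))) \<in> psp {(g, h). g \<otimes> inv h \<otimes> inv g \<otimes> h = ad u}"
      using c by (cases "rho (inv g) y x = 0") (auto intro: psp_csmul)
  qed
qed

lemma braided_bialgebra_hom_BD: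
  fixes K :: "('g, 'v, 'z) crossed_module_scheme"
  assumes "braided_cover X K P dl ep tm [] G Aw ad" and f: "\<And>p. p \<in> psp X \<Longrightarrow> f (P p) = lext ph p"
  shows "braided_bialgebra_hom G K (qcomult X dl P) (qcounit X ep P) (BD G) (D_comult G) (D_counit G) f"
proof -
  interpret braided_cover X K P dl ep tm "[]" G Aw ad by fact
  have lin: "linear_map K (BD G) f"
    by (rule linear_mapI) (simp_all add: f lph_psp psp_add psp_csmul lext_linear)
  have "f \<one>\<^bsub>K\<^esub> = ph []" using f[of "basis []"] by (simp add: P_one)
  then have "algebra_hom K (BD G) f"
    unfolding algebra_hom_def using lin
    by (auto elim!: P_ex simp: P_mult[symmetric] f lph_ltm lmul_psp)
  moreover have "crossed_hom G K (BD G) f"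
  proof (rule crossed_homI[OF lin])
    fix g p assume g: "g \<in> carrier G" and p: "p \<in> psp X"
    show "f (P (lext (Aw g) p)) = act (BD G) g (f (P p))"
      using lext_psp_cong[OF p ph_Aw[OF _ g]] g p
      by (simp add: f ac_psp BD_def with_crossed_def lext_lext)
    have "lext ph (hpart ad g u) = lext (\<lambda>(k, h). if k \<otimes> inv h \<otimes> inv k \<otimes> h = g then basis (k, h) else 0) (ph u)"
      if u: "u \<in> X" for u
    proof -
      have "lext (\<lambda>(k, h). if k \<otimes> inv h \<otimes> inv k \<otimes> h = g then basis (k, h) else 0) (ph u)
        = lext (\<lambda>w. if ad u = g then basis w else 0) (ph u)"
        by (rule lext_psp_cong[OF ph_deg[OF u]]) auto
      then show ?thesis by (simp add: hpart_def)
    qed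
    from lext_psp_cong[OF p this] show "f (P (lext (hpart ad g) p)) = hcomp (BD G) g (f (P p))"
      using g p by (simp add: f hpart_psp BD_def with_crossed_def lext_lext)
  qed
  ultimately show ?thesis
    unfolding braided_bialgebra_hom_def bialgebra_hom_def
    using coalgebra_hom_D[OF cocover_axioms cover_BD f] by blast
qed

end

section \<open>Bilinear and trilinear forms on quotients\<close>

definition qform :: "'x set \<Rightarrow> (('x \<Rightarrow>\<^sub>0 complex) \<Rightarrow> 'v) \<Rightarrow> ('x \<Rightarrow> 'x \<Rightarrow> complex) \<Rightarrow> 'v \<Rightarrow> 'v \<Rightarrow> complex" where
  "qform X P b x y = ceval (\<lambda>u. ceval (b u) (qsec X P y)) (qsec X P x)"

definition trilin :: "(complex, 'v, 'z) module_scheme \<Rightarrow> ('v \<Rightarrow> 'v \<Rightarrow> 'v \<Rightarrow> complex) \<Rightarrow> bool" where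
  "trilin V \<tau> \<longleftrightarrow>
     (\<forall>y\<in>carrier V. \<forall>z\<in>carrier V. linear_form V (\<lambda>x. \<tau> x y z) \<and> linear_form V (\<lambda>x. \<tau> y x z) \<and> linear_form V (\<tau> y z))"

lemma trilin_tensor3_null:
  assumes "trilin V \<tau>" "p \<in> tensor3_null V"
  shows "ceval (\<lambda>(x, y, z). \<tau> x y z) p = 0"
  using assms(2)
  by induction (use assms(1) in \<open>auto simp: ceval_linear trilin_def linear_form_def\<close>)

lemma psp_pairs: "p \<in> psp A \<Longrightarrow> q \<in> psp B \<Longrightarrow> pairs p q \<in> psp (A \<times> B)"
  unfolding pairs_def by (rule psp_lext, assumption, rule psp_lext) auto

context cover
begin

text \<open>The chosen representatives are replaced by the given ones in one argument at a time,
  each change being an element of the kernel.\<close>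

lemma qform_P:
  assumes b: "vanish2 X ker b" and p: "p \<in> psp X" and q: "q \<in> psp X"
  shows "qform X P b (P p) (P q) = ceval (\<lambda>u. ceval (b u) q) p"
proof -
  let ?p = "qsec X P (P p)" and ?q = "qsec X P (P q)"
  have qs: "?q \<in> psp X" using qsec P_closed q by blast
  have "ceval (\<lambda>u. ceval (b u) ?q) (?p - p) = 0"
    by (rule vanish2D(1)[OF b qsec_ker[OF p] qs])
  then have "qform X P b (P p) (P q) = ceval (\<lambda>u. ceval (b u) ?q) p"
    by (simp only: qform_def ceval_diff right_minus_eq)
  also have "\<dots> = ceval (\<lambda>v. ceval (\<lambda>u. b u v) p) ?q" by (rule ceval_swap)
  also have "ceval (\<lambda>v. ceval (\<lambda>u. b u v) p) (?q - q) = 0"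
    by (rule vanish2D(2)[OF b qsec_ker[OF q] p])
  then have "ceval (\<lambda>v. ceval (\<lambda>u. b u v) p) ?q = ceval (\<lambda>v. ceval (\<lambda>u. b u v) p) q"
    by (simp only: ceval_diff right_minus_eq)
  also have "\<dots> = ceval (\<lambda>u. ceval (b u) q) p" by (rule ceval_swap)
  finally show ?thesis .
qed

lemma qform_bilinear: assumes b: "vanish2 X ker b" shows "bilinear_form K (qform X P b)"
  unfolding bilinear_form_def linear_form_def
  by (auto elim!: P_ex simp: P_add[symmetric] P_csmul[symmetric] qform_P[OF b] psp_add psp_csmul
      ceval_linear ceval_fun_add ceval_fun_mult)

lemma leval_closed:
  assumes "\<And>t. t \<in> Poly_Mapping.keys q \<Longrightarrow> F t \<in> carrier K"
  shows "leval K F q \<in> carrier K"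
proof -
  have "leval K F q = P (lext (\<lambda>t. qsec X P (F t)) q)"
    by (rule leval_P) (use assms qsec in simp)
  moreover have "lext (\<lambda>t. qsec X P (F t)) q \<in> psp X"
    by (rule psp_lext[of q "Poly_Mapping.keys q"]) (use assms qsec in \<open>auto simp: psp_def\<close>)
  ultimately show ?thesis by (simp add: P_closed)
qed

definition lin :: "('x \<Rightarrow> complex) \<Rightarrow> 'v \<Rightarrow> complex" where "lin f x = ceval f (qsec X P x)"

lemma lin_P: "(\<And>n. n \<in> ker \<Longrightarrow> ceval f n = 0) \<Longrightarrow> p \<in> psp X \<Longrightarrow> lin f (P p) = ceval f p"
  using qsec_ker[of p] by (force simp: lin_def ceval_diff)

lemma lin_linear: assumes "\<And>n. n \<in> ker \<Longrightarrow> ceval f n = 0" shows "linear_form K (lin f)"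
  unfolding linear_form_def
  by (auto elim!: P_ex simp: P_add[symmetric] P_csmul[symmetric] lin_P[OF assms] psp_add psp_csmul ceval_linear)

lemma lin_leval:
  assumes f: "\<And>n. n \<in> ker \<Longrightarrow> ceval f n = 0" and F: "\<And>t. t \<in> Poly_Mapping.keys q \<Longrightarrow> F t \<in> carrier K"
  shows "lin f (leval K F q) = ceval (\<lambda>t. lin f (F t)) q"
proof -
  have "leval K F q = P (lext (\<lambda>t. qsec X P (F t)) q)"
    by (rule leval_P) (use F qsec in simp)
  moreover have "lext (\<lambda>t. qsec X P (F t)) q \<in> psp X"
    by (rule psp_lext[of q "Poly_Mapping.keys q"]) (use F qsec in \<open>auto simp: psp_def\<close>)
  ultimately show ?thesis by (simp add: lin_P[OF f] ceval_lext) (simp add: lin_def)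
qed

lemma lin_separates:
  assumes "x \<in> carrier K" "y \<in> carrier K" "\<And>f. (\<And>n. n \<in> ker \<Longrightarrow> ceval f n = 0) \<Longrightarrow> lin f x = lin f y"
  shows "x = y"
proof (rule ccontr)
  assume ne: "x \<noteq> y"
  have q: "qsec X P x \<in> psp X" "P (qsec X P x) = x" "qsec X P y \<in> psp X" "P (qsec X P y) = y"
    using qsec assms(1,2) by auto
  then have "qsec X P x - qsec X P y \<notin> ker" using ne P_eq_iff[of "qsec X P x" "qsec X P y"] by (auto simp: ker_def)
  from exists_separating[OF ker_subspace this] obtain f where
    f: "\<forall>n\<in>ker. ceval f n = 0" "ceval f (qsec X P x - qsec X P y) \<noteq> 0" by blast
  then show False using assms(3)[of f] by (simp add: lin_def ceval_diff)
qed

end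

context cocover
begin

text \<open>Trilinear forms vanish on null triples, so they see the twofold coproduct of the
  quotient only through the one on words.\<close>

lemma comult2_ceval:
  assumes "trilin K \<tau>" "x \<in> carrier K"
  shows "ceval (\<lambda>(x, y, z). \<tau> x y z) (comult2 \<Delta> x)
    = ceval (\<lambda>(u, v, w). \<tau> (P (basis u)) (P (basis v)) (P (basis w))) (\<delta>2 (qsec X P x))"
proof -
  have "ceval (\<lambda>(x, y, z). \<tau> x y z) (comult2 \<Delta> x - timg3 (\<delta>2 (qsec X P x))) = 0"
    using trilin_tensor3_null[OF assms(1)] comult2_eq[OF assms(2) refl] by (simp add: tensor3_eq_def)
  then show ?thesis by (simp add: ceval_diff timg3_def ceval_lext split_def)
qed

lemma comult2_psp: assumes "x \<in> carrier K" shows "comult2 \<Delta> x \<in> psp (carrier K \<times> carrier K \<times> carrier K)"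
proof -
  have d: "\<Delta> y \<in> psp (carrier K \<times> carrier K)" if "y \<in> carrier K" for y
    using \<Delta>_tensor_space[OF that] by (simp add: tensor_space_def psp_def)
  show ?thesis unfolding comult2_def
    by (rule psp_lext[OF d[OF assms]], clarify, rule psp_lext[OF d]) auto
qed

lemma \<delta>2_psp: "p \<in> psp X \<Longrightarrow> \<delta>2 p \<in> psp (X \<times> X \<times> X)"
  unfolding \<delta>2_def
  by (rule psp_lext[OF lext_\<delta>_closed], assumption, clarify, rule psp_lext[OF \<delta>_closed]) auto

end

context orep
begin

section \<open>Coquasitriangular structure and transmutation\<close>

text \<open>The pullback along \<open>ph\<close> of the coquasitriangular structure of the dual
  double: the unit in the first entry of \<open>ph u\<close> contributes \<open>ep u\<close>, and
  the second entry there, the inverse of the degree of the index word, selects the coefficient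
  \<open>chi\<close> of \<open>v\<close>.\<close>

definition rt :: "('a \<times> 'a) list \<Rightarrow> ('a \<times> 'a) list \<Rightarrow> complex" where
  "rt u v = ep u * chi (dg (wl u)) v"

definition rt' :: "('a \<times> 'a) list \<Rightarrow> ('a \<times> 'a) list \<Rightarrow> complex" where
  "rt' u v = ep u * chi (inv dg (wl u)) v"

text \<open>Splitting by \<open>k = dg (wl u)\<close> writes the form as a finite sum of products of
  \<open>gam k\<close> and \<open>chi (s k)\<close>, functionals that factor through
  \<open>ph\<close> and so vanish on \<open>NH\<close>. The map \<open>s\<close> is the identity for
  \<open>rt\<close> and inversion for \<open>rt'\<close>.\<close>

lemma ep_chi_vanish:
  assumes "n \<in> NH" and s: "\<And>k. k \<in> carrier G \<Longrightarrow> s k \<in> carrier G"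
  shows "ceval (\<lambda>u. ep u * chi (s (dg (wl u))) v) n = 0" and "u \<in> X \<Longrightarrow> ceval (\<lambda>v. ep u * chi (s (dg (wl u))) v) n = 0"
proof -
  have nX: "n \<in> psp X" and ph: "lext ph n = 0" using tid_psp[OF NH_tid assms(1)] ph_NH[OF assms(1)] by auto
  have "ceval (\<lambda>u. ep u * chi (s (dg (wl u))) v) n = ceval (\<lambda>u. \<Sum>k\<in>carrier G. gam k u * chi (s k) v) n"
  proof (rule ceval_psp_cong[OF nX])
    fix u assume u: "u \<in> X"
    have "(\<Sum>k\<in>carrier G. gam k u * chi (s k) v) = (\<Sum>k\<in>carrier G. if k = dg (wl u) then ep u * chi (s (dg (wl u))) v else 0)"
      by (intro sum.cong refl) (auto simp: gam_def ep_def)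
    then show "ep u * chi (s (dg (wl u))) v = (\<Sum>k\<in>carrier G. gam k u * chi (s k) v)"
      using u finG by simp
  qed
  also have "\<dots> = (\<Sum>k\<in>carrier G. ceval (gam k) n * chi (s k) v)"
    by (simp add: ceval_fun_sum ceval_fun_mult_right)
  also have "\<dots> = 0" by (intro sum.neutral ballI) (simp add: gam_vanish[OF _ nX ph])
  finally show "ceval (\<lambda>u. ep u * chi (s (dg (wl u))) v) n = 0" .
  show "u \<in> X \<Longrightarrow> ceval (\<lambda>v. ep u * chi (s (dg (wl u))) v) n = 0"
    by (simp add: ceval_fun_mult chi_vanish[OF s ph])
qed

lemma rt_vanish: "vanish2 X NH rt" and rt'_vanish: "vanish2 X NH rt'"
  using ep_chi_vanish[of _ "\<lambda>k. k"] ep_chi_vanish[of _ "\<lambda>k. inv k"]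
  by (auto simp: vanish2_def rt_def[abs_def] rt'_def[abs_def])

lemma dl_ep_left: assumes "u \<in> X" shows "ceval (\<lambda>(u1, u2). ep u1 * F (wl u1) u2) (dl u) = F (wl u) u"
proof -
  from assms obtain x y where [simp]: "set x \<subseteq> I" "set y \<subseteq> I" "length x = length y" "u = zip x y"
    by (rule XE)
  have "ceval (\<lambda>(u1, u2). ep u1 * F (wl u1) u2) (dl u) = (\<Sum>z\<in>mi (length y). (if x = z then 1 else 0) * F x (zip z y))"
    by (simp add: ceval_dl)
  also have "\<dots> = F (wl u) u" by (subst sum_if_eq(2)) auto
  finally show ?thesis .
qed

lemma chi_mult: assumes "g \<in> carrier G" "k \<in> carrier G" "v \<in> X"
  shows "ceval (\<lambda>(v1, v2). chi g v1 * chi k v2) (dl v) = chi (k \<otimes> g) v"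
proof -
  from assms(3) obtain x y where [simp]: "set x \<subseteq> I" "set y \<subseteq> I" "length x = length y" "v = zip x y"
    by (rule XE)
  have "ceval (\<lambda>(v1, v2). chi g v1 * chi k v2) (dl v) = (\<Sum>z\<in>mi (length y). rho k y z * rho g z x)"
    by (simp add: ceval_dl chi_def mult.commute)
  then show ?thesis using assms by (simp add: rho_mult chi_def)
qed

lemma chi_one: "v \<in> X \<Longrightarrow> chi \<one> v = ep v"
  by (auto simp: chi_def ep_def)

lemma chi_append: "v \<in> X \<Longrightarrow> w \<in> X \<Longrightarrow> chi g (v @ w) = chi g v * chi g w"
  by (simp add: chi_def)

lemma rt_append_left: assumes "u \<in> X" "v \<in> X" "w \<in> X"
  shows "rt (u @ v) w = ceval (\<lambda>(w1, w2). rt u w1 * rt v w2) (dl w)"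
proof -
  have "ceval (\<lambda>(w1, w2). rt u w1 * rt v w2) (dl w)
      = ep u * ep v * ceval (\<lambda>(w1, w2). chi (dg (wl u)) w1 * chi (dg (wl v)) w2) (dl w)"
    unfolding ceval_fun_mult[symmetric] by (rule ceval_cong) (auto simp: rt_def)
  then show ?thesis using assms by (simp add: chi_mult rt_def ep_append)
qed

lemma rt_append_right: assumes "u \<in> X" "v \<in> X" "w \<in> X"
  shows "rt u (v @ w) = ceval (\<lambda>(u1, u2). rt u1 w * rt u2 v) (dl u)"
proof -
  have "ceval (\<lambda>(u1, u2). rt u1 w * rt u2 v) (dl u) = ceval (\<lambda>(u1, u2). ep u1 * (chi (dg (wl u1)) w * rt u2 v)) (dl u)"
    by (rule ceval_cong) (auto simp: rt_def)
  also have "\<dots> = chi (dg (wl u)) w * rt u v" using dl_ep_left[OF assms(1), where F = "\<lambda>x u2. chi (dg x) w * rt u2 v"] by simp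
  finally show ?thesis using assms by (simp add: rt_def chi_append)
qed

lemma rt_inv: assumes "u \<in> X" "v \<in> X"
  shows "ceval (\<lambda>(u1, u2). ceval (\<lambda>(v1, v2). rt u1 v1 * rt' u2 v2) (dl v)) (dl u) = ep u * ep v"
    and "ceval (\<lambda>(u1, u2). ceval (\<lambda>(v1, v2). rt' u1 v1 * rt u2 v2) (dl v)) (dl u) = ep u * ep v"
proof -
  have c: "dg (wl u) \<in> carrier G" using assms by simp
  have "ceval (\<lambda>(u1, u2). ceval (\<lambda>(v1, v2). rt u1 v1 * rt' u2 v2) (dl v)) (dl u)
    = ceval (\<lambda>(u1, u2). ep u1 * ceval (\<lambda>(v1, v2). chi (dg (wl u1)) v1 * rt' u2 v2) (dl v)) (dl u)"
    by (intro ceval_cong) (auto simp: rt_def ceval_fun_mult[symmetric] split_def mult.assoc)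
  also have "\<dots> = ceval (\<lambda>(v1, v2). chi (dg (wl u)) v1 * rt' u v2) (dl v)"
    using dl_ep_left[OF assms(1), where F = "\<lambda>x u2. ceval (\<lambda>(v1, v2). chi (dg x) v1 * rt' u2 v2) (dl v)"] by simp
  also have "\<dots> = ep u * ceval (\<lambda>(v1, v2). chi (dg (wl u)) v1 * chi (inv dg (wl u)) v2) (dl v)"
    unfolding ceval_fun_mult[symmetric] by (rule ceval_cong) (auto simp: rt'_def)
  finally show "ceval (\<lambda>(u1, u2). ceval (\<lambda>(v1, v2). rt u1 v1 * rt' u2 v2) (dl v)) (dl u) = ep u * ep v"
    using assms c by (simp add: chi_mult chi_one)
  have "ceval (\<lambda>(u1, u2). ceval (\<lambda>(v1, v2). rt' u1 v1 * rt u2 v2) (dl v)) (dl u)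
    = ceval (\<lambda>(u1, u2). ep u1 * ceval (\<lambda>(v1, v2). chi (inv dg (wl u1)) v1 * rt u2 v2) (dl v)) (dl u)"
    by (intro ceval_cong) (auto simp: rt'_def ceval_fun_mult[symmetric] split_def mult.assoc)
  also have "\<dots> = ceval (\<lambda>(v1, v2). chi (inv dg (wl u)) v1 * rt u v2) (dl v)"
    using dl_ep_left[OF assms(1), where F = "\<lambda>x u2. ceval (\<lambda>(v1, v2). chi (inv dg x) v1 * rt u2 v2) (dl v)"] by simp
  also have "\<dots> = ep u * ceval (\<lambda>(v1, v2). chi (inv dg (wl u)) v1 * chi (dg (wl u)) v2) (dl v)"
    unfolding ceval_fun_mult[symmetric] by (rule ceval_cong) (auto simp: rt_def)
  finally show "ceval (\<lambda>(u1, u2). ceval (\<lambda>(v1, v2). rt' u1 v1 * rt u2 v2) (dl v)) (dl u) = ep u * ep v"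
    using assms c by (simp add: chi_mult chi_one)
qed

text \<open>The two sides of quasi-commutativity are the two terms of \<open>frt u v\<close>; the
  axiom is thus equivalent to the vanishing of these elements in the quotient.\<close>

lemma rt_quasi: assumes "u \<in> X" "v \<in> X"
  shows "lext (\<lambda>((u1, u2), (v1, v2)). csmul (rt u2 v2) (cm v1 u1)) (pairs (dl u) (dl v)) = lmul cm (Rw (inv dg (wr u)) v) (basis u)"
    and "lext (\<lambda>((u1, u2), (v1, v2)). csmul (rt u1 v1) (cm u2 v2)) (pairs (dl u) (dl v)) = lmul cm (basis u) (Lw (dg (wl u)) v)"
proof -
  from assms(1) obtain x y where [simp]: "set x \<subseteq> I" "set y \<subseteq> I" "length x = length y" "u = zip x y"
    by (rule XE)
  from assms(2) obtain z w where [simp]: "set z \<subseteq> I" "set w \<subseteq> I" "length z = length w" "v = zip z w"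
    by (rule XE)
  show "lext (\<lambda>((u1, u2), (v1, v2)). csmul (rt u2 v2) (cm v1 u1)) (pairs (dl u) (dl v)) = lmul cm (Rw (inv dg (wr u)) v) (basis u)"
  proof (rule ceval_ext)
    fix f
    have "ceval f (lext (\<lambda>((u1, u2), (v1, v2)). csmul (rt u2 v2) (cm v1 u1)) (pairs (dl u) (dl v)))
      = (\<Sum>s\<in>mi (length y). (if s = y then 1 else 0) * (\<Sum>t\<in>mi (length w). rho (dg s) w t * f (zip z t @ zip x s)))"
      by (simp add: ceval_lext ceval_pairs ceval_dl ceval_csmul cm_def rt_def chi_def sum_distrib_left mult.assoc)
    also have "\<dots> = (\<Sum>t\<in>mi (length w). rho (dg y) w t * f (zip z t @ zip x y))"
      by (rule sum_if_eq(1)) simp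
    also have "\<dots> = (\<Sum>t\<in>mi (length w). rho (inv dg y) t w * f (zip z t @ zip x y))"
      by (intro sum.cong refl) (simp add: rho_inv)
    finally show "ceval f (lext (\<lambda>((u1, u2), (v1, v2)). csmul (rt u2 v2) (cm v1 u1)) (pairs (dl u) (dl v)))
      = ceval f (lmul cm (Rw (inv dg (wr u)) v) (basis u))"
      by (simp add: ceval_lmul ceval_Rw cm_def)
  qed
  show "lext (\<lambda>((u1, u2), (v1, v2)). csmul (rt u1 v1) (cm u2 v2)) (pairs (dl u) (dl v)) = lmul cm (basis u) (Lw (dg (wl u)) v)"
  proof (rule ceval_ext)
    fix f
    have "ceval f (lext (\<lambda>((u1, u2), (v1, v2)). csmul (rt u1 v1) (cm u2 v2)) (pairs (dl u) (dl v)))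
      = (\<Sum>s\<in>mi (length y). (if x = s then 1 else 0) * (\<Sum>t\<in>mi (length w). rho (dg x) t z * f (zip s y @ zip t w)))"
      by (simp add: ceval_lext ceval_pairs ceval_dl ceval_csmul cm_def rt_def chi_def sum_distrib_left mult.assoc)
    also have "\<dots> = (\<Sum>t\<in>mi (length w). rho (dg x) t z * f (zip x y @ zip t w))"
      by (rule sum_if_eq(2)) simp
    finally show "ceval f (lext (\<lambda>((u1, u2), (v1, v2)). csmul (rt u1 v1) (cm u2 v2)) (pairs (dl u) (dl v)))
      = ceval f (lmul cm (basis u) (Lw (dg (wl u)) v))"
      by (simp add: ceval_lmul ceval_Lw cm_def)
  qed
qed

lemma coquasitriangular_K:
  assumes "bicover X K P dl ep cm []" "cover.ker X K P = NH"
  shows "coquasitriangular K (qcomult X dl P) (qcounit X ep P) (qform X P rt)"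
proof -
  interpret bicover X K P dl ep cm "[]" by fact
  have v: "vanish2 X ker rt" "vanish2 X ker rt'" by (simp_all add: assms(2) rt_vanish rt'_vanish)
  let ?R = "qform X P rt" and ?R' = "qform X P rt'"
  have Rw: "?R (P (basis u)) (P (basis w)) = rt u w" "?R' (P (basis u)) (P (basis w)) = rt' u w"
    if "u \<in> X" "w \<in> X" for u w
    using that by (simp_all add: qform_P v)
  have pt: "pairs (timg P d) (timg P d') = lext (\<lambda>((u1, u2), (v1, v2)). basis ((P (basis u1), P (basis u2)), (P (basis v1), P (basis v2)))) (pairs d d')" for d d'
    by (simp add: pairs_def timg_def lext_lext split_def)
  show ?thesis
    unfolding coquasitriangular_def
  proof (intro conjI exI[of _ ?R'] ballI qform_bilinear v)
    fix x y assume x: "x \<in> carrier K" and y: "y \<in> carrier K"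
    define p q where "p = qsec X P x" and "q = qsec X P y"
    have p: "p \<in> psp X" "x = P p" and q: "q \<in> psp X" "y = P q" using qsec x y by (auto simp: p_def q_def)
    have D: "\<Delta> x = timg P (lext dl p)" "\<Delta> y = timg P (lext dl q)" by (simp_all add: qcomult_def p_def q_def)
    have conv: "ceval (\<lambda>((x1, x2), (y1, y2)). R x1 y1 * R2 x2 y2) (pairs (\<Delta> x) (\<Delta> y)) = cou x * cou y"
      if R: "\<And>u w. u \<in> X \<Longrightarrow> w \<in> X \<Longrightarrow> R (P (basis u)) (P (basis w)) = b u w"
        "\<And>u w. u \<in> X \<Longrightarrow> w \<in> X \<Longrightarrow> R2 (P (basis u)) (P (basis w)) = b' u w"
        and bb: "\<And>u v. u \<in> X \<Longrightarrow> v \<in> X \<Longrightarrow> ceval (\<lambda>(u1, u2). ceval (\<lambda>(v1, v2). b u1 v1 * b' u2 v2) (dl v)) (dl u) = ep u * ep v"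
      for R R2 b b'
    proof -
      have "ceval (\<lambda>((x1, x2), (y1, y2)). R x1 y1 * R2 x2 y2) (pairs (\<Delta> x) (\<Delta> y))
        = ceval (\<lambda>(u1, u2). ceval (\<lambda>(v1, v2). b u1 v1 * b' u2 v2) (lext dl q)) (lext dl p)"
        unfolding D pt ceval_lext[of _ _ "pairs _ _"] ceval_pairs split_def
        by (intro ceval_psp_cong[OF lext_\<delta>_closed[OF p(1)]] ceval_psp_cong[OF lext_\<delta>_closed[OF q(1)]])
          (auto simp: R)
      also have "\<dots> = ceval (\<lambda>u. ceval (\<lambda>v. ceval (\<lambda>(u1, u2). ceval (\<lambda>(v1, v2). b u1 v1 * b' u2 v2) (dl v)) (dl u)) q) p"
        unfolding ceval_lext split_def by (intro ceval_cong ceval_swap)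
      also have "\<dots> = ceval (\<lambda>u. ceval (\<lambda>v. ep u * ep v) q) p"
        by (intro ceval_psp_cong[OF p(1)] ceval_psp_cong[OF q(1)] bb)
      also have "\<dots> = cou x * cou y" by (simp add: p q ep_P ceval_fun_mult ceval_fun_mult_right)
      finally show ?thesis .
    qed
    show "ceval (\<lambda>((x1, x2), (y1, y2)). ?R x1 y1 * ?R' x2 y2) (pairs (\<Delta> x) (\<Delta> y)) = cou x * cou y"
      by (rule conv[OF Rw rt_inv(1)])
    show "ceval (\<lambda>((x1, x2), (y1, y2)). ?R' x1 y1 * ?R x2 y2) (pairs (\<Delta> x) (\<Delta> y)) = cou x * cou y"
      by (rule conv[OF Rw(2,1) rt_inv(2)])
    let ?d = "pairs (lext dl p) (lext dl q)"
    have dX: "?d \<in> psp ((X \<times> X) \<times> (X \<times> X))" using p q by (intro psp_pairs lext_\<delta>_closed)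
    have "leval K (\<lambda>((x1, x2), (y1, y2)). ?R x2 y2 \<odot>\<^bsub>K\<^esub> (y1 \<otimes>\<^bsub>K\<^esub> x1)) (pairs (\<Delta> x) (\<Delta> y))
      = P (lext (\<lambda>((u1, u2), (v1, v2)). csmul (rt u2 v2) (cm v1 u1)) ?d)"
      unfolding D pt split_def
    proof (rule leval_lext_basis, goal_cases)
      case (1 w)
      then have "w \<in> (X \<times> X) \<times> X \<times> X" using psp_keysD[OF dX] by blast
      then show ?case by (auto simp: Rw P_mult[symmetric] P_csmul cm_X psp_csmul)
    qed
    also have "lext (\<lambda>((u1, u2), (v1, v2)). csmul (rt u2 v2) (cm v1 u1)) ?d
        = lext (\<lambda>u. lext (\<lambda>v. lmul cm (Rw (inv dg (wr u)) v) (basis u)) q) p"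
    proof -
      have "lext (\<lambda>((u1, u2), (v1, v2)). csmul (rt u2 v2) (cm v1 u1)) ?d
        = lext (\<lambda>u. lext (\<lambda>v. lext (\<lambda>((u1, u2), (v1, v2)). csmul (rt u2 v2) (cm v1 u1)) (pairs (dl u) (dl v))) q) p"
        unfolding lext_pairs lext_lext split_def by (intro lext_cong lext_swap)
      also have "\<dots> = lext (\<lambda>u. lext (\<lambda>v. lmul cm (Rw (inv dg (wr u)) v) (basis u)) q) p"
        by (intro lext_psp_cong[OF p(1)] lext_psp_cong[OF q(1)] rt_quasi)
      finally show ?thesis .
    qed
    also have "P (lext (\<lambda>u. lext (\<lambda>v. lmul cm (Rw (inv dg (wr u)) v) (basis u)) q) p)
      = P (lext (\<lambda>u. lext (\<lambda>v. lmul cm (basis u) (Lw (dg (wl u)) v)) q) p)"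
    proof (rule P_lext_cong)
      fix u assume "u \<in> Poly_Mapping.keys p"
      then have u: "u \<in> X" using psp_keysD[OF p(1)] by blast
      have c: "lmul cm (Rw (inv dg (wr u)) v) (basis u) \<in> psp X \<and> lmul cm (basis u) (Lw (dg (wl u)) v) \<in> psp X \<and>
        P (lmul cm (Rw (inv dg (wr u)) v) (basis u)) = P (lmul cm (basis u) (Lw (dg (wl u)) v))" if v: "v \<in> X" for v
      proof -
        have 1: "lmul cm (Rw (inv dg (wr u)) v) (basis u) \<in> psp X" "lmul cm (basis u) (Lw (dg (wl u)) v) \<in> psp X"
          using u v by (auto intro!: lcm_psp Rw_psp Lw_psp)
        have "frt u v \<in> ker" by (simp add: assms(2) frt_all[OF NH_tid NH_frts u v])
        then show ?thesis using 1 P_eq_iff[OF 1(2,1)] by (simp add: frt_def ker_def)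
      qed
      show "P (lext (\<lambda>v. lmul cm (Rw (inv dg (wr u)) v) (basis u)) q) = P (lext (\<lambda>v. lmul cm (basis u) (Lw (dg (wl u)) v)) q)
        \<and> lext (\<lambda>v. lmul cm (Rw (inv dg (wr u)) v) (basis u)) q \<in> psp X \<and> lext (\<lambda>v. lmul cm (basis u) (Lw (dg (wl u)) v)) q \<in> psp X"
        using c psp_keysD[OF q(1)] by (intro conjI P_lext_cong psp_lext[OF q(1)]) auto
    qed
    also have "lext (\<lambda>u. lext (\<lambda>v. lmul cm (basis u) (Lw (dg (wl u)) v)) q) p
      = lext (\<lambda>((u1, u2), (v1, v2)). csmul (rt u1 v1) (cm u2 v2)) ?d"
    proof -
      have "lext (\<lambda>((u1, u2), (v1, v2)). csmul (rt u1 v1) (cm u2 v2)) ?d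
        = lext (\<lambda>u. lext (\<lambda>v. lext (\<lambda>((u1, u2), (v1, v2)). csmul (rt u1 v1) (cm u2 v2)) (pairs (dl u) (dl v))) q) p"
        unfolding lext_pairs lext_lext split_def by (intro lext_cong lext_swap)
      also have "\<dots> = lext (\<lambda>u. lext (\<lambda>v. lmul cm (basis u) (Lw (dg (wl u)) v)) q) p"
        by (intro lext_psp_cong[OF p(1)] lext_psp_cong[OF q(1)] rt_quasi)
      finally show ?thesis by simp
    qed
    also have "P (lext (\<lambda>((u1, u2), (v1, v2)). csmul (rt u1 v1) (cm u2 v2)) ?d)
      = leval K (\<lambda>((x1, x2), (y1, y2)). ?R x1 y1 \<odot>\<^bsub>K\<^esub> (x2 \<otimes>\<^bsub>K\<^esub> y2)) (pairs (\<Delta> x) (\<Delta> y))"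
      unfolding D pt split_def
    proof (rule leval_lext_basis[symmetric], goal_cases)
      case (1 w)
      then have "w \<in> (X \<times> X) \<times> X \<times> X" using psp_keysD[OF dX] by blast
      then show ?case by (auto simp: Rw P_mult[symmetric] P_csmul cm_X psp_csmul)
    qed
    finally show "leval K (\<lambda>((x1, x2), (y1, y2)). ?R x2 y2 \<odot>\<^bsub>K\<^esub> (y1 \<otimes>\<^bsub>K\<^esub> x1)) (pairs (\<Delta> x) (\<Delta> y))
      = leval K (\<lambda>((x1, x2), (y1, y2)). ?R x1 y1 \<odot>\<^bsub>K\<^esub> (x2 \<otimes>\<^bsub>K\<^esub> y2)) (pairs (\<Delta> x) (\<Delta> y))" .
  next
    fix x y z assume x: "x \<in> carrier K" and y: "y \<in> carrier K" and z: "z \<in> carrier K"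
    define p q s where "p = qsec X P x" and "q = qsec X P y" and "s = qsec X P z"
    have p: "p \<in> psp X" "x = P p" and q: "q \<in> psp X" "y = P q" and s: "s \<in> psp X" "z = P s"
      using qsec x y z by (auto simp: p_def q_def s_def)
    have D: "\<Delta> x = timg P (lext dl p)" "\<Delta> z = timg P (lext dl s)" by (simp_all add: qcomult_def p_def s_def)
    show "?R (x \<otimes>\<^bsub>K\<^esub> y) z = ceval (\<lambda>(z1, z2). ?R x z1 * ?R y z2) (\<Delta> z)"
    proof -
      have "?R (x \<otimes>\<^bsub>K\<^esub> y) z = ceval (\<lambda>u. ceval (\<lambda>v. ceval (\<lambda>w. ceval (\<lambda>(w1, w2). rt u w1 * rt v w2) (dl w)) s) q) p"
        using p q s rt_append_left
        by (simp add: P_mult[symmetric] qform_P v lmul_psp ceval_lmul cm_def)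
          (intro ceval_psp_cong[OF p(1)] ceval_psp_cong[OF q(1)] ceval_psp_cong[OF s(1)])
      also have "\<dots> = ceval (\<lambda>u. ceval (\<lambda>v. ceval (\<lambda>(w1, w2). rt u w1 * rt v w2) (lext dl s)) q) p"
        by (simp add: ceval_lext)
      also have "\<dots> = ceval (\<lambda>u. ceval (\<lambda>(w1, w2). ceval (\<lambda>v. rt u w1 * rt v w2) q) (lext dl s)) p"
        unfolding split_def by (intro ceval_cong ceval_swap)
      also have "\<dots> = ceval (\<lambda>(w1, w2). ceval (\<lambda>u. ceval (\<lambda>v. rt u w1 * rt v w2) q) p) (lext dl s)"
        unfolding split_def by (rule ceval_swap)
      also have "\<dots> = ceval (\<lambda>(w1, w2). ?R x (P (basis w1)) * ?R y (P (basis w2))) (lext dl s)"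
        by (intro ceval_psp_cong[OF lext_\<delta>_closed[OF s(1)]])
          (auto simp: p q qform_P v ceval_fun_mult ceval_fun_mult_right)
      also have "\<dots> = ceval (\<lambda>(z1, z2). ?R x z1 * ?R y z2) (\<Delta> z)" by (simp add: D ceval_timg)
      finally show ?thesis .
    qed
    show "?R x (y \<otimes>\<^bsub>K\<^esub> z) = ceval (\<lambda>(x1, x2). ?R x1 z * ?R x2 y) (\<Delta> x)"
    proof -
      have "?R x (y \<otimes>\<^bsub>K\<^esub> z) = ceval (\<lambda>u. ceval (\<lambda>v. ceval (\<lambda>w. ceval (\<lambda>(u1, u2). rt u1 w * rt u2 v) (dl u)) s) q) p"
        using p q s rt_append_right
        by (simp add: P_mult[symmetric] qform_P v lmul_psp ceval_lmul cm_def)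
          (intro ceval_psp_cong[OF p(1)] ceval_psp_cong[OF q(1)] ceval_psp_cong[OF s(1)])
      also have "\<dots> = ceval (\<lambda>u. ceval (\<lambda>v. ceval (\<lambda>(u1, u2). ceval (\<lambda>w. rt u1 w * rt u2 v) s) (dl u)) q) p"
        unfolding split_def by (intro ceval_cong ceval_swap)
      also have "\<dots> = ceval (\<lambda>u. ceval (\<lambda>(u1, u2). ceval (\<lambda>v. ceval (\<lambda>w. rt u1 w * rt u2 v) s) q) (dl u)) p"
        unfolding split_def by (intro ceval_cong ceval_swap)
      also have "\<dots> = ceval (\<lambda>(u1, u2). ceval (\<lambda>v. ceval (\<lambda>w. rt u1 w * rt u2 v) s) q) (lext dl p)"
        by (simp add: ceval_lext)
      also have "\<dots> = ceval (\<lambda>(u1, u2). ?R (P (basis u1)) z * ?R (P (basis u2)) y) (lext dl p)"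
        by (intro ceval_psp_cong[OF lext_\<delta>_closed[OF p(1)]])
          (auto simp: q s qform_P v ceval_fun_mult ceval_fun_mult_right)
      also have "\<dots> = ceval (\<lambda>(x1, x2). ?R x1 z * ?R x2 y) (\<Delta> x)" by (simp add: D ceval_timg)
      finally show ?thesis .
    qed
  qed
qed

section \<open>Comodule transmutation\<close>

lemma ceval_dl2:
  assumes "set x \<subseteq> I" "set y \<subseteq> I" "length x = length y"
  shows "ceval f (lext (\<lambda>(u, v). lext (\<lambda>(s, t). basis (s, t, v)) (dl u)) (dl (zip x y)))
    = (\<Sum>v\<in>mi (length x). \<Sum>u\<in>mi (length x). f (zip x u, zip u v, zip v y))"
  using assms by (simp add: ceval_lext ceval_dl)

text \<open>The counit contained in \<open>rt\<close> forces both contracted indices of the twofold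
  coproduct to be outer indices of \<open>u\<close>, so the middle leg is \<open>u\<close> itself.
  The group element that remains is the inverse of \<open>|u|\<close>, and evaluated on the antipode
  of the first leg of \<open>v\<close> it becomes the left action of \<open>|u|\<close>.\<close>

lemma transmuted_words:
  assumes "u \<in> X" "v \<in> X"
  shows "ceval (\<lambda>(u1, u2, u3). ceval (\<lambda>(v1, v2). rt (Sw u1 @ u3) (Sw v1) * f (u2 @ v2)) (dl v))
      (lext (\<lambda>(u, v). lext (\<lambda>(s, t). basis (s, t, v)) (dl u)) (dl u)) = ceval f (tm u v)"
proof -
  from assms(1) obtain x y where [simp]: "set x \<subseteq> I" "set y \<subseteq> I" "length x = length y" "u = zip x y"
    by (rule XE)
  from assms(2) obtain z t where [simp]: "set z \<subseteq> I" "set t \<subseteq> I" "length z = length t" "v = zip z t"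
    by (rule XE)
  have stI: "st a = st b \<longleftrightarrow> a = b" if "set a \<subseteq> I" "set b \<subseteq> I" for a b
    using st_st[OF that(1)] st_st[OF that(2)] by metis
  have r: "rt (Sw (zip x a) @ zip b y) (Sw (zip z s))
      = (if b = y then 1 else 0) * ((if a = x then 1 else 0) * rho (dg x \<otimes> inv dg y) s z)"
    if "a \<in> mi (length y)" "b \<in> mi (length y)" "s \<in> mi (length t)" for a b s
  proof -
    have "rt (Sw (zip x a) @ zip b y) (Sw (zip z s))
        = (if a = x \<and> b = y then 1 else 0) * rho (dg b \<otimes> inv dg a) z s"
      using that by (simp add: rt_def Sw_def chi_def ep_append stI zip_append1[symmetric] wl_def wr_def ep_def map_fst_zip map_snd_zip)
    also have "\<dots> = (if a = x \<and> b = y then 1 else 0) * rho (inv (dg x \<otimes> inv dg y)) z s"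
      by (simp add: inv_mult_group)
    also have "\<dots> = (if a = x \<and> b = y then 1 else 0) * rho (dg x \<otimes> inv dg y) s z"
      using that by (subst rho_inv) auto
    finally show ?thesis by simp
  qed
  have "ceval (\<lambda>(u1, u2, u3). ceval (\<lambda>(v1, v2). rt (Sw u1 @ u3) (Sw v1) * f (u2 @ v2)) (dl v))
      (lext (\<lambda>(u, v). lext (\<lambda>(s, t). basis (s, t, v)) (dl u)) (dl u))
    = (\<Sum>b\<in>mi (length y). \<Sum>a\<in>mi (length y). \<Sum>s\<in>mi (length t).
        rt (Sw (zip x a) @ zip b y) (Sw (zip z s)) * f (zip a b @ zip s t))"
    by (simp add: ceval_dl2 ceval_dl)
  also have "\<dots> = (\<Sum>b\<in>mi (length y). (if b = y then 1 else 0) * (\<Sum>a\<in>mi (length y). (if a = x then 1 else 0) *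
      (\<Sum>s\<in>mi (length t). rho (dg x \<otimes> inv dg y) s z * f (zip a b @ zip s t))))"
    unfolding sum_distrib_left by (intro sum.cong refl) (simp only: r mult.assoc)
  also have "\<dots> = (\<Sum>s\<in>mi (length t). rho (dg x \<otimes> inv dg y) s z * f (zip x y @ zip s t))"
    by (subst sum_if_eq(1), simp, subst sum_if_eq(1), simp, simp)
  also have "\<dots> = ceval f (tm u v)" by (simp add: tm_def ceval_lmul ceval_Lw cm_def)
  finally show ?thesis .
qed

text \<open>In the image of the product of the antipode of the first leg with the third leg every
  pair has second entry \<open>|w|\<close>. The coefficient at \<open>g\<close> is a product of two
  matrix entries, one for each contracted index, and these assemble to \<open>Aw g w\<close> in the
  middle leg.\<close>

lemma coaction_words:
  assumes "w \<in> X" and b: "\<And>u. linear_form (Dvee G) (\<beta> u)"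
  shows "ceval (\<lambda>(u1, u2, u3). \<beta> u2 (ph (Sw u1 @ u3)))
      (lext (\<lambda>(u, v). lext (\<lambda>(s, t). basis (s, t, v)) (dl u)) (dl w))
    = (\<Sum>g\<in>carrier G. ceval (\<lambda>v. \<beta> v (basis (g, ad w))) (Aw g w))"
proof -
  from assms(1) obtain x y where [simp]: "set x \<subseteq> I" "set y \<subseteq> I" "length x = length y" "w = zip x y"
    by (rule XE)
  have p: "\<beta> u (ph (Sw (zip x a) @ zip b y)) = (\<Sum>g\<in>carrier G. rho g a x * rho g b y * \<beta> u (basis (g, ad w)))"
    if "a \<in> mi (length y)" "b \<in> mi (length y)" for u a b
  proof -
    have z: "Sw (zip x a) @ zip b y = zip (st a @ b) (st x @ y)"
      using that by (simp add: Sw_def)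
    have "\<beta> u (ph (Sw (zip x a) @ zip b y)) = ceval (\<lambda>k. \<beta> u (basis k)) (ph (Sw (zip x a) @ zip b y))"
      using cover.linear_eval[OF cover_Dvee, of "\<beta> u" "ph (Sw (zip x a) @ zip b y)"] b[of u] that
      by (simp add: linear_form_def ph_psp)
    also have "\<dots> = (\<Sum>g\<in>carrier G. rho (inv g) (st x @ y) (st a @ b) * \<beta> u (basis (g, inv dg (st x @ y))))"
      unfolding z using that by (subst ceval_ph) auto
    also have "\<dots> = (\<Sum>g\<in>carrier G. rho g a x * rho g b y * \<beta> u (basis (g, ad w)))"
      using that by (intro sum.cong refl) (simp add: rho_inv inv_mult_group)
    finally show ?thesis .
  qed
  have "ceval (\<lambda>(u1, u2, u3). \<beta> u2 (ph (Sw u1 @ u3)))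
      (lext (\<lambda>(u, v). lext (\<lambda>(s, t). basis (s, t, v)) (dl u)) (dl w))
    = (\<Sum>b\<in>mi (length y). \<Sum>a\<in>mi (length y). \<Sum>g\<in>carrier G. rho g a x * rho g b y * \<beta> (zip a b) (basis (g, ad w)))"
    by (simp add: ceval_dl2 p[simplified])
  also have "\<dots> = (\<Sum>g\<in>carrier G. \<Sum>b\<in>mi (length y). \<Sum>a\<in>mi (length y). rho g a x * rho g b y * \<beta> (zip a b) (basis (g, ad w)))"
    by (subst (2) sum.swap) (subst sum.swap, rule refl)
  also have "\<dots> = (\<Sum>g\<in>carrier G. ceval (\<lambda>v. \<beta> v (basis (g, ad w))) (Aw g w))"
    by (simp add: ceval_Aw mult.commute)
  finally show ?thesis .
qed

lemma antip_Sw: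
  assumes "bicover X K P dl ep cm []" "cover.ker X K P = NH" "u \<in> X"
  shows "coalgcover.antip X P (\<lambda>u. basis (Sw u)) (P (basis u)) = P (basis (Sw u))"
  using hopf_K(2)[OF assms(1,2), of "basis u"] assms(3) by simp

text \<open>The transmuted product is given by coproducts of \<open>P p\<close> and
  \<open>P q\<close> that agree with those on words only up to null tensors. Tested against a
  functional of the quotient the expression is trilinear in the legs of the twofold coproduct, and
  so it may be computed on words.\<close>

lemma transmuted_mult:
  fixes K :: "(complex, 'v) module"
  assumes K: "bicover X K P dl ep cm []" "cover.ker X K P = NH" and p: "p \<in> psp X" and q: "q \<in> psp X"
  defines "S \<equiv> coalgcover.antip X P (\<lambda>u. basis (Sw u))" and "R \<equiv> qform X P rt" and "D \<equiv> qcomult X dl P"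
  shows "mult (transmuted_algebra K D S R) (P p) (P q) = P (lmul tm p q)"
proof -
  interpret bicover X K P dl ep cm "[]" by fact
  interpret ring K by (rule ring)
  have alg: "complex_algebra K" by (rule complex_algebra)
  let ?F = "\<lambda>((x1, x2, x3), (y1, y2)). R (S x1 \<otimes>\<^bsub>K\<^esub> x3) (S y1) \<odot>\<^bsub>K\<^esub> (x2 \<otimes>\<^bsub>K\<^esub> y2)"
  define p' q' where "p' = qsec X P (P p)" and "q' = qsec X P (P q)"
  have p': "p' \<in> psp X" and q': "q' \<in> psp X" using qsec P_closed p q by (auto simp: p'_def q'_def)
  have Slin: "linear_map K K S"
    using hopf_K(1)[OF K] by (simp add: hopf_algebra_def antipode_for_def S_def)
  have S_in: "S x \<in> carrier K" if "x \<in> carrier K" for x using Slin that by (auto simp: linear_map_def)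
  have SP: "S (P (basis u)) = P (basis (Sw u))" if "u \<in> X" for u
    unfolding S_def by (rule antip_Sw[OF K that])
  have Rb: "bilinear_form K R"
    using coquasitriangular_K[OF K] by (simp add: coquasitriangular_def R_def)
  have RP: "R (P (basis u)) (P (basis v)) = rt u v" if "u \<in> X" "v \<in> X" for u v
    unfolding R_def using that by (simp add: qform_P K(2) rt_vanish)
  have smc: "k \<odot>\<^bsub>K\<^esub> x \<in> carrier K" if "x \<in> carrier K" for k x
    using module that by (simp add: Module.module_def Module.module_axioms_def)
  have keys: "(x1, x2, x3) \<in> carrier K \<times> carrier K \<times> carrier K \<and> (y1, y2) \<in> carrier K \<times> carrier K"
    if "((x1, x2, x3), (y1, y2)) \<in> Poly_Mapping.keys (pairs (comult2 \<Delta> (P p)) (\<Delta> (P q)))" for x1 x2 x3 y1 y2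
    using psp_keysD[OF psp_pairs that] comult2_psp[OF P_closed[OF p]] \<Delta>_tensor_space[OF P_closed[OF q]]
    by (auto simp: tensor_space_def psp_def)
  have Fc: "?F t \<in> carrier K" if "t \<in> Poly_Mapping.keys (pairs (comult2 \<Delta> (P p)) (\<Delta> (P q)))" for t
    using that keys by (cases t) (auto intro!: smc)
  have "leval K ?F (pairs (comult2 \<Delta> (P p)) (\<Delta> (P q))) = P (lmul tm p' q')"
  proof (rule lin_separates[OF leval_closed[OF Fc] P_closed[OF ltm_psp[OF p' q']]])
    fix f assume f: "\<And>n. n \<in> ker \<Longrightarrow> ceval f n = 0"
    note lf = lin_linear[OF f]
    have tri: "trilin K (\<lambda>x1 x2 x3. R (S x1 \<otimes>\<^bsub>K\<^esub> x3) y * lin f (x2 \<otimes>\<^bsub>K\<^esub> z))" if "y \<in> carrier K" "z \<in> carrier K" for y z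
      using that Rb lf Slin alg S_in smc
      unfolding trilin_def linear_form_def bilinear_form_def linear_map_def complex_algebra_def
      by (simp add: l_distr r_distr algebra_simps)
    have "lin f (leval K ?F (pairs (comult2 \<Delta> (P p)) (\<Delta> (P q))))
        = ceval (\<lambda>t. lin f (?F t)) (pairs (comult2 \<Delta> (P p)) (\<Delta> (P q)))"
      by (rule lin_leval[OF f Fc])
    also have "\<dots> = ceval (\<lambda>((x1, x2, x3), (y1, y2)). R (S x1 \<otimes>\<^bsub>K\<^esub> x3) (S y1) * lin f (x2 \<otimes>\<^bsub>K\<^esub> y2))
        (pairs (comult2 \<Delta> (P p)) (\<Delta> (P q)))"
      using lf keys by (intro ceval_cong) (force simp: linear_form_def)
    also have "\<dots> = ceval (\<lambda>(y1, y2). ceval (\<lambda>(x1, x2, x3). R (S x1 \<otimes>\<^bsub>K\<^esub> x3) (S y1) * lin f (x2 \<otimes>\<^bsub>K\<^esub> y2))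
        (comult2 \<Delta> (P p))) (\<Delta> (P q))"
      unfolding ceval_pairs split_def by (rule trans[OF ceval_swap]) simp
    also have "\<dots> = ceval (\<lambda>(v1, v2). ceval (\<lambda>(x1, x2, x3). R (S x1 \<otimes>\<^bsub>K\<^esub> x3) (S (P (basis v1))) * lin f (x2 \<otimes>\<^bsub>K\<^esub> P (basis v2)))
        (comult2 \<Delta> (P p))) (lext dl q')"
      by (simp add: qcomult_def[of X dl P "P q"] ceval_timg q'_def)
    also have "\<dots> = ceval (\<lambda>(v1, v2). ceval (\<lambda>(u1, u2, u3). rt (Sw u1 @ u3) (Sw v1) * f (u2 @ v2)) (\<delta>2 p')) (lext dl q')"
    proof (rule ceval_psp_cong[OF lext_\<delta>_closed[OF q']], clarify)
      fix v1 v2 assume v: "v1 \<in> X" "v2 \<in> X"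
      have "ceval (\<lambda>(x1, x2, x3). R (S x1 \<otimes>\<^bsub>K\<^esub> x3) (S (P (basis v1))) * lin f (x2 \<otimes>\<^bsub>K\<^esub> P (basis v2))) (comult2 \<Delta> (P p))
        = ceval (\<lambda>(u1, u2, u3). R (S (P (basis u1)) \<otimes>\<^bsub>K\<^esub> P (basis u3)) (S (P (basis v1))) * lin f (P (basis u2) \<otimes>\<^bsub>K\<^esub> P (basis v2))) (\<delta>2 p')"
        unfolding p'_def using v by (intro comult2_ceval tri P_closed p S_in) auto
      also have "\<dots> = ceval (\<lambda>(u1, u2, u3). rt (Sw u1 @ u3) (Sw v1) * f (u2 @ v2)) (\<delta>2 p')"
        using v by (intro ceval_psp_cong[OF \<delta>2_psp[OF p']])
          (auto simp: SP P_mult[symmetric] cm_def RP lin_P[OF f])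
      finally show "ceval (\<lambda>(x1, x2, x3). R (S x1 \<otimes>\<^bsub>K\<^esub> x3) (S (P (basis v1))) * lin f (x2 \<otimes>\<^bsub>K\<^esub> P (basis v2))) (comult2 \<Delta> (P p))
        = ceval (\<lambda>(u1, u2, u3). rt (Sw u1 @ u3) (Sw v1) * f (u2 @ v2)) (\<delta>2 p')" .
    qed
    also have "\<dots> = ceval (\<lambda>(u1, u2, u3). ceval (\<lambda>(v1, v2). rt (Sw u1 @ u3) (Sw v1) * f (u2 @ v2)) (lext dl q')) (\<delta>2 p')"
      unfolding split_def by (rule ceval_swap)
    also have "\<dots> = ceval (\<lambda>u. ceval (\<lambda>(u1, u2, u3). ceval (\<lambda>v. ceval (\<lambda>(v1, v2). rt (Sw u1 @ u3) (Sw v1) * f (u2 @ v2)) (dl v)) q')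
        (lext (\<lambda>(u, v). lext (\<lambda>(s, t). basis (s, t, v)) (dl u)) (dl u))) p'"
      by (simp add: \<delta>2_def ceval_lext lext_lext split_def)
    also have "\<dots> = ceval (\<lambda>u. ceval (\<lambda>v. ceval (\<lambda>(u1, u2, u3). ceval (\<lambda>(v1, v2). rt (Sw u1 @ u3) (Sw v1) * f (u2 @ v2)) (dl v))
        (lext (\<lambda>(u, v). lext (\<lambda>(s, t). basis (s, t, v)) (dl u)) (dl u))) q') p'"
      unfolding split_def by (intro ceval_cong ceval_swap)
    also have "\<dots> = ceval (\<lambda>u. ceval (\<lambda>v. ceval f (tm u v)) q') p'"
      by (intro ceval_psp_cong[OF p'] ceval_psp_cong[OF q'] transmuted_words)
    also have "\<dots> = lin f (P (lmul tm p' q'))"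
      by (simp add: lin_P[OF f] ltm_psp p' q' ceval_lmul)
    finally show "lin f (leval K ?F (pairs (comult2 \<Delta> (P p)) (\<Delta> (P q)))) = lin f (P (lmul tm p' q'))" .
  qed
  \<comment> \<open>\<open>NH\<close> is also an ideal for the twisted product, so the chosen
    representatives may be replaced by the given ones.\<close>
  also have "P (lmul tm p' q') = P (lmul tm p q)"
  proof -
    have "lmul tm p' q' - lmul tm p q = lmul tm (p' - p) q' + lmul tm p (q' - q)"
      by (simp add: lmul_linear)
    also have "\<dots> \<in> ker"
      using tmid_mult[OF nice_tmid[OF nice_NH]] qsec_ker p q p' q' ker_subspace
      by (auto simp: K(2) p'_def q'_def intro: csmul.subspace_add)
    finally show ?thesis using P_eq_iff[OF ltm_psp[OF p' q'] ltm_psp[OF p q]] by (simp add: ker_def)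
  qed
  finally show ?thesis by (simp add: transmuted_algebra_def D_def)
qed

theorem transmutation_K:
  fixes K :: "(complex, 'v) module"
  assumes K: "bicover X K P dl ep cm []" "cover.ker X K P = NH"
    and ps: "\<And>p. p \<in> psp X \<Longrightarrow> \<psi> (P p) = lext ph p"
  defines "S \<equiv> coalgcover.antip X P (\<lambda>u. basis (Sw u))" and "R \<equiv> qform X P rt" and "D \<equiv> qcomult X dl P"
  shows "\<exists>M :: ('g, 'v) crossed_module. is_transmutation G K D S R \<psi> M \<and>
    braided_cover X M P dl ep tm [] G Aw ad \<and> cover.ker X M P = NH"
proof -
  interpret bicover X K P dl ep cm "[]" by fact
  interpret ring K by (rule ring)
  have alg: "complex_algebra K" by (rule complex_algebra)
  define M :: "('g, 'v) crossed_module" where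
    "M = with_crossed (transmuted_algebra K D S R) (\<lambda>g x. P (lext (Aw g) (qsec X P x)))
      (\<lambda>g x. P (lext (hpart ad g) (qsec X P x)))"
  have M_simps: "carrier M = carrier K" "zero M = zero K" "one M = one K" "add M = add K" "smult M = smult K"
    "mult M = mult (transmuted_algebra K D S R)"
    by (simp_all add: M_def with_crossed_def transmuted_algebra_def)
  have nice: "nice ker" by (simp add: K(2) nice_NH)
  have desc: "P (lext s (qsec X P (P p))) = P (lext s p)"
    if "p \<in> psp X" "\<And>w. w \<in> X \<Longrightarrow> s w \<in> psp X" "\<And>p. p \<in> ker \<Longrightarrow> lext s p \<in> ker" for s p
    using qdesc_endo[OF that] by (simp add: qdesc_def)
  have actM: "act M g (P p) = P (lext (Aw g) p)" if "g \<in> carrier G" "p \<in> psp X" for g p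
    using nice that desc[of p "Aw g"] by (simp add: M_def with_crossed_def Aw_psp lAw nice_def)
  have hcM: "hcomp M g (P p) = P (lext (hpart ad g) p)" if "g \<in> carrier G" "p \<in> psp X" for g p
    using nice that desc[of p "hpart ad g"] by (simp add: M_def with_crossed_def hpart_closed nice_def)
  have cM: "cover X M P"
    using cover_axioms by (simp add: cover_def M_simps)
  have kM: "cover.ker X M P = NH" by (simp add: cover.ker_def[OF cM] M_simps K(2)[symmetric] ker_def)
  have aM: "algcover X M P tm []"
  proof -
    interpret M: cover X M P by fact
    show ?thesis
      by unfold_locales
        (simp_all add: tm_psp tm_assoc tm_nil M_simps P_one,
         simp add: transmuted_mult[OF K] D_def S_def R_def)
  qed
  have bM: "braided_cover X M P dl ep tm [] G Aw ad"
    by (rule braided_K[OF aM _ actM hcM]) (simp_all add: kM coideal_NH)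
  then interpret M: braided_cover X M P dl ep tm "[]" G Aw ad .
  have hom: "bialgebra_hom K \<Delta> cou (Dvee G) (D_comult G) (D_counit G) \<psi>"
    by (rule bialgebra_hom_Dvee[OF K(1) ps])
  have pslin: "linear_map K (Dvee G) \<psi>"
    using hom by (simp add: bialgebra_hom_def algebra_hom_def)
  have Slin: "linear_map K K S"
    using hopf_K(1)[OF K] by (simp add: hopf_algebra_def antipode_for_def S_def)
  have S_in: "S x \<in> carrier K" if "x \<in> carrier K" for x using Slin that by (auto simp: linear_map_def)
  have smc: "k \<odot>\<^bsub>K\<^esub> x \<in> carrier K" if "x \<in> carrier K" for k x
    using module that by (simp add: Module.module_def Module.module_axioms_def)
  have "is_transmutation G K D S R \<psi> M"
    unfolding is_transmutation_def
  proof (intro conjI ballI)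
    show "\<exists>ac hc. M = with_crossed (transmuted_algebra K D S R) ac hc" by (auto simp: M_def)
    show "is_crossed_module G M" by (rule M.is_crossed_module)
    fix x assume x: "x \<in> carrier K"
    define p where "p = qsec X P x"
    have p: "p \<in> psp X" "x = P p" using qsec x by (auto simp: p_def)
    show "tensor_eq K (Dvee G) (tensor_map id \<psi> (adjoint_coaction K D S x))
      (\<Sum>g\<in>carrier G. \<Sum>k\<in>carrier G. basis (act M g (hcomp M k x), basis (g, k)))"
    proof (rule tensor_eqI)
      fix \<beta> assume b: "bilin K (Dvee G) \<beta>"
      have b2: "linear_form (Dvee G) (\<beta> y)" if "y \<in> carrier K" for y
        using b that by (simp add: bilin_def linear_form_def)
      have tri: "trilin K (\<lambda>x1 x2 x3. \<beta> x2 (\<psi> (S x1 \<otimes>\<^bsub>K\<^esub> x3)))"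
        using b pslin Slin alg S_in smc
        unfolding trilin_def bilin_def linear_form_def linear_map_def complex_algebra_def
        by (simp add: l_distr r_distr Pi_iff)
      have "ceval (\<lambda>(x, y). \<beta> x y) (tensor_map id \<psi> (adjoint_coaction K D S x))
          = ceval (\<lambda>(x1, x2, x3). \<beta> x2 (\<psi> (S x1 \<otimes>\<^bsub>K\<^esub> x3))) (comult2 D x)"
        by (simp add: tensor_map_def adjoint_coaction_def ceval_lext split_def)
      also have "\<dots> = ceval (\<lambda>(u1, u2, u3). \<beta> (P (basis u2)) (\<psi> (S (P (basis u1)) \<otimes>\<^bsub>K\<^esub> P (basis u3)))) (\<delta>2 p)"
        unfolding D_def p_def by (rule comult2_ceval[OF tri x])
      also have "\<dots> = ceval (\<lambda>(u1, u2, u3). \<beta> (P (basis u2)) (ph (Sw u1 @ u3))) (\<delta>2 p)"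
        by (intro ceval_psp_cong[OF \<delta>2_psp[OF p(1)]])
          (auto simp: S_def antip_Sw[OF K] P_mult[symmetric] cm_def ps)
      also have "\<dots> = ceval (\<lambda>w. ceval (\<lambda>(u1, u2, u3). \<beta> (P (basis u2)) (ph (Sw u1 @ u3)))
          (lext (\<lambda>(u, v). lext (\<lambda>(s, t). basis (s, t, v)) (dl u)) (dl w))) p"
        by (simp add: \<delta>2_def lext_lext ceval_lext split_def)
      also have "\<dots> = ceval (\<lambda>w. \<Sum>g\<in>carrier G. ceval (\<lambda>v. \<beta> (P (basis v)) (basis (g, ad w))) (Aw g w)) p"
      proof (rule ceval_psp_cong[OF p(1)])
        fix w assume w: "w \<in> X"
        \<comment> \<open>\<open>coaction_words\<close> asks for a linear form at every word, so the
          form is replaced by zero outside \<open>X\<close>, where \<open>P (basis u2)\<close> need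
          not lie in the carrier.\<close>
        have "ceval (\<lambda>(u1, u2, u3). \<beta> (P (basis u2)) (ph (Sw u1 @ u3))) (\<delta>2 (basis w))
          = ceval (\<lambda>(u1, u2, u3). (if u2 \<in> X then \<beta> (P (basis u2)) else (\<lambda>_. 0)) (ph (Sw u1 @ u3))) (\<delta>2 (basis w))"
          using w by (intro ceval_psp_cong[OF \<delta>2_psp]) auto
        also have "\<dots> = (\<Sum>g\<in>carrier G. ceval (\<lambda>v. (if v \<in> X then \<beta> (P (basis v)) else (\<lambda>_. 0)) (basis (g, ad w))) (Aw g w))"
          unfolding \<delta>2_def lext_basis
          by (rule coaction_words[OF w]) (use b2 P_closed in \<open>auto simp: linear_form_def\<close>)
        also have "\<dots> = (\<Sum>g\<in>carrier G. ceval (\<lambda>v. \<beta> (P (basis v)) (basis (g, ad w))) (Aw g w))"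
          using w by (intro sum.cong refl ceval_psp_cong[OF Aw_psp]) auto
        finally show "ceval (\<lambda>(u1, u2, u3). \<beta> (P (basis u2)) (ph (Sw u1 @ u3)))
            (lext (\<lambda>(u, v). lext (\<lambda>(s, t). basis (s, t, v)) (dl u)) (dl w))
          = (\<Sum>g\<in>carrier G. ceval (\<lambda>v. \<beta> (P (basis v)) (basis (g, ad w))) (Aw g w))"
          by (simp add: \<delta>2_def)
      qed
      also have "\<dots> = ceval (\<lambda>w. \<Sum>g\<in>carrier G. \<Sum>k\<in>carrier G.
          ceval (\<lambda>v. \<beta> (P (basis v)) (basis (g, k))) (lext (Aw g) (hpart ad k w))) p"
      proof (rule ceval_psp_cong[OF p(1)], rule sum.cong[OF refl])
        fix w g assume w: "w \<in> X"
        have "(\<Sum>k\<in>carrier G. ceval (\<lambda>v. \<beta> (P (basis v)) (basis (g, k))) (lext (Aw g) (hpart ad k w)))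
          = (\<Sum>k\<in>carrier G. if k = ad w then ceval (\<lambda>v. \<beta> (P (basis v)) (basis (g, k))) (Aw g w) else 0)"
          by (intro sum.cong refl) (auto simp: hpart_def)
        then show "ceval (\<lambda>v. \<beta> (P (basis v)) (basis (g, ad w))) (Aw g w)
          = (\<Sum>k\<in>carrier G. ceval (\<lambda>v. \<beta> (P (basis v)) (basis (g, k))) (lext (Aw g) (hpart ad k w)))"
          using w finG by simp
      qed
      also have "\<dots> = (\<Sum>g\<in>carrier G. \<Sum>k\<in>carrier G. ceval (\<lambda>v. \<beta> (P (basis v)) (basis (g, k))) (lext (Aw g) (lext (hpart ad k) p)))"
        by (simp add: ceval_fun_sum ceval_lext)
      also have "\<dots> = (\<Sum>g\<in>carrier G. \<Sum>k\<in>carrier G. \<beta> (act M g (hcomp M k x)) (basis (g, k)))"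
      proof (intro sum.cong refl)
        fix g k assume g: "g \<in> carrier G" "k \<in> carrier G"
        have hp: "lext (hpart ad k) p \<in> psp X" by (rule psp_lext[OF p(1) hpart_closed])
        show "ceval (\<lambda>v. \<beta> (P (basis v)) (basis (g, k))) (lext (Aw g) (lext (hpart ad k) p)) = \<beta> (act M g (hcomp M k x)) (basis (g, k))"
          using bilin_left[OF b lAw_psp[OF g(1) hp], of "basis (g, k)"] g hp p by (simp add: hcM actM)
      qed
      also have "\<dots> = ceval (\<lambda>(x, y). \<beta> x y) (\<Sum>g\<in>carrier G. \<Sum>k\<in>carrier G. basis (act M g (hcomp M k x), basis (g, k)))"
        by (simp add: ceval_sum)
      finally show "ceval (\<lambda>(x, y). \<beta> x y) (tensor_map id \<psi> (adjoint_coaction K D S x))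
        = ceval (\<lambda>(x, y). \<beta> x y) (\<Sum>g\<in>carrier G. \<Sum>k\<in>carrier G. basis (act M g (hcomp M k x), basis (g, k)))" .
    qed
  qed
  then show ?thesis using bM kM by blast
qed

section \<open>The four algebras as quotients of words\<close>

lemma lists_X: "lists (I \<times> I) = X" by (simp add: X_def)

lemma Idl_tgen: assumes A: "is_free (I \<times> I) A" and S: "S \<subseteq> psp X" shows "Idl\<^bsub>A\<^esub> S = tgen S"
proof
  show "Idl\<^bsub>A\<^esub> S \<subseteq> tgen S" by (rule genideal_minimal_free[OF A tgen_tid[OF S] tgen_incl])
  show "tgen S \<subseteq> Idl\<^bsub>A\<^esub> S" using genideal_tideal[OF A] S by (intro tgen_min) (auto simp: lists_X)
qed

text \<open>A quotient of a quotient is again presented by words. The preimage of \<open>J\<close>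
  is an ideal of words that contains \<open>S\<close>, which is sent to zero, and \<open>T\<close>;
  the reverse inclusion is the minimality of \<open>J\<close>.\<close>

lemma quot_cover:
  assumes K: "algcover X K Q cm []" "cover.ker X K Q = tgen S" and S: "S \<subseteq> psp X" "T \<subseteq> psp X"
    and J: "J = Idl\<^bsub>K\<^esub> (Q ` T)"
  shows "ideal J K" "{p \<in> psp X. Q p \<in> J} = tgen (S \<union> T)"
    "algcover X (quot_algebra K J) (\<lambda>p. J +>\<^bsub>K\<^esub> Q p) cm []"
    "cover.ker X (quot_algebra K J) (\<lambda>p. J +>\<^bsub>K\<^esub> Q p) = tgen (S \<union> T)"
proof -
  interpret algcover X K Q cm "[]" by fact
  interpret R: ring K by (rule ring)
  have QT: "Q ` T \<subseteq> carrier K" using S(2) P_closed by blast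
  show iJ: "ideal J K" unfolding J by (rule R.genideal_ideal[OF QT])
  note KL = K[folded lists_X]
  show eq: "{p \<in> psp X. Q p \<in> J} = tgen (S \<union> T)"
  proof
    have "tgen S \<subseteq> tgen (S \<union> T)" using S tgen_incl[of "S \<union> T"] by (intro tgen_min tgen_tid) auto
    then show "{p \<in> psp X. Q p \<in> J} \<subseteq> tgen (S \<union> T)"
      using genideal_minimal_cover[OF KL(1), of "tgen (S \<union> T)" "Q ` T"] KL(2) tgen_incl[of "S \<union> T"] S tgen_tid[of "S \<union> T"]
      unfolding J lists_X by blast
    have "Q s \<in> J" if "s \<in> S" for s
    proof -
      have "s \<in> ker" using that tgen_incl[of S] by (auto simp: K(2))
      then show ?thesis using additive_subgroup.zero_closed[OF ideal.axioms(1)[OF iJ]] by (simp add: ker_def)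
    qed
    moreover have "Q t \<in> J" if "t \<in> T" for t using R.genideal_self[OF QT] that unfolding J by blast
    ultimately show "tgen (S \<union> T) \<subseteq> {p \<in> psp X. Q p \<in> J}"
      using kernel_tideal[OF KL(1) iJ] S unfolding lists_X by (intro tgen_min) auto
  qed
  show "algcover X (quot_algebra K J) (\<lambda>p. J +>\<^bsub>K\<^esub> Q p) cm []"
    "cover.ker X (quot_algebra K J) (\<lambda>p. J +>\<^bsub>K\<^esub> Q p) = tgen (S \<union> T)"
    using algcover_quot[OF iJ] eq by auto
qed

lemma free_quot_cover:
  assumes A: "is_free (I \<times> I) A" and S: "S \<subseteq> psp X"
  shows "ideal (tgen S) A" "algcover X (quot_algebra A (tgen S)) (\<lambda>p. tgen S +>\<^bsub>A\<^esub> p) cm []"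
    "cover.ker X (quot_algebra A (tgen S)) (\<lambda>p. tgen S +>\<^bsub>A\<^esub> p) = tgen S"
proof -
  interpret algcover X A id cm "[]" using algcover_free[OF A] by (simp add: lists_X)
  show i: "ideal (tgen S) A" using tgen_tid[OF S] ideal_iff_tideal[OF A] by blast
  show "algcover X (quot_algebra A (tgen S)) (\<lambda>p. tgen S +>\<^bsub>A\<^esub> p) cm []"
    "cover.ker X (quot_algebra A (tgen S)) (\<lambda>p. tgen S +>\<^bsub>A\<^esub> p) = tgen S"
    using algcover_quot[OF i] tid_psp[OF tgen_tid[OF S]] by auto
qed

text \<open>Composing with \<open>th'\<close> keeps the algebra \<open>K\<close> and only changes
  which words name its elements, so that its product is read as \<open>tm\<close>. This makes
  \<open>U\<close> and \<open>B\<close> comparable with \<open>A\<close> and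
  \<open>H\<close>.\<close>

lemma twist_cover:
  assumes "algcover X K Q cm []"
  shows "algcover X K (\<lambda>p. Q (lext th' p)) tm []"
    "cover.ker X K (\<lambda>p. Q (lext th' p)) = {p \<in> psp X. lext th' p \<in> cover.ker X K Q}"
proof -
  interpret algcover X K Q cm "[]" by fact
  show a: "algcover X K (\<lambda>p. Q (lext th' p)) tm []"
  proof (unfold_locales)
    fix x assume "x \<in> carrier K"
    then obtain p where "p \<in> psp X" "x = Q p" by (rule P_ex)
    then show "\<exists>p\<in>psp X. Q (lext th' p) = x" by (intro bexI[of _ "lext th p"]) (auto simp: lth'_lth lth_psp)
  qed (auto simp: lth'_psp P_closed P_zero P_one lext_linear P_add P_csmul lth'_ltm P_mult tm_psp tm_assoc tm_nil)
  interpret a: algcover X K "\<lambda>p. Q (lext th' p)" tm "[]" by fact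
  show "cover.ker X K (\<lambda>p. Q (lext th' p)) = {p \<in> psp X. lext th' p \<in> cover.ker X K Q}"
    by (auto simp: a.ker_def ker_def lth'_psp)
qed

text \<open>Stability is transported from \<open>NA\<close> along \<open>th\<close>, which commutes
  with the action and turns the degree of the tensor algebra into \<open>ad\<close>.\<close>

lemma NU_stable:
  assumes "i \<in> NU" "g \<in> carrier G"
  shows "lext (Aw g) i \<in> NU" "lext (hpart degw g) i \<in> NU"
proof -
  let ?p = "lext th i"
  have i: "i \<in> psp X" using assms(1) NU_tid tid_psp by blast
  have p: "?p \<in> psp X" "lext th' ?p = i" using i by (simp_all add: lth_psp lth'_lth)
  then have "?p \<in> NA" using assms(1) by (simp flip: kerU)
  then have "lext (Aw g) ?p \<in> NA" "lext (hpart ad g) ?p \<in> NA"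
    using nice_NA assms(2) by (auto simp: nice_def lAw)
  then have "lext th' (lext (Aw g) ?p) \<in> NU" "lext th' (lext (hpart ad g) ?p) \<in> NU"
    by (simp_all flip: kerU)
  then show "lext (Aw g) i \<in> NU" "lext (hpart degw g) i \<in> NU"
    using p assms(2) by (simp_all add: lth'_lAw lth'_hpart)
qed

lemma U_cover:
  fixes T :: "('g, ('a \<times> 'a) list \<Rightarrow>\<^sub>0 complex) crossed_module"
  assumes T: "is_free (I \<times> I) T"
    and aT: "\<And>g p. g \<in> carrier G \<Longrightarrow> p \<in> psp X \<Longrightarrow> act T g p = lext (Aw g) p"
    and hT: "\<And>g p. g \<in> carrier G \<Longrightarrow> p \<in> psp X \<Longrightarrow> hcomp T g p = lext (hpart degw g) p"
  shows "braided_cover X (quot_crossed T NU) (\<lambda>p. NU +>\<^bsub>T\<^esub> lext th' p) dl ep tm [] G Aw ad"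
    "cover.ker X (quot_crossed T NU) (\<lambda>p. NU +>\<^bsub>T\<^esub> lext th' p) = NA"
    "algcover X (quot_crossed T NU) (\<lambda>p. NU +>\<^bsub>T\<^esub> p) cm []"
    "cover.ker X (quot_crossed T NU) (\<lambda>p. NU +>\<^bsub>T\<^esub> p) = NU"
proof -
  note q = free_quot_cover[OF T gUs_psp, folded NU_def]
  have cT: "carrier T = psp X" "add T = (+)" using T by (simp_all add: is_free_def lists_X)
  show a: "algcover X (quot_crossed T NU) (\<lambda>p. NU +>\<^bsub>T\<^esub> p) cm []"
    by (rule algcover_same[OF q(2) same_alg_quot_crossed])
  have "cover X (quot_algebra T NU) (\<lambda>p. NU +>\<^bsub>T\<^esub> p)" using q(2) by (simp add: algcover_def)
  from ker_same[OF this same_alg_quot_crossed] q(3)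
  show k: "cover.ker X (quot_crossed T NU) (\<lambda>p. NU +>\<^bsub>T\<^esub> p) = NU" by simp
  note t = twist_cover[OF a]
  show k': "cover.ker X (quot_crossed T NU) (\<lambda>p. NU +>\<^bsub>T\<^esub> lext th' p) = NA"
    using t(2) k kerU by simp
  show "braided_cover X (quot_crossed T NU) (\<lambda>p. NU +>\<^bsub>T\<^esub> lext th' p) dl ep tm [] G Aw ad"
  proof (rule braided_K[OF t(1)])
    show "coideal X dl ep (cover.ker X (quot_crossed T NU) (\<lambda>p. NU +>\<^bsub>T\<^esub> lext th' p))"
      by (simp add: k' coideal_NA)
    fix g p assume g: "g \<in> carrier G" and p: "p \<in> psp X"
    have N: "i \<in> NU \<Longrightarrow> i \<in> psp X" for i using NU_tid tid_psp by blast
    have hX: "lext (hpart degw g) p \<in> psp X" if "p \<in> psp X" for p by (rule psp_lext[OF that hpart_closed])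
    have "act (quot_crossed T NU) g (NU +>\<^bsub>T\<^esub> lext th' p) = NU +>\<^bsub>T\<^esub> act T g (lext th' p)"
      by (rule act_quot_crossed(1)[OF q(1) _ _ _ _ refl])
        (use g p N in \<open>auto simp: cT aT lth'_psp lAw_psp psp_add lext_add NU_stable\<close>)
    then show "act (quot_crossed T NU) g (NU +>\<^bsub>T\<^esub> lext th' p) = NU +>\<^bsub>T\<^esub> lext th' (lext (Aw g) p)"
      using g p by (simp add: aT lth'_psp lth'_lAw)
    have "hcomp (quot_crossed T NU) g (NU +>\<^bsub>T\<^esub> lext th' p) = NU +>\<^bsub>T\<^esub> hcomp T g (lext th' p)"
      by (rule act_quot_crossed(2)[OF q(1) _ _ _ _ refl])
        (use g p N in \<open>auto simp: cT hT lth'_psp hX psp_add lext_add NU_stable\<close>)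
    then show "hcomp (quot_crossed T NU) g (NU +>\<^bsub>T\<^esub> lext th' p) = NU +>\<^bsub>T\<^esub> lext th' (lext (hpart ad g) p)"
      using g p by (simp add: hT lth'_psp lth'_hpart)
  qed
qed

lemma B_cover:
  fixes U :: "('g, 'v) crossed_module"
  assumes U: "braided_cover X U (\<lambda>p. Q (lext th' p)) dl ep tm [] G Aw ad"
    and Q: "algcover X U Q cm []" "cover.ker X U Q = NU"
    and J: "J = Idl\<^bsub>U\<^esub> (Q ` antsB)"
  shows "braided_cover X (quot_crossed U J) (\<lambda>p. J +>\<^bsub>U\<^esub> Q (lext th' p)) dl ep tm [] G Aw ad"
    "cover.ker X (quot_crossed U J) (\<lambda>p. J +>\<^bsub>U\<^esub> Q (lext th' p)) = NH"
proof -
  interpret U: braided_cover X U "\<lambda>p. Q (lext th' p)" dl ep tm "[]" G Aw ad by fact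
  note q = quot_cover[OF Q(1) Q(2)[unfolded NU_def] gUs_psp antsB_psp J, folded NB_def]
  have a: "algcover X (quot_crossed U J) (\<lambda>p. J +>\<^bsub>U\<^esub> Q p) cm []"
    by (rule algcover_same[OF q(3) same_alg_quot_crossed])
  have "cover X (quot_algebra U J) (\<lambda>p. J +>\<^bsub>U\<^esub> Q p)" using q(3) by (simp add: algcover_def)
  from ker_same[OF this same_alg_quot_crossed] q(4)
  have k: "cover.ker X (quot_crossed U J) (\<lambda>p. J +>\<^bsub>U\<^esub> Q p) = NB" by simp
  note t = twist_cover[OF a]
  show k': "cover.ker X (quot_crossed U J) (\<lambda>p. J +>\<^bsub>U\<^esub> Q (lext th' p)) = NH"
    using t(2) k kerB by simp
  have JN: "Q (lext th' p) \<in> J \<longleftrightarrow> p \<in> NH" if "p \<in> psp X" for p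
  proof -
    have "Q (lext th' p) \<in> J \<longleftrightarrow> lext th' p \<in> NB" using q(2) lth'_psp[OF that] by blast
    then show ?thesis using kerB that by blast
  qed
  \<comment> \<open>An operation on \<open>U\<close> that is given on twisted words by
    \<open>s\<close> preserves \<open>J\<close> as soon as \<open>s\<close> preserves
    \<open>NH\<close>; this covers both the action and the grading.\<close>
  have st: "f i \<in> J" if "i \<in> J" "\<And>p. p \<in> psp X \<Longrightarrow> f (Q (lext th' p)) = Q (lext th' (lext s p))"
    "\<And>p. p \<in> NH \<Longrightarrow> lext s p \<in> NH" for f i s
  proof -
    have "i \<in> carrier U" using ideal.Icarr[OF q(1) that(1)] .
    then obtain p where p: "p \<in> psp X" "i = Q (lext th' p)" by (rule U.P_ex)
    then have "p \<in> NH" using JN that(1) by simp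
    then have "lext s p \<in> NH" by (rule that(3))
    moreover have "lext s p \<in> psp X" using calculation NH_tid tid_psp by blast
    ultimately show ?thesis using p that(2) JN by simp
  qed
  have lin: "linear_map U U (act U g)" "linear_map U U (hcomp U g)" if "g \<in> carrier G" for g
    using U.is_crossed_module that by (auto simp: is_crossed_module_def)
  show "braided_cover X (quot_crossed U J) (\<lambda>p. J +>\<^bsub>U\<^esub> Q (lext th' p)) dl ep tm [] G Aw ad"
  proof (rule braided_K[OF t(1)])
    show "coideal X dl ep (cover.ker X (quot_crossed U J) (\<lambda>p. J +>\<^bsub>U\<^esub> Q (lext th' p)))"
      by (simp add: k' coideal_NH)
    fix g p assume g: "g \<in> carrier G" and p: "p \<in> psp X"
    have n: "lext (Aw g) n \<in> NH" "lext (hpart ad g) n \<in> NH" if "n \<in> NH" for n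
      using nice_NH that g by (auto simp: nice_def lAw)
    have "act (quot_crossed U J) g (J +>\<^bsub>U\<^esub> Q (lext th' p)) = J +>\<^bsub>U\<^esub> act U g (Q (lext th' p))"
      by (rule act_quot_crossed(1)[OF q(1) _ _ _ _ refl])
        (use g p lin(1)[OF g] U.P_closed st[of _ "act U g" "Aw g"] n in \<open>auto simp: linear_map_def U.act_P\<close>)
    then show "act (quot_crossed U J) g (J +>\<^bsub>U\<^esub> Q (lext th' p)) = J +>\<^bsub>U\<^esub> Q (lext th' (lext (Aw g) p))"
      using g p by (simp add: U.act_P)
    have "hcomp (quot_crossed U J) g (J +>\<^bsub>U\<^esub> Q (lext th' p)) = J +>\<^bsub>U\<^esub> hcomp U g (Q (lext th' p))"
      by (rule act_quot_crossed(2)[OF q(1) _ _ _ _ refl])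
        (use g p lin(2)[OF g] U.P_closed st[of _ "hcomp U g" "hpart ad g"] n in \<open>auto simp: linear_map_def U.hcomp_P\<close>)
    then show "hcomp (quot_crossed U J) g (J +>\<^bsub>U\<^esub> Q (lext th' p)) = J +>\<^bsub>U\<^esub> Q (lext th' (lext (hpart ad g) p))"
      using g p by (simp add: U.hcomp_P)
  qed
qed

section \<open>Explicit formulas for letters\<close>

lemma sum_mi_1: "(\<Sum>z\<in>mi (Suc 0). f z) = (\<Sum>a\<in>I. f [a])"
  using sum_mi_Suc[of f 0] by simp

lemma Lw_letter: "Lw g [(x, y)] = (\<Sum>v\<in>I. csmul (rho1 g v x) (basis [(v, y)]))"
  and Rw_letter: "Rw g [(x, y)] = (\<Sum>v\<in>I. csmul (rho1 g v y) (basis [(x, v)]))"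
  by (simp_all add: Lw_def Rw_def wl_def wr_def sum_mi_1)

lemma dl_letter: "dl [(x, y)] = (\<Sum>z\<in>I. basis ([(x, z)], [(z, y)]))"
  by (simp add: dl_def wl_def wr_def sum_mi_1)

lemma ad_letter: "x \<in> I \<Longrightarrow> y \<in> I \<Longrightarrow> ad [(x, y)] = dg1 x \<otimes> inv dg1 y"
  by (simp add: ad_def wl_def wr_def dg1_closed)

lemma Sw_letter: "Sw [(x, y)] = [(st1 y, st1 x)]"
  by (simp add: Sw_def wl_def wr_def st_def)

text \<open>Kronecker deltas and a second summation are introduced to obtain the shape of the
  generators in \<open>A_ideal\<close>.\<close>

lemma frt_letter: assumes "x \<in> I" "y \<in> I" "z \<in> I" "w \<in> I"
  shows "frt [(x, y)] [(z, w)] =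
    (\<Sum>u\<in>I. \<Sum>v\<in>I. csmul (if u = x then rho1 (dg1 u) v z else 0) (basis [(u, y), (v, w)])) -
    (\<Sum>u\<in>I. \<Sum>v\<in>I. csmul (if y = u then rho1 (dg1 y) w v else 0) (basis [(z, v), (x, u)]))"
proof -
  have "frt [(x, y)] [(z, w)] = (\<Sum>v\<in>I. csmul (rho1 (dg1 x) v z) (basis [(x, y), (v, w)])) -
      (\<Sum>v\<in>I. csmul (rho1 (inv dg1 y) v w) (basis [(z, v), (x, y)]))"
    using assms by (simp add: frt_def Lw_letter Rw_letter lmul_linear cm_def wl_def wr_def dg1_closed)
  also have "(\<Sum>v\<in>I. csmul (rho1 (inv dg1 y) v w) (basis [(z, v), (x, y)]))
      = (\<Sum>v\<in>I. csmul (rho1 (dg1 y) w v) (basis [(z, v), (x, y)]))"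
    using assms by (intro sum.cong refl) (simp add: rho1_inv dg1_closed)
  also have "\<dots> = (\<Sum>u\<in>I. if u = y then (\<Sum>v\<in>I. csmul (rho1 (dg1 y) w v) (basis [(z, v), (x, u)])) else 0)"
    using assms finI by simp
  also have "\<dots> = (\<Sum>u\<in>I. \<Sum>v\<in>I. csmul (if y = u then rho1 (dg1 y) w v else 0) (basis [(z, v), (x, u)]))"
    by (intro sum.cong refl) (auto simp: csmul_basis)
  also have "(\<Sum>v\<in>I. csmul (rho1 (dg1 x) v z) (basis [(x, y), (v, w)]))
      = (\<Sum>u\<in>I. if u = x then (\<Sum>v\<in>I. csmul (rho1 (dg1 u) v z) (basis [(u, y), (v, w)])) else 0)"
    using assms finI by simp
  also have "\<dots> = (\<Sum>u\<in>I. \<Sum>v\<in>I. csmul (if u = x then rho1 (dg1 u) v z else 0) (basis [(u, y), (v, w)]))"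
    by (intro sum.cong refl) (auto simp: csmul_basis)
  finally show ?thesis .
qed

lemma Aw_letter: "Aw g [(x, y)] = lext (\<lambda>l. basis [l])
    (pairs (\<Sum>v\<in>I. csmul (rho1 g v x) (basis v)) (\<Sum>v\<in>I. csmul (rho1 g v y) (basis v)))"
  by (rule ceval_ext)
    (simp add: Aw_def Rw_letter Lw_letter ceval_lext ceval_pairs ceval_linear sum_distrib_left,
     subst sum.swap, simp add: mult.left_commute)

lemma gU_letter: assumes "x \<in> I" "y \<in> I"
  shows "gU [(x, y)] [l] = basis [(x, y), l] - lext (\<lambda>(z, w). basis [z, w])
    (lext (\<lambda>z'. lext (\<lambda>x'. basis (z', (x', y))) (\<Sum>v\<in>I. csmul (rho1 (inv ad [z']) v x) (basis v)))
      (pairs (\<Sum>v\<in>I. csmul (rho1 (inv dg1 y) v (fst l)) (basis v)) (\<Sum>v\<in>I. csmul (rho1 (inv dg1 y) v (snd l)) (basis v))))"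
  using assms by (cases l)
    (simp add: gU_def cm_def wr_def dg1_closed Aw_letter lext_lext lext_linear Lw_letter lmul_linear)

lemma d1_letter: "x \<in> I \<Longrightarrow> y \<in> I \<Longrightarrow>
    d1 [x] [y] = (\<Sum>z\<in>I. lmul cm (basis [(x, z)]) (basis [(st1 y, st1 z)])) - (if x = y then basis [] else 0)"
  and d2_letter: "x \<in> I \<Longrightarrow> y \<in> I \<Longrightarrow>
    d2 [x] [y] = (\<Sum>z\<in>I. lmul cm (basis [(st1 z, st1 x)]) (basis [(z, y)])) - (if x = y then basis [] else 0)"
  by (simp_all add: d1_def d2_def s1_def s2_def sum_mi_1 Sw_letter cm_def)

lemma sB_letter: "x \<in> I \<Longrightarrow> y \<in> I \<Longrightarrow>
    sB [(x, y)] = (\<Sum>v\<in>I. csmul (rho1 (dg1 x \<otimes> inv dg1 y) v (st1 y)) (basis [(v, st1 x)]))"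
  by (simp add: sB_def ad_letter Sw_letter Lw_letter)

lemma e1_letter: "e1 x y = (\<Sum>z\<in>I. lmul cm (basis [(x, z)]) (sB [(z, y)])) - (if x = y then basis [] else 0)"
  and e2_letter: "e2 x y = (\<Sum>z\<in>I. lmul cm (sB [(x, z)]) (basis [(z, y)])) - (if x = y then basis [] else 0)"
  by (simp_all add: e1_def e2_def dl_letter lext_linear)

lemma ph_letter: "y \<in> I \<Longrightarrow>
    ph [(x, y)] = (\<Sum>g\<in>carrier G. csmul (rho1 (inv g) y x) (basis (g, inv dg1 y)))"
  by (simp add: ph_def wl_def wr_def dg1_closed)

lemma rt_letter: "x \<in> I \<Longrightarrow> rt [(x, y)] [(z, w)] = (if x = y then rho1 (dg1 x) w z else 0)"
  by (simp add: rt_def ep_def chi_def wl_def wr_def dg1_closed)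

lemma tensor_eq_comult_letter:
  assumes "cocover X K P dl ep" "x \<in> I" "y \<in> I"
  shows "tensor_eq K K (qcomult X dl P (P (basis [(x, y)]))) (\<Sum>z\<in>I. basis (P (basis [(x, z)]), P (basis [(z, y)])))"
    and "qcounit X ep P (P (basis [(x, y)])) = (if x = y then 1 else 0)"
proof -
  interpret cocover X K P dl ep by fact
  have b: "basis [(x, y)] \<in> psp X" using assms by simp
  show "tensor_eq K K (qcomult X dl P (P (basis [(x, y)]))) (\<Sum>z\<in>I. basis (P (basis [(x, z)]), P (basis [(z, y)])))"
    using \<Delta>_P[OF b] by (simp add: dl_letter timg_def lext_linear)
  show "qcounit X ep P (P (basis [(x, y)])) = (if x = y then 1 else 0)"
    using ep_P[OF b] by (simp add: ep_def wl_def wr_def)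
qed

end

section \<open>The data of a conjugacy class\<close>

lemma setcompr2_cong:
  "(\<And>x y. P x y \<Longrightarrow> f x y = g x y) \<Longrightarrow> {f x y | x y. P x y} = {g x y | x y. P x y}"
  by (intro Collect_cong ex_cong1) auto

lemma image_setcompr2: "h ` {f x y | x y. P x y} = {h (f x y) | x y. P x y}"
  by blast

lemma setcompr4_cong:
  "(\<And>x y z w. P x y z w \<Longrightarrow> f x y z w = g x y z w) \<Longrightarrow>
    {f x y z w | x y z w. P x y z w} = {g x y z w | x y z w. P x y z w}"
  by (intro Collect_cong ex_cong1) auto

locale class_rep = group G for G :: "('g, 'm) monoid_scheme" (structure) +
  fixes C :: "'g set" and r :: 'g and q :: "'g \<Rightarrow> 'g" and \<pi> :: "'g \<Rightarrow> complex^'i^'i"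
  assumes finite_G: "finite (carrier G)" and r_G: "r \<in> carrier G" and C_def: "C = conjugacy_class G r"
    and C_inv: "\<forall>c\<in>C. inv c \<in> C" and sect: "coset_section G C r q"
    and rep: "matrix_rep G (centraliser G r) \<pi>" and orthogonal: "real_orthogonal_rep (centraliser G r) \<pi>"
    and compatible: "inversion_compatible G C q \<pi>"
begin

lemma cancel [simp]: "a \<in> carrier G \<Longrightarrow> b \<in> carrier G \<Longrightarrow> a \<otimes> (inv a \<otimes> b) = b"
  "a \<in> carrier G \<Longrightarrow> b \<in> carrier G \<Longrightarrow> inv a \<otimes> (a \<otimes> b) = b"
  by (simp_all add: m_assoc[symmetric])

lemma C_G: "c \<in> C \<Longrightarrow> c \<in> carrier G"
  using r_G by (auto simp: C_def conjugacy_class_def)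

lemma C_conj: assumes "g \<in> carrier G" "c \<in> C" shows "g \<otimes> c \<otimes> inv g \<in> C"
proof -
  from assms(2) obtain h where h: "h \<in> carrier G" "c = h \<otimes> r \<otimes> inv h"
    by (auto simp: C_def conjugacy_class_def)
  then have "g \<otimes> c \<otimes> inv g = (g \<otimes> h) \<otimes> r \<otimes> inv (g \<otimes> h)"
    using assms(1) r_G by (simp add: m_assoc inv_mult_group)
  then show ?thesis using assms(1) h(1) unfolding C_def conjugacy_class_def by blast
qed

lemma finite_C: "finite C"
  using C_G finite_G by (meson finite_subset subsetI)

lemma conj_iff: "g \<in> carrier G \<Longrightarrow> c \<in> carrier G \<Longrightarrow> d \<in> carrier G \<Longrightarrow>
    d = inv g \<otimes> c \<otimes> g \<longleftrightarrow> c = g \<otimes> d \<otimes> inv g"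
  by (auto simp: m_assoc)

lemma q_G: "c \<in> C \<Longrightarrow> q c \<in> carrier G"
  using sect by (simp add: coset_section_def)

lemma q_r: assumes "c \<in> C" shows "q c \<otimes> r = c \<otimes> q c" "r \<otimes> inv (q c) = inv (q c) \<otimes> c"
proof -
  have e: "c = q c \<otimes> r \<otimes> inv (q c)" using sect assms by (simp add: coset_section_def)
  have "q c \<otimes> r = (q c \<otimes> r \<otimes> inv (q c)) \<otimes> q c" "r \<otimes> inv (q c) = inv (q c) \<otimes> (q c \<otimes> r \<otimes> inv (q c))"
    using q_G[OF assms] r_G by (simp_all add: m_assoc)
  then show "q c \<otimes> r = c \<otimes> q c" "r \<otimes> inv (q c) = inv (q c) \<otimes> c" using e by simp_all
qed

text \<open>\<open>q c\<close> conjugates \<open>r\<close> to \<open>c\<close>, \<open>g\<close>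
  conjugates \<open>c\<close> to \<open>d\<close>, and the inverse of \<open>q d\<close> conjugates
  \<open>d\<close> back to \<open>r\<close>, so the composite commutes with
  \<open>r\<close>.\<close>

lemma zeta_cent: assumes c: "c \<in> C" and g: "g \<in> carrier G" shows "zeta G q c g \<in> centraliser G r"
proof -
  define d where "d = g \<otimes> c \<otimes> inv g"
  have d: "d \<in> C" unfolding d_def by (rule C_conj[OF g c])
  note G = c g d q_G[OF c] q_G[OF d] C_G[OF c] C_G[OF d] r_G
  have dg: "d \<otimes> g = g \<otimes> c" using G by (simp add: d_def m_assoc)
  have "inv (q d) \<otimes> g \<otimes> q c \<otimes> r = inv (q d) \<otimes> g \<otimes> (c \<otimes> q c)"
    using G by (simp add: m_assoc q_r)
  also have "\<dots> = inv (q d) \<otimes> (d \<otimes> g) \<otimes> q c" using G by (simp add: m_assoc dg)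
  also have "\<dots> = (r \<otimes> inv (q d)) \<otimes> g \<otimes> q c" using G by (simp add: m_assoc q_r)
  finally show ?thesis using G by (simp add: zeta_def centraliser_def d_def[symmetric] m_assoc)
qed

lemma cent_G: "n \<in> centraliser G r \<Longrightarrow> n \<in> carrier G"
  by (simp add: centraliser_def)

lemma cent_inv: assumes "n \<in> centraliser G r" shows "inv n \<in> centraliser G r"
proof -
  have n: "n \<in> carrier G" "n \<otimes> r = r \<otimes> n" using assms by (auto simp: centraliser_def)
  have "inv n \<otimes> r = inv n \<otimes> (r \<otimes> n) \<otimes> inv n" using n(1) r_G by (simp add: m_assoc)
  also have "\<dots> = r \<otimes> inv n" using n(1) r_G by (simp flip: n(2) add: m_assoc)
  finally show ?thesis using n(1) by (simp add: centraliser_def)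
qed

lemma zeta_one: "c \<in> C \<Longrightarrow> zeta G q c \<one> = \<one>"
  using C_G q_G by (simp add: zeta_def)

text \<open>The cocycle identity that makes the matrices \<open>rh\<close> multiplicative in the
  group element.\<close>

lemma zeta_mult: assumes c: "c \<in> C" and g: "g \<in> carrier G" "h \<in> carrier G"
  shows "zeta G q c (g \<otimes> h) = zeta G q (h \<otimes> c \<otimes> inv h) g \<otimes> zeta G q c h"
proof -
  define d where "d = h \<otimes> c \<otimes> inv h"
  define e where "e = g \<otimes> d \<otimes> inv g"
  have d: "d \<in> C" unfolding d_def by (rule C_conj[OF g(2) c])
  have e: "e \<in> C" unfolding e_def by (rule C_conj[OF g(1) d])
  have "(g \<otimes> h) \<otimes> c \<otimes> inv (g \<otimes> h) = e"
    using c g C_G[OF c] by (simp add: e_def d_def m_assoc inv_mult_group)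
  then show ?thesis
    using g q_G[OF c] q_G[OF d] q_G[OF e]
    by (simp add: zeta_def d_def[symmetric] e_def[symmetric] m_assoc)
qed

lemma zeta_inv: assumes c: "c \<in> C" and g: "g \<in> carrier G"
  shows "zeta G q (g \<otimes> c \<otimes> inv g) (inv g) = inv (zeta G q c g)"
proof -
  have "zeta G q (g \<otimes> c \<otimes> inv g) (inv g) \<otimes> zeta G q c g = \<one>"
    using zeta_mult[OF c inv_closed[OF g] g] g zeta_one[OF c] by simp
  then show ?thesis
    using zeta_cent[OF c g] zeta_cent[OF C_conj[OF g c] inv_closed[OF g]] by (simp add: inv_equality cent_G)
qed

text \<open>The inverse of an orthogonal matrix is its transpose; since the entries are real, no
  complex conjugation enters.\<close>

lemma pi_inv: assumes n: "n \<in> centraliser G r" shows "\<pi> (inv n) $ i $ j = \<pi> n $ j $ i"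
proof -
  from orthogonal n obtain Q :: "real^'i^'i" where
    Q: "orthogonal_matrix Q" "\<pi> n = (\<chi> i j. complex_of_real (Q $ i $ j))"
    by (auto simp: real_orthogonal_rep_def)
  have "\<pi> n ** transpose (\<pi> n) = (\<chi> i j. complex_of_real ((Q ** transpose Q) $ i $ j))"
    by (simp add: Q(2) matrix_matrix_mult_def transpose_def vec_eq_iff)
  also have "Q ** transpose Q = mat 1" using Q(1) by (simp add: orthogonal_matrix_def)
  also have "(\<chi> i j. complex_of_real (mat 1 $ i $ j)) = mat 1" by (simp add: mat_def vec_eq_iff)
  finally have 1: "\<pi> n ** transpose (\<pi> n) = mat 1" .
  have "\<pi> (inv n) ** \<pi> n = \<pi> (inv n \<otimes> n)"
    using rep n cent_inv[OF n] by (simp add: matrix_rep_def)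
  then have 2: "\<pi> (inv n) ** \<pi> n = mat 1" using rep cent_G[OF n] by (simp add: matrix_rep_def)
  have "\<pi> (inv n) = \<pi> (inv n) ** (\<pi> n ** transpose (\<pi> n))" by (simp add: 1)
  also have "\<dots> = transpose (\<pi> n)" by (simp add: matrix_mul_assoc 2)
  finally show ?thesis by (simp add: transpose_def)
qed

text \<open>The matrix of the representation induced from the centraliser, in the basis provided by
  the section \<open>q\<close>.\<close>

definition rh :: "'g \<Rightarrow> 'g \<times> 'i \<Rightarrow> 'g \<times> 'i \<Rightarrow> complex" where
  "rh g = (\<lambda>(c, m) (d, l). if c = g \<otimes> d \<otimes> inv g then \<pi> (zeta G q d g) $ m $ l else 0)"

definition iv :: "'g \<times> 'i \<Rightarrow> 'g \<times> 'i" where "iv = (\<lambda>(a, i). (inv a, i))"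

lemma sum_indices: "(\<Sum>v\<in>indices C. f v) = (\<Sum>c\<in>C. \<Sum>m\<in>UNIV. f (c, m :: 'i))"
  unfolding indices_def sum.cartesian_product by (rule sum.cong) auto

lemma rh_sum:
  assumes "c \<in> C" "g \<in> carrier G"
  shows "(\<Sum>v\<in>indices C. csmul (rh g v (c, l)) (f v)) = (\<Sum>m\<in>UNIV. csmul (\<pi> (zeta G q c g) $ m $ l) (f (g \<otimes> c \<otimes> inv g, m)))"
    and "(\<Sum>v\<in>indices C. h v * rh g v (c, l)) = (\<Sum>m\<in>UNIV. h (g \<otimes> c \<otimes> inv g, m) * \<pi> (zeta G q c g) $ m $ l)"
proof -
  have "(\<Sum>v\<in>indices C. csmul (rh g v (c, l)) (f v))
      = (\<Sum>d\<in>C. if d = g \<otimes> c \<otimes> inv g then (\<Sum>m\<in>UNIV. csmul (\<pi> (zeta G q c g) $ m $ l) (f (d, m))) else 0)"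
    unfolding sum_indices by (intro sum.cong refl) (auto simp: rh_def csmul.scale_zero_left)
  then show "(\<Sum>v\<in>indices C. csmul (rh g v (c, l)) (f v)) = (\<Sum>m\<in>UNIV. csmul (\<pi> (zeta G q c g) $ m $ l) (f (g \<otimes> c \<otimes> inv g, m)))"
    using C_conj[OF assms(2,1)] finite_C by simp
  have "(\<Sum>v\<in>indices C. h v * rh g v (c, l))
      = (\<Sum>d\<in>C. if d = g \<otimes> c \<otimes> inv g then (\<Sum>m\<in>UNIV. h (d, m) * \<pi> (zeta G q c g) $ m $ l) else 0)"
    unfolding sum_indices by (intro sum.cong refl) (auto simp: rh_def)
  then show "(\<Sum>v\<in>indices C. h v * rh g v (c, l)) = (\<Sum>m\<in>UNIV. h (g \<otimes> c \<otimes> inv g, m) * \<pi> (zeta G q c g) $ m $ l)"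
    using C_conj[OF assms(2,1)] finite_C by simp
qed

text \<open>The degree of the index \<open>(c, m)\<close> is \<open>c\<close>. Multiplicativity is
  the cocycle identity \<open>zeta_mult\<close>, symmetry under inversion combines
  \<open>zeta_inv\<close> with \<open>pi_inv\<close>, and \<open>inversion_compatible\<close> is
  what makes the involution \<open>iv\<close> equivariant.\<close>

sublocale orep G "indices C" fst rh iv
proof (unfold_locales, goal_cases)
  case (4 x y) then show ?case
    using C_G rep by (auto simp: rh_def indices_def zeta_one matrix_rep_def mat_def split: if_splits)
next
  case (5 g h x y)
  obtain c m d l where [simp]: "y = (c, m)" "x = (d, l)" by (cases x, cases y)
  have d: "d \<in> C" using 5 by (simp add: indices_def)
  define e where "e = h \<otimes> d \<otimes> inv h"
  have e: "e \<in> C" unfolding e_def by (rule C_conj[OF 5(2) d])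
  have "g \<otimes> h \<otimes> d \<otimes> inv (g \<otimes> h) = g \<otimes> e \<otimes> inv g"
    using 5(1,2) C_G[OF d] by (simp add: e_def m_assoc inv_mult_group)
  moreover have "\<pi> (zeta G q d (g \<otimes> h)) = \<pi> (zeta G q e g) ** \<pi> (zeta G q d h)"
    using rep zeta_cent[OF d 5(2)] zeta_cent[OF e 5(1)] 5(1,2) d
    by (simp add: zeta_mult e_def matrix_rep_def)
  ultimately show ?case
    using rh_sum(2)[OF d 5(2), of "rh g y" l]
    by (auto simp: rh_def e_def[symmetric] matrix_matrix_mult_def)
next
  case (6 g x y) then show ?case by (auto simp: rh_def split: prod.splits if_splits)
next
  case (7 g x y)
  obtain c m d l where [simp]: "y = (c, m)" "x = (d, l)" by (cases x, cases y)
  have d: "d \<in> C" "c \<in> C" using 7 by (auto simp: indices_def)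
  show ?case
    using conj_iff[OF 7(1) C_G[OF d(2)] C_G[OF d(1)]] zeta_inv[OF d(1) 7(1)] pi_inv[OF zeta_cent[OF d(1) 7(1)]] 7(1)
    by (auto simp: rh_def)
next
  case (11 g x y)
  obtain c m d l where [simp]: "y = (c, m)" "x = (d, l)" by (cases x, cases y)
  have d: "d \<in> C" "c \<in> C" using 11 by (auto simp: indices_def)
  have "inv (g \<otimes> d \<otimes> inv g) = g \<otimes> inv d \<otimes> inv g"
    using 11(1) C_G[OF d(1)] by (simp add: inv_mult_group m_assoc)
  then have "inv c = g \<otimes> inv d \<otimes> inv g \<longleftrightarrow> c = g \<otimes> d \<otimes> inv g"
    using 11(1) C_G[OF d(1)] C_G[OF d(2)] by (metis inv_inv m_closed inv_closed)
  then show ?case using compatible d 11(1) by (simp add: rh_def iv_def inversion_compatible_def)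
qed (use finite_G finite_C C_G C_inv in \<open>auto simp: indices_def iv_def\<close>)

section \<open>Identification of the concrete relations\<close>

lemma letters_I: "letters C = indices C \<times> indices C" by (simp add: letters_def)

text \<open>Orthogonality turns the contragredient matrices in \<open>actV_dual\<close> into those
  of \<open>actV\<close>.\<close>

lemma actV_rh:
  assumes "g \<in> carrier G" "x \<in> indices C"
  shows "actV G q \<pi> g x = (\<Sum>v\<in>indices C. csmul (rh g v x) (basis v))"
    and "actV_dual G q \<pi> g x = (\<Sum>v\<in>indices C. csmul (rh g v x) (basis v))"
proof -
  obtain c l where [simp]: "x = (c, l)" by (cases x)
  have c: "c \<in> C" using assms(2) by (simp add: indices_def)
  show "actV G q \<pi> g x = (\<Sum>v\<in>indices C. csmul (rh g v x) (basis v))"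
    "actV_dual G q \<pi> g x = (\<Sum>v\<in>indices C. csmul (rh g v x) (basis v))"
    using rh_sum(1)[OF c assms(1), of l basis] by (simp_all add: actV_def actV_dual_def pi_inv[OF zeta_cent[OF c assms(1)]])
qed

lemma Aw_actL:
  assumes "g \<in> carrier G" "l \<in> letters C" shows "Aw g [l] = lext (\<lambda>l. basis [l]) (actL G q \<pi> g l)"
  using assms by (cases l) (simp add: Aw_letter actL_def actV_rh letters_I)

lemma act_word_Aw: "g \<in> carrier G \<Longrightarrow> w \<in> X \<Longrightarrow> act_word (actL G q \<pi>) g w = Aw g w"
proof (induction w)
  case (Cons l w)
  then have l: "l \<in> letters C" "w \<in> X" by (auto simp: letters_I)
  have "Aw g ([l] @ w) = lmul cm (Aw g [l]) (Aw g w)"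
    using Cons.prems l by (intro Aw_append) (auto simp: letters_I)
  then show ?case using Cons l by (simp add: Aw_actL lmul_def lext_lext cm_def)
qed (simp add: Aw_nil)

lemma degL_ad: "l \<in> letters C \<Longrightarrow> degL G l = ad [l]"
  by (auto simp: letters_I degL_def ad_letter)

lemma deg_word_degw: "w \<in> X \<Longrightarrow> deg_word G (degL G) w = degw w"
  by (induction w) (auto simp: degL_ad letters_I)

lemma TL_free: "is_free (indices C \<times> indices C) (TL G C q \<pi>)"
  unfolding TL_def letters_I by (rule is_free_tensor_algebra)

lemma TL_act: "g \<in> carrier G \<Longrightarrow> p \<in> psp X \<Longrightarrow> act (TL G C q \<pi>) g p = lext (Aw g) p"
  by (simp add: TL_def tensor_algebra_def with_crossed_def) (rule lext_psp_cong, assumption, rule act_word_Aw)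

lemma TL_hcomp: "p \<in> psp X \<Longrightarrow> hcomp (TL G C q \<pi>) g p = lext (hpart degw g) p"
  by (simp add: TL_def tensor_algebra_def with_crossed_def)
    (rule lext_psp_cong, assumption, simp add: deg_word_degw hpart_def)

lemma Rmat_rh: "Rmat G q \<pi> x y z w = (if x = y then rh (fst x) z w else 0)"
  by (cases x, cases y, cases z, cases w) (auto simp: Rmat_def rh_def)

lemma A_ideal_NA: "A_ideal G C q \<pi> = NA"
proof -
  have "frts = {frt [(x, y)] [(z, w)] | x y z w. x \<in> indices C \<and> y \<in> indices C \<and> z \<in> indices C \<and> w \<in> indices C}"
    unfolding frts_def by blast
  also have "\<dots> = {(\<Sum>u\<in>indices C. \<Sum>v\<in>indices C. csmul (Rmat G q \<pi> u x v z) (basis [(u, y), (v, w)])) -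
      (\<Sum>u\<in>indices C. \<Sum>v\<in>indices C. csmul (Rmat G q \<pi> y u w v) (basis [(z, v), (x, u)]))
        | x y z w. x \<in> indices C \<and> y \<in> indices C \<and> z \<in> indices C \<and> w \<in> indices C}"
    by (rule setcompr4_cong) (simp only: Rmat_rh frt_letter)
  finally have "A_ideal G C q \<pi> = Idl\<^bsub>free_algebra (letters C)\<^esub> frts"
    by (simp only: A_ideal_def)
  also have "\<dots> = NA" unfolding NA_def letters_I by (rule Idl_tgen[OF is_free_free_algebra frts_psp])
  finally show ?thesis .
qed

lemma fundamental_gU:
  assumes "l \<in> letters C" "l' \<in> letters C"
  shows "gU [l] [l'] = basis [l, l'] - lext (\<lambda>(z, w). basis [z, w]) (fundamental_braiding G q \<pi> (l, l'))"
proof -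
  obtain x b j where l: "l = (x, (b, j))" by (metis surj_pair)
  have xb: "x \<in> indices C" "(b, j) \<in> indices C" "b \<in> carrier G"
    using assms(1) C_G by (auto simp: l letters_I indices_def)
  have l'I: "fst l' \<in> indices C" "snd l' \<in> indices C" using assms(2) by (auto simp: letters_I)
  have aL: "actL G q \<pi> (inv b) l' = pairs (\<Sum>v\<in>indices C. csmul (rh (inv b) v (fst l')) (basis v))
      (\<Sum>v\<in>indices C. csmul (rh (inv b) v (snd l')) (basis v))" (is "_ = ?q")
    using xb l'I by (cases l') (simp add: actL_def actV_rh)
  have q: "?q \<in> psp (letters C)"
    unfolding letters_I by (intro psp_pairs psp_sum psp_csmul) auto
  show ?thesis
    unfolding l gU_letter[OF xb(1,2)] fundamental_braiding_def prod.case aL fst_conv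
    by (intro arg_cong[of _ _ "\<lambda>p. basis _ - lext _ p"] lext_psp_cong[OF q])
      (simp add: actV_rh degL_ad xb letters_I)
qed

lemma U_ideal_NU: "U_ideal G C q \<pi> = NU"
proof -
  have "gUs = {basis [l, l'] - lext (\<lambda>(z, w). basis [z, w]) (fundamental_braiding G q \<pi> (l, l'))
      | l l'. l \<in> letters C \<and> l' \<in> letters C}"
    unfolding gUs_def letters_I[symmetric] by (rule setcompr2_cong) (simp only: fundamental_gU)
  then have "U_ideal G C q \<pi> = Idl\<^bsub>TL G C q \<pi>\<^esub> gUs" by (simp only: U_ideal_def)
  also have "\<dots> = NU" unfolding NU_def by (rule Idl_tgen[OF TL_free gUs_psp])
  finally show ?thesis .
qed

text \<open>Relations of this shape define \<open>H\<close> from \<open>A\<close> and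
  \<open>B\<close> from \<open>U\<close>. The parameter \<open>\<sigma>\<close> represents the
  antipode of a letter by words: \<open>St\<close> in the one case and \<open>sB\<close> in the
  other.\<close>

lemma antipode_relations_cover:
  assumes "algcover X K P cm []" and \<sigma>: "\<And>l. l \<in> letters C \<Longrightarrow> \<sigma> l \<in> psp X"
    and t: "\<And>l. l \<in> letters C \<Longrightarrow> t l = P (basis [l])" and s: "\<And>l. l \<in> letters C \<Longrightarrow> s l = P (\<sigma> l)"
  shows "antipode_relations K C t s = P `
    ({(\<Sum>z\<in>indices C. lmul cm (basis [(x, z)]) (\<sigma> (z, y))) - (if x = y then basis [] else 0) | x y. x \<in> indices C \<and> y \<in> indices C} \<union>
     {(\<Sum>z\<in>indices C. lmul cm (\<sigma> (x, z)) (basis [(z, y)])) - (if x = y then basis [] else 0) | x y. x \<in> indices C \<and> y \<in> indices C})"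
proof -
  interpret algcover X K P cm "[]" by fact
  have d: "(if x = y then \<one>\<^bsub>K\<^esub> else \<zero>\<^bsub>K\<^esub>) = P (if x = y then basis [] else 0)" for x y :: "'g \<times> 'i"
    by (simp add: P_one P_zero)
  have b: "basis [l] \<in> psp X" if "l \<in> letters C" for l using that by (simp add: letters_I)
  have 1: "finsum K (\<lambda>z. t (x, z) \<otimes>\<^bsub>K\<^esub> s (z, y)) (indices C) \<ominus>\<^bsub>K\<^esub> (if x = y then \<one>\<^bsub>K\<^esub> else \<zero>\<^bsub>K\<^esub>)
      = P ((\<Sum>z\<in>indices C. lmul cm (basis [(x, z)]) (\<sigma> (z, y))) - (if x = y then basis [] else 0))"
    "finsum K (\<lambda>z. s (x, z) \<otimes>\<^bsub>K\<^esub> t (z, y)) (indices C) \<ominus>\<^bsub>K\<^esub> (if x = y then \<one>\<^bsub>K\<^esub> else \<zero>\<^bsub>K\<^esub>)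
      = P ((\<Sum>z\<in>indices C. lmul cm (\<sigma> (x, z)) (basis [(z, y)])) - (if x = y then basis [] else 0))"
    if xy: "x \<in> indices C" "y \<in> indices C" for x y
  proof -
    have l: "(x, z) \<in> letters C" "(z, y) \<in> letters C" if "z \<in> indices C" for z
      using xy that by (auto simp: letters_I)
    have c: "lmul cm (basis [(x, z)]) (\<sigma> (z, y)) \<in> psp X" "lmul cm (\<sigma> (x, z)) (basis [(z, y)]) \<in> psp X"
      if "z \<in> indices C" for z by (intro lcm_psp b \<sigma> l that)+
    have m: "t (x, z) \<otimes>\<^bsub>K\<^esub> s (z, y) = P (lmul cm (basis [(x, z)]) (\<sigma> (z, y)))"
      "s (x, z) \<otimes>\<^bsub>K\<^esub> t (z, y) = P (lmul cm (\<sigma> (x, z)) (basis [(z, y)]))" if "z \<in> indices C" for z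
      by (simp_all only: t[OF l(1)[OF that]] t[OF l(2)[OF that]] s[OF l(1)[OF that]] s[OF l(2)[OF that]]
          P_mult[OF b[OF l(1)[OF that]] \<sigma>[OF l(2)[OF that]]] P_mult[OF \<sigma>[OF l(1)[OF that]] b[OF l(2)[OF that]]])
    have "finsum K (\<lambda>z. t (x, z) \<otimes>\<^bsub>K\<^esub> s (z, y)) (indices C) = finsum K (\<lambda>z. P (lmul cm (basis [(x, z)]) (\<sigma> (z, y)))) (indices C)"
      "finsum K (\<lambda>z. s (x, z) \<otimes>\<^bsub>K\<^esub> t (z, y)) (indices C) = finsum K (\<lambda>z. P (lmul cm (\<sigma> (x, z)) (basis [(z, y)]))) (indices C)"
      using c m by (intro abelian_monoid.finsum_cong'[OF abelian_group.axioms(1)[OF abelian_group] refl] Pi_I P_closed; simp only:)+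
    then show "finsum K (\<lambda>z. t (x, z) \<otimes>\<^bsub>K\<^esub> s (z, y)) (indices C) \<ominus>\<^bsub>K\<^esub> (if x = y then \<one>\<^bsub>K\<^esub> else \<zero>\<^bsub>K\<^esub>)
      = P ((\<Sum>z\<in>indices C. lmul cm (basis [(x, z)]) (\<sigma> (z, y))) - (if x = y then basis [] else 0))"
    "finsum K (\<lambda>z. s (x, z) \<otimes>\<^bsub>K\<^esub> t (z, y)) (indices C) \<ominus>\<^bsub>K\<^esub> (if x = y then \<one>\<^bsub>K\<^esub> else \<zero>\<^bsub>K\<^esub>)
      = P ((\<Sum>z\<in>indices C. lmul cm (\<sigma> (x, z)) (basis [(z, y)])) - (if x = y then basis [] else 0))"
      unfolding d using c by (simp_all only: P_sum[symmetric], (subst P_diff; auto intro!: psp_sum)+)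
  qed
  show ?thesis
    unfolding antipode_relations_def image_Un image_setcompr2
    by (intro arg_cong2[of _ _ _ _ "(\<union>)"] setcompr2_cong) (simp_all only: 1)
qed

end

lemma (in cover) bij_betw_qdesc:
  assumes "cover X L Q" "cover.ker X L Q = ker"
  shows "bij_betw (qdesc X P Q) (carrier K) (carrier L)"
proof -
  interpret L: cover X L Q by fact
  have d: "qdesc X P Q (P p) = Q p" if "p \<in> psp X" for p
    using qdesc_cover[OF assms(1) that] assms(2) by simp
  show ?thesis
    unfolding bij_betw_def
  proof
    show "inj_on (qdesc X P Q) (carrier K)"
    proof (rule inj_onI, elim P_ex)
      fix x y p p' assume p: "p \<in> psp X" "p' \<in> psp X" "x = P p" "y = P p'" "qdesc X P Q x = qdesc X P Q y"
      then have "Q p = Q p'" by (simp add: d)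
      then have "p - p' \<in> L.ker" using L.P_eq_iff[of p p'] p(1,2) by (simp add: L.ker_def psp_diff)
      then show "x = y" using P_eq_iff[of p p'] p by (simp add: assms(2) ker_def)
    qed
    have "Q p \<in> qdesc X P Q ` carrier K" if "p \<in> psp X" for p
      using that d P_closed by (metis imageI)
    then show "qdesc X P Q ` carrier K = carrier L"
      using d L.P_closed by (auto elim!: P_ex L.P_ex)
  qed
qed

context class_rep
begin

text \<open>The \<open>g\<close> that conjugate \<open>b\<close> to \<open>a\<close> correspond to
  the elements \<open>n\<close> of the centraliser through \<open>n = zeta G q a (inv g)\<close>,
  with inverse \<open>g = q a \<otimes> inv n \<otimes> inv (q b)\<close>. All other
  \<open>g\<close> have coefficient zero.\<close>

lemma r_elt_ph: assumes "l \<in> letters C" shows "r_elt G r q \<pi> l = ph [l]"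
proof -
  obtain a i b j where l [simp]: "l = ((a, i), (b, j))" by (metis surj_pair)
  have ab: "a \<in> C" "b \<in> C" using assms by (auto simp: letters_def indices_def)
  note G = C_G[OF ab(1)] C_G[OF ab(2)] q_G[OF ab(1)] q_G[OF ab(2)] r_G
  let ?T = "{g \<in> carrier G. b = inv g \<otimes> a \<otimes> inv (inv g)}"
  have "ph [l] = (\<Sum>g\<in>carrier G. csmul (rh (inv g) (b, j) (a, i)) (basis (g, inv b)))"
    using ab by (simp add: ph_letter indices_def)
  also have "\<dots> = (\<Sum>g\<in>?T. csmul (rh (inv g) (b, j) (a, i)) (basis (g, inv b)))"
    by (rule sum.mono_neutral_right) (auto simp: finite_G rh_def)
  also have "\<dots> = (\<Sum>g\<in>?T. csmul (\<pi> (zeta G q a (inv g)) $ j $ i) (basis (g, inv b)))"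
    by (intro sum.cong refl) (auto simp: rh_def)
  also have "\<dots> = r_elt G r q \<pi> l"
    unfolding r_elt_def l prod.case
  proof (rule sum.reindex_bij_witness[where i = "\<lambda>n. q a \<otimes> inv n \<otimes> inv (q b)" and j = "\<lambda>g. zeta G q a (inv g)"])
    fix g assume g: "g \<in> ?T"
    then show "zeta G q a (inv g) \<in> centraliser G r" using ab by (intro zeta_cent) auto
    have z: "zeta G q a (inv g) = inv (q b) \<otimes> inv g \<otimes> q a" using g by (simp add: zeta_def)
    have "q a \<otimes> inv (zeta G q a (inv g)) \<otimes> inv (q b) = g"
      unfolding z using g G by (simp add: inv_mult_group m_assoc)
    then show "q a \<otimes> inv (zeta G q a (inv g)) \<otimes> inv (q b) = g"
      "csmul (\<pi> (zeta G q a (inv g)) $ j $ i) (basis (q a \<otimes> inv (zeta G q a (inv g)) \<otimes> inv (q b), inv b)) =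
        csmul (\<pi> (zeta G q a (inv g)) $ j $ i) (basis (g, inv b))" by simp_all
  next
    fix n assume n: "n \<in> centraliser G r"
    let ?g = "q a \<otimes> inv n \<otimes> inv (q b)"
    note n' = cent_G[OF n] cent_inv[OF n]
    have "?g \<otimes> b = q a \<otimes> inv n \<otimes> (r \<otimes> inv (q b))" using G n' by (simp add: q_r(2)[OF ab(2)] m_assoc)
    also have "\<dots> = q a \<otimes> (inv n \<otimes> r) \<otimes> inv (q b)" using G n' by (simp add: m_assoc)
    also have "\<dots> = (q a \<otimes> r) \<otimes> inv n \<otimes> inv (q b)" using G n' by (simp add: m_assoc centraliser_def)
    also have "\<dots> = a \<otimes> ?g" using G n' by (simp add: q_r(1)[OF ab(1)] m_assoc)
    finally have e: "?g \<otimes> b = a \<otimes> ?g" .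
    have g: "?g \<in> carrier G" using G n' by simp
    have "inv ?g \<otimes> a \<otimes> inv (inv ?g) = inv ?g \<otimes> (a \<otimes> ?g)" using g G by (simp add: m_assoc)
    also have "\<dots> = b" unfolding e[symmetric] using g G by simp
    finally have b: "inv ?g \<otimes> a \<otimes> inv (inv ?g) = b" .
    show "?g \<in> ?T" using g b by simp
    have "zeta G q a (inv ?g) = inv (q b) \<otimes> inv ?g \<otimes> q a" unfolding zeta_def b ..
    also have "\<dots> = n" using G n' by (simp add: inv_mult_group m_assoc)
    finally show "zeta G q a (inv ?g) = n" .
  qed
  finally show ?thesis by simp
qed

text \<open>The degree of the letter moves \<open>inv b\<close> to
  \<open>a \<otimes> inv b \<otimes> inv a\<close> with the matrix of \<open>zeta\<close> at
  \<open>inv b\<close>. \<open>inversion_compatible\<close> replaces this by the matrix at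
  \<open>b\<close>, and \<open>pi_inv\<close> brings it into the form used in
  \<open>SL\<close>.\<close>

lemma SL_sB: assumes "l \<in> letters C" shows "lext (\<lambda>x. basis [x]) (SL G q \<pi> l) = sB [l]"
proof -
  obtain a i b j where l [simp]: "l = ((a, i), (b, j))" by (metis surj_pair)
  have ab: "a \<in> C" "b \<in> C" using assms by (auto simp: letters_def indices_def)
  have G: "a \<in> carrier G" "b \<in> carrier G" "inv b \<in> C" "a \<otimes> inv b \<in> carrier G"
    using ab C_G C_inv by auto
  have I: "(a, i) \<in> indices C" "(b, j) \<in> indices C" using ab by (simp_all add: indices_def)
  have iv: "iv (a, i) = (inv a, i)" "iv (b, j) = (inv b, j)" by (simp_all add: iv_def)
  have c: "(a \<otimes> inv b) \<otimes> inv b \<otimes> inv (a \<otimes> inv b) = a \<otimes> inv b \<otimes> inv a"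
    using G by (simp add: inv_mult_group m_assoc)
  have "sB [l] = (\<Sum>m\<in>UNIV. csmul (\<pi> (zeta G q (inv b) (a \<otimes> inv b)) $ m $ j) (basis [((a \<otimes> inv b \<otimes> inv a, m), (inv a, i))]))"
    unfolding l sB_letter[OF I] using rh_sum(1)[OF G(3,4), of j "\<lambda>v. basis [(v, (inv a, i))]"]
    by (simp add: iv c)
  also have "\<dots> = lext (\<lambda>x. basis [x]) (SL G q \<pi> l)"
    using compatible ab G by (simp add: SL_def lext_linear pi_inv zeta_cent inversion_compatible_def)
  finally show ?thesis by simp
qed

section \<open>Presentations of the four algebras by words\<close>

definition "PA p = A_ideal G C q \<pi> +>\<^bsub>free_algebra (letters C)\<^esub> p"
definition "PH p = H_proj G C q \<pi> (PA p)"
text \<open>\<open>PU0\<close> presents \<open>U\<close> by words with concatenation and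
  \<open>PU\<close> presents the same algebra by words with the product \<open>tm\<close>; on
  letters the two agree (\<open>PU_singles\<close>).\<close>

definition "PU0 p = U_ideal G C q \<pi> +>\<^bsub>TL G C q \<pi>\<^esub> p"
definition "PU p = PU0 (lext th' p)"
definition "PB p = B_proj G C q \<pi> (PU p)"

lemma A_cover: "algcover X (A_alg G C q \<pi>) PA cm []" "cover.ker X (A_alg G C q \<pi>) PA = NA"
  using free_quot_cover[OF is_free_free_algebra frts_psp]
  unfolding NA_def[symmetric] letters_I[symmetric] A_ideal_NA[symmetric] A_alg_def[symmetric] PA_def[symmetric]
  by simp_all

lemma A_bicover: "bicover X (A_alg G C q \<pi>) PA dl ep cm []"
  by (rule bicover_K[OF A_cover(1)]) (simp add: A_cover(2) coideal_NA)

lemma A_gen_PA: "A_gen G C q \<pi> l = PA (basis [l])"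
  by (simp add: A_gen_def PA_def)

lemma St_iv: "St G (x, y) = (iv y, iv x)"
  by (cases x, cases y) (simp add: St_def iv_def)

lemma H_ideal_ants: "H_ideal G C q \<pi> = Idl\<^bsub>A_alg G C q \<pi>\<^esub> (PA ` ants)"
proof -
  have "ants = {(\<Sum>z\<in>indices C. lmul cm (basis [(x, z)]) (basis [St G (z, y)])) - (if x = y then basis [] else 0) | x y. x \<in> indices C \<and> y \<in> indices C} \<union>
     {(\<Sum>z\<in>indices C. lmul cm (basis [St G (x, z)]) (basis [(z, y)])) - (if x = y then basis [] else 0) | x y. x \<in> indices C \<and> y \<in> indices C}"
    unfolding ants_def by (intro arg_cong2[of _ _ _ _ "(\<union>)"] setcompr2_cong) (simp_all add: d1_letter d2_letter St_iv)
  then show ?thesis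
    unfolding H_ideal_def
    by (subst antipode_relations_cover[OF A_cover(1), where \<sigma> = "\<lambda>l. basis [St G l]"])
      (auto simp: A_gen_PA letters_I St_iv st1_closed)
qed

lemma H_cover: "algcover X (H_alg G C q \<pi>) PH cm []" "cover.ker X (H_alg G C q \<pi>) PH = NH"
  using quot_cover(3,4)[OF A_cover(1) A_cover(2)[unfolded NA_def] frts_psp ants_psp H_ideal_ants]
  unfolding NH_def[symmetric] H_alg_def[symmetric] H_proj_def[symmetric] PH_def[symmetric]
  by simp_all

lemma H_bicover: "bicover X (H_alg G C q \<pi>) PH dl ep cm []"
  by (rule bicover_K[OF H_cover(1)]) (simp add: H_cover(2) coideal_NH)

lemma H_gen_PH: "H_gen G C q \<pi> l = PH (basis [l])"
  by (simp add: H_gen_def PH_def A_gen_PA)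

lemma U_covers:
  "braided_cover X (U_alg G C q \<pi>) PU dl ep tm [] G Aw ad" "cover.ker X (U_alg G C q \<pi>) PU = NA"
  "algcover X (U_alg G C q \<pi>) PU0 cm []" "cover.ker X (U_alg G C q \<pi>) PU0 = NU"
  using U_cover[OF TL_free TL_act TL_hcomp]
  unfolding U_ideal_NU[symmetric] U_alg_def[symmetric] PU0_def[symmetric] PU_def[symmetric]
  by simp_all

lemma U_lin_PU0: "U_lin G C q \<pi> p = PU0 (lext (\<lambda>x. basis [x]) p)"
  by (simp add: U_lin_def PU0_def)

lemma U_gen_PU0: "U_gen G C q \<pi> l = PU0 (basis [l])"
  by (simp add: U_gen_def U_lin_PU0)

lemma PU_singles: assumes "p \<in> psp singles" shows "PU p = PU0 p"
proof -
  have "lext th' p = lext basis p" by (rule lext_psp_cong[OF assms]) (auto simp: th'_single)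
  then show ?thesis by (simp add: PU_def)
qed

lemma B_ideal_antsB: "B_ideal G C q \<pi> = Idl\<^bsub>U_alg G C q \<pi>\<^esub> (PU0 ` antsB)"
proof -
  have "antsB = {(\<Sum>z\<in>indices C. lmul cm (basis [(x, z)]) (sB [(z, y)])) - (if x = y then basis [] else 0) | x y. x \<in> indices C \<and> y \<in> indices C} \<union>
     {(\<Sum>z\<in>indices C. lmul cm (sB [(x, z)]) (basis [(z, y)])) - (if x = y then basis [] else 0) | x y. x \<in> indices C \<and> y \<in> indices C}"
    unfolding antsB_def e1_letter e2_letter ..
  then show ?thesis
    unfolding B_ideal_def
    by (subst antipode_relations_cover[OF U_covers(3), where \<sigma> = "\<lambda>l. sB [l]"])
      (auto simp: U_gen_PU0 U_lin_PU0 SL_sB letters_I sB_psp)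
qed

lemma B_covers:
  "braided_cover X (B_alg G C q \<pi>) PB dl ep tm [] G Aw ad" "cover.ker X (B_alg G C q \<pi>) PB = NH"
  using B_cover[OF U_covers(1)[unfolded PU_def[abs_def]] U_covers(3,4) B_ideal_antsB]
  unfolding B_alg_def[symmetric] PU_def[symmetric] B_proj_def[symmetric] PB_def[symmetric]
  by simp_all

lemma matrix_coalgebra_cover:
  assumes "cocover X K P dl ep" and t: "\<And>l. l \<in> letters C \<Longrightarrow> t l = P (basis [l])"
  shows "matrix_coalgebra_on K C t (qcomult X dl P) (qcounit X ep P)"
  unfolding matrix_coalgebra_on_def
proof (intro ballI)
  fix x y :: "'g \<times> 'i" assume xy: "x \<in> indices C" "y \<in> indices C"
  have "(\<Sum>z\<in>indices C. basis (t (x, z), t (z, y))) = (\<Sum>z\<in>indices C. basis (P (basis [(x, z)]), P (basis [(z, y)])))"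
    using xy by (intro sum.cong refl) (simp add: t letters_I)
  then show "tensor_eq K K (qcomult X dl P (t (x, y))) (\<Sum>z\<in>indices C. basis (t (x, z), t (z, y)))
      \<and> qcounit X ep P (t (x, y)) = (if x = y then 1 else 0)"
    using tensor_eq_comult_letter[OF assms(1) xy] xy by (simp add: t letters_I)
qed

lemma qdesc_ph:
  assumes "cover X K P" "cover.ker X K P \<subseteq> NH" "p \<in> psp X"
  shows "qdesc X P (lext ph) (P p) = lext ph p"
  by (rule cover.qdesc_P[OF assms(1) cover.abelian_group[OF cover_Dvee] assms(3)])
    (use assms(2) ph_NH in \<open>auto simp: lph_psp lext_add\<close>)

end

theorem proposition5p19:
  fixes G :: "('g, 'm) monoid_scheme" and C :: "'g set" and r :: 'g and q :: "'g \<Rightarrow> 'g"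
    and \<pi> :: "'g \<Rightarrow> complex^'i^'i"
  assumes "group G" and "finite (carrier G)"
    and "r \<in> carrier G" and "C = conjugacy_class G r"
    and "\<forall>c\<in>C. inv\<^bsub>G\<^esub> c \<in> C"
    and "coset_section G C r q"
    and "matrix_rep G (centraliser G r) \<pi>"
    and "irreducible_rep (centraliser G r) \<pi>"
    and "real_orthogonal_rep (centraliser G r) \<pi>"
    and "inversion_compatible G C q \<pi>"
  shows
    "\<exists>\<Delta>U \<epsilon>U SU \<Delta>B \<epsilon>B SB \<Delta>A \<epsilon>A \<Delta>H \<epsilon>H SH RH.
      \<comment> \<open>the braided bialgebra \<open>U\<close> and the map \<open>S\<close> on it\<close>
      braided_bialgebra G (U_alg G C q \<pi>) \<Delta>U \<epsilon>U \<and>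
      matrix_coalgebra_on (U_alg G C q \<pi>) C (U_gen G C q \<pi>) \<Delta>U \<epsilon>U \<and>
      unital_braided_antialgebra_map G (U_alg G C q \<pi>) SU \<and>
      (\<forall>x\<in>letters C. SU (U_gen G C q \<pi> x) = U_lin G C q \<pi> (SL G q \<pi> x)) \<and>
      \<comment> \<open>the braided Hopf algebra \<open>B\<close>\<close>
      braided_hopf_algebra G (B_alg G C q \<pi>) \<Delta>B \<epsilon>B SB \<and>
      braided_bialgebra_hom G (U_alg G C q \<pi>) \<Delta>U \<epsilon>U (B_alg G C q \<pi>) \<Delta>B \<epsilon>B (B_proj G C q \<pi>) \<and>
      (\<forall>x\<in>carrier (U_alg G C q \<pi>). SB (B_proj G C q \<pi> x) = B_proj G C q \<pi> (SU x)) \<and>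
      bij_betw SB (carrier (B_alg G C q \<pi>)) (carrier (B_alg G C q \<pi>)) \<and>
      (\<exists>\<phi> \<psi>.
        braided_bialgebra_hom G (U_alg G C q \<pi>) \<Delta>U \<epsilon>U (BD G) (D_comult G) (D_counit G) \<phi> \<and>
        (\<forall>x\<in>letters C. \<phi> (U_gen G C q \<pi> x) = r_elt G r q \<pi> x) \<and>
        braided_bialgebra_hom G (B_alg G C q \<pi>) \<Delta>B \<epsilon>B (BD G) (D_comult G) (D_counit G) \<psi> \<and>
        (\<forall>x\<in>carrier (U_alg G C q \<pi>). \<phi> x = \<psi> (B_proj G C q \<pi> x))) \<and>
      \<comment> \<open>the coquasitriangular Hopf algebra \<open>H\<close>\<close>
      bialgebra (A_alg G C q \<pi>) \<Delta>A \<epsilon>A \<and>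
      matrix_coalgebra_on (A_alg G C q \<pi>) C (A_gen G C q \<pi>) \<Delta>A \<epsilon>A \<and>
      hopf_algebra (H_alg G C q \<pi>) \<Delta>H \<epsilon>H SH \<and>
      bialgebra_hom (A_alg G C q \<pi>) \<Delta>A \<epsilon>A (H_alg G C q \<pi>) \<Delta>H \<epsilon>H (H_proj G C q \<pi>) \<and>
      (\<forall>x\<in>letters C. SH (H_gen G C q \<pi> x) = H_gen G C q \<pi> (St G x)) \<and>
      coquasitriangular (H_alg G C q \<pi>) \<Delta>H \<epsilon>H RH \<and>
      (\<forall>x\<in>indices C. \<forall>y\<in>indices C. \<forall>z\<in>indices C. \<forall>w\<in>indices C.
        RH (H_gen G C q \<pi> (x, y)) (H_gen G C q \<pi> (z, w)) = Rmat G q \<pi> y x w z) \<and>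
      (\<exists>\<phi> \<psi>.
        bialgebra_hom (A_alg G C q \<pi>) \<Delta>A \<epsilon>A (Dvee G) (D_comult G) (D_counit G) \<phi> \<and>
        (\<forall>x\<in>letters C. \<phi> (A_gen G C q \<pi> x) = r_elt G r q \<pi> x) \<and>
        bialgebra_hom (H_alg G C q \<pi>) \<Delta>H \<epsilon>H (Dvee G) (D_comult G) (D_counit G) \<psi> \<and>
        (\<forall>x\<in>carrier (A_alg G C q \<pi>). \<phi> x = \<psi> (H_proj G C q \<pi> x)) \<and>
        \<comment> \<open>the comodule transmutation of \<open>H\<close> is isomorphic to \<open>B\<close>\<close>
        (\<exists>M SM \<theta>.
          is_transmutation G (H_alg G C q \<pi>) \<Delta>H SH RH \<psi> M \<and>
          braided_hopf_algebra G M \<Delta>H \<epsilon>H SM \<and>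
          braided_bialgebra_hom G (B_alg G C q \<pi>) \<Delta>B \<epsilon>B M \<Delta>H \<epsilon>H \<theta> \<and>
          bij_betw \<theta> (carrier (B_alg G C q \<pi>)) (carrier M) \<and>
          (\<forall>x\<in>carrier (B_alg G C q \<pi>). \<theta> (SB x) = SM (\<theta> x)) \<and>
          (\<forall>x\<in>letters C. \<theta> (B_proj G C q \<pi> (U_gen G C q \<pi> x)) = H_gen G C q \<pi> x)))"
proof -
  interpret class_rep G C r q \<pi> by (rule class_rep.intro[OF assms(1)]) (unfold_locales, use assms in auto)
  let ?U = "U_alg G C q \<pi>" and ?B = "B_alg G C q \<pi>" and ?A = "A_alg G C q \<pi>" and ?H = "H_alg G C q \<pi>"
  let ?DU = "qcomult X dl PU" and ?eU = "qcounit X ep PU" and ?SU = "coalgcover.antip X PU sB"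
  let ?DB = "qcomult X dl PB" and ?eB = "qcounit X ep PB" and ?SB = "coalgcover.antip X PB sB"
  let ?DA = "qcomult X dl PA" and ?eA = "qcounit X ep PA"
  let ?DH = "qcomult X dl PH" and ?eH = "qcounit X ep PH"
  let ?SH = "coalgcover.antip X PH (\<lambda>u. basis (Sw u))" and ?SM = "coalgcover.antip X PH sB" and ?R = "qform X PH rt"
  let ?\<phi>U = "qdesc X PU (lext ph)" and ?\<phi>B = "qdesc X PB (lext ph)" and ?\<phi>A = "qdesc X PA (lext ph)" and ?\<phi>H = "qdesc X PH (lext ph)"
  let ?\<theta> = "qdesc X PB PH"
  interpret U: braided_cover X ?U PU dl ep tm "[]" G Aw ad by (rule U_covers(1))
  interpret B: braided_cover X ?B PB dl ep tm "[]" G Aw ad by (rule B_covers(1))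
  interpret A: bicover X ?A PA dl ep cm "[]" by (rule A_bicover)
  interpret H: bicover X ?H PH dl ep cm "[]" by (rule H_bicover)
  have bl: "basis [l] \<in> psp X" "basis [l] \<in> psp singles" if "l \<in> letters C" for l using that by (auto simp: letters_I)
  have gU: "U_gen G C q \<pi> l = PU (basis [l])" if "l \<in> letters C" for l
    using PU_singles[OF bl(2)[OF that]] by (simp add: U_gen_PU0)
  have SUP: "?SU (PU p) = PU (lext sB p)" "?SB (PB p) = PB (lext sB p)" if "p \<in> psp X" for p
    using braided_antip(1)[OF U_covers(1) _ _ that] braided_antip(1)[OF B_covers(1) _ _ that]
    by (simp_all add: U_covers(2) B_covers(2) nice_NA nice_NH lS_NA lS_NH)
  have ph: "?\<phi>U (PU p) = lext ph p" "?\<phi>B (PB p) = lext ph p" "?\<phi>A (PA p) = lext ph p" "?\<phi>H (PH p) = lext ph p"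
    if "p \<in> psp X" for p
    using that by (auto intro!: qdesc_ph U.cover_axioms B.cover_axioms A.cover_axioms H.cover_axioms
        simp: U_covers(2) B_covers(2) A_cover(2) H_cover(2) subsetD[OF NA_NH])
  \<comment> \<open>The transmutation has the same presentation as \<open>B\<close>, by words with
    product \<open>tm\<close> and with kernel \<open>NH\<close>. Hence the identity on words induces
    the isomorphism \<open>?\<theta>\<close>, and all structure maps, being given on words,
    correspond.\<close>
  obtain M :: "('g, (('g, 'i) letter list \<Rightarrow>\<^sub>0 complex) set set) crossed_module"
    where M: "is_transmutation G ?H ?DH ?SH ?R ?\<phi>H M" "braided_cover X M PH dl ep tm [] G Aw ad" "cover.ker X M PH = NH"
    using transmutation_K[OF H_bicover H_cover(2) ph(4)] by blast
  interpret M: braided_cover X M PH dl ep tm "[]" G Aw ad by (rule M(2))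
  have \<theta>: "?\<theta> (PB p) = PH p" if "p \<in> psp X" for p
    using B.qdesc_cover[OF M.cover_axioms that] by (simp add: M(3) B_covers(2))
  have SM: "?SM (PH p) = PH (lext sB p)" if "p \<in> psp X" for p
    using braided_antip(1)[OF M(2) _ _ that] by (simp add: M(3) nice_NH lS_NH)
  have u3: "unital_braided_antialgebra_map G ?U ?SU"
    by (rule braided_antip(3)[OF U_covers(1)]) (simp_all add: U_covers(2) nice_NA lS_NA)
  have u4: "\<forall>l\<in>letters C. ?SU (U_gen G C q \<pi> l) = U_lin G C q \<pi> (SL G q \<pi> l)"
  proof
    fix l :: "('g, 'i) letter" assume l: "l \<in> letters C"
    have "PU (sB [l]) = PU0 (sB [l])" using l by (intro PU_singles sB_single) (auto simp: letters_I)
    then show "?SU (U_gen G C q \<pi> l) = U_lin G C q \<pi> (SL G q \<pi> l)"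
      using bl(1)[OF l] l by (simp add: gU SUP U_lin_PU0 SL_sB)
  qed
  have b6: "braided_bialgebra_hom G ?U ?DU ?eU ?B ?DB ?eB (B_proj G C q \<pi>)"
    by (rule U.braided_bialgebra_hom_cover[OF B_covers(1)]) (simp add: PB_def)
  have b7: "\<forall>x\<in>carrier ?U. ?SB (B_proj G C q \<pi> x) = B_proj G C q \<pi> (?SU x)"
    using SUP by (auto elim!: U.P_ex simp: PB_def)
  have b8: "bij_betw ?SB (carrier ?B) (carrier ?B)"
    by (rule braided_antip(4)[OF B_covers(1)]) (simp_all add: B_covers(2) nice_NH lS_NH)
  have p1: "\<forall>l\<in>letters C. ?\<phi>U (U_gen G C q \<pi> l) = r_elt G r q \<pi> l" "\<forall>l\<in>letters C. ?\<phi>A (A_gen G C q \<pi> l) = r_elt G r q \<pi> l"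
    using bl ph by (auto simp: gU A_gen_PA r_elt_ph)
  have p2: "\<forall>x\<in>carrier ?U. ?\<phi>U x = ?\<phi>B (B_proj G C q \<pi> x)" "\<forall>x\<in>carrier ?A. ?\<phi>A x = ?\<phi>H (H_proj G C q \<pi> x)"
    using ph by (auto elim!: U.P_ex A.P_ex simp: PB_def[symmetric] PH_def[symmetric])
  have h1: "bialgebra_hom ?A ?DA ?eA ?H ?DH ?eH (H_proj G C q \<pi>)"
    unfolding bialgebra_hom_def
    by (intro conjI A.algebra_hom_cover[OF H.algcover_axioms] coalgebra_hom_cover[OF A.cocover_axioms H.cocover_axioms])
      (simp_all add: PH_def)
  have h2: "\<forall>l\<in>letters C. ?SH (H_gen G C q \<pi> l) = H_gen G C q \<pi> (St G l)"
    using hopf_K(2)[OF H_bicover H_cover(2) bl(1)] by (auto simp: H_gen_PH letters_I St_iv Sw_letter)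
  have h3: "\<forall>x\<in>indices C. \<forall>y\<in>indices C. \<forall>z\<in>indices C. \<forall>w\<in>indices C.
      ?R (H_gen G C q \<pi> (x, y)) (H_gen G C q \<pi> (z, w)) = Rmat G q \<pi> y x w z"
    by (simp add: H_gen_PH H.qform_P H_cover(2) rt_vanish rt_letter Rmat_rh)
  have m1: "\<forall>x\<in>carrier ?B. ?\<theta> (?SB x) = ?SM (?\<theta> x)"
    using SUP(2) SM \<theta> lsB_psp by (auto elim!: B.P_ex)
  have m2: "\<forall>l\<in>letters C. ?\<theta> (B_proj G C q \<pi> (U_gen G C q \<pi> l)) = H_gen G C q \<pi> l"
    using \<theta> bl by (simp add: gU PB_def[symmetric] H_gen_PH)
  have m3: "braided_bialgebra_hom G ?B ?DB ?eB M ?DH ?eH ?\<theta>"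
    by (rule B.braided_bialgebra_hom_cover[OF M(2) \<theta>])
  have m4: "bij_betw ?\<theta> (carrier ?B) (carrier M)"
    by (rule B.bij_betw_qdesc[OF M.cover_axioms]) (simp add: M(3) B_covers(2))
  show ?thesis
    by (intro exI conjI,
      rule U.braided_bialgebra,
      rule matrix_coalgebra_cover[OF U.cocover_axioms gU], assumption,
      rule u3, rule u4,
      rule braided_hopf_K[OF B_covers],
      rule b6, rule b7, rule b8,
      rule braided_bialgebra_hom_BD[OF U_covers(1) ph(1)], assumption,
      rule p1(1),
      rule braided_bialgebra_hom_BD[OF B_covers(1) ph(2)], assumption,
      rule p2(1),
      rule A.bialgebra,
      rule matrix_coalgebra_cover[OF A.cocover_axioms A_gen_PA],
      rule hopf_K(1)[OF H_bicover H_cover(2)],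
      rule h1, rule h2,
      rule coquasitriangular_K[OF H_bicover H_cover(2)],
      rule h3,
      rule bialgebra_hom_Dvee[OF A_bicover ph(3)], assumption,
      rule p1(2),
      rule bialgebra_hom_Dvee[OF H_bicover ph(4)], assumption,
      rule p2(2),
      rule M(1),
      rule braided_hopf_K[OF M(2,3)],
      rule m3, rule m4, rule m1, rule m2)
qed

end
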